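(* Consider the half-duplex $(a,b,c)$-relay channel with $a=b=p$, with receive CSI only. Its generalized diversity-multiplexing tradeoff is given by $$d^*_{(p,p,c)}(r)=\begin{cases}(p-r)^++(c-r)^+ & \text{if } c\ge p,\\ p+c-2r & \text{if } c<p,\ r\le c,\\ p-\dfrac{(p-c)r}{p-r} & \text{if } c<p,\ c<r<\frac p2,\\ p+c-2r & \text{if } c<p,\ \frac p2\le r\le \frac{p+c}{2},\end{cases}$$ where the optimal strategy for the first, second and fourth cases is static quantize-map-forward with a half-transmit half-receive schedule, and in the third case the tradeoff is achieved by a dynamic decode-and-forward strategy.
   Context: Notation: $x^+=\max(x,0)$. Channel. For $a,b,c\ge 0$, the half-duplex $(a,b,c)$-relay channel (indexed by $\rho$) has a source S, relay R, destination D, each with one antenna. The gains of the S-R, R-D, S-D links are $h_{sr}\rho^{a/2},h_{rd}\rho^{b/2},h_{sd}\rho^{c/2}$ with $h_{sr},h_{rd},h_{sd}$ i.i.d. $\mathcal{CN}(0,1)$, constant over a codeword (quasi-static fading) and independent across codewords. At times when the relay listens, $y_r=h_{sr}\rho^{a/2}x_s+z_r$ and $y_d=h_{sd}\rho^{c/2}x_s+z_d$; at times when the relay transmits, $y_r=0$ and $y_d=h_{sd}\rho^{c/2}x_s+h_{rd}\rho^{b/2}x_r+z_d$. Noises are i.i.d. $\mathcal{CN}(0,1)$ over time and independent across nodes; $x_s,x_r$ satisfy a unit power constraint. Codeword lengths are assumed large enough that an error occurs only when the channel is in outage. Receive CSI: the source knows no channel realization; the relay knows only $h_{sr}$ (its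 listen/transmit schedule may be random and may depend on its receive CSI and received signals); the destination knows the realizations (the relay can communicate $h_{sr}$ to it). The parameters $a,b,c,\rho,r$ are known to all nodes. DMT. A sequence of codes indexed by $\rho$, with rate $R$ and average error probability $P_e$ (both depending on $\rho$), achieves multiplexing gain $r$ and diversity gain $d$ if $\lim_{\rho\to\infty}R/\log\rho=r$ and $\lim_{\rho\to\infty}\log P_e/\log\rho=-d$. For each $r$, $d^*_{(a,b,c)}(r)$ is the supremum of diversity gains achievable over all families of codes. Static quantize-map-forward (QMF) with half-transmit half-receive schedule: the relay listens during the first half of the block, quantizes its received signal at the noise level, maps it to a random codeword, and transmits that in the second half, regardless of the channel realizations. For given realizations it achieves a rate at least $C-\kappa$, where $\kappa$ is a constant independent of $\rho$ and of the realizations, and $C$ (an upper bound on the rate achievable with this schedule) is the value at $t=\frac12$ of $$\min\Big\{t\log(1+|h_{sr}|^2\rho^a+|h_{sd}|^2\rho^c)+(1-t)\log(1+|h_{sd}|^2\rho^c),\ t\log(1+|h_{sd}|^2\rho^c)+(1-t)\log\big(1+(|h_{rd}|\rho^{b/2}+|h_{sd}|\rho^{c/2})^2\big)\Big\}.$$ Dynamic decode-and-forward (DDF): the source uses a random Gaussian codebook; the relay listens until it can decode the message, i.e. for a fraction $t=r\log\rho/\log(1+|h_{sr}|^2\rho^a)$ of the block, then re-encodes the message with an independent random Gaussian codebook and transmits it in the remaining time. With $\alpha=\log(|h_{sr}|^2\rho^a)/\log\rho$, $\beta=\log(|h_{rd}|^2\rho^b)/\log\rho$, $\gamma=\log(|h_{sd}|^2\rho^c)/\log\rho$,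 one has $t\to r/\alpha$ asymptotically in $\rho$, and outage occurs if either $r/\alpha>1$ and $\gamma<r$, or $t=r/\alpha\le1$ and $t\gamma+(1-t)\max(\gamma,\beta)<r$.
   Formalization: Codes achieving multiplexing gain r are also required to have rate R bounded away from 0; this is automatic for r>0, but at r=0 codes with R tending to 0 would make the diversity gain infinite, so the stated formula would fail. *)

theory Defs
  imports "HOL-Probability.Probability"
begin

section \<open>Probability space of one codeword transmission\<close>

text \<open>The circularly symmetric law CN(0,1): independent real and imaginary parts of variance 1/2.\<close>

definition CN :: "complex measure" where
  "CN = distr (density lborel (normal_density 0 (1 / sqrt 2)) \<Otimes>\<^sub>M
               density lborel (normal_density 0 (1 / sqrt 2)))
              borel (\<lambda>(x, y). Complex x y)"

type_synonym cseq = "nat \<Rightarrow> complex"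

abbreviation cseq_borel :: "cseq measure" where
  "cseq_borel \<equiv> PiM UNIV (\<lambda>_. borel)"

definition iid_CN :: "cseq measure" where
  "iid_CN = PiM UNIV (\<lambda>_. CN)"

text \<open>
  An outcome is \<open>(h_sr, h_rd, h_sd, z_r, z_d, w, v)\<close>: the three fading coefficients, the noise
  sequences at relay and destination, and two seeds. The seed \<open>w\<close> generates the (possibly random)
  codebooks and is known to all nodes; the seed \<open>v\<close> is private randomness of the relay. Every
  randomization over a standard Borel space is a measurable function of such a seed, so taking the
  seeds to be i.i.d. Gaussian sequences is no restriction.
\<close>

type_synonym outcome = "complex \<times> complex \<times> complex \<times> cseq \<times> cseq \<times> cseq \<times> cseq"

definition channel_space :: "outcome measure" where
  "channel_space =
     CN \<Otimes>\<^sub>M CN \<Otimes>\<^sub>M CN \<Otimes>\<^sub>M iid_CN \<Otimes>\<^sub>M iid_CN \<Otimes>\<^sub>M iid_CN \<Otimes>\<^sub>M iid_CN"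

lemma prob_space_CN: "prob_space CN"
proof -
  have n: "prob_space (density lborel (normal_density 0 (1 / sqrt 2)))"
    by (rule prob_space_normal_density) simp
  interpret pair_prob_space "density lborel (normal_density 0 (1 / sqrt 2))"
      "density lborel (normal_density 0 (1 / sqrt 2))"
    using n by (simp add: pair_prob_space_def pair_sigma_finite_def prob_space_imp_sigma_finite)
  have "(\<lambda>(x, y). Complex x y) \<in> borel_measurable (borel \<Otimes>\<^sub>M borel)"
    unfolding Complex_eq by measurable
  then show ?thesis
    unfolding CN_def by (intro prob_space_distr) (simp cong: measurable_cong_sets)
qed

lemma prob_space_iid_CN: "prob_space iid_CN"
  unfolding iid_CN_def by (intro prob_space_PiM prob_space_CN)

lemma prob_space_channel_space: "prob_space channel_space"
  unfolding channel_space_def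
  by (intro prob_space_pair prob_space_CN prob_space_iid_CN)

section \<open>Codes for the half-duplex relay channel with receive CSI\<close>

text \<open>
  What the relay bases its actions at a given time on: the two seeds, its receive CSI \<open>h_sr\<close>, and
  the signals it has received strictly before that time (later entries are 0).
\<close>

type_synonym relay_view = "cseq \<times> cseq \<times> complex \<times> cseq"

text \<open>
  The destination sees the codebook seed, all channel realizations \<open>(h_sr, h_rd, h_sd)\<close> and its
  received block.
\<close>

type_synonym dest_view = "cseq \<times> (complex \<times> complex \<times> complex) \<times> cseq"

text \<open>
  Messages are \<open>0, \<dots>, num_msgs - 1\<close> and times are \<open>0, \<dots>, blocklength - 1\<close>. The schedule
  \<open>listens i\<close> tells whether the relay listens (otherwise it transmits) at time \<open>i\<close>.
\<close>

record hd_code =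
  blocklength :: nat
  num_msgs :: nat
  src_enc :: "cseq \<Rightarrow> nat \<Rightarrow> nat \<Rightarrow> complex"
  listens :: "nat \<Rightarrow> relay_view \<Rightarrow> bool"
  relay_enc :: "nat \<Rightarrow> relay_view \<Rightarrow> complex"
  dest_dec :: "dest_view \<Rightarrow> nat"

text \<open>
  \<open>relay_past a \<rho> C g w v zr m i\<close> is the sequence received by the relay before time \<open>i\<close>
  when \<open>h_sr = g\<close> and message \<open>m\<close> is sent; it receives 0 whenever it transmits.
\<close>

primrec relay_past :: "real \<Rightarrow> real \<Rightarrow> hd_code \<Rightarrow> complex \<Rightarrow> cseq \<Rightarrow> cseq \<Rightarrow> cseq \<Rightarrow> nat \<Rightarrow> nat \<Rightarrow> cseq"
  where
  "relay_past a \<rho> C g w v zr m 0 = (\<lambda>_. 0)"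
| "relay_past a \<rho> C g w v zr m (Suc i) =
     (let past = relay_past a \<rho> C g w v zr m i in
      past(i := (if listens C i (w, v, g, past)
                 then g * complex_of_real (\<rho> powr (a / 2)) * src_enc C w m i + zr i
                 else 0)))"

definition relay_input :: "real \<Rightarrow> real \<Rightarrow> hd_code \<Rightarrow> complex \<Rightarrow> cseq \<Rightarrow> cseq \<Rightarrow> cseq \<Rightarrow> nat \<Rightarrow> cseq" where
  "relay_input a \<rho> C g w v zr m i =
     (let view = (w, v, g, relay_past a \<rho> C g w v zr m i) in
      if listens C i view then 0 else relay_enc C i view)"

definition dest_output :: "real \<Rightarrow> real \<Rightarrow> real \<Rightarrow> real \<Rightarrow> hd_code \<Rightarrow> outcome \<Rightarrow> nat \<Rightarrow> cseq" where
  "dest_output a b c \<rho> C \<omega> m i =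
     (case \<omega> of (hsr, hrd, hsd, zr, zd, w, v) \<Rightarrow>
      if i < blocklength C
      then hsd * complex_of_real (\<rho> powr (c / 2)) * src_enc C w m i
           + hrd * complex_of_real (\<rho> powr (b / 2)) * relay_input a \<rho> C hsr w v zr m i
           + zd i
      else 0)"

definition error_event :: "real \<Rightarrow> real \<Rightarrow> real \<Rightarrow> real \<Rightarrow> hd_code \<Rightarrow> nat \<Rightarrow> outcome set" where
  "error_event a b c \<rho> C m =
     {\<omega> \<in> space channel_space.
        (case \<omega> of (hsr, hrd, hsd, zr, zd, w, v) \<Rightarrow>
           dest_dec C (w, (hsr, hrd, hsd), dest_output a b c \<rho> C \<omega> m) \<noteq> m)}"

definition avg_error :: "real \<Rightarrow> real \<Rightarrow> real \<Rightarrow> real \<Rightarrow> hd_code \<Rightarrow> real" where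
  "avg_error a b c \<rho> C =
     (\<Sum>m<num_msgs C. measure channel_space (error_event a b c \<rho> C m)) / real (num_msgs C)"

text \<open>Rate in nats per channel use; the base of the logarithm cancels in the multiplexing gain.\<close>

definition rate :: "hd_code \<Rightarrow> real" where
  "rate C = ln (real (num_msgs C)) / real (blocklength C)"

text \<open>
  Unit power per block, on average over the codebook seed (so that i.i.d. CN(0,1) codebooks are
  admissible). The relay constraint holds for every value of \<open>h_sr\<close>: the relay cannot save power in
  good fading states for use in bad ones.
\<close>

definition source_power_ok :: "hd_code \<Rightarrow> bool" where
  "source_power_ok C \<longleftrightarrow>
     (\<forall>m<num_msgs C.
        (\<integral>\<^sup>+ w. ennreal (\<Sum>i<blocklength C. (cmod (src_enc C w m i))\<^sup>2) \<partial>iid_CN)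
          \<le> ennreal (real (blocklength C)))"

definition relay_power_ok :: "real \<Rightarrow> real \<Rightarrow> hd_code \<Rightarrow> bool" where
  "relay_power_ok a \<rho> C \<longleftrightarrow>
     (\<forall>g. (\<Sum>m<num_msgs C.
             (\<integral>\<^sup>+ (w, v, zr).
                ennreal (\<Sum>i<blocklength C. (cmod (relay_input a \<rho> C g w v zr m i))\<^sup>2)
              \<partial>(iid_CN \<Otimes>\<^sub>M iid_CN \<Otimes>\<^sub>M iid_CN)))
          \<le> ennreal (real (num_msgs C) * real (blocklength C)))"

abbreviation relay_view_borel :: "relay_view measure" where
  "relay_view_borel \<equiv> cseq_borel \<Otimes>\<^sub>M cseq_borel \<Otimes>\<^sub>M borel \<Otimes>\<^sub>M cseq_borel"

abbreviation dest_view_borel :: "dest_view measure" where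
  "dest_view_borel \<equiv> cseq_borel \<Otimes>\<^sub>M (borel \<Otimes>\<^sub>M borel \<Otimes>\<^sub>M borel) \<Otimes>\<^sub>M cseq_borel"

definition valid_code :: "real \<Rightarrow> real \<Rightarrow> hd_code \<Rightarrow> bool" where
  "valid_code a \<rho> C \<longleftrightarrow>
     0 < blocklength C \<and> 0 < num_msgs C \<and>
     (\<forall>m<num_msgs C. \<forall>i<blocklength C. (\<lambda>w. src_enc C w m i) \<in> borel_measurable cseq_borel) \<and>
     (\<forall>i<blocklength C. listens C i \<in> measurable relay_view_borel (count_space UNIV)) \<and>
     (\<forall>i<blocklength C. relay_enc C i \<in> borel_measurable relay_view_borel) \<and>
     dest_dec C \<in> measurable dest_view_borel (count_space UNIV) \<and>
     source_power_ok C \<and> relay_power_ok a \<rho> C"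

section \<open>Diversity-multiplexing tradeoff\<close>

text \<open>
  \<open>achieves a b c S r d\<close>: some family of codes belonging, for each \<open>\<rho>\<close>, to the class \<open>S \<rho>\<close>
  has multiplexing gain \<open>r\<close> and diversity gain \<open>d\<close>. The blocklength may depend on \<open>\<rho>\<close> without
  restriction. Requiring the rate to be bounded away from zero is automatic for \<open>r > 0\<close>; for \<open>r = 0\<close>
  it excludes rates tending to 0 (e.g. a single message), for which any diversity gain would be
  achievable. Positivity of the error probability is required because \<open>ln 0 = 0\<close> here.
\<close>

definition achieves ::
  "real \<Rightarrow> real \<Rightarrow> real \<Rightarrow> (real \<Rightarrow> hd_code \<Rightarrow> bool) \<Rightarrow> real \<Rightarrow> real \<Rightarrow> bool" where
  "achieves a b c S r d \<longleftrightarrow>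
     (\<exists>C :: real \<Rightarrow> hd_code.
        (\<forall>\<^sub>F \<rho> in at_top. valid_code a \<rho> (C \<rho>) \<and> S \<rho> (C \<rho>)) \<and>
        (\<exists>R\<^sub>0>0. \<forall>\<^sub>F \<rho> in at_top. R\<^sub>0 \<le> rate (C \<rho>)) \<and>
        ((\<lambda>\<rho>. rate (C \<rho>) / ln \<rho>) \<longlongrightarrow> r) at_top \<and>
        (\<forall>\<^sub>F \<rho> in at_top. 0 < avg_error a b c \<rho> (C \<rho>)) \<and>
        ((\<lambda>\<rho>. ln (avg_error a b c \<rho> (C \<rho>)) / ln \<rho>) \<longlongrightarrow> - d) at_top)"

definition gdmt :: "real \<Rightarrow> real \<Rightarrow> real \<Rightarrow> real \<Rightarrow> ereal" where
  "gdmt a b c r = Sup {ereal d | d. achieves a b c (\<lambda>_ _. True) r d}"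

section \<open>The two strategies\<close>

text \<open>
  Independent random Gaussian codebooks are read off from disjoint coordinates of the codebook
  seed, addressed through the injection \<open>to_nat\<close>. Summand \<open>Inl\<close> is the source codebook (message,
  time); summand \<open>Inr\<close> is the relay codebook (label, time), where the label is the quantized block
  for QMF and the message for DDF; its type \<open>'l\<close> fixes the layout. The decoder of the destination
  is left free in both strategies.
\<close>

definition source_gauss :: "'l::countable itself \<Rightarrow> cseq \<Rightarrow> nat \<Rightarrow> nat \<Rightarrow> complex" where
  "source_gauss _ w m i = w (to_nat (Inl (m, i) :: (nat \<times> nat) + ('l \<times> nat)))"

definition relay_gauss :: "cseq \<Rightarrow> 'l::countable \<Rightarrow> nat \<Rightarrow> complex" where
  "relay_gauss w l i = w (to_nat (Inr (l, i) :: (nat \<times> nat) + ('l \<times> nat)))"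

text \<open>Scalar quantization at the (unit) noise level.\<close>

definition quantize :: "complex \<Rightarrow> int \<times> int" where
  "quantize y = (round (Re y), round (Im y))"

definition static_qmf_half :: "hd_code \<Rightarrow> bool" where
  "static_qmf_half C \<longleftrightarrow>
     even (blocklength C) \<and>
     (\<forall>w. \<forall>m<num_msgs C. \<forall>i<blocklength C.
        src_enc C w m i = source_gauss TYPE((int \<times> int) list) w m i) \<and>
     (\<forall>i<blocklength C. \<forall>view. listens C i view \<longleftrightarrow> i < blocklength C div 2) \<and>
     (\<forall>i<blocklength C. \<forall>w v g y. blocklength C div 2 \<le> i \<longrightarrow>
        relay_enc C i (w, v, g, y) =
          relay_gauss w (map (\<lambda>j. quantize (y j)) [0..<blocklength C div 2]) i)"

text \<open>
  Times \<open>i < t n\<close> with \<open>t = r log \<rho> / log (1 + |g|\<^sup>2 \<rho>\<^sup>a)\<close>, written without division so that the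
  relay keeps listening when \<open>g = 0\<close>.
\<close>

definition ddf_listening :: "real \<Rightarrow> real \<Rightarrow> real \<Rightarrow> nat \<Rightarrow> complex \<Rightarrow> nat set" where
  "ddf_listening a \<rho> r n g =
     {i. i < n \<and> real i * ln (1 + (cmod g)\<^sup>2 * \<rho> powr a) < real n * (r * ln \<rho>)}"

text \<open>
  The relay decodes by maximum likelihood, i.e. minimum distance over its listening period, using
  the codebook seed, \<open>h_sr\<close> and its received signals. Its received sequence is 0 outside the
  listening period, so the decision \<open>\<mu> (w, g, y)\<close> does not change once it starts transmitting.
\<close>

definition ddf :: "real \<Rightarrow> real \<Rightarrow> real \<Rightarrow> hd_code \<Rightarrow> bool" where
  "ddf a r \<rho> C \<longleftrightarrow>
     (\<forall>w. \<forall>m<num_msgs C. \<forall>i<blocklength C. src_enc C w m i = source_gauss TYPE(nat) w m i) \<and>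
     (\<forall>i<blocklength C. \<forall>w v g y.
        listens C i (w, v, g, y) \<longleftrightarrow> i \<in> ddf_listening a \<rho> r (blocklength C) g) \<and>
     (\<exists>\<mu> :: cseq \<times> complex \<times> cseq \<Rightarrow> nat.
        (\<forall>w g y. is_arg_min
           (\<lambda>m. \<Sum>i\<in>ddf_listening a \<rho> r (blocklength C) g.
                  (cmod (y i - g * complex_of_real (\<rho> powr (a / 2)) * src_enc C w m i))\<^sup>2)
           (\<lambda>m. m < num_msgs C) (\<mu> (w, g, y))) \<and>
        (\<forall>i<blocklength C. \<forall>w v g y.
           i \<notin> ddf_listening a \<rho> r (blocklength C) g \<longrightarrow>
           relay_enc C i (w, v, g, y) = relay_gauss w (\<mu> (w, g, y)) i))"

definition qmf_achieves :: "real \<Rightarrow> real \<Rightarrow> real \<Rightarrow> real \<Rightarrow> real \<Rightarrow> bool" where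
  "qmf_achieves a b c r d \<longleftrightarrow> achieves a b c (\<lambda>_ C. static_qmf_half C) r d"

definition ddf_achieves :: "real \<Rightarrow> real \<Rightarrow> real \<Rightarrow> real \<Rightarrow> real \<Rightarrow> bool" where
  "ddf_achieves a b c r d \<longleftrightarrow> achieves a b c (\<lambda>\<rho> C. ddf a r \<rho> C) r d"

end

(*
Converse. For fixed gains, the success probability of a code is bounded by a change of measure from
the actual received signals to the output of a Gaussian codebook that is independent of the message;
the logarithm of the likelihood ratio is, on average, at most a cut value, and a Fano-type argument
bounds the success probability away from 1 when the rate exceeds this value. The value of each cut
depends on the relay's policy only through the expected fraction t of listening time given h_sr, and
this t cannot depend on the gains to the destination. Hence for h_sr of order one either t is so
short that the cut around the source fails once the direct link is weak, or so long that the cut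
around the destination fails once both links to the destination are weak; the cheaper of the two
polynomially small events lower-bounds the error probability. For c >= p or r <= c it suffices that
the links out of the source are weak.

Achievability. Both strategies are analyzed for i.i.d. Gaussian codebooks with a threshold decoder on
squared distances, by exponential moments of Gaussian quadratic forms and a union bound over wrong
messages (and, for quantize-map-forward, over the quantizer labels). With blocklength proportional
to log rho the error off the outage event decays faster than the outage probability. The latter
event forces a product of gains to be small, which Markov's inequality for the moments of
1 / |h|^(2s), s < 1, turns into the claimed exponent.
*)
theory Submission
  imports Defs "HOL-Real_Asymp.Real_Asymp"
begin

section \<open>The circularly symmetric Gaussian law\<close>

text \<open>In the converse the exponent comes from the fading event alone; on that event an error
  probability bounded away from 0 suffices, and Markov's inequality for the expected cost delivers
  it. The obstacle is feedback: which gain acts at a given time depends on earlier noise through the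
  schedule. It is removed by fixing the whole schedule, at the price of a union over 2 ^ n of them.
  For r > 0 this price is absorbed by a rate gap proportional to n ln \<rho>; for r = 0 the rate may
  stay bounded and a separate argument avoids the union. In the achievability,
  \<open>achieves\<close> asks for a limit, so a single family must serve every exponent below the
  optimum, and the opposite half of the limit is the converse applied to that same family.
  Independence of wrong codewords from the received signal is expressed by resampling coordinates of
  one seed, and the exponential moments are bounded uniformly in the received signal, whose law is
  never computed.\<close>

abbreviation half_normal :: "real measure" where
  "half_normal \<equiv> density lborel (normal_density 0 (1 / sqrt 2))"

lemma prob_space_half_normal: "prob_space half_normal"
  by (rule prob_space_normal_density) simp

lemma sets_CN [simp, measurable_cong]: "sets CN = sets borel"
  by (simp add: CN_def)

lemma space_CN [simp]: "space CN = UNIV"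
  by (simp add: CN_def)

interpretation CN: prob_space CN
  by (rule prob_space_CN)

lemma measurable_Complex [measurable]:
  assumes [measurable]: "f \<in> borel_measurable M" "g \<in> borel_measurable M"
  shows "(\<lambda>x. Complex (f x) (g x)) \<in> borel_measurable M"
  unfolding Complex_eq by measurable

lemma nn_integral_CN:
  assumes [measurable]: "f \<in> borel_measurable borel"
  shows "(\<integral>\<^sup>+z. f z \<partial>CN) = (\<integral>\<^sup>+x. \<integral>\<^sup>+y. f (Complex x y) \<partial>half_normal \<partial>half_normal)"
proof -
  interpret H: prob_space half_normal by (rule prob_space_half_normal)
  show ?thesis
    unfolding CN_def
    by (subst nn_integral_distr)
      (simp_all add: H.nn_integral_fst[symmetric] split_beta' cong: measurable_cong_sets)
qed

lemma nn_integral_half_normal: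
  assumes [measurable]: "f \<in> borel_measurable borel"
  shows "(\<integral>\<^sup>+x. f x \<partial>half_normal) = (\<integral>\<^sup>+x. ennreal (exp (- x\<^sup>2) / sqrt pi) * f x \<partial>lborel)"
  by (subst nn_integral_density)
     (auto intro!: nn_integral_cong simp: normal_density_def real_sqrt_divide power2_eq_square field_simps)

lemma nn_integral_half_normal_exp:
  assumes s: "s > -1"
  shows "(\<integral>\<^sup>+x. ennreal (exp (2 * u * x - s * x\<^sup>2)) \<partial>half_normal) =
    ennreal (exp (u\<^sup>2 / (1 + s)) / sqrt (1 + s))"
proof -
  let ?m = "u / (1 + s)" and ?d = "1 / sqrt (2 * (1 + s))"
  have d: "?d > 0" using s by simp
  have "exp (- x\<^sup>2) / sqrt pi * exp (2 * u * x - s * x\<^sup>2) =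
     exp (u\<^sup>2 / (1 + s)) / sqrt (1 + s) * normal_density ?m ?d x" for x
  proof -
    have sq: "- x\<^sup>2 + (2 * (m * (1 + s)) * x - s * x\<^sup>2) = m * (m * (1 + s)) - (x - m)\<^sup>2 * (1 + s)" for m
      by (simp add: power2_eq_square algebra_simps)
    have um: "?m * (1 + s) = u" using s by simp
    have "- x\<^sup>2 + (2 * u * x - s * x\<^sup>2) = u\<^sup>2 / (1 + s) - (x - ?m)\<^sup>2 * (1 + s)"
      using sq[of ?m] unfolding um by (simp add: power2_eq_square)
    moreover have "(x - ?m)\<^sup>2 / (2 * ?d\<^sup>2) = (x - ?m)\<^sup>2 * (1 + s)"
      using s by (simp add: power_divide)
    moreover have "sqrt (2 * pi * ?d\<^sup>2) = sqrt pi / sqrt (1 + s)"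
    proof -
      have "2 * pi * ?d\<^sup>2 = pi / (1 + s)" using s by (simp add: power_divide divide_simps)
      then show ?thesis by (simp only: real_sqrt_divide)
    qed
    ultimately have nd: "normal_density ?m ?d x = sqrt (1 + s) / sqrt pi * exp (- ((x - ?m)\<^sup>2 * (1 + s)))"
      and ex: "exp (- x\<^sup>2 + (2 * u * x - s * x\<^sup>2)) = exp (u\<^sup>2 / (1 + s)) * exp (- ((x - ?m)\<^sup>2 * (1 + s)))"
      unfolding normal_density_def by (simp_all add: exp_add[symmetric] del: power_divide)
    have "exp (- x\<^sup>2) / sqrt pi * exp (2 * u * x - s * x\<^sup>2) = exp (- x\<^sup>2 + (2 * u * x - s * x\<^sup>2)) / sqrt pi"
      by (simp only: exp_add times_divide_eq_left)
    then show ?thesis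
      unfolding nd ex using s by simp
  qed
  then have "(\<integral>\<^sup>+x. ennreal (exp (2 * u * x - s * x\<^sup>2)) \<partial>half_normal) =
    (\<integral>\<^sup>+x. ennreal (exp (u\<^sup>2 / (1 + s)) / sqrt (1 + s)) * ennreal (normal_density ?m ?d x) \<partial>lborel)"
    using s by (subst nn_integral_half_normal) (auto intro!: nn_integral_cong simp: ennreal_mult[symmetric])
  also have "\<dots> = ennreal (exp (u\<^sup>2 / (1 + s)) / sqrt (1 + s)) * (\<integral>\<^sup>+x. ennreal (normal_density ?m ?d x) \<partial>lborel)"
    by (rule nn_integral_cmult) simp
  also have "(\<integral>\<^sup>+x. ennreal (normal_density ?m ?d x) \<partial>lborel) = 1"
    using prob_space.emeasure_space_1[OF prob_space_normal_density[OF d, of ?m]]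
    by (simp add: emeasure_density)
  finally show ?thesis by simp
qed

text \<open>Expanding the squared distance between a received value and a scaled Gaussian input
  gives this form with s the squared gain. All codebook averages and, with s = -1/2, all Chernoff
  bounds below reduce to it.\<close>

lemma nn_integral_CN_exp:
  assumes s: "s > -1"
  shows "(\<integral>\<^sup>+z. ennreal (exp (2 * Re (cnj u * z) - s * (cmod z)\<^sup>2)) \<partial>CN) =
    ennreal (exp ((cmod u)\<^sup>2 / (1 + s)) / (1 + s))"
proof -
  have eq: "exp (2 * Re (cnj u * Complex x y) - s * (cmod (Complex x y))\<^sup>2) =
    exp (2 * Re u * x - s * x\<^sup>2) * exp (2 * Im u * y - s * y\<^sup>2)" for x y
    by (simp add: exp_add[symmetric] cmod_power2 algebra_simps)
  have "(\<integral>\<^sup>+z. ennreal (exp (2 * Re (cnj u * z) - s * (cmod z)\<^sup>2)) \<partial>CN) =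
    (\<integral>\<^sup>+x. \<integral>\<^sup>+y. ennreal (exp (2 * Re u * x - s * x\<^sup>2)) * ennreal (exp (2 * Im u * y - s * y\<^sup>2)) \<partial>half_normal \<partial>half_normal)"
    unfolding eq[symmetric] ennreal_mult[symmetric, OF exp_ge_zero exp_ge_zero]
    by (rule nn_integral_CN) simp
  also have "\<dots> = ennreal (exp ((Re u)\<^sup>2 / (1 + s)) / sqrt (1 + s)) * ennreal (exp ((Im u)\<^sup>2 / (1 + s)) / sqrt (1 + s))"
    by (simp add: nn_integral_cmult nn_integral_multc nn_integral_half_normal_exp[OF s])
  also have "\<dots> = ennreal (exp ((cmod u)\<^sup>2 / (1 + s)) / (1 + s))"
    using s by (simp add: ennreal_mult[symmetric] exp_add[symmetric] cmod_power2 add_divide_distrib)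
  finally show ?thesis .
qed

lemma nn_integral_CN_norm_sq: "(\<integral>\<^sup>+z. ennreal ((cmod z)\<^sup>2) \<partial>CN) = 1"
proof -
  interpret H: prob_space half_normal by (rule prob_space_half_normal)
  have "has_bochner_integral lborel (\<lambda>x. normal_density 0 (1 / sqrt 2) x * x\<^sup>2) (1 / 2)"
    using normal_moment_even[of "1 / sqrt 2" 0 1] by (simp add: power_divide)
  then have "(\<integral>\<^sup>+x. ennreal (normal_density 0 (1 / sqrt 2) x * x\<^sup>2) \<partial>lborel) = ennreal (1 / 2)"
    by (subst nn_integral_eq_integral) (simp_all only: has_bochner_integral_iff, simp_all)
  then have "(\<integral>\<^sup>+x. ennreal (x\<^sup>2) \<partial>half_normal) = ennreal (1 / 2)"
    by (subst nn_integral_density) (auto simp: ennreal_mult)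
  note half = this
  have "(\<integral>\<^sup>+z. ennreal ((cmod z)\<^sup>2) \<partial>CN) =
    (\<integral>\<^sup>+x. \<integral>\<^sup>+y. ennreal (x\<^sup>2) + ennreal (y\<^sup>2) \<partial>half_normal \<partial>half_normal)"
    by (subst nn_integral_CN) (simp_all add: cmod_power2)
  also have "\<dots> = ennreal (1 / 2) + ennreal (1 / 2)"
    by (simp add: nn_integral_add half H.emeasure_space_1[simplified] del: ennreal_half)
  finally show ?thesis by (simp add: ennreal_plus[symmetric] del: ennreal_plus ennreal_half)
qed

text \<open>The square of half side sqrt (t / 2) lies in the disc, and each real density is at least
  exp (-1) / sqrt pi on [-1, 1]. The factor 2 in the constant is the area 2 t of the square divided
  by t.\<close>

lemma CN_small_ball_lower:
  obtains k where "k > 0" "\<And>t. 0 \<le> t \<Longrightarrow> t \<le> 1 \<Longrightarrow> ennreal (k * t) \<le> emeasure CN {z. (cmod z)\<^sup>2 \<le> t}"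
proof -
  let ?k = "(exp (-1) / sqrt pi)\<^sup>2 * 2"
  have "ennreal (?k * t) \<le> emeasure CN {z. (cmod z)\<^sup>2 \<le> t}" if t: "0 \<le> t" "t \<le> 1" for t
  proof -
  define u where "u = sqrt (t / 2)"
  have u: "0 \<le> u" "u \<le> 1" "u\<^sup>2 = t / 2" using t by (auto simp: u_def)
  have N: "ennreal (2 * u * (exp (-1) / sqrt pi)) \<le> (\<integral>\<^sup>+x. indicator {-u..u} x \<partial>half_normal)"
  proof -
    have "ennreal (2 * u * (exp (-1) / sqrt pi)) = (\<integral>\<^sup>+x. ennreal (exp (-1) / sqrt pi) * indicator {-u..u} x \<partial>lborel)"
    proof -
      have "(\<integral>\<^sup>+x. ennreal (exp (-1) / sqrt pi) * indicator {-u..u} x \<partial>lborel) =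
        ennreal (exp (-1) / sqrt pi) * ennreal (2 * u)"
        using u by (subst nn_integral_cmult_indicator) simp_all
      also have "\<dots> = ennreal (exp (-1) / sqrt pi * (2 * u))"
        using u by (intro ennreal_mult[symmetric]) auto
      finally show ?thesis by (simp add: mult.commute)
    qed
    also have "\<dots> \<le> (\<integral>\<^sup>+x. ennreal (exp (- x\<^sup>2) / sqrt pi) * indicator {-u..u} x \<partial>lborel)"
    proof (intro nn_integral_mono)
      fix x :: real
      show "ennreal (exp (-1) / sqrt pi) * indicator {-u..u} x \<le> ennreal (exp (- x\<^sup>2) / sqrt pi) * indicator {-u..u} x"
      proof (cases "x \<in> {-u..u}")
        case True
        then have "\<bar>x\<bar> \<le> 1" using u by auto
        then have "x\<^sup>2 \<le> 1" by (simp add: abs_square_le_1)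
        then show ?thesis by (auto intro!: mult_right_mono ennreal_leI divide_right_mono)
      qed auto
    qed
    also have "\<dots> = (\<integral>\<^sup>+x. indicator {-u..u} x \<partial>half_normal)"
      by (subst nn_integral_half_normal) auto
    finally show ?thesis .
  qed
  have "ennreal (?k * t) = ennreal (2 * u * (exp (-1) / sqrt pi)) * ennreal (2 * u * (exp (-1) / sqrt pi))"
  proof -
    have "?k * t = (2 * u * (exp (-1) / sqrt pi)) * (2 * u * (exp (-1) / sqrt pi))"
      using u(3) by (simp add: power2_eq_square algebra_simps)
    then show ?thesis using u by (simp add: ennreal_mult[symmetric])
  qed
  also have "\<dots> \<le> (\<integral>\<^sup>+x. indicator {-u..u} x \<partial>half_normal) * (\<integral>\<^sup>+x. indicator {-u..u} x \<partial>half_normal)"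
    by (intro mult_mono N) auto
  also have "\<dots> = (\<integral>\<^sup>+x. \<integral>\<^sup>+y. indicator {-u..u} x * indicator {-u..u} y \<partial>half_normal \<partial>half_normal)"
    by (simp add: nn_integral_cmult nn_integral_multc)
  also have "\<dots> \<le> (\<integral>\<^sup>+x. \<integral>\<^sup>+y. indicator {z. (cmod z)\<^sup>2 \<le> t} (Complex x y) \<partial>half_normal \<partial>half_normal)"
  proof (intro nn_integral_mono)
    fix x y :: real
    show "indicator {-u..u} x * indicator {-u..u} y \<le> (indicator {z. (cmod z)\<^sup>2 \<le> t} (Complex x y) :: ennreal)"
    proof (cases "x \<in> {-u..u} \<and> y \<in> {-u..u}")
      case True
      then have "x\<^sup>2 \<le> u\<^sup>2" "y\<^sup>2 \<le> u\<^sup>2" using u by (auto simp: abs_le_square_iff[symmetric])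
      then have "(cmod (Complex x y))\<^sup>2 \<le> t" using u by (simp add: cmod_power2)
      then show ?thesis using True by simp
    qed (auto simp: indicator_def)
  qed
  also have "\<dots> = emeasure CN {z. (cmod z)\<^sup>2 \<le> t}"
    by (subst nn_integral_CN[symmetric]) (simp_all)
  finally show ?thesis .
  qed
  then show thesis by (intro that[of ?k]) auto
qed

text \<open>Since x^2 + y^2 >= |x| |y|, the moment is at most a product of two real moments of |x|
  powr (- s), which are finite near 0 because s < 1. At s = 1 the complex moment diverges, so each
  outage estimate built on it loses an arbitrarily small exponent.\<close>

lemma CN_inverse_moment_finite:
  assumes s: "0 < s" "s < 1"
  obtains K where "K > 0" "(\<integral>\<^sup>+z. ennreal ((cmod z)\<^sup>2 powr (- s)) \<partial>CN) \<le> ennreal K"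
proof -
  let ?J = "\<integral>\<^sup>+x. ennreal (\<bar>x\<bar> powr (- s)) \<partial>half_normal"
  interpret H: prob_space half_normal by (rule prob_space_half_normal)
  have pos: "(\<integral>\<^sup>+x. ennreal (x powr (- s)) * indicator {0..1} x \<partial>lborel) = ennreal (1 / (1 - s))"
    using s by (intro nn_integral_has_integral_lebesgue') (auto intro!: has_integral_powr_from_0[of "-s" 1, simplified])
  have neg: "(\<integral>\<^sup>+x. ennreal (\<bar>x\<bar> powr (- s)) * indicator {-1..0} x \<partial>lborel) = ennreal (1 / (1 - s))"
  proof -
    have "(\<integral>\<^sup>+x. ennreal (\<bar>x\<bar> powr (- s)) * indicator {-1..0} x \<partial>lborel) =
      (\<integral>\<^sup>+x. ennreal (\<bar>-x\<bar> powr (- s)) * indicator {-1..0} (-x) \<partial>lborel)"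
      by (subst nn_integral_real_affine[where c="-1" and t=0]) auto
    also have "\<dots> = (\<integral>\<^sup>+x. ennreal (x powr (- s)) * indicator {0..1} x \<partial>lborel)"
      by (intro nn_integral_cong) (auto simp: indicator_def)
    finally show ?thesis using pos by simp
  qed
  \<comment> \<open>Near 0 the density is at most 1 and the power is integrated explicitly; for |x|
    > 1 the power is at most 1 and the density integrates to 1.\<close>
  have "?J \<le> (\<integral>\<^sup>+x. ennreal (\<bar>x\<bar> powr (- s)) * indicator {0..1} x +
      ennreal (\<bar>x\<bar> powr (- s)) * indicator {-1..0} x + ennreal (exp (- x\<^sup>2) / sqrt pi) \<partial>lborel)"
  proof (subst nn_integral_half_normal, simp, rule nn_integral_mono)
    fix x :: real
    have "1 / sqrt pi \<le> 1" using pi_gt3 by (simp add: divide_simps)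
    then have w: "exp (- x\<^sup>2) / sqrt pi \<le> 1"
      by (smt (verit) divide_right_mono exp_le_one_iff pi_ge_zero real_sqrt_ge_zero zero_le_power2)
    show "ennreal (exp (- x\<^sup>2) / sqrt pi) * ennreal (\<bar>x\<bar> powr (- s)) \<le> ennreal (\<bar>x\<bar> powr (- s)) * indicator {0..1} x +
      ennreal (\<bar>x\<bar> powr (- s)) * indicator {-1..0} x + ennreal (exp (- x\<^sup>2) / sqrt pi)"
    proof (cases "\<bar>x\<bar> \<le> 1")
      case True
      have "ennreal (exp (- x\<^sup>2) / sqrt pi) * ennreal (\<bar>x\<bar> powr (- s)) \<le> 1 * ennreal (\<bar>x\<bar> powr (- s))"
        using w by (intro mult_right_mono) auto
      also have "\<dots> \<le> ennreal (\<bar>x\<bar> powr (- s)) * indicator {0..1} x + ennreal (\<bar>x\<bar> powr (- s)) * indicator {-1..0} x"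
        using True by (auto simp: indicator_def abs_le_iff)
      finally show ?thesis by (simp add: add_increasing2)
    next
      case False
      then have "\<bar>x\<bar> powr (- s) \<le> \<bar>x\<bar> powr 0" using s by (intro powr_mono) auto
      moreover have "\<bar>x\<bar> powr 0 = 1" using False by (intro powr_zero_eq_one[THEN trans]) auto
      ultimately have "\<bar>x\<bar> powr (- s) \<le> 1" by simp
      then have "ennreal (exp (- x\<^sup>2) / sqrt pi) * ennreal (\<bar>x\<bar> powr (- s)) \<le> ennreal (exp (- x\<^sup>2) / sqrt pi) * 1"
        by (intro mult_left_mono) auto
      then show ?thesis by (simp add: add_increasing)
    qed
  qed
  also have "\<dots> = ennreal (1 / (1 - s)) + ennreal (1 / (1 - s)) + 1"
  proof -
    have "(\<integral>\<^sup>+x. ennreal (\<bar>x\<bar> powr (- s)) * indicator {0..1} x \<partial>lborel) = ennreal (1 / (1 - s))"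
      unfolding pos[symmetric] by (intro nn_integral_cong) (auto simp: indicator_def)
    moreover have "(\<integral>\<^sup>+x. ennreal (exp (- x\<^sup>2) / sqrt pi) \<partial>lborel) = 1"
      using nn_integral_half_normal[of "\<lambda>_. 1"] H.emeasure_space_1 by simp
    ultimately show ?thesis using neg by (simp add: nn_integral_add)
  qed
  also have "\<dots> = ennreal (2 / (1 - s) + 1)"
    using s by (simp add: ennreal_plus[symmetric] ennreal_1[symmetric] del: ennreal_plus ennreal_1)
  finally have J: "?J \<le> ennreal (2 / (1 - s) + 1)" .
  have "(\<integral>\<^sup>+z. ennreal ((cmod z)\<^sup>2 powr (- s)) \<partial>CN) =
    (\<integral>\<^sup>+x. \<integral>\<^sup>+y. ennreal ((cmod (Complex x y))\<^sup>2 powr (- s)) \<partial>half_normal \<partial>half_normal)"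
    by (rule nn_integral_CN) simp
  also have "\<dots> \<le> (\<integral>\<^sup>+x. \<integral>\<^sup>+y. ennreal (\<bar>x\<bar> powr (- s)) * ennreal (\<bar>y\<bar> powr (- s)) \<partial>half_normal \<partial>half_normal)"
  proof -
    have neq: "AE x in half_normal. x \<noteq> 0"
      using AE_lborel_singleton[of "0::real"] by (auto simp: AE_density)
    have pw: "(x\<^sup>2 + y\<^sup>2) powr (- s) \<le> \<bar>x\<bar> powr (- s) * \<bar>y\<bar> powr (- s)" if "x \<noteq> 0" "y \<noteq> 0" for x y :: real
    proof -
      have "0 \<le> (\<bar>x\<bar> - \<bar>y\<bar>)\<^sup>2" by simp
      then have "2 * (\<bar>x\<bar> * \<bar>y\<bar>) \<le> x\<^sup>2 + y\<^sup>2" by (simp add: power2_diff)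
      moreover have "\<bar>x\<bar> * \<bar>y\<bar> \<ge> 0" by simp
      ultimately have "\<bar>x\<bar> * \<bar>y\<bar> \<le> x\<^sup>2 + y\<^sup>2" by linarith
      then have "(x\<^sup>2 + y\<^sup>2) powr (- s) \<le> (\<bar>x\<bar> * \<bar>y\<bar>) powr (- s)"
        using s that by (intro powr_mono2') auto
      then show ?thesis by (simp add: powr_mult)
    qed
    then have pw': "ennreal ((cmod (Complex x y))\<^sup>2 powr (- s)) \<le> ennreal (\<bar>x\<bar> powr (- s)) * ennreal (\<bar>y\<bar> powr (- s))"
      if "x \<noteq> 0" "y \<noteq> 0" for x y :: real
      using that by (simp add: cmod_power2 ennreal_mult[symmetric])
    have inner: "(\<integral>\<^sup>+y. ennreal ((cmod (Complex x y))\<^sup>2 powr (- s)) \<partial>half_normal) \<le>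
        (\<integral>\<^sup>+y. ennreal (\<bar>x\<bar> powr (- s)) * ennreal (\<bar>y\<bar> powr (- s)) \<partial>half_normal)" if "x \<noteq> 0" for x
      by (rule nn_integral_mono_AE, rule eventually_mono[OF neq]) (rule pw'[OF that])
    have "AE x in half_normal. (\<integral>\<^sup>+y. ennreal ((cmod (Complex x y))\<^sup>2 powr (- s)) \<partial>half_normal) \<le>
        (\<integral>\<^sup>+y. ennreal (\<bar>x\<bar> powr (- s)) * ennreal (\<bar>y\<bar> powr (- s)) \<partial>half_normal)"
      by (rule eventually_mono[OF neq]) (rule inner)
    then show ?thesis
      by (rule nn_integral_mono_AE)
  qed
  also have "\<dots> = ?J * ?J"
    by (simp add: nn_integral_cmult nn_integral_multc)
  also have "\<dots> \<le> ennreal (2 / (1 - s) + 1) * ennreal (2 / (1 - s) + 1)"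
    by (intro mult_mono J) auto
  also have "\<dots> = ennreal ((2 / (1 - s) + 1)\<^sup>2)"
    unfolding power2_eq_square using s by (intro ennreal_mult[symmetric]) auto
  finally show thesis
    using that[of "(2 / (1 - s) + 1)\<^sup>2"] s
    by (smt (verit, ccfv_SIG) divide_pos_pos zero_less_power)
qed

text \<open>Chernoff bound with exponent 1/2, whose exponential moment is 2.\<close>

lemma CN_tail:
  assumes "0 \<le> t"
  shows "emeasure CN {z. t < (cmod z)\<^sup>2} \<le> ennreal (2 * exp (- t / 2))"
proof -
  have "emeasure CN {z. t < (cmod z)\<^sup>2} = (\<integral>\<^sup>+z. indicator {z. t < (cmod z)\<^sup>2} z \<partial>CN)"
    by simp
  also have "\<dots> \<le> (\<integral>\<^sup>+z. ennreal (exp (- t / 2)) * ennreal (exp (2 * Re (cnj 0 * z) - (-1/2) * (cmod z)\<^sup>2)) \<partial>CN)"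
  proof (rule nn_integral_mono)
    fix z :: complex
    have "1 \<le> exp (- t / 2 + (cmod z)\<^sup>2 / 2)" if "t < (cmod z)\<^sup>2" using that by simp
    then show "indicator {z. t < (cmod z)\<^sup>2} z \<le> ennreal (exp (- t / 2)) * ennreal (exp (2 * Re (cnj 0 * z) - (-1/2) * (cmod z)\<^sup>2))"
      by (auto simp: indicator_def ennreal_mult[symmetric] exp_add[symmetric] ennreal_ge_1)
  qed
  also have "\<dots> = ennreal (exp (- t / 2)) * ennreal (exp ((cmod 0)\<^sup>2 / (1 + (-1/2))) / (1 + (-1/2)))"
    by (subst nn_integral_cmult, simp, subst nn_integral_CN_exp) auto
  also have "\<dots> = ennreal (2 * exp (- t / 2))"
    by (simp add: ennreal_mult'' mult.commute)
  finally show ?thesis .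
qed

section \<open>Sequences of independent Gaussians\<close>

lemma sets_iid_CN [simp, measurable_cong]: "sets iid_CN = sets cseq_borel"
  unfolding iid_CN_def by (rule sets_PiM_cong) auto

lemma space_iid_CN [simp]: "space iid_CN = UNIV"
  by (auto simp: iid_CN_def space_PiM)

lemma space_cseq_borel [simp]: "space cseq_borel = UNIV"
  by (auto simp: space_PiM)

interpretation iid: prob_space iid_CN
  by (rule prob_space_iid_CN)

interpretation iid2: pair_prob_space iid_CN iid_CN ..

lemma measurable_cseq_component:
  assumes "f \<in> measurable M cseq_borel"
  shows "(\<lambda>x. f x i) \<in> borel_measurable M"
  using measurable_compose[OF assms measurable_component_singleton[of i UNIV]] by simp

lemma measurable_cseq_lambda:
  assumes "\<And>i. (\<lambda>x. f x i) \<in> borel_measurable M"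
  shows "f \<in> measurable M cseq_borel"
  using assms by (intro measurable_PiM_single') auto

lemma measurable_override_on [measurable (raw)]:
  assumes [measurable]: "f \<in> measurable M cseq_borel" "g \<in> measurable M cseq_borel"
  shows "(\<lambda>x. override_on (f x) (g x) J) \<in> measurable M cseq_borel"
proof (rule measurable_cseq_lambda)
  show "(\<lambda>x. override_on (f x) (g x) J i) \<in> borel_measurable M" for i
    by (cases "i \<in> J") (simp_all)
qed

lemma measurable_cseq_fun_upd [measurable (raw)]:
  assumes [measurable]: "f \<in> measurable M cseq_borel" "g \<in> borel_measurable M"
  shows "(\<lambda>x. (f x)(k := g x)) \<in> measurable M cseq_borel"
proof (rule measurable_cseq_lambda)
  show "(\<lambda>x. ((f x)(k := g x)) i) \<in> borel_measurable M" for i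
    by (cases "i = k") simp_all
qed

text \<open>Both laws give a cylinder set the same product of one-coordinate probabilities:
  coordinates in J are read from the second sequence, the others from the first.\<close>

lemma distr_override_on_iid:
  "distr (iid_CN \<Otimes>\<^sub>M iid_CN) cseq_borel (\<lambda>(w, w'). override_on w w' J) = iid_CN"
proof -
  interpret P: product_prob_space "\<lambda>_. CN" "UNIV :: nat set" ..
  have "distr (iid_CN \<Otimes>\<^sub>M iid_CN) cseq_borel (\<lambda>(w, w'). override_on w w' J) = PiM UNIV (\<lambda>_. CN)"
  proof (rule P.PiM_eq)
    show "sets (distr (iid_CN \<Otimes>\<^sub>M iid_CN) cseq_borel (\<lambda>(w, w'). override_on w w' J)) = sets (PiM UNIV (\<lambda>_. CN))"
      using sets_iid_CN unfolding iid_CN_def by simp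
    fix K :: "nat set" and F
    assume K: "finite K" "K \<subseteq> UNIV" and F: "\<And>j. j \<in> K \<Longrightarrow> F j \<in> sets CN"
    have F'[measurable]: "\<And>j. j \<in> K \<Longrightarrow> F j \<in> sets borel" using F by simp
    have emb: "prod_emb UNIV (\<lambda>_. CN) L (Pi\<^sub>E L F) = {w. \<forall>j\<in>L. w j \<in> F j}" for L
      by (auto simp: prod_emb_def)
    have m: "{w. \<forall>j\<in>L. w j \<in> F j} \<in> sets cseq_borel" if "L \<subseteq> K" for L
    proof -
      have "finite L" using that K(1) by (rule finite_subset)
      then have "{w \<in> space cseq_borel. \<forall>j\<in>L. w j \<in> F j} \<in> sets cseq_borel"
        using that F' by (intro sets_Collect_single sets.sets_Collect_finite_All) (auto simp: Pi_iff subset_iff)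
      then show ?thesis by simp
    qed
    have pr: "emeasure iid_CN {w. \<forall>j\<in>L. w j \<in> F j} = (\<Prod>j\<in>L. emeasure CN (F j))" if "L \<subseteq> K" for L
      unfolding iid_CN_def emb[symmetric] using that F K(1)
      by (intro P.emeasure_PiM_emb) (auto intro: finite_subset)
    have vimage: "(\<lambda>(w, w'). override_on w w' J) -` {w. \<forall>j\<in>K. w j \<in> F j} \<inter> space (iid_CN \<Otimes>\<^sub>M iid_CN)
      = {w. \<forall>j\<in>K - J. w j \<in> F j} \<times> {w. \<forall>j\<in>K \<inter> J. w j \<in> F j}"
      by (auto simp: space_pair_measure override_on_def)
    have "emeasure (distr (iid_CN \<Otimes>\<^sub>M iid_CN) cseq_borel (\<lambda>(w, w'). override_on w w' J)) {w. \<forall>j\<in>K. w j \<in> F j}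
      = emeasure (iid_CN \<Otimes>\<^sub>M iid_CN) ({w. \<forall>j\<in>K - J. w j \<in> F j} \<times> {w. \<forall>j\<in>K \<inter> J. w j \<in> F j})"
    proof (subst emeasure_distr)
      show "(\<lambda>(w, w'). override_on w w' J) \<in> measurable (iid_CN \<Otimes>\<^sub>M iid_CN) cseq_borel"
        by (simp add: split_beta')
    qed (simp_all only: m[of K, simplified] vimage)
    also have "\<dots> = (\<Prod>j\<in>K - J. emeasure CN (F j)) * (\<Prod>j\<in>K \<inter> J. emeasure CN (F j))"
      using m by (subst iid.emeasure_pair_measure_Times) (auto simp: pr)
    also have "\<dots> = (\<Prod>j\<in>K. emeasure CN (F j))"
      using K(1) by (metis mult.commute prod.Int_Diff)
    finally show "emeasure (distr (iid_CN \<Otimes>\<^sub>M iid_CN) cseq_borel (\<lambda>(w, w'). override_on w w' J))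
      (prod_emb UNIV (\<lambda>_. CN) K (Pi\<^sub>E K F)) = (\<Prod>j\<in>K. emeasure CN (F j))"
      unfolding emb .
  qed
  then show ?thesis by (simp add: iid_CN_def)
qed

text \<open>This is how independence inside the single seed is exploited: the coordinates in J are
  drawn afresh and integrated first, while everything that ignores J remains a function of
  w.\<close>

lemma nn_integral_iid_resample:
  assumes [measurable]: "F \<in> borel_measurable cseq_borel"
  shows "(\<integral>\<^sup>+w. F w \<partial>iid_CN) = (\<integral>\<^sup>+w. \<integral>\<^sup>+w'. F (override_on w w' J) \<partial>iid_CN \<partial>iid_CN)"
  by (subst distr_override_on_iid[of J, symmetric], subst nn_integral_distr)
    (simp_all add: iid.nn_integral_fst[symmetric] split_beta')

lemma nn_integral_iid_component:
  assumes [measurable]: "f \<in> borel_measurable borel"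
  shows "(\<integral>\<^sup>+w. f (w k) \<partial>iid_CN) = (\<integral>\<^sup>+z. f z \<partial>CN)"
proof -
  interpret P: product_prob_space "\<lambda>_. CN" "UNIV :: nat set" ..
  have "(\<integral>\<^sup>+z. f z \<partial>CN) = (\<integral>\<^sup>+z. f z \<partial>distr iid_CN CN (\<lambda>w. w k))"
    by (simp add: P.PiM_component iid_CN_def)
  also have "\<dots> = (\<integral>\<^sup>+w. f (w k) \<partial>iid_CN)"
    by (subst nn_integral_distr) (simp_all cong: measurable_cong_sets)
  finally show ?thesis ..
qed

lemma nn_integral_iid_resample1:
  assumes [measurable]: "F \<in> borel_measurable cseq_borel"
  shows "(\<integral>\<^sup>+w. F w \<partial>iid_CN) = (\<integral>\<^sup>+w. \<integral>\<^sup>+z. F (w(k := z)) \<partial>CN \<partial>iid_CN)"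
proof -
  have "override_on w w' {k} = w(k := w' k)" for w w' :: cseq
    by (auto simp: override_on_def)
  moreover have "(\<integral>\<^sup>+w'. F (w(k := w' k)) \<partial>iid_CN) = (\<integral>\<^sup>+z. F (w(k := z)) \<partial>CN)" for w
    by (rule nn_integral_iid_component[of "\<lambda>z. F (w(k := z))"]) measurable
  ultimately show ?thesis
    by (subst nn_integral_iid_resample[of _ "{k}"]) simp_all
qed

lemma nn_integral_iid_prod:
  assumes "finite I" and [measurable]: "\<And>i. f i \<in> borel_measurable borel"
  shows "(\<integral>\<^sup>+w. (\<Prod>i\<in>I. f i (w i)) \<partial>iid_CN) = (\<Prod>i\<in>I. \<integral>\<^sup>+z. f i z \<partial>CN)"
  using assms(1)
proof induction
  case empty
  then show ?case by (simp add: iid.emeasure_space_1[simplified])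
next
  case (insert k I)
  have "(\<Prod>i\<in>I. f i ((w(k := z)) i)) = (\<Prod>i\<in>I. f i (w i))" for w z
    using insert by (intro prod.cong) auto
  then have "(\<integral>\<^sup>+w. (\<Prod>i\<in>insert k I. f i (w i)) \<partial>iid_CN) =
      (\<integral>\<^sup>+w. (\<integral>\<^sup>+z. f k z * (\<Prod>i\<in>I. f i (w i)) \<partial>CN) \<partial>iid_CN)"
    using insert by (subst nn_integral_iid_resample1[of _ k]) simp_all
  also have "\<dots> = (\<integral>\<^sup>+w. (\<integral>\<^sup>+z. f k z \<partial>CN) * (\<Prod>i\<in>I. f i (w i)) \<partial>iid_CN)"
    by (intro nn_integral_cong nn_integral_multc) measurable
  also have "\<dots> = (\<Prod>i\<in>insert k I. \<integral>\<^sup>+z. f i z \<partial>CN)"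
    using insert by (subst nn_integral_cmult) simp_all
  finally show ?case .
qed


section \<open>Change of measure for Gaussian sequences\<close>

text \<open>Cameron-Martin formula in one real dimension: substitute x + a and compare the two
  densities.\<close>

lemma nn_integral_half_normal_shift:
  assumes [measurable]: "f \<in> borel_measurable borel"
  shows "(\<integral>\<^sup>+x. f (x + a) \<partial>half_normal) = (\<integral>\<^sup>+x. ennreal (exp (2 * a * x - a\<^sup>2)) * f x \<partial>half_normal)"
proof -
  have "(\<integral>\<^sup>+x. ennreal (exp (2 * a * x - a\<^sup>2)) * f x \<partial>half_normal) =
    (\<integral>\<^sup>+x. ennreal (exp (- x\<^sup>2) / sqrt pi) * (ennreal (exp (2 * a * x - a\<^sup>2)) * f x) \<partial>lborel)"
    by (rule nn_integral_half_normal) simp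
  also have "\<dots> = (\<integral>\<^sup>+x. ennreal (exp (- (a + 1 * x)\<^sup>2) / sqrt pi) * (ennreal (exp (2 * a * (a + 1 * x) - a\<^sup>2)) * f (a + 1 * x)) \<partial>lborel)"
    by (subst nn_integral_real_affine[where c=1 and t=a]) auto
  also have "\<dots> = (\<integral>\<^sup>+x. ennreal (exp (- x\<^sup>2) / sqrt pi) * f (x + a) \<partial>lborel)"
  proof (intro nn_integral_cong)
    fix x
    have "exp (- (a + 1 * x)\<^sup>2) / sqrt pi * exp (2 * a * (a + 1 * x) - a\<^sup>2) = exp (- x\<^sup>2) / sqrt pi"
      by (simp add: exp_add[symmetric] power2_eq_square algebra_simps)
    then show "ennreal (exp (- (a + 1 * x)\<^sup>2) / sqrt pi) * (ennreal (exp (2 * a * (a + 1 * x) - a\<^sup>2)) * f (a + 1 * x)) =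
      ennreal (exp (- x\<^sup>2) / sqrt pi) * f (x + a)"
      by (simp add: mult.assoc[symmetric] ennreal_mult[symmetric] add.commute)
  qed
  also have "\<dots> = (\<integral>\<^sup>+x. f (x + a) \<partial>half_normal)"
    by (rule nn_integral_half_normal[symmetric]) simp
  finally show ?thesis ..
qed

text \<open>Real and imaginary part are shifted one after the other; their likelihood ratios
  multiply to the complex one.\<close>

lemma nn_integral_CN_shift:
  assumes [measurable]: "f \<in> borel_measurable borel"
  shows "(\<integral>\<^sup>+z. f (z + a) \<partial>CN) = (\<integral>\<^sup>+z. ennreal (exp (2 * Re (cnj a * z) - (cmod a)\<^sup>2)) * f z \<partial>CN)"
proof -
  interpret H: prob_space half_normal by (rule prob_space_half_normal)
  interpret HH: pair_sigma_finite half_normal half_normal ..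
  have eq: "exp (2 * Re a * x - (Re a)\<^sup>2) * exp (2 * Im a * y - (Im a)\<^sup>2) =
    exp (2 * Re (cnj a * Complex x y) - (cmod a)\<^sup>2)" for x y
    unfolding exp_add[symmetric] cmod_power2 by (simp add: algebra_simps)
  have cx: "Complex x y + a = Complex (x + Re a) (y + Im a)" for x y
    by (simp add: complex_eq_iff)
  have "(\<integral>\<^sup>+z. f (z + a) \<partial>CN) = (\<integral>\<^sup>+x. \<integral>\<^sup>+y. f (Complex (x + Re a) (y + Im a)) \<partial>half_normal \<partial>half_normal)"
    by (subst nn_integral_CN) (simp_all add: cx)
  also have "\<dots> = (\<integral>\<^sup>+x. ennreal (exp (2 * Re a * x - (Re a)\<^sup>2)) *
      (\<integral>\<^sup>+y. f (Complex x (y + Im a)) \<partial>half_normal) \<partial>half_normal)"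
    by (rule nn_integral_half_normal_shift) simp
  also have "\<dots> = (\<integral>\<^sup>+x. ennreal (exp (2 * Re a * x - (Re a)\<^sup>2)) *
      (\<integral>\<^sup>+y. ennreal (exp (2 * Im a * y - (Im a)\<^sup>2)) * f (Complex x y) \<partial>half_normal) \<partial>half_normal)"
    by (subst nn_integral_half_normal_shift) simp_all
  also have "\<dots> = (\<integral>\<^sup>+x. \<integral>\<^sup>+y. ennreal (exp (2 * Re (cnj a * Complex x y) - (cmod a)\<^sup>2)) * f (Complex x y) \<partial>half_normal \<partial>half_normal)"
    unfolding eq[symmetric]
    by (subst nn_integral_cmult[symmetric]) (simp_all add: ennreal_mult mult.assoc)
  also have "\<dots> = (\<integral>\<^sup>+z. ennreal (exp (2 * Re (cnj a * z) - (cmod a)\<^sup>2)) * f z \<partial>CN)"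
    by (subst nn_integral_CN) simp_all
  finally show ?thesis .
qed

lemma measurable_cnj [measurable (raw)]:
  "f \<in> borel_measurable M \<Longrightarrow> (\<lambda>x. cnj (f x)) \<in> borel_measurable M"
  using borel_measurable_continuous_onI[OF continuous_on_cnj[OF continuous_on_id]]
  by (rule measurable_compose[rotated])

lemma nn_integral_swap:
  assumes "prob_space M" "prob_space N"
    and "(\<lambda>(x, y). f x y) \<in> borel_measurable (M \<Otimes>\<^sub>M N)"
  shows "(\<integral>\<^sup>+x. \<integral>\<^sup>+y. f x y \<partial>N \<partial>M) = (\<integral>\<^sup>+y. \<integral>\<^sup>+x. f x y \<partial>M \<partial>N)"
proof -
  interpret pair_prob_space M N
    using assms(1,2) by (simp add: pair_prob_space_def pair_sigma_finite_def prob_space_imp_sigma_finite)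
  show ?thesis using Fubini'[OF assms(3)] by simp
qed

text \<open>
  The reference law on the right is the output law of a Gaussian input. The constant comes from
  maximizing the likelihood ratio over the output, a quadratic form.
\<close>

lemma CN_simo_reference:
  fixes F :: "complex \<times> complex \<Rightarrow> ennreal"
  assumes [measurable]: "F \<in> borel_measurable (borel \<Otimes>\<^sub>M borel)"
  shows "(\<integral>\<^sup>+z. \<integral>\<^sup>+z'. F (z + g * x, z' + h * x) \<partial>CN \<partial>CN) \<le>
    ennreal ((1 + (cmod g)\<^sup>2 + (cmod h)\<^sup>2) * exp ((cmod x)\<^sup>2)) *
      (\<integral>\<^sup>+X. \<integral>\<^sup>+z. \<integral>\<^sup>+z'. F (z + g * X, z' + h * X) \<partial>CN \<partial>CN \<partial>CN)"
proof -
  let ?s = "(cmod g)\<^sup>2 + (cmod h)\<^sup>2"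
  \<comment> \<open>Likelihood ratio of the output pair for input X relative to pure noise. The fact
    \<open>L\<close> below shows that the outputs enter only through the matched filter cnj g y +
    cnj h y'.\<close>
  define L where "L X y y' = exp (2 * Re (cnj (g * X) * y) - (cmod (g * X))\<^sup>2) *
    exp (2 * Re (cnj (h * X) * y') - (cmod (h * X))\<^sup>2)" for X y y'
  have L_nonneg: "0 \<le> L X y y'" for X y y' by (simp add: L_def)
  have L: "L X y y' = exp (2 * Re (cnj (cnj g * y + cnj h * y') * X) - ?s * (cmod X)\<^sup>2)" for X y y'
    unfolding L_def exp_add[symmetric] norm_mult power_mult_distrib by (simp add: algebra_simps)
  have s: "0 \<le> ?s" by simp
  have ratio: "ennreal (L x y y') \<le> ennreal ((1 + ?s) * exp ((cmod x)\<^sup>2)) * (\<integral>\<^sup>+X. ennreal (L X y y') \<partial>CN)" for y y'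
  proof -
    define u where "u = cnj g * y + cnj h * y'"
    have "2 * Re (cnj u * x) \<le> 2 * (cmod u * cmod x)"
      using complex_Re_le_cmod[of "cnj u * x"] by (simp add: norm_mult)
    \<comment> \<open>AM-GM with weight 1 + ?s, chosen so that the term in |u|^2 is exactly the
      exponent of the Gaussian average of \<open>L\<close> and cancels against it.\<close>
    also have "\<dots> \<le> (cmod u)\<^sup>2 / (1 + ?s) + (1 + ?s) * (cmod x)\<^sup>2"
    proof -
      let ?q = "sqrt (1 + ?s)"
      have q: "?q > 0" "?q\<^sup>2 = 1 + ?s" using s by (simp_all add: add_pos_nonneg)
      have "0 \<le> (cmod u / ?q - ?q * cmod x)\<^sup>2" by simp
      also have "\<dots> = (cmod u)\<^sup>2 / ?q\<^sup>2 + ?q\<^sup>2 * (cmod x)\<^sup>2 - 2 * (cmod u * cmod x)"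
        using q(1) by (simp add: power2_diff power_divide power_mult_distrib)
      finally show ?thesis using q(2) by simp
    qed
    finally have "2 * Re (cnj u * x) - ?s * (cmod x)\<^sup>2 \<le> (cmod x)\<^sup>2 + (cmod u)\<^sup>2 / (1 + ?s)"
      by (simp add: algebra_simps)
    then have "L x y y' \<le> exp ((cmod x)\<^sup>2) * exp ((cmod u)\<^sup>2 / (1 + ?s))"
      unfolding L u_def[symmetric] exp_add[symmetric] by simp
    also have "\<dots> = (1 + ?s) * exp ((cmod x)\<^sup>2) * (exp ((cmod u)\<^sup>2 / (1 + ?s)) / (1 + ?s))"
    proof -
      have "e * b = k * e * (b / k)" if "k \<noteq> 0" for e b k :: real using that by simp
      moreover have "1 + ?s \<noteq> 0" using s by linarith
      ultimately show ?thesis by blast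
    qed
    finally have "ennreal (L x y y') \<le> ennreal ((1 + ?s) * exp ((cmod x)\<^sup>2) * (exp ((cmod u)\<^sup>2 / (1 + ?s)) / (1 + ?s)))"
      by (rule ennreal_leI)
    also have "\<dots> = ennreal ((1 + ?s) * exp ((cmod x)\<^sup>2)) * ennreal (exp ((cmod u)\<^sup>2 / (1 + ?s)) / (1 + ?s))"
      using s by (intro ennreal_mult mult_nonneg_nonneg divide_nonneg_nonneg add_nonneg_nonneg) auto
    also have "ennreal (exp ((cmod u)\<^sup>2 / (1 + ?s)) / (1 + ?s)) = (\<integral>\<^sup>+X. ennreal (L X y y') \<partial>CN)"
      unfolding L u_def[symmetric] using s by (intro nn_integral_CN_exp[symmetric]) linarith
    finally show ?thesis .
  qed
  have shift: "(\<integral>\<^sup>+z. \<integral>\<^sup>+z'. F (z + g * X, z' + h * X) \<partial>CN \<partial>CN) = (\<integral>\<^sup>+y. \<integral>\<^sup>+y'. ennreal (L X y y') * F (y, y') \<partial>CN \<partial>CN)" for X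
  proof -
    have "(\<integral>\<^sup>+z. \<integral>\<^sup>+z'. F (z + g * X, z' + h * X) \<partial>CN \<partial>CN) =
      (\<integral>\<^sup>+y. ennreal (exp (2 * Re (cnj (g * X) * y) - (cmod (g * X))\<^sup>2)) * (\<integral>\<^sup>+z'. F (y, z' + h * X) \<partial>CN) \<partial>CN)"
      by (rule nn_integral_CN_shift) measurable
    also have "\<dots> = (\<integral>\<^sup>+y. ennreal (exp (2 * Re (cnj (g * X) * y) - (cmod (g * X))\<^sup>2)) *
        (\<integral>\<^sup>+y'. ennreal (exp (2 * Re (cnj (h * X) * y') - (cmod (h * X))\<^sup>2)) * F (y, y') \<partial>CN) \<partial>CN)"
      by (subst nn_integral_CN_shift) simp_all
    also have "\<dots> = (\<integral>\<^sup>+y. \<integral>\<^sup>+y'. ennreal (L X y y') * F (y, y') \<partial>CN \<partial>CN)"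
      unfolding L_def by (subst nn_integral_cmult[symmetric]) (simp_all add: ennreal_mult mult.assoc)
    finally show ?thesis .
  qed
  let ?K = "ennreal ((1 + ?s) * exp ((cmod x)\<^sup>2))"
  have "(\<integral>\<^sup>+y. \<integral>\<^sup>+y'. ennreal (L x y y') * F (y, y') \<partial>CN \<partial>CN) \<le>
    (\<integral>\<^sup>+y. \<integral>\<^sup>+y'. (?K * (\<integral>\<^sup>+X. ennreal (L X y y') \<partial>CN)) * F (y, y') \<partial>CN \<partial>CN)"
    by (intro nn_integral_mono mult_right_mono ratio) simp
  also have "\<dots> = ?K * (\<integral>\<^sup>+y. \<integral>\<^sup>+y'. \<integral>\<^sup>+X. ennreal (L X y y') * F (y, y') \<partial>CN \<partial>CN \<partial>CN)"
  proof -
    have pull: "(\<integral>\<^sup>+X. ennreal (L X y y') \<partial>CN) * F (y, y') = (\<integral>\<^sup>+X. ennreal (L X y y') * F (y, y') \<partial>CN)" for y y'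
      by (rule nn_integral_multc[symmetric]) (unfold L_def, measurable)
    define J where "J y y' = (\<integral>\<^sup>+X. ennreal (L X y y') * F (y, y') \<partial>CN)" for y y'
    have [measurable]: "(\<lambda>(y, y'). J y y') \<in> borel_measurable (borel \<Otimes>\<^sub>M borel)"
    proof -
      have "(\<lambda>q. ennreal (L (snd q) (fst (fst q)) (snd (fst q))) * F (fst q))
          \<in> borel_measurable ((borel \<Otimes>\<^sub>M borel) \<Otimes>\<^sub>M CN)"
        unfolding L_def by measurable
      then show ?thesis
        unfolding J_def by (auto intro!: CN.borel_measurable_nn_integral simp: split_beta')
    qed
    have "(\<integral>\<^sup>+y. \<integral>\<^sup>+y'. ?K * J y y' \<partial>CN \<partial>CN) = (\<integral>\<^sup>+y. ?K * (\<integral>\<^sup>+y'. J y y' \<partial>CN) \<partial>CN)"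
      by (intro nn_integral_cong nn_integral_cmult) measurable
    also have "\<dots> = ?K * (\<integral>\<^sup>+y. \<integral>\<^sup>+y'. J y y' \<partial>CN \<partial>CN)"
      by (rule nn_integral_cmult) measurable
    finally show ?thesis
      by (simp only: mult.assoc J_def pull)
  qed
  also have "(\<integral>\<^sup>+y. \<integral>\<^sup>+y'. \<integral>\<^sup>+X. ennreal (L X y y') * F (y, y') \<partial>CN \<partial>CN \<partial>CN) =
    (\<integral>\<^sup>+y. \<integral>\<^sup>+X. \<integral>\<^sup>+y'. ennreal (L X y y') * F (y, y') \<partial>CN \<partial>CN \<partial>CN)"
    by (rule nn_integral_cong, rule nn_integral_swap[OF prob_space_CN prob_space_CN]) (unfold L_def, measurable)
  also have "\<dots> = (\<integral>\<^sup>+X. \<integral>\<^sup>+y. \<integral>\<^sup>+y'. ennreal (L X y y') * F (y, y') \<partial>CN \<partial>CN \<partial>CN)"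
    by (intro nn_integral_swap prob_space_CN) (unfold L_def, measurable)
  finally show ?thesis
    by (simp add: shift add.assoc)
qed

text \<open>Noise sequences are infinite, but a signal is present only in the n times of the
  block.\<close>

definition shift :: "nat \<Rightarrow> cseq \<Rightarrow> cseq \<Rightarrow> cseq" where
  "shift n s z = (\<lambda>i. if i < n then z i + s i else z i)"

lemma measurable_shift [measurable (raw)]:
  assumes [measurable]: "f \<in> measurable M cseq_borel" "g \<in> measurable M cseq_borel"
  shows "(\<lambda>x. shift n (f x) (g x)) \<in> measurable M cseq_borel"
proof (rule measurable_cseq_lambda)
  show "(\<lambda>x. shift n (f x) (g x) i) \<in> borel_measurable M" for i
    unfolding shift_def by (cases "i < n") simp_all
qed

lemma measurable_cseq_mult [measurable (raw)]:
  assumes [measurable]: "f \<in> measurable M cseq_borel"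
  shows "(\<lambda>x i. g i * f x i) \<in> measurable M cseq_borel"
  by (rule measurable_cseq_lambda) simp

text \<open>The one-sample bound tensorizes, by induction over time. The gains may vary with i, so
  that a fixed schedule can be encoded by switching them on and off.\<close>

lemma iid_simo_reference:
  assumes "(\<lambda>(y, y'). F y y') \<in> borel_measurable (cseq_borel \<Otimes>\<^sub>M cseq_borel)"
  shows "(\<integral>\<^sup>+z. \<integral>\<^sup>+z'. F (shift n (\<lambda>i. g i * x i) z) (shift n (\<lambda>i. h i * x i) z') \<partial>iid_CN \<partial>iid_CN) \<le>
    ennreal (\<Prod>i<n. (1 + (cmod (g i))\<^sup>2 + (cmod (h i))\<^sup>2) * exp ((cmod (x i))\<^sup>2)) *
      (\<integral>\<^sup>+X. \<integral>\<^sup>+z. \<integral>\<^sup>+z'. F (shift n (\<lambda>i. g i * X i) z) (shift n (\<lambda>i. h i * X i) z') \<partial>iid_CN \<partial>iid_CN \<partial>iid_CN)"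
  using assms
proof (induction n arbitrary: F)
  case 0
  then show ?case by (simp add: shift_def iid.emeasure_space_1[simplified])
next
  case (Suc n)
  note [measurable] = Suc.prems
  let ?k = "\<lambda>i. (1 + (cmod (g i))\<^sup>2 + (cmod (h i))\<^sup>2) * exp ((cmod (x i))\<^sup>2)"
  have k: "0 \<le> ?k i" for i by (intro mult_nonneg_nonneg add_nonneg_nonneg) auto
  \<comment> \<open>The signal at time n is absorbed into the functional, so that the induction
    hypothesis concerns the first n samples only.\<close>
  define F' where "F' y y' = F (y(n := y n + g n * x n)) (y'(n := y' n + h n * x n))" for y y'
  have [measurable]: "(\<lambda>(y, y'). F' y y') \<in> borel_measurable (cseq_borel \<Otimes>\<^sub>M cseq_borel)"
    unfolding F'_def by measurable
  define \<Phi> where "\<Phi> X = (\<integral>\<^sup>+z. \<integral>\<^sup>+z'. F (shift (Suc n) (\<lambda>i. g i * X i) z)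
    (shift (Suc n) (\<lambda>i. h i * X i) z') \<partial>iid_CN \<partial>iid_CN)" for X
  have [measurable]: "\<Phi> \<in> borel_measurable cseq_borel"
    unfolding \<Phi>_def by measurable
  have shift_Suc: "shift (Suc n) s z = (shift n s z)(n := shift n s z n + s n)" for s z
    by (auto simp: shift_def fun_eq_iff)
  have "(\<integral>\<^sup>+z. \<integral>\<^sup>+z'. F (shift (Suc n) (\<lambda>i. g i * x i) z) (shift (Suc n) (\<lambda>i. h i * x i) z') \<partial>iid_CN \<partial>iid_CN) =
    (\<integral>\<^sup>+z. \<integral>\<^sup>+z'. F' (shift n (\<lambda>i. g i * x i) z) (shift n (\<lambda>i. h i * x i) z') \<partial>iid_CN \<partial>iid_CN)"
    by (simp add: shift_Suc F'_def)
  also have "\<dots> \<le> ennreal (\<Prod>i<n. ?k i) *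
      (\<integral>\<^sup>+X. \<integral>\<^sup>+z. \<integral>\<^sup>+z'. F' (shift n (\<lambda>i. g i * X i) z) (shift n (\<lambda>i. h i * X i) z') \<partial>iid_CN \<partial>iid_CN \<partial>iid_CN)"
    by (rule Suc.IH) measurable
  also have "\<dots> \<le> ennreal (\<Prod>i<n. ?k i) * (\<integral>\<^sup>+X. ennreal (?k n) * (\<integral>\<^sup>+\<xi>. \<Phi> (X(n := \<xi>)) \<partial>CN) \<partial>iid_CN)"
  proof (intro mult_left_mono nn_integral_mono)
    fix X :: cseq
    define G where "G y y' = F (shift n (\<lambda>i. g i * X i) y) (shift n (\<lambda>i. h i * X i) y')" for y y'
    have [measurable]: "(\<lambda>(y, y'). G y y') \<in> borel_measurable (cseq_borel \<Otimes>\<^sub>M cseq_borel)"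
      unfolding G_def by measurable
    \<comment> \<open>Resampling coordinate n of both noises isolates the pair of samples to which
      \<open>CN_simo_reference\<close> applies.\<close>
    have expand: "(\<integral>\<^sup>+z. \<integral>\<^sup>+z'. G (z(n := z n + s)) (z'(n := z' n + s')) \<partial>iid_CN \<partial>iid_CN) =
      (\<integral>\<^sup>+z. \<integral>\<^sup>+z'. \<integral>\<^sup>+y. \<integral>\<^sup>+y'. G (z(n := y + s)) (z'(n := y' + s')) \<partial>CN \<partial>CN \<partial>iid_CN \<partial>iid_CN)" for s s'
    proof -
      have "(\<integral>\<^sup>+z. \<integral>\<^sup>+z'. G (z(n := z n + s)) (z'(n := z' n + s')) \<partial>iid_CN \<partial>iid_CN) =
        (\<integral>\<^sup>+z. \<integral>\<^sup>+y. \<integral>\<^sup>+z'. G (z(n := y + s)) (z'(n := z' n + s')) \<partial>iid_CN \<partial>CN \<partial>iid_CN)"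
        by (subst nn_integral_iid_resample1[of _ n]) simp_all
      also have "\<dots> = (\<integral>\<^sup>+z. \<integral>\<^sup>+y. \<integral>\<^sup>+z'. \<integral>\<^sup>+y'. G (z(n := y + s)) (z'(n := y' + s')) \<partial>CN \<partial>iid_CN \<partial>CN \<partial>iid_CN)"
        by (subst (2) nn_integral_iid_resample1[of _ n]) simp_all
      also have "\<dots> = (\<integral>\<^sup>+z. \<integral>\<^sup>+z'. \<integral>\<^sup>+y. \<integral>\<^sup>+y'. G (z(n := y + s)) (z'(n := y' + s')) \<partial>CN \<partial>CN \<partial>iid_CN \<partial>iid_CN)"
        by (intro nn_integral_cong nn_integral_swap prob_space_CN prob_space_iid_CN) measurable
      finally show ?thesis .
    qed
    have "(\<integral>\<^sup>+z. \<integral>\<^sup>+z'. F' (shift n (\<lambda>i. g i * X i) z) (shift n (\<lambda>i. h i * X i) z') \<partial>iid_CN \<partial>iid_CN) =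
      (\<integral>\<^sup>+z. \<integral>\<^sup>+z'. G (z(n := z n + g n * x n)) (z'(n := z' n + h n * x n)) \<partial>iid_CN \<partial>iid_CN)"
      unfolding F'_def G_def
      by (intro nn_integral_cong arg_cong2[where f=F]) (auto simp: shift_def fun_eq_iff)
    also have "\<dots> = (\<integral>\<^sup>+z. \<integral>\<^sup>+z'. \<integral>\<^sup>+y. \<integral>\<^sup>+y'. G (z(n := y + g n * x n)) (z'(n := y' + h n * x n)) \<partial>CN \<partial>CN \<partial>iid_CN \<partial>iid_CN)"
      by (rule expand)
    also have "\<dots> \<le> (\<integral>\<^sup>+z. \<integral>\<^sup>+z'. ennreal (?k n) *
        (\<integral>\<^sup>+\<xi>. \<integral>\<^sup>+y. \<integral>\<^sup>+y'. G (z(n := y + g n * \<xi>)) (z'(n := y' + h n * \<xi>)) \<partial>CN \<partial>CN \<partial>CN) \<partial>iid_CN \<partial>iid_CN)"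
      using CN_simo_reference[of "\<lambda>(y, y'). G (z(n := y)) (z'(n := y'))" for z z']
      by (intro nn_integral_mono) simp
    also have "\<dots> = ennreal (?k n) * (\<integral>\<^sup>+z. \<integral>\<^sup>+z'.
        \<integral>\<^sup>+\<xi>. \<integral>\<^sup>+y. \<integral>\<^sup>+y'. G (z(n := y + g n * \<xi>)) (z'(n := y' + h n * \<xi>)) \<partial>CN \<partial>CN \<partial>CN \<partial>iid_CN \<partial>iid_CN)"
      by (simp add: nn_integral_cmult)
    also have "(\<integral>\<^sup>+z. \<integral>\<^sup>+z'.
        \<integral>\<^sup>+\<xi>. \<integral>\<^sup>+y. \<integral>\<^sup>+y'. G (z(n := y + g n * \<xi>)) (z'(n := y' + h n * \<xi>)) \<partial>CN \<partial>CN \<partial>CN \<partial>iid_CN \<partial>iid_CN) =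
      (\<integral>\<^sup>+z. \<integral>\<^sup>+\<xi>. \<integral>\<^sup>+z'.
        \<integral>\<^sup>+y. \<integral>\<^sup>+y'. G (z(n := y + g n * \<xi>)) (z'(n := y' + h n * \<xi>)) \<partial>CN \<partial>CN \<partial>iid_CN \<partial>CN \<partial>iid_CN)"
      by (intro nn_integral_cong nn_integral_swap prob_space_CN prob_space_iid_CN) measurable
    also have "\<dots> = (\<integral>\<^sup>+\<xi>. \<integral>\<^sup>+z. \<integral>\<^sup>+z'.
        \<integral>\<^sup>+y. \<integral>\<^sup>+y'. G (z(n := y + g n * \<xi>)) (z'(n := y' + h n * \<xi>)) \<partial>CN \<partial>CN \<partial>iid_CN \<partial>iid_CN \<partial>CN)"
      by (intro nn_integral_swap prob_space_CN prob_space_iid_CN) measurable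
    also have "\<dots> = (\<integral>\<^sup>+\<xi>. \<integral>\<^sup>+z. \<integral>\<^sup>+z'. G (z(n := z n + g n * \<xi>)) (z'(n := z' n + h n * \<xi>)) \<partial>iid_CN \<partial>iid_CN \<partial>CN)"
      by (simp only: expand)
    also have "\<dots> = (\<integral>\<^sup>+\<xi>. \<Phi> (X(n := \<xi>)) \<partial>CN)"
      unfolding G_def \<Phi>_def
      by (intro nn_integral_cong arg_cong2[where f=F]) (auto simp: shift_def fun_eq_iff less_Suc_eq)
    finally show "(\<integral>\<^sup>+z. \<integral>\<^sup>+z'. F' (shift n (\<lambda>i. g i * X i) z) (shift n (\<lambda>i. h i * X i) z') \<partial>iid_CN \<partial>iid_CN) \<le>
      ennreal (?k n) * (\<integral>\<^sup>+\<xi>. \<Phi> (X(n := \<xi>)) \<partial>CN)" .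
  qed simp
  also have "\<dots> = ennreal (\<Prod>i<n. ?k i) * (ennreal (?k n) * (\<integral>\<^sup>+X. \<integral>\<^sup>+\<xi>. \<Phi> (X(n := \<xi>)) \<partial>CN \<partial>iid_CN))"
    by (simp add: nn_integral_cmult)
  also have "(\<integral>\<^sup>+X. \<integral>\<^sup>+\<xi>. \<Phi> (X(n := \<xi>)) \<partial>CN \<partial>iid_CN) =
     (\<integral>\<^sup>+X. \<Phi> X \<partial>iid_CN)"
    by (rule nn_integral_iid_resample1[symmetric]) measurable
  also have "ennreal (\<Prod>i<n. ?k i) * (ennreal (?k n) * Z) = ennreal (\<Prod>i<Suc n. ?k i) * Z" for Z
    using k by (simp add: ennreal_mult prod_nonneg mult_ac)
  finally show ?case unfolding \<Phi>_def .
qed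


section \<open>Cut-set bounds for a single code\<close>

text \<open>
  The relay driven by the sequence \<open>y\<close> of its would-be observations, of which it sees only the
  entries in its listening periods.
\<close>

primrec relay_run :: "hd_code \<Rightarrow> complex \<Rightarrow> cseq \<Rightarrow> cseq \<Rightarrow> cseq \<Rightarrow> nat \<Rightarrow> cseq" where
  "relay_run C g w v y 0 = (\<lambda>_. 0)"
| "relay_run C g w v y (Suc i) = (relay_run C g w v y i)
     (i := if listens C i (w, v, g, relay_run C g w v y i) then y i else 0)"

definition run_input :: "hd_code \<Rightarrow> complex \<Rightarrow> cseq \<Rightarrow> cseq \<Rightarrow> cseq \<Rightarrow> nat \<Rightarrow> complex" where
  "run_input C g w v y i = (if listens C i (w, v, g, relay_run C g w v y i) then 0
     else relay_enc C i (w, v, g, relay_run C g w v y i))"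

definition schedule :: "hd_code \<Rightarrow> complex \<Rightarrow> cseq \<Rightarrow> cseq \<Rightarrow> cseq \<Rightarrow> nat set" where
  "schedule C g w v y = {i. i < blocklength C \<and> listens C i (w, v, g, relay_run C g w v y i)}"

text \<open>Separates the relay from the channel: \<open>relay_run\<close> accepts arbitrary
  would-be observations, which may then be altered wherever the relay does not listen.\<close>

lemma relay_past_eq_run:
  assumes "\<And>j. j < i \<Longrightarrow> y j = zr j + g * complex_of_real (\<rho> powr (a / 2)) * src_enc C w m j"
  shows "relay_past a \<rho> C g w v zr m i = relay_run C g w v y i"
  using assms by (induction i) (simp_all add: Let_def add.commute)

text \<open>The relay is causal and discards what arrives while it transmits, so by induction
  entries outside its schedule cannot influence it.\<close>

lemma relay_run_cong:
  assumes "i \<le> blocklength C" and "\<And>j. j < i \<Longrightarrow> j \<in> schedule C g w v y \<Longrightarrow> y' j = y j"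
  shows "relay_run C g w v y' i = relay_run C g w v y i"
  using assms
proof (induction i)
  case (Suc i)
  then have "relay_run C g w v y' i = relay_run C g w v y i" by auto
  moreover have "y' i = y i" if "listens C i (w, v, g, relay_run C g w v y i)"
    using Suc.prems that by (auto simp: schedule_def)
  ultimately show ?case by auto
qed simp

lemma schedule_cong:
  assumes "\<And>j. j \<in> schedule C g w v y \<Longrightarrow> y' j = y j"
  shows "schedule C g w v y' = schedule C g w v y"
    and "i < blocklength C \<Longrightarrow> run_input C g w v y' i = run_input C g w v y i"
  using relay_run_cong[of _ C g w v y y'] assms
  by (auto simp: schedule_def run_input_def)

definition dest_word :: "real \<Rightarrow> real \<Rightarrow> hd_code \<Rightarrow> complex \<Rightarrow> complex \<Rightarrow> cseq \<Rightarrow> cseq \<Rightarrow> cseq \<Rightarrow> cseq \<Rightarrow> cseq" where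
  "dest_word b \<rho> C g f w v y y' = (\<lambda>i. if i < blocklength C
     then y' i + f * complex_of_real (\<rho> powr (b / 2)) * run_input C g w v y i else 0)"

text \<open>The cutoffs make the codeword measurable in the seed for all messages and times.\<close>

definition codeword :: "hd_code \<Rightarrow> cseq \<Rightarrow> nat \<Rightarrow> cseq" where
  "codeword C w m = (\<lambda>i. if i < blocklength C \<and> m < num_msgs C then src_enc C w m i else 0)"

text \<open>For actual messages this is the complement of \<open>error_event\<close>, see
  \<open>error_event_eq\<close>. The signals enter through \<open>shift\<close>, the form on which
  the change of measure operates.\<close>

definition decoded :: "real \<Rightarrow> real \<Rightarrow> real \<Rightarrow> real \<Rightarrow> hd_code \<Rightarrow> complex \<Rightarrow> complex \<Rightarrow> complex \<Rightarrow>
    cseq \<Rightarrow> cseq \<Rightarrow> cseq \<Rightarrow> cseq \<Rightarrow> nat \<Rightarrow> bool" where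
  "decoded a b c \<rho> C g f h w v zr zd m \<longleftrightarrow>
     dest_dec C (w, (g, f, h), dest_word b \<rho> C g f w v
       (shift (blocklength C) (\<lambda>i. g * complex_of_real (\<rho> powr (a / 2)) * codeword C w m i) zr)
       (shift (blocklength C) (\<lambda>i. h * complex_of_real (\<rho> powr (c / 2)) * codeword C w m i) zd)) = m"

lemma dest_output_eq_word:
  assumes "m < num_msgs C"
  shows "dest_output a b c \<rho> C (g, f, h, zr, zd, w, v) m = dest_word b \<rho> C g f w v
     (shift (blocklength C) (\<lambda>i. g * complex_of_real (\<rho> powr (a / 2)) * codeword C w m i) zr)
     (shift (blocklength C) (\<lambda>i. h * complex_of_real (\<rho> powr (c / 2)) * codeword C w m i) zd)"
proof
  fix i
  have "relay_past a \<rho> C g w v zr m i = relay_run C g w v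
      (shift (blocklength C) (\<lambda>i. g * complex_of_real (\<rho> powr (a / 2)) * codeword C w m i) zr) i"
    if "i < blocklength C"
    using that assms by (intro relay_past_eq_run) (auto simp: shift_def codeword_def)
  then show "dest_output a b c \<rho> C (g, f, h, zr, zd, w, v) m i = dest_word b \<rho> C g f w v
     (shift (blocklength C) (\<lambda>i. g * complex_of_real (\<rho> powr (a / 2)) * codeword C w m i) zr)
     (shift (blocklength C) (\<lambda>i. h * complex_of_real (\<rho> powr (c / 2)) * codeword C w m i) zd) i"
    using assms
    by (auto simp: dest_output_def dest_word_def relay_input_def run_input_def Let_def shift_def codeword_def)
qed

section \<open>Measurability of a single valid code\<close>

locale relay_code =
  fixes a b c \<rho> :: real and C :: hd_code
  assumes valid: "valid_code a \<rho> C"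
begin

abbreviation "n \<equiv> blocklength C"
abbreviation "M \<equiv> num_msgs C"

lemma n_pos: "0 < n" and M_pos: "0 < M"
  using valid by (auto simp: valid_code_def)

lemma measurable_codeword [measurable]: "(\<lambda>w. codeword C w m) \<in> measurable cseq_borel cseq_borel"
proof (rule measurable_cseq_lambda)
  show "(\<lambda>w. codeword C w m i) \<in> borel_measurable cseq_borel" for i
    using valid by (cases "i < n \<and> m < M") (auto simp: codeword_def valid_code_def)
qed

text \<open>\<open>valid_code\<close> guarantees measurability of the relay's maps only inside the
  block, hence i <= n.\<close>

lemma measurable_relay_run:
  assumes "i \<le> n"
    and [measurable]: "w \<in> measurable N cseq_borel" "v \<in> measurable N cseq_borel"
      "g \<in> borel_measurable N" "y \<in> measurable N cseq_borel"
  shows "(\<lambda>x. relay_run C (g x) (w x) (v x) (y x) i) \<in> measurable N cseq_borel"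
  using assms(1)
proof (induction i)
  case (Suc i)
  have [measurable]: "listens C i \<in> measurable relay_view_borel (count_space UNIV)"
    using valid Suc.prems by (auto simp: valid_code_def)
  have [measurable]: "(\<lambda>x. relay_run C (g x) (w x) (v x) (y x) i) \<in> measurable N cseq_borel"
    using Suc by simp
  show ?case unfolding relay_run.simps by measurable
qed simp

lemma measurable_listens:
  assumes "i < n"
    and [measurable]: "w \<in> measurable N cseq_borel" "v \<in> measurable N cseq_borel"
      "g \<in> borel_measurable N" "y \<in> measurable N cseq_borel"
  shows "Measurable.pred N (\<lambda>x. listens C i (w x, v x, g x, relay_run C (g x) (w x) (v x) (y x) i))"
proof -
  have [measurable]: "listens C i \<in> measurable relay_view_borel (count_space UNIV)"
    using valid assms(1) by (auto simp: valid_code_def)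
  have [measurable]: "(\<lambda>x. relay_run C (g x) (w x) (v x) (y x) i) \<in> measurable N cseq_borel"
    using assms by (intro measurable_relay_run) auto
  show ?thesis by measurable
qed

lemma measurable_run_input:
  assumes "i < n"
    and [measurable]: "w \<in> measurable N cseq_borel" "v \<in> measurable N cseq_borel"
      "g \<in> borel_measurable N" "y \<in> measurable N cseq_borel"
  shows "(\<lambda>x. run_input C (g x) (w x) (v x) (y x) i) \<in> borel_measurable N"
proof -
  have [measurable]: "listens C i \<in> measurable relay_view_borel (count_space UNIV)"
    "relay_enc C i \<in> borel_measurable relay_view_borel"
    using valid assms(1) by (auto simp: valid_code_def)
  have [measurable]: "(\<lambda>x. relay_run C (g x) (w x) (v x) (y x) i) \<in> measurable N cseq_borel"
    using assms by (intro measurable_relay_run) auto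
  show ?thesis unfolding run_input_def by measurable
qed

lemma measurable_mem_schedule [measurable (raw)]:
  assumes [measurable]: "w \<in> measurable N cseq_borel" "v \<in> measurable N cseq_borel"
      "g \<in> borel_measurable N" "y \<in> measurable N cseq_borel"
  shows "Measurable.pred N (\<lambda>x. i \<in> schedule C (g x) (w x) (v x) (y x))"
proof (cases "i < n")
  case True
  then show ?thesis using measurable_listens[OF True assms] by (simp add: schedule_def)
qed (simp add: schedule_def)

lemma schedule_subset: "schedule C g w v y \<subseteq> {..<n}"
  by (auto simp: schedule_def)

text \<open>A block has finitely many times, so equality of schedules is a finite conjunction of
  measurable conditions.\<close>

lemma measurable_schedule_eq [measurable (raw)]:
  assumes [measurable]: "w \<in> measurable N cseq_borel" "v \<in> measurable N cseq_borel"
      "g \<in> borel_measurable N" "y \<in> measurable N cseq_borel"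
  shows "Measurable.pred N (\<lambda>x. schedule C (g x) (w x) (v x) (y x) = S)"
proof (cases "S \<subseteq> {..<n}")
  case True
  then have "schedule C (g x) (w x) (v x) (y x) = S \<longleftrightarrow>
      (\<forall>i\<in>{..<n}. i \<in> schedule C (g x) (w x) (v x) (y x) \<longleftrightarrow> i \<in> S)" for x
    using schedule_subset by blast
  then show ?thesis by simp
next
  case False
  then have "(schedule C (g x) (w x) (v x) (y x) = S) = False" for x
    using schedule_subset by blast
  then show ?thesis by simp
qed

lemma measurable_dest_word [measurable (raw)]:
  assumes [measurable]: "w \<in> measurable N cseq_borel" "v \<in> measurable N cseq_borel"
      "g \<in> borel_measurable N" "f \<in> borel_measurable N" "y \<in> measurable N cseq_borel" "y' \<in> measurable N cseq_borel"
  shows "(\<lambda>x. dest_word b \<rho> C (g x) (f x) (w x) (v x) (y x) (y' x)) \<in> measurable N cseq_borel"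
proof (rule measurable_cseq_lambda)
  fix i
  show "(\<lambda>x. dest_word b \<rho> C (g x) (f x) (w x) (v x) (y x) (y' x) i) \<in> borel_measurable N"
  proof (cases "i < n")
    case True
    have [measurable]: "(\<lambda>x. run_input C (g x) (w x) (v x) (y x) i) \<in> borel_measurable N"
      using True by (intro measurable_run_input) auto
    show ?thesis unfolding dest_word_def using True by simp
  qed (simp add: dest_word_def)
qed

lemma measurable_dest_dec [measurable]: "dest_dec C \<in> measurable dest_view_borel (count_space UNIV)"
  using valid by (auto simp: valid_code_def)

lemma measurable_decoded [measurable (raw)]:
  assumes [measurable]: "g \<in> borel_measurable N" "f \<in> borel_measurable N" "h \<in> borel_measurable N"
      "w \<in> measurable N cseq_borel" "v \<in> measurable N cseq_borel"
      "zr \<in> measurable N cseq_borel" "zd \<in> measurable N cseq_borel"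
  shows "Measurable.pred N (\<lambda>x. decoded a b c \<rho> C (g x) (f x) (h x) (w x) (v x) (zr x) (zd x) m)"
proof -
  have [measurable]: "(\<lambda>x i. k x * codeword C (w x) m i) \<in> measurable N cseq_borel"
    if [measurable]: "k \<in> borel_measurable N" for k
  proof (rule measurable_cseq_lambda)
    fix i
    have [measurable]: "(\<lambda>w. codeword C w m i) \<in> borel_measurable cseq_borel"
      by (rule measurable_cseq_component) measurable
    show "(\<lambda>x. k x * codeword C (w x) m i) \<in> borel_measurable N" by measurable
  qed
  show ?thesis unfolding decoded_def by measurable
qed

end


lemma card_filter_less:
  assumes "S \<subseteq> {..<n}"
  shows "(\<Sum>i<n. if i \<in> S then A else B) = real (card S) * A + (real n - real (card S)) * (B::real)"
proof -
  have fin: "finite S" using assms finite_subset by blast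
  have c: "card S \<le> n" using card_mono[OF _ assms] by simp
  have "(\<Sum>i<n. if i \<in> S then A else B) = (\<Sum>i\<in>S. A) + (\<Sum>i\<in>{..<n} - S. B)"
    using assms by (subst sum.If_cases) (auto intro!: arg_cong2[where f="(+)"] sum.cong simp: Int_absorb1 Diff_eq)
  moreover have "card ({..<n} - S) = n - card S"
    using fin assms by (simp add: card_Diff_subset)
  ultimately show ?thesis using c by (simp add: of_nat_diff)
qed

text \<open>Log-likelihood cost of replacing the transmitted word \<open>x\<close> by Gaussian inputs.\<close>

definition cost :: "nat \<Rightarrow> real \<Rightarrow> real \<Rightarrow> nat set \<Rightarrow> real \<Rightarrow> real" where
  "cost n A B S E = real (card S) * A + (real n - real (card S)) * B + E"

lemma cost_prod:
  assumes "S \<subseteq> {..<n}" "\<And>i. i < n \<Longrightarrow> 0 \<le> s i" "\<And>i. i < n \<Longrightarrow> ln (1 + s i) = (if i \<in> S then A else B)"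
    "(\<Sum>i<n. (cmod (x i))\<^sup>2) \<le> E"
  shows "(\<Prod>i<n. (1 + s i) * exp ((cmod (x i))\<^sup>2)) \<le> exp (cost n A B S E)"
proof -
  have "(\<Prod>i<n. (1 + s i) * exp ((cmod (x i))\<^sup>2)) = (\<Prod>i<n. exp ((if i \<in> S then A else B) + (cmod (x i))\<^sup>2))"
    using assms(2) by (intro prod.cong refl) (simp add: exp_add assms(3)[symmetric] add_pos_nonneg)
  also have "\<dots> = exp (\<Sum>i<n. (if i \<in> S then A else B) + (cmod (x i))\<^sup>2)"
    by (simp add: exp_sum)
  also have "\<dots> \<le> exp (cost n A B S E)"
    unfolding sum.distrib card_filter_less[OF assms(1)] cost_def using assms(4) by simp
  finally show ?thesis .
qed

section \<open>The cut around the source\<close>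

context relay_code
begin

definition gain_sr :: "complex \<Rightarrow> complex" where "gain_sr g = g * complex_of_real (\<rho> powr (a / 2))"
definition gain_rd :: "complex \<Rightarrow> complex" where "gain_rd f = f * complex_of_real (\<rho> powr (b / 2))"
definition gain_sd :: "complex \<Rightarrow> complex" where "gain_sd h = h * complex_of_real (\<rho> powr (c / 2))"

definition energy :: "cseq \<Rightarrow> nat \<Rightarrow> real" where
  "energy w m = (\<Sum>i<n. (cmod (codeword C w m i))\<^sup>2)"

lemma energy_nonneg: "0 \<le> energy w m"
  by (simp add: energy_def sum_nonneg)

definition sched :: "complex \<Rightarrow> cseq \<Rightarrow> cseq \<Rightarrow> cseq \<Rightarrow> nat \<Rightarrow> nat set" where
  "sched g w v zr m = schedule C g w v (shift n (\<lambda>i. gain_sr g * codeword C w m i) zr)"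

lemma sched_subset: "sched g w v zr m \<subseteq> {..<n}"
  by (simp add: sched_def schedule_subset)

lemma measurable_scaled_codeword [measurable (raw)]:
  assumes [measurable]: "k \<in> borel_measurable N" "w \<in> measurable N cseq_borel"
  shows "(\<lambda>x i. k x * codeword C (w x) m i) \<in> measurable N cseq_borel"
proof (rule measurable_cseq_lambda)
  fix i
  have [measurable]: "(\<lambda>w. codeword C w m i) \<in> borel_measurable cseq_borel"
    by (rule measurable_cseq_component) measurable
  show "(\<lambda>x. k x * codeword C (w x) m i) \<in> borel_measurable N" by measurable
qed

lemma measurable_gain_sr [measurable]: "gain_sr \<in> borel_measurable borel"
  unfolding gain_sr_def by measurable

lemma measurable_energy [measurable]: "(\<lambda>w. energy w m) \<in> borel_measurable cseq_borel"
proof -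
  have [measurable]: "(\<lambda>w. codeword C w m i) \<in> borel_measurable cseq_borel" for i
    by (rule measurable_cseq_component) measurable
  show ?thesis unfolding energy_def by measurable
qed

lemma measurable_sched_eq [measurable (raw)]:
  assumes [measurable]: "g \<in> borel_measurable N" "w \<in> measurable N cseq_borel" "v \<in> measurable N cseq_borel"
     "zr \<in> measurable N cseq_borel"
  shows "Measurable.pred N (\<lambda>x. sched (g x) (w x) (v x) (zr x) m = S)"
  unfolding sched_def by measurable

text \<open>
  Cut around the source. On the event that the schedule is \<open>S\<close>, the relay's observations can be
  replaced by those with the signal present exactly on \<open>S\<close>, which removes the feedback from the
  observations to the schedule. With \<open>full\<close>, a genie lets the destination see all of the relay's
  would-be observations and only one schedule is needed.
\<close>

lemma source_cut:
  fixes full :: bool and P \<theta> :: real and g f h :: complex and w v :: cseq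
  assumes P: "0 < P"
  defines "\<sigma> \<equiv> \<lambda>zr m. if full then {..<n} else sched g w v zr m"
    and "\<S> \<equiv> if full then {{..<n}} else Pow {..<n}"
    and "W \<equiv> \<lambda>S m. cost n (ln (1 + P * ((cmod (gain_sr g))\<^sup>2 + (cmod (gain_sd h))\<^sup>2))) (ln (1 + P * (cmod (gain_sd h))\<^sup>2)) S (energy w m / P)"
  shows "(\<Sum>m<M. \<integral>\<^sup>+zr. \<integral>\<^sup>+zd. indicator {m. decoded a b c \<rho> C g f h w v zr zd m} m \<partial>iid_CN \<partial>iid_CN) \<le>
    (\<Sum>m<M. \<integral>\<^sup>+zr. indicator {zr. \<theta> < W (\<sigma> zr m) m} zr \<partial>iid_CN) + ennreal (exp \<theta>) * of_nat (card \<S>)"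
proof -
  \<comment> \<open>The reference input has power P: gains are multiplied by q and the codeword is
    divided by q, which leaves the signal unchanged. This trades the energy penalty against the
    logarithms and pays off when the gains are small.\<close>
  define q where "q = sqrt P"
  have q: "q > 0" "q\<^sup>2 = P" using P by (simp_all add: q_def)
  define \<tau> where "\<tau> y = (if full then {..<n} else schedule C g w v y)" for y
  have \<sigma>: "\<sigma> zr m = \<tau> (shift n (\<lambda>i. gain_sr g * codeword C w m i) zr)" for zr m
    by (simp add: \<sigma>_def \<tau>_def sched_def)
  have \<tau>_sub: "\<tau> y \<in> \<S>" for y by (simp add: \<tau>_def \<S>_def schedule_subset)
  have \<S>: "finite \<S>" "\<And>S. S \<in> \<S> \<Longrightarrow> S \<subseteq> {..<n}" by (auto simp: \<S>_def split: if_splits)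
  have sub_\<tau>: "schedule C g w v y \<subseteq> \<tau> y" for y
    using schedule_subset by (auto simp: \<tau>_def)
  have \<tau>_cong: "\<tau> y' = \<tau> y" "\<And>i. i < n \<Longrightarrow> run_input C g w v y' i = run_input C g w v y i"
    if "\<And>i. i \<in> \<tau> y \<Longrightarrow> y' i = y i" for y y'
    using schedule_cong[of C g w v y y'] that sub_\<tau>[of y] by (auto simp: \<tau>_def)
  have [measurable]: "Measurable.pred cseq_borel (\<lambda>y. \<tau> y = S)" for S
    unfolding \<tau>_def by (cases full) simp_all
  \<comment> \<open>The schedule is part of the event, so that for fixed S the event is a condition
    on the two observation sequences alone.\<close>
  define E where "E S m y y' \<longleftrightarrow> \<tau> y = S \<and> dest_dec C (w, (g, f, h), dest_word b \<rho> C g f w v y y') = m" for S m y y'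
  have [measurable]: "Measurable.pred (cseq_borel \<Otimes>\<^sub>M cseq_borel) (\<lambda>x. E S m (fst x) (snd x))" for S m
    unfolding E_def by measurable
  have "Measurable.pred (cseq_borel \<Otimes>\<^sub>M cseq_borel) (\<lambda>(y, y'). E S m y y')" for S m
    by (simp add: split_beta')
  note [measurable] = this
  define gS where "gS S i = complex_of_real q * (if i \<in> S then gain_sr g else 0)" for S and i :: nat
  define hS where "hS = (\<lambda>i::nat. complex_of_real q * gain_sd h)"
  define x where "x m i = codeword C w m i / complex_of_real q" for m i
  have gSx: "gS S i * x m i = (if i \<in> S then gain_sr g else 0) * codeword C w m i" for S m i
    using q(1) by (simp add: gS_def x_def)
  have hSx: "hS i * x m i = gain_sd h * codeword C w m i" for m i
    using q(1) by (simp add: hS_def x_def)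
  define s1 where "s1 S m zr = shift n (\<lambda>i. gS S i * x m i) zr" for S m zr
  define s2 where "s2 m zd = shift n (\<lambda>i. hS i * x m i) zd" for m zd
  have [measurable]: "s1 S m \<in> measurable cseq_borel cseq_borel" "s2 m \<in> measurable cseq_borel cseq_borel" for S m
    unfolding s1_def s2_def by measurable
  \<comment> \<open>\<open>s1\<close> carries the relay's signal only at the times in
    \<open>\<sigma> zr m\<close>, where it agrees with the true observations; by
    \<open>\<tau>_cong\<close> the relay then listens and transmits exactly as before.\<close>
  have dec_E: "E (\<sigma> zr m) m (s1 (\<sigma> zr m) m zr) (s2 m zd)" if "decoded a b c \<rho> C g f h w v zr zd m" for zr zd m
  proof -
    let ?y = "shift n (\<lambda>i. gain_sr g * codeword C w m i) zr"
    let ?S = "\<tau> ?y"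
    have eq: "s1 ?S m zr i = ?y i" if "i \<in> ?S" for i
      using that by (simp add: s1_def shift_def gSx)
    have "\<tau> (s1 ?S m zr) = ?S" "\<And>i. i < n \<Longrightarrow> run_input C g w v (s1 ?S m zr) i = run_input C g w v ?y i"
      using \<tau>_cong[of ?y "s1 ?S m zr", OF eq] by auto
    moreover from this have "dest_word b \<rho> C g f w v (s1 ?S m zr) (s2 m zd) =
        dest_word b \<rho> C g f w v ?y (shift n (\<lambda>i. gain_sd h * codeword C w m i) zd)"
      by (auto simp: dest_word_def fun_eq_iff s2_def hSx)
    ultimately show ?thesis
      using that by (simp add: E_def \<sigma> decoded_def gain_sr_def gain_sd_def)
  qed
  let ?I = "\<lambda>S m X zr zd. indicator {m. E S m (shift n (\<lambda>i. gS S i * X i) zr) (shift n (\<lambda>i. hS i * X i) zd)} m :: ennreal"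
  have bound: "(\<integral>\<^sup>+zr. \<integral>\<^sup>+zd. indicator {m'. E S m' (s1 S m zr) (s2 m zd)} m \<partial>iid_CN \<partial>iid_CN) \<le>
     ennreal (exp (W S m)) * (\<integral>\<^sup>+X. \<integral>\<^sup>+zr. \<integral>\<^sup>+zd. ?I S m X zr zd \<partial>iid_CN \<partial>iid_CN \<partial>iid_CN)" if "S \<in> \<S>" for S m
  proof -
    have "(\<integral>\<^sup>+zr. \<integral>\<^sup>+zd. indicator {m'. E S m' (s1 S m zr) (s2 m zd)} m \<partial>iid_CN \<partial>iid_CN) \<le>
      ennreal (\<Prod>i<n. (1 + (cmod (gS S i))\<^sup>2 + (cmod (hS i))\<^sup>2) * exp ((cmod (x m i))\<^sup>2)) *
      (\<integral>\<^sup>+X. \<integral>\<^sup>+zr. \<integral>\<^sup>+zd. ?I S m X zr zd \<partial>iid_CN \<partial>iid_CN \<partial>iid_CN)"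
    proof -
      have m: "(\<lambda>(y, y'). indicator {m. E S m y y'} m :: ennreal) \<in> borel_measurable (cseq_borel \<Otimes>\<^sub>M cseq_borel)"
        unfolding indicator_def by (simp add: split_beta')
      show ?thesis
        unfolding s1_def s2_def by (rule iid_simo_reference[OF m])
    qed
    also have "\<dots> \<le> ennreal (exp (W S m)) * (\<integral>\<^sup>+X. \<integral>\<^sup>+zr. \<integral>\<^sup>+zd. ?I S m X zr zd \<partial>iid_CN \<partial>iid_CN \<partial>iid_CN)"
    proof (intro mult_right_mono ennreal_leI)
      show "(\<Prod>i<n. (1 + (cmod (gS S i))\<^sup>2 + (cmod (hS i))\<^sup>2) * exp ((cmod (x m i))\<^sup>2)) \<le> exp (W S m)"
        unfolding W_def add.assoc
      proof (rule cost_prod)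
        show "ln (1 + ((cmod (gS S i))\<^sup>2 + (cmod (hS i))\<^sup>2)) =
          (if i \<in> S then ln (1 + P * ((cmod (gain_sr g))\<^sup>2 + (cmod (gain_sd h))\<^sup>2)) else ln (1 + P * (cmod (gain_sd h))\<^sup>2))" for i
          by (simp add: gS_def hS_def norm_mult power_mult_distrib q(2) algebra_simps)
        show "(\<Sum>i<n. (cmod (x m i))\<^sup>2) \<le> energy w m / P"
          by (simp add: x_def energy_def norm_divide power_divide q(2) sum_divide_distrib)
      qed (use \<S> that in auto)
    qed simp
    finally show ?thesis .
  qed
  \<comment> \<open>Outcomes whose cost exceeds \<theta> are counted as successes. The others are
    enumerated by S, which turns the cost into a number that no longer depends on the noise.\<close>
  have "(\<Sum>m<M. \<integral>\<^sup>+zr. \<integral>\<^sup>+zd. indicator {m. decoded a b c \<rho> C g f h w v zr zd m} m \<partial>iid_CN \<partial>iid_CN) \<le>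
    (\<Sum>m<M. \<integral>\<^sup>+zr. \<integral>\<^sup>+zd. indicator {zr. \<theta> < W (\<sigma> zr m) m} zr +
      (\<Sum>S\<in>\<S>. (if W S m \<le> \<theta> then 1 else 0) * indicator {m'. E S m' (s1 S m zr) (s2 m zd)} m) \<partial>iid_CN \<partial>iid_CN)"
  proof (intro sum_mono nn_integral_mono)
    fix m zr zd
    show "indicator {m. decoded a b c \<rho> C g f h w v zr zd m} m \<le> (indicator {zr. \<theta> < W (\<sigma> zr m) m} zr :: ennreal) +
      (\<Sum>S\<in>\<S>. (if W S m \<le> \<theta> then 1 else 0) * indicator {m'. E S m' (s1 S m zr) (s2 m zd)} m)"
    proof (cases "decoded a b c \<rho> C g f h w v zr zd m \<and> W (\<sigma> zr m) m \<le> \<theta>")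
      case True
      let ?S = "\<sigma> zr m"
      have "1 = (if W ?S m \<le> \<theta> then 1 else 0) * (indicator {m'. E ?S m' (s1 ?S m zr) (s2 m zd)} m :: ennreal)"
        using True dec_E by simp
      also have "\<dots> \<le> (\<Sum>S\<in>\<S>. (if W S m \<le> \<theta> then 1 else 0) * indicator {m'. E S m' (s1 S m zr) (s2 m zd)} m)"
        using \<S>(1) \<tau>_sub by (intro member_le_sum) (auto simp: \<sigma>)
      finally show ?thesis using True by (simp add: add_increasing)
    qed (auto simp: indicator_def)
  qed
  also have "\<dots> = (\<Sum>m<M. (\<integral>\<^sup>+zr. indicator {zr. \<theta> < W (\<sigma> zr m) m} zr \<partial>iid_CN) +
      (\<Sum>S\<in>\<S>. (if W S m \<le> \<theta> then 1 else 0) * (\<integral>\<^sup>+zr. \<integral>\<^sup>+zd. indicator {m'. E S m' (s1 S m zr) (s2 m zd)} m \<partial>iid_CN \<partial>iid_CN)))"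
  proof (intro sum.cong refl)
    fix m
    have fin: "finite (Pow {..<n})" by simp
    have [measurable]: "Measurable.pred cseq_borel (\<lambda>zr. \<theta> < W (\<sigma> zr m) m)"
    proof -
      have "(\<lambda>zr. \<theta> < W (\<sigma> zr m) m) = (\<lambda>zr. \<exists>S\<in>\<S>. \<sigma> zr m = S \<and> \<theta> < W S m)"
        using \<tau>_sub by (auto simp: \<sigma> fun_eq_iff)
      moreover have [measurable]: "Measurable.pred cseq_borel (\<lambda>zr. \<sigma> zr m = S)" for S
        unfolding \<sigma> by measurable
      have "Measurable.pred cseq_borel (\<lambda>zr. \<exists>S\<in>\<S>. \<sigma> zr m = S \<and> \<theta> < W S m)"
        using \<S>(1) by measurable
      ultimately show ?thesis by (simp only:)
    qed
    have [measurable]: "Measurable.pred (cseq_borel \<Otimes>\<^sub>M cseq_borel) (\<lambda>p. E S m (s1 S m (fst p)) (s2 m (snd p)))" for S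
      unfolding E_def by measurable
    have [measurable]: "(\<lambda>p. indicator {m'. E S m' (s1 S m (fst p)) (s2 m (snd p))} m :: ennreal)
        \<in> borel_measurable (cseq_borel \<Otimes>\<^sub>M cseq_borel)" for S
      unfolding indicator_def by simp
    have m2: "(\<lambda>zd. indicator {m'. E S m' (s1 S m zr) (s2 m zd)} m :: ennreal) \<in> borel_measurable iid_CN" for S zr
      unfolding indicator_def E_def by measurable
    have m1: "(\<lambda>zr. \<integral>\<^sup>+zd. indicator {m'. E S m' (s1 S m zr) (s2 m zd)} m \<partial>iid_CN) \<in> borel_measurable iid_CN" for S
    proof -
      have "(\<lambda>(zr, zd). indicator {m'. E S m' (s1 S m zr) (s2 m zd)} m :: ennreal) \<in> borel_measurable (iid_CN \<Otimes>\<^sub>M iid_CN)"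
        by (simp add: split_beta')
      then show ?thesis by (rule iid.borel_measurable_nn_integral)
    qed
    have "(\<integral>\<^sup>+zr. \<integral>\<^sup>+zd. indicator {zr. \<theta> < W (\<sigma> zr m) m} zr +
      (\<Sum>S\<in>\<S>. (if W S m \<le> \<theta> then 1 else 0) * indicator {m'. E S m' (s1 S m zr) (s2 m zd)} m) \<partial>iid_CN \<partial>iid_CN) =
      (\<integral>\<^sup>+zr. indicator {zr. \<theta> < W (\<sigma> zr m) m} zr +
      (\<Sum>S\<in>\<S>. (if W S m \<le> \<theta> then 1 else 0) * (\<integral>\<^sup>+zd. indicator {m'. E S m' (s1 S m zr) (s2 m zd)} m \<partial>iid_CN)) \<partial>iid_CN)"
      using m2 by (simp add: nn_integral_add nn_integral_sum nn_integral_cmult iid.emeasure_space_1[simplified])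
    also have "\<dots> = (\<integral>\<^sup>+zr. indicator {zr. \<theta> < W (\<sigma> zr m) m} zr \<partial>iid_CN) +
      (\<Sum>S\<in>\<S>. (if W S m \<le> \<theta> then 1 else 0) * (\<integral>\<^sup>+zr. \<integral>\<^sup>+zd. indicator {m'. E S m' (s1 S m zr) (s2 m zd)} m \<partial>iid_CN \<partial>iid_CN))"
      using m1 by (subst nn_integral_add) (simp_all add: nn_integral_sum nn_integral_cmult)
    finally show "(\<integral>\<^sup>+zr. \<integral>\<^sup>+zd. indicator {zr. \<theta> < W (\<sigma> zr m) m} zr +
      (\<Sum>S\<in>\<S>. (if W S m \<le> \<theta> then 1 else 0) * indicator {m'. E S m' (s1 S m zr) (s2 m zd)} m) \<partial>iid_CN \<partial>iid_CN) = \<dots>" .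
  qed
  also have "\<dots> \<le> (\<Sum>m<M. (\<integral>\<^sup>+zr. indicator {zr. \<theta> < W (\<sigma> zr m) m} zr \<partial>iid_CN) +
      (\<Sum>S\<in>\<S>. ennreal (exp \<theta>) * (\<integral>\<^sup>+X. \<integral>\<^sup>+zr. \<integral>\<^sup>+zd. ?I S m X zr zd \<partial>iid_CN \<partial>iid_CN \<partial>iid_CN)))"
  proof (intro sum_mono add_left_mono)
    fix m S assume S: "S \<in> \<S>"
    show "(if W S m \<le> \<theta> then 1 else 0) * (\<integral>\<^sup>+zr. \<integral>\<^sup>+zd. indicator {m'. E S m' (s1 S m zr) (s2 m zd)} m \<partial>iid_CN \<partial>iid_CN)
      \<le> ennreal (exp \<theta>) * (\<integral>\<^sup>+X. \<integral>\<^sup>+zr. \<integral>\<^sup>+zd. ?I S m X zr zd \<partial>iid_CN \<partial>iid_CN \<partial>iid_CN)"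
    proof (cases "W S m \<le> \<theta>")
      case True
      then have "ennreal (exp (W S m)) \<le> ennreal (exp \<theta>)" by (intro ennreal_leI) simp
      then show ?thesis using True order.trans[OF bound[OF S, of m] mult_right_mono] by simp
    qed simp
  qed
  also have "\<dots> = (\<Sum>m<M. \<integral>\<^sup>+zr. indicator {zr. \<theta> < W (\<sigma> zr m) m} zr \<partial>iid_CN) +
      ennreal (exp \<theta>) * (\<Sum>S\<in>\<S>. \<Sum>m<M. \<integral>\<^sup>+X. \<integral>\<^sup>+zr. \<integral>\<^sup>+zd. ?I S m X zr zd \<partial>iid_CN \<partial>iid_CN \<partial>iid_CN)"
    by (simp add: sum.distrib sum_distrib_left sum.swap[of _ "{..<M}"])
  \<comment> \<open>The reference outputs do not depend on the message, and the decoder names one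
    message, so for each S the sum over m is at most 1.\<close>
  also have "\<dots> \<le> (\<Sum>m<M. \<integral>\<^sup>+zr. indicator {zr. \<theta> < W (\<sigma> zr m) m} zr \<partial>iid_CN) +
      ennreal (exp \<theta>) * (\<Sum>S\<in>\<S>. 1)"
  proof (intro add_left_mono mult_left_mono sum_mono)
    fix S assume "S \<in> \<S>"
    have [measurable]: "(\<lambda>p. ?I S m (fst p) (fst (snd p)) (snd (snd p))) \<in> borel_measurable (iid_CN \<Otimes>\<^sub>M iid_CN \<Otimes>\<^sub>M iid_CN)" for m
      unfolding indicator_def E_def by measurable
    have m3: "?I S m X zr \<in> borel_measurable iid_CN" for m X zr
      unfolding indicator_def E_def by measurable
    have m2: "(\<lambda>zr. \<integral>\<^sup>+zd. ?I S m X zr zd \<partial>iid_CN) \<in> borel_measurable iid_CN" for m X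
    proof -
      have "(\<lambda>(zr, zd). ?I S m X zr zd) \<in> borel_measurable (iid_CN \<Otimes>\<^sub>M iid_CN)"
        unfolding indicator_def E_def by measurable
      then show ?thesis by (rule iid.borel_measurable_nn_integral)
    qed
    have m1: "(\<lambda>X. \<integral>\<^sup>+zr. \<integral>\<^sup>+zd. ?I S m X zr zd \<partial>iid_CN \<partial>iid_CN) \<in> borel_measurable iid_CN" for m
      unfolding indicator_def E_def by measurable
    have "(\<Sum>m<M. \<integral>\<^sup>+X. \<integral>\<^sup>+zr. \<integral>\<^sup>+zd. ?I S m X zr zd \<partial>iid_CN \<partial>iid_CN \<partial>iid_CN) =
      (\<integral>\<^sup>+X. \<integral>\<^sup>+zr. \<integral>\<^sup>+zd. (\<Sum>m<M. ?I S m X zr zd) \<partial>iid_CN \<partial>iid_CN \<partial>iid_CN)"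
      using m1 m2 m3 by (simp add: nn_integral_sum)
    also have "\<dots> \<le> (\<integral>\<^sup>+X. \<integral>\<^sup>+zr. \<integral>\<^sup>+zd. 1 \<partial>iid_CN \<partial>iid_CN \<partial>iid_CN)"
    proof (intro nn_integral_mono)
      fix X zr zd
      let ?d = "dest_dec C (w, (g, f, h), dest_word b \<rho> C g f w v (shift n (\<lambda>i. gS S i * X i) zr) (shift n (\<lambda>i. hS i * X i) zd))"
      have "(\<Sum>m<M. ?I S m X zr zd) \<le> (\<Sum>m<M. if m = ?d then 1 else 0)"
        by (intro sum_mono) (simp add: indicator_def E_def)
      also have "\<dots> \<le> 1" by (subst sum.delta) auto
      finally show "(\<Sum>m<M. ?I S m X zr zd) \<le> 1" .
    qed
    finally show "(\<Sum>m<M. \<integral>\<^sup>+X. \<integral>\<^sup>+zr. \<integral>\<^sup>+zd. ?I S m X zr zd \<partial>iid_CN \<partial>iid_CN \<partial>iid_CN) \<le> 1"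
      by (simp add: iid.emeasure_space_1[simplified])
  qed simp
  finally show ?thesis by simp
qed

end


lemma emeasure_iid_CN_UNIV [simp]: "emeasure iid_CN UNIV = 1"
  using iid.emeasure_space_1 by simp

section \<open>The cut around the destination\<close>

context relay_code
begin

definition relay_in :: "complex \<Rightarrow> cseq \<Rightarrow> cseq \<Rightarrow> cseq \<Rightarrow> nat \<Rightarrow> nat \<Rightarrow> complex" where
  "relay_in g w v zr m i = run_input C g w v (shift n (\<lambda>i. gain_sr g * codeword C w m i) zr) i"

definition relay_energy :: "complex \<Rightarrow> cseq \<Rightarrow> cseq \<Rightarrow> cseq \<Rightarrow> nat \<Rightarrow> real" where
  "relay_energy g w v zr m = (\<Sum>i<n. (cmod (relay_in g w v zr m i))\<^sup>2)"

lemma relay_energy_nonneg: "0 \<le> relay_energy g w v zr m"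
  by (simp add: relay_energy_def sum_nonneg)

lemma measurable_relay_in:
  assumes "i < n" and [measurable]: "g \<in> borel_measurable N" "w \<in> measurable N cseq_borel" "v \<in> measurable N cseq_borel"
     "zr \<in> measurable N cseq_borel"
  shows "(\<lambda>x. relay_in (g x) (w x) (v x) (zr x) m i) \<in> borel_measurable N"
  unfolding relay_in_def using assms(1) by (intro measurable_run_input) measurable

lemma measurable_relay_energy [measurable (raw)]:
  assumes [measurable]: "g \<in> borel_measurable N" "w \<in> measurable N cseq_borel" "v \<in> measurable N cseq_borel"
     "zr \<in> measurable N cseq_borel"
  shows "(\<lambda>x. relay_energy (g x) (w x) (v x) (zr x) m) \<in> borel_measurable N"
  unfolding relay_energy_def
proof (rule borel_measurable_sum)
  fix i assume "i \<in> {..<n}"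
  then have [measurable]: "(\<lambda>x. relay_in (g x) (w x) (v x) (zr x) m i) \<in> borel_measurable N"
    by (intro measurable_relay_in) auto
  show "(\<lambda>x. (cmod (relay_in (g x) (w x) (v x) (zr x) m i))\<^sup>2) \<in> borel_measurable N" by measurable
qed

lemma measurable_mem_sched [measurable (raw)]:
  assumes [measurable]: "g \<in> borel_measurable N" "w \<in> measurable N cseq_borel" "v \<in> measurable N cseq_borel"
     "zr \<in> measurable N cseq_borel"
  shows "Measurable.pred N (\<lambda>x. i \<in> sched (g x) (w x) (v x) (zr x) m)"
  unfolding sched_def by measurable

text \<open>Opposite to the cut around the source, listening times carry the smaller value, since
  only the direct link is heard then. The squared gains are simply added; coherent combining is paid
  for by adding the two energies.\<close>

definition dest_cost :: "complex \<Rightarrow> complex \<Rightarrow> complex \<Rightarrow> cseq \<Rightarrow> cseq \<Rightarrow> cseq \<Rightarrow> nat \<Rightarrow> real" where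
  "dest_cost g f h w v zr m = cost n (ln (1 + (cmod (gain_sd h))\<^sup>2)) (ln (1 + ((cmod (gain_sd h))\<^sup>2 + (cmod (gain_rd f))\<^sup>2)))
     (sched g w v zr m) (energy w m + relay_energy g w v zr m)"

text \<open>For fixed seeds and relay noise the schedule and the relay's inputs are determined, so
  source and relay jointly send a known word to which the change of measure applies. The reference
  law still depends on the schedule, hence the factor 2 ^ n.\<close>

lemma dest_cut:
  "(\<Sum>m<M. \<integral>\<^sup>+zr. \<integral>\<^sup>+zd. indicator {m. decoded a b c \<rho> C g f h w v zr zd m} m \<partial>iid_CN \<partial>iid_CN) \<le>
    (\<Sum>m<M. \<integral>\<^sup>+zr. indicator {zr. \<theta> < dest_cost g f h w v zr m} zr \<partial>iid_CN) + ennreal (exp \<theta>) * 2 ^ n"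
proof -
  let ?H = "(cmod (gain_sd h))\<^sup>2" and ?F = "(cmod (gain_rd f))\<^sup>2"
  define \<eta> where "\<eta> S i = ?H + (if i \<in> S then 0 else ?F)" for S and i :: nat
  have \<eta>: "0 \<le> \<eta> S i" for S i by (simp add: \<eta>_def)
  define k where "k S i = complex_of_real (sqrt (\<eta> S i))" for S i
  have k: "(cmod (k S i))\<^sup>2 = \<eta> S i" for S i by (simp add: k_def \<eta>)
  define D where "D m y \<longleftrightarrow> dest_dec C (w, (g, f, h), \<lambda>i. if i < n then y i else 0) = m" for m and y :: cseq
  have [measurable]: "(\<lambda>y i. if i < n then y i else 0) \<in> measurable cseq_borel cseq_borel"
  proof (rule measurable_cseq_lambda)
    show "(\<lambda>y. if i < n then y i else 0) \<in> borel_measurable cseq_borel" for i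
      by (cases "i < n") simp_all
  qed
  have [measurable]: "Measurable.pred cseq_borel (D m)" for m
    unfolding D_def by measurable
  define R where "R S m = (\<integral>\<^sup>+X. \<integral>\<^sup>+zd. indicator {m. D m (shift n (\<lambda>i. k S i * X i) zd)} m \<partial>iid_CN \<partial>iid_CN)" for S m
  have step: "(\<integral>\<^sup>+zd. indicator {m. decoded a b c \<rho> C g f h w v zr zd m} m \<partial>iid_CN) \<le>
      ennreal (exp (dest_cost g f h w v zr m)) * R (sched g w v zr m) m" for zr m
  proof -
    let ?S = "sched g w v zr m"
    define s where "s i = gain_sd h * codeword C w m i + gain_rd f * relay_in g w v zr m i" for i
    \<comment> \<open>Equivalent single input seen through the gain \<open>k\<close>. Where this
      gain is 0, \<open>sq\<close> forces the signal to be 0 as well.\<close>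
    define x where "x i = (if \<eta> ?S i = 0 then 0 else s i / k ?S i)" for i
    have rin0: "relay_in g w v zr m i = 0" if "i \<in> ?S" for i
      using that by (simp add: relay_in_def run_input_def sched_def schedule_def)
    \<comment> \<open>Cauchy-Schwarz for the sum of the two links; at listening times the relay's
      input is 0.\<close>
    have sq: "(cmod (s i))\<^sup>2 \<le> \<eta> ?S i * ((cmod (codeword C w m i))\<^sup>2 + (cmod (relay_in g w v zr m i))\<^sup>2)" for i
    proof (cases "i \<in> ?S")
      case True
      then show ?thesis by (simp add: s_def rin0 \<eta>_def norm_mult power_mult_distrib)
    next
      case False
      let ?h = "cmod (gain_sd h)" and ?f = "cmod (gain_rd f)" and ?x = "cmod (codeword C w m i)" and ?u = "cmod (relay_in g w v zr m i)"
      have "cmod (s i) \<le> ?h * ?x + ?f * ?u"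
        unfolding s_def by (metis norm_triangle_ineq norm_mult)
      then have "(cmod (s i))\<^sup>2 \<le> (?h * ?x + ?f * ?u)\<^sup>2" by (rule power_mono) simp
      also have "\<dots> \<le> (?H + ?F) * (?x\<^sup>2 + ?u\<^sup>2)"
      proof -
        have "0 \<le> (?h * ?u - ?f * ?x)\<^sup>2" by simp
        also have "\<dots> = (?H + ?F) * (?x\<^sup>2 + ?u\<^sup>2) - (?h * ?x + ?f * ?u)\<^sup>2"
          by (simp add: power2_eq_square algebra_simps)
        finally show ?thesis by simp
      qed
      finally show ?thesis using False by (simp add: \<eta>_def)
    qed
    have kx: "k ?S i * x i = s i" for i
    proof (cases "\<eta> ?S i = 0")
      case True
      then show ?thesis using sq[of i] by (simp add: x_def)
    next
      case False
      then have "k ?S i \<noteq> 0" using k[of ?S i] by auto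
      then show ?thesis using False by (simp add: x_def)
    qed
    have x_le: "(cmod (x i))\<^sup>2 \<le> (cmod (codeword C w m i))\<^sup>2 + (cmod (relay_in g w v zr m i))\<^sup>2" for i
    proof (cases "\<eta> ?S i = 0")
      case False
      then have pos: "0 < \<eta> ?S i" using \<eta>[of ?S i] by linarith
      have "(cmod (x i))\<^sup>2 = (cmod (s i))\<^sup>2 / \<eta> ?S i"
        using False by (simp add: x_def norm_divide power_divide k)
      then show ?thesis using sq[of i] pos by (simp add: pos_divide_le_eq mult.commute)
    qed (simp add: x_def)
    have dec: "decoded a b c \<rho> C g f h w v zr zd m \<longleftrightarrow> D m (shift n (\<lambda>i. k ?S i * x i) zd)" for zd
      unfolding decoded_def D_def kx
      by (intro arg_cong[where f="\<lambda>y. dest_dec C (w, (g, f, h), y) = m"])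
        (auto simp: dest_word_def s_def shift_def relay_in_def gain_sr_def gain_rd_def gain_sd_def fun_eq_iff)
    \<comment> \<open>A dummy noise \<open>zr'\<close> received with gain 0 brings the integral into
      the two-output form of \<open>iid_simo_reference\<close>.\<close>
    have "(\<integral>\<^sup>+zd. indicator {m. decoded a b c \<rho> C g f h w v zr zd m} m \<partial>iid_CN) =
      (\<integral>\<^sup>+zr'. \<integral>\<^sup>+zd. indicator {m'. D m' (shift n (\<lambda>i. k ?S i * x i) zd)} m \<partial>iid_CN \<partial>iid_CN)"
      by (simp add: indicator_def dec iid.emeasure_space_1[simplified])
    also have "\<dots> \<le> ennreal (\<Prod>i<n. (1 + (cmod ((\<lambda>_. 0) i :: complex))\<^sup>2 + (cmod (k ?S i))\<^sup>2) * exp ((cmod (x i))\<^sup>2)) *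
      (\<integral>\<^sup>+X. \<integral>\<^sup>+zr'. \<integral>\<^sup>+zd. indicator {m'. D m' (shift n (\<lambda>i. k ?S i * X i) zd)} m \<partial>iid_CN \<partial>iid_CN \<partial>iid_CN)"
    proof -
      have m: "(\<lambda>(y, y'). indicator {m. D m y'} m :: ennreal) \<in> borel_measurable (cseq_borel \<Otimes>\<^sub>M cseq_borel)" for m
        unfolding indicator_def by (simp add: split_beta')
      show ?thesis
        by (rule iid_simo_reference[OF m])
    qed
    also have "\<dots> \<le> ennreal (exp (dest_cost g f h w v zr m)) * R ?S m"
    proof (rule mult_mono)
      have "(\<Prod>i<n. (1 + \<eta> ?S i) * exp ((cmod (x i))\<^sup>2)) \<le> exp (dest_cost g f h w v zr m)"
        unfolding dest_cost_def
      proof (rule cost_prod)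
        show "(\<Sum>i<n. (cmod (x i))\<^sup>2) \<le> energy w m + relay_energy g w v zr m"
          unfolding energy_def relay_energy_def sum.distrib[symmetric] by (intro sum_mono x_le)
      qed (use sched_subset in \<open>auto simp: \<eta>_def\<close>)
      then show "ennreal (\<Prod>i<n. (1 + (cmod ((\<lambda>_. 0) i :: complex))\<^sup>2 + (cmod (k ?S i))\<^sup>2) * exp ((cmod (x i))\<^sup>2))
        \<le> ennreal (exp (dest_cost g f h w v zr m))"
        by (intro ennreal_leI) (simp add: k)
    qed (simp_all add: R_def indicator_def iid.emeasure_space_1[simplified])
    finally show ?thesis .
  qed
  have R_sum: "(\<Sum>m<M. R S m) \<le> 1" for S
  proof -
    have m2: "(\<lambda>zd. indicator {m. D m (shift n (\<lambda>i. k S i * X i) zd)} m :: ennreal) \<in> borel_measurable iid_CN" for m X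
      unfolding indicator_def by measurable
    have m1: "(\<lambda>X. \<integral>\<^sup>+zd. indicator {m. D m (shift n (\<lambda>i. k S i * X i) zd)} m \<partial>iid_CN) \<in> borel_measurable iid_CN" for m
      unfolding indicator_def by measurable
    have "(\<Sum>m<M. R S m) = (\<integral>\<^sup>+X. \<integral>\<^sup>+zd. (\<Sum>m<M. indicator {m. D m (shift n (\<lambda>i. k S i * X i) zd)} m) \<partial>iid_CN \<partial>iid_CN)"
      unfolding R_def using m1 m2 by (simp add: nn_integral_sum)
    also have "\<dots> \<le> (\<integral>\<^sup>+X. \<integral>\<^sup>+zd. 1 \<partial>iid_CN \<partial>iid_CN)"
    proof (intro nn_integral_mono)
      fix X zd
      let ?d = "dest_dec C (w, (g, f, h), \<lambda>i. if i < n then shift n (\<lambda>i. k S i * X i) zd i else 0)"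
      have "(\<Sum>m<M. indicator {m. D m (shift n (\<lambda>i. k S i * X i) zd)} m) \<le> (\<Sum>m<M. if m = ?d then 1 else 0 :: ennreal)"
        by (intro sum_mono) (simp add: indicator_def D_def)
      also have "\<dots> \<le> 1" by (subst sum.delta) auto
      finally show "(\<Sum>m<M. indicator {m. D m (shift n (\<lambda>i. k S i * X i) zd)} m) \<le> (1 :: ennreal)" .
    qed
    finally show ?thesis by (simp add: iid.emeasure_space_1[simplified])
  qed
  have [measurable]: "Measurable.pred cseq_borel (\<lambda>zr. \<theta> < dest_cost g f h w v zr m)" for m
    unfolding dest_cost_def cost_def by measurable
  have "(\<Sum>m<M. \<integral>\<^sup>+zr. \<integral>\<^sup>+zd. indicator {m. decoded a b c \<rho> C g f h w v zr zd m} m \<partial>iid_CN \<partial>iid_CN) \<le>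
    (\<Sum>m<M. \<integral>\<^sup>+zr. indicator {zr. \<theta> < dest_cost g f h w v zr m} zr + ennreal (exp \<theta>) * (\<Sum>S\<in>Pow {..<n}. R S m) \<partial>iid_CN)"
  proof (intro sum_mono nn_integral_mono)
    fix m zr
    let ?L = "\<integral>\<^sup>+zd. indicator {m. decoded a b c \<rho> C g f h w v zr zd m} m \<partial>iid_CN"
    show "?L \<le> indicator {zr. \<theta> < dest_cost g f h w v zr m} zr + ennreal (exp \<theta>) * (\<Sum>S\<in>Pow {..<n}. R S m)"
    proof (cases "\<theta> < dest_cost g f h w v zr m")
      case True
      have "?L \<le> (\<integral>\<^sup>+zd. 1 \<partial>iid_CN)" by (intro nn_integral_mono) (simp add: indicator_def)
      then have "?L \<le> 1" by (simp add: iid.emeasure_space_1[simplified])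
      then show ?thesis using True by (simp add: add_increasing2)
    next
      case False
      have "?L \<le> ennreal (exp (dest_cost g f h w v zr m)) * R (sched g w v zr m) m" by (rule step)
      also have "\<dots> \<le> ennreal (exp \<theta>) * (\<Sum>S\<in>Pow {..<n}. R S m)"
        using False sched_subset by (intro mult_mono member_le_sum) (auto intro!: ennreal_leI)
      finally show ?thesis by (simp add: add_increasing)
    qed
  qed
  also have "\<dots> = (\<Sum>m<M. \<integral>\<^sup>+zr. indicator {zr. \<theta> < dest_cost g f h w v zr m} zr \<partial>iid_CN) +
      ennreal (exp \<theta>) * (\<Sum>S\<in>Pow {..<n}. \<Sum>m<M. R S m)"
    by (subst nn_integral_add)
      (simp_all add: iid.emeasure_space_1[simplified] sum.distrib sum_distrib_left sum.swap[of _ "{..<M}"])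
  also have "\<dots> \<le> (\<Sum>m<M. \<integral>\<^sup>+zr. indicator {zr. \<theta> < dest_cost g f h w v zr m} zr \<partial>iid_CN) +
      ennreal (exp \<theta>) * (\<Sum>S\<in>Pow {..<n}. 1)"
    by (intro add_left_mono mult_left_mono sum_mono R_sum) simp
  finally show ?thesis by (simp add: card_Pow)
qed

section \<open>Success probability for given fading\<close>

definition success :: "complex \<Rightarrow> complex \<Rightarrow> complex \<Rightarrow> ennreal" where
  "success g f h = (\<Sum>m<M. \<integral>\<^sup>+w. \<integral>\<^sup>+v. \<integral>\<^sup>+zr. \<integral>\<^sup>+zd.
     indicator {m. decoded a b c \<rho> C g f h w v zr zd m} m \<partial>iid_CN \<partial>iid_CN \<partial>iid_CN \<partial>iid_CN)"

definition listen_time :: "complex \<Rightarrow> real" where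
  "listen_time g = enn2real (\<Sum>m<M. \<integral>\<^sup>+w. \<integral>\<^sup>+v. \<integral>\<^sup>+zr. ennreal (real (card (sched g w v zr m)))
     \<partial>iid_CN \<partial>iid_CN \<partial>iid_CN) / (real M * real n)"

text \<open>Listening and transmitting times add up to n in every realization, so both expectations
  are finite and \<open>enn2real\<close> loses nothing.\<close>

lemma listen_time:
  shows "0 \<le> listen_time g" "listen_time g \<le> 1"
    and "(\<Sum>m<M. \<integral>\<^sup>+w. \<integral>\<^sup>+v. \<integral>\<^sup>+zr. ennreal (real (card (sched g w v zr m)))
      \<partial>iid_CN \<partial>iid_CN \<partial>iid_CN) = ennreal (listen_time g * (real M * real n))"
    and "(\<Sum>m<M. \<integral>\<^sup>+w. \<integral>\<^sup>+v. \<integral>\<^sup>+zr. ennreal (real n - real (card (sched g w v zr m)))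
      \<partial>iid_CN \<partial>iid_CN \<partial>iid_CN) = ennreal ((1 - listen_time g) * (real M * real n))"
proof -
  define L where "L = (\<Sum>m<M. \<integral>\<^sup>+w. \<integral>\<^sup>+v. \<integral>\<^sup>+zr. ennreal (real (card (sched g w v zr m)))
      \<partial>iid_CN \<partial>iid_CN \<partial>iid_CN)"
  define T where "T = (\<Sum>m<M. \<integral>\<^sup>+w. \<integral>\<^sup>+v. \<integral>\<^sup>+zr. ennreal (real n - real (card (sched g w v zr m)))
      \<partial>iid_CN \<partial>iid_CN \<partial>iid_CN)"
  have le: "real (card (sched g w v zr m)) \<le> real n" for w v zr m
    using card_mono[OF _ sched_subset, of g w v zr m] by simp
  have MN: "0 < real M * real n" using n_pos M_pos by simp
  have "L + T = (\<Sum>m<M. \<integral>\<^sup>+w. \<integral>\<^sup>+v. \<integral>\<^sup>+zr. ennreal (real (card (sched g w v zr m))) +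
      ennreal (real n - real (card (sched g w v zr m))) \<partial>iid_CN \<partial>iid_CN \<partial>iid_CN)"
    unfolding L_def T_def by (simp add: sum.distrib nn_integral_add)
  also have "\<dots> = (\<Sum>m<M. ennreal (real n))"
    using le by (simp add: ennreal_plus[symmetric] del: ennreal_plus)
  also have "\<dots> = ennreal (real M * real n)"
    by (simp add: ennreal_mult ennreal_of_nat_eq_real_of_nat)
  finally have LT: "L + T = ennreal (real M * real n)" .
  then have fin: "L \<noteq> \<top>" "T \<noteq> \<top>" by (auto simp: ennreal_add_eq_top)
  show "0 \<le> listen_time g" by (simp add: listen_time_def)
  have "enn2real L + enn2real T = real M * real n"
    using LT fin MN by (metis enn2real_ennreal enn2real_plus less_eq_real_def top.not_eq_extremum)
  moreover have EL: "enn2real L = listen_time g * (real M * real n)"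
    using n_pos M_pos by (simp add: listen_time_def L_def[symmetric])
  ultimately have ET: "enn2real T = (1 - listen_time g) * (real M * real n)"
    by (simp add: algebra_simps)
  then have "0 \<le> (1 - listen_time g) * (real M * real n)"
    by (metis enn2real_nonneg)
  then show "listen_time g \<le> 1" using MN by (simp add: zero_le_mult_iff)
  show "L = ennreal (listen_time g * (real M * real n))"
    using EL fin by (metis ennreal_enn2real top.not_eq_extremum)
  show "T = ennreal ((1 - listen_time g) * (real M * real n))"
    using ET fin by (metis ennreal_enn2real top.not_eq_extremum)
qed

lemma energy_bound: "(\<Sum>m<M. \<integral>\<^sup>+w. \<integral>\<^sup>+v. \<integral>\<^sup>+zr. ennreal (energy w m) \<partial>iid_CN \<partial>iid_CN \<partial>iid_CN)
   \<le> ennreal (real M * real n)"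
proof -
  have "(\<Sum>m<M. \<integral>\<^sup>+w. \<integral>\<^sup>+v. \<integral>\<^sup>+zr. ennreal (energy w m) \<partial>iid_CN \<partial>iid_CN \<partial>iid_CN) =
    (\<Sum>m<M. \<integral>\<^sup>+w. ennreal (\<Sum>i<n. (cmod (src_enc C w m i))\<^sup>2) \<partial>iid_CN)"
    by (simp add: energy_def codeword_def)
  also have "\<dots> \<le> (\<Sum>m<M. ennreal (real n))"
    using valid by (intro sum_mono) (auto simp: valid_code_def source_power_ok_def)
  also have "\<dots> = ennreal (real M * real n)"
    by (simp add: ennreal_mult ennreal_of_nat_eq_real_of_nat)
  finally show ?thesis .
qed

lemma relay_energy_bound: "(\<Sum>m<M. \<integral>\<^sup>+w. \<integral>\<^sup>+v. \<integral>\<^sup>+zr. ennreal (relay_energy g w v zr m) \<partial>iid_CN \<partial>iid_CN \<partial>iid_CN)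
   \<le> ennreal (real M * real n)"
proof -
  \<comment> \<open>The power constraint speaks of \<open>relay_input\<close>; for actual messages
    and times it is the input computed from the would-be observations.\<close>
  have eq: "relay_input a \<rho> C g w v zr m i = relay_in g w v zr m i" if "m < M" "i < n" for w v zr m i
  proof -
    have "relay_past a \<rho> C g w v zr m i = relay_run C g w v (shift n (\<lambda>i. gain_sr g * codeword C w m i) zr) i"
      using that by (intro relay_past_eq_run) (auto simp: shift_def codeword_def gain_sr_def)
    then show ?thesis by (simp add: relay_input_def relay_in_def run_input_def Let_def)
  qed
  have "(\<Sum>m<M. \<integral>\<^sup>+w. \<integral>\<^sup>+v. \<integral>\<^sup>+zr. ennreal (relay_energy g w v zr m) \<partial>iid_CN \<partial>iid_CN \<partial>iid_CN) =
    (\<Sum>m<M. \<integral>\<^sup>+(w, v, zr). ennreal (relay_energy g w v zr m) \<partial>(iid_CN \<Otimes>\<^sub>M iid_CN \<Otimes>\<^sub>M iid_CN))"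
  proof (intro sum.cong refl)
    fix m
    have "(\<integral>\<^sup>+(w, v, zr). ennreal (relay_energy g w v zr m) \<partial>(iid_CN \<Otimes>\<^sub>M iid_CN \<Otimes>\<^sub>M iid_CN)) =
      (\<integral>\<^sup>+w. \<integral>\<^sup>+(v, zr). ennreal (relay_energy g w v zr m) \<partial>(iid_CN \<Otimes>\<^sub>M iid_CN) \<partial>iid_CN)"
      by (subst iid2.P.nn_integral_fst[symmetric]) (simp_all add: split_beta')
    also have "\<dots> = (\<integral>\<^sup>+w. \<integral>\<^sup>+v. \<integral>\<^sup>+zr. ennreal (relay_energy g w v zr m) \<partial>iid_CN \<partial>iid_CN \<partial>iid_CN)"
      by (intro nn_integral_cong, subst iid.nn_integral_fst[symmetric]) (simp_all add: split_beta')
    finally show "(\<integral>\<^sup>+w. \<integral>\<^sup>+v. \<integral>\<^sup>+zr. ennreal (relay_energy g w v zr m) \<partial>iid_CN \<partial>iid_CN \<partial>iid_CN) =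
      (\<integral>\<^sup>+(w, v, zr). ennreal (relay_energy g w v zr m) \<partial>(iid_CN \<Otimes>\<^sub>M iid_CN \<Otimes>\<^sub>M iid_CN))" ..
  qed
  also have "\<dots> = (\<Sum>m<M. \<integral>\<^sup>+(w, v, zr). ennreal (\<Sum>i<n. (cmod (relay_input a \<rho> C g w v zr m i))\<^sup>2)
      \<partial>(iid_CN \<Otimes>\<^sub>M iid_CN \<Otimes>\<^sub>M iid_CN))"
    by (intro sum.cong refl nn_integral_cong) (auto simp: relay_energy_def eq)
  also have "\<dots> \<le> ennreal (real M * real n)"
    using valid by (simp add: valid_code_def relay_power_ok_def)
  finally show ?thesis .
qed

end


lemma nn_integral_pair:
  assumes "prob_space N" "f \<in> borel_measurable (M \<Otimes>\<^sub>M N)"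
  shows "(\<integral>\<^sup>+z. f z \<partial>(M \<Otimes>\<^sub>M N)) = (\<integral>\<^sup>+x. \<integral>\<^sup>+y. f (x, y) \<partial>N \<partial>M)"
proof -
  interpret prob_space N by fact
  show ?thesis using assms(2) by (rule nn_integral_fst[symmetric])
qed

context relay_code
begin

text \<open>Holds because \<open>cost\<close> is affine in the size of the schedule and in the
  energy.\<close>

lemma expected_cost:
  assumes A: "0 \<le> A" and B: "0 \<le> B"
    and E: "\<And>w v zr m. 0 \<le> E w v zr m" and e: "0 \<le> e"
    and Em: "\<And>m. (\<lambda>(w, v, zr). E w v zr m) \<in> borel_measurable (cseq_borel \<Otimes>\<^sub>M cseq_borel \<Otimes>\<^sub>M cseq_borel)"
    and Ee: "(\<Sum>m<M. \<integral>\<^sup>+w. \<integral>\<^sup>+v. \<integral>\<^sup>+zr. ennreal (E w v zr m) \<partial>iid_CN \<partial>iid_CN \<partial>iid_CN) \<le> ennreal e"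
  shows "(\<Sum>m<M. \<integral>\<^sup>+w. \<integral>\<^sup>+v. \<integral>\<^sup>+zr. ennreal (cost n A B (sched g w v zr m) (E w v zr m)) \<partial>iid_CN \<partial>iid_CN \<partial>iid_CN)
    \<le> ennreal (real M * real n * (listen_time g * A + (1 - listen_time g) * B) + e)"
proof -
  have [measurable]: "(\<lambda>x. E (w x) (v x) (zr x) m) \<in> borel_measurable N"
    if "w \<in> measurable N cseq_borel" "v \<in> measurable N cseq_borel" "zr \<in> measurable N cseq_borel"
    for N :: "'x measure" and w v zr m
    using measurable_compose[OF measurable_Pair[OF that(1) measurable_Pair[OF that(2,3)]] Em[of m]] by simp
  have le: "real (card (sched g w v zr m)) \<le> real n" for w v zr m
    using card_mono[OF _ sched_subset, of g w v zr m] by simp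
  have eq: "ennreal (cost n A B (sched g w v zr m) (E w v zr m)) =
     ennreal A * ennreal (real (card (sched g w v zr m))) + (ennreal B * ennreal (real n - real (card (sched g w v zr m))) +
     ennreal (E w v zr m))" for w v zr m
    using A B E le by (simp add: cost_def ennreal_mult[symmetric] ennreal_plus[symmetric] mult.commute add.assoc del: ennreal_plus)
  have "(\<Sum>m<M. \<integral>\<^sup>+w. \<integral>\<^sup>+v. \<integral>\<^sup>+zr. ennreal (cost n A B (sched g w v zr m) (E w v zr m)) \<partial>iid_CN \<partial>iid_CN \<partial>iid_CN) =
    ennreal A * (\<Sum>m<M. \<integral>\<^sup>+w. \<integral>\<^sup>+v. \<integral>\<^sup>+zr. ennreal (real (card (sched g w v zr m))) \<partial>iid_CN \<partial>iid_CN \<partial>iid_CN) +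
    (ennreal B * (\<Sum>m<M. \<integral>\<^sup>+w. \<integral>\<^sup>+v. \<integral>\<^sup>+zr. ennreal (real n - real (card (sched g w v zr m))) \<partial>iid_CN \<partial>iid_CN \<partial>iid_CN) +
    (\<Sum>m<M. \<integral>\<^sup>+w. \<integral>\<^sup>+v. \<integral>\<^sup>+zr. ennreal (E w v zr m) \<partial>iid_CN \<partial>iid_CN \<partial>iid_CN))"
    unfolding eq by (simp add: nn_integral_add nn_integral_cmult sum.distrib sum_distrib_left)
  also have "\<dots> \<le> ennreal A * ennreal (listen_time g * (real M * real n)) +
     (ennreal B * ennreal ((1 - listen_time g) * (real M * real n)) + ennreal e)"
    unfolding listen_time(3,4) by (intro add_left_mono Ee)
  also have "\<dots> = ennreal (real M * real n * (listen_time g * A + (1 - listen_time g) * B) + e)"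
  proof -
    have nn: "0 \<le> listen_time g * (real M * real n)" "0 \<le> (1 - listen_time g) * (real M * real n)"
      using listen_time(1,2)[of g] by auto
    show ?thesis
      using A B e by (simp only: ennreal_mult[symmetric] ennreal_plus[symmetric] nn mult_nonneg_nonneg add_nonneg_nonneg)
        (simp only: algebra_simps)
  qed
  finally show ?thesis .
qed

text \<open>Markov's inequality for the event that the cost exceeds \<theta>. It is strong enough
  because success only has to be bounded away from 1.\<close>

lemma success_le:
  assumes \<theta>: "0 < \<theta>" and e: "0 \<le> e"
    and cut: "\<And>w v. (\<Sum>m<M. \<integral>\<^sup>+zr. \<integral>\<^sup>+zd. indicator {m. decoded a b c \<rho> C g f h w v zr zd m} m \<partial>iid_CN \<partial>iid_CN) \<le>
      (\<Sum>m<M. \<integral>\<^sup>+zr. indicator {zr. \<theta> < W w v zr m} zr \<partial>iid_CN) + K"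
    and Wm: "\<And>m. (\<lambda>(w, v, zr). W w v zr m) \<in> borel_measurable (cseq_borel \<Otimes>\<^sub>M cseq_borel \<Otimes>\<^sub>M cseq_borel)"
    and We: "(\<Sum>m<M. \<integral>\<^sup>+w. \<integral>\<^sup>+v. \<integral>\<^sup>+zr. ennreal (W w v zr m) \<partial>iid_CN \<partial>iid_CN \<partial>iid_CN) \<le> ennreal e"
  shows "success g f h \<le> ennreal (e / \<theta>) + K"
proof -
  have [measurable]: "(\<lambda>x. W (w x) (v x) (zr x) m) \<in> borel_measurable N"
    if "w \<in> measurable N cseq_borel" "v \<in> measurable N cseq_borel" "zr \<in> measurable N cseq_borel"
    for N :: "'x measure" and w v zr m
    using measurable_compose[OF measurable_Pair[OF that(1) measurable_Pair[OF that(2,3)]] Wm[of m]] by simp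
  have [measurable]: "(\<lambda>(w, v, zr, zd). indicator {m. decoded a b c \<rho> C g f h w v zr zd m} m :: ennreal)
      \<in> borel_measurable (cseq_borel \<Otimes>\<^sub>M cseq_borel \<Otimes>\<^sub>M cseq_borel \<Otimes>\<^sub>M cseq_borel)" for m
    unfolding indicator_def by measurable
  have "success g f h = (\<integral>\<^sup>+w. \<integral>\<^sup>+v. (\<Sum>m<M. \<integral>\<^sup>+zr. \<integral>\<^sup>+zd.
     indicator {m. decoded a b c \<rho> C g f h w v zr zd m} m \<partial>iid_CN \<partial>iid_CN) \<partial>iid_CN \<partial>iid_CN)"
    unfolding success_def by (simp add: nn_integral_sum)
  also have "\<dots> \<le> (\<integral>\<^sup>+w. \<integral>\<^sup>+v. (\<Sum>m<M. \<integral>\<^sup>+zr. ennreal (1 / \<theta>) * ennreal (W w v zr m) \<partial>iid_CN) + K \<partial>iid_CN \<partial>iid_CN)"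
  proof (intro nn_integral_mono order.trans[OF cut] add_right_mono sum_mono)
    fix w v zr m
    show "indicator {zr. \<theta> < W w v zr m} zr \<le> ennreal (1 / \<theta>) * ennreal (W w v zr m)"
    proof (cases "\<theta> < W w v zr m")
      case True
      then have "ennreal 1 \<le> ennreal (1 / \<theta> * W w v zr m)"
        using \<theta> by (intro ennreal_leI) (simp add: pos_le_divide_eq)
      then show ?thesis using True \<theta> by (subst ennreal_mult[symmetric]) auto
    qed simp
  qed
  also have "\<dots> = ennreal (1 / \<theta>) * (\<Sum>m<M. \<integral>\<^sup>+w. \<integral>\<^sup>+v. \<integral>\<^sup>+zr. ennreal (W w v zr m) \<partial>iid_CN \<partial>iid_CN \<partial>iid_CN) + K"
    by (simp add: nn_integral_add nn_integral_sum nn_integral_cmult sum_distrib_left)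
  also have "\<dots> \<le> ennreal (1 / \<theta>) * ennreal e + K"
    by (intro add_right_mono mult_left_mono We) simp
  also have "ennreal (1 / \<theta>) * ennreal e = ennreal (e / \<theta>)"
    using \<theta> e by (subst ennreal_mult[symmetric]) auto
  finally show ?thesis .
qed

text \<open>The genie version has a single schedule, hence no factor 2 ^ n, and leaves the reference
  power P free. Both are decisive when the rate does not grow with \<rho>.\<close>

lemma success_full:
  assumes P: "0 < P" and \<theta>: "0 < \<theta>"
  shows "success g f h \<le> ennreal (real M * real n * (ln (1 + P * ((cmod (gain_sr g))\<^sup>2 + (cmod (gain_sd h))\<^sup>2)) + 1 / P) / \<theta> + exp \<theta>)"
proof -
  let ?A = "ln (1 + P * ((cmod (gain_sr g))\<^sup>2 + (cmod (gain_sd h))\<^sup>2))" and ?B = "ln (1 + P * (cmod (gain_sd h))\<^sup>2)"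
  let ?W = "\<lambda>w v zr m. cost n ?A ?B {..<n} (energy w m / P)"
  have A: "0 \<le> ?A" using P by (intro ln_ge_zero) simp
  have "success g f h \<le> ennreal (real M * real n * (?A + 1 / P) / \<theta>) + ennreal (exp \<theta>)"
  proof (rule success_le[OF \<theta>])
    show "(\<Sum>m<M. \<integral>\<^sup>+zr. \<integral>\<^sup>+zd. indicator {m. decoded a b c \<rho> C g f h w v zr zd m} m \<partial>iid_CN \<partial>iid_CN) \<le>
      (\<Sum>m<M. \<integral>\<^sup>+zr. indicator {zr. \<theta> < ?W w v zr m} zr \<partial>iid_CN) + ennreal (exp \<theta>)" for w v
      using source_cut[OF P, of g f h w v \<theta> True] by simp
    have eq: "ennreal (?W w v zr m) = ennreal (real n * ?A) + ennreal (1 / P) * ennreal (energy w m)" for w v zr m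
      using A P energy_nonneg by (simp add: cost_def ennreal_mult[symmetric] ennreal_plus[symmetric] del: ennreal_plus)
    have "(\<Sum>m<M. \<integral>\<^sup>+w. \<integral>\<^sup>+v. \<integral>\<^sup>+zr. ennreal (?W w v zr m) \<partial>iid_CN \<partial>iid_CN \<partial>iid_CN) =
      of_nat M * ennreal (real n * ?A) + ennreal (1 / P) * (\<Sum>m<M. \<integral>\<^sup>+w. \<integral>\<^sup>+v. \<integral>\<^sup>+zr. ennreal (energy w m) \<partial>iid_CN \<partial>iid_CN \<partial>iid_CN)"
      unfolding eq by (simp add: nn_integral_add nn_integral_cmult sum.distrib sum_distrib_left)
    also have "\<dots> \<le> of_nat M * ennreal (real n * ?A) + ennreal (1 / P) * ennreal (real M * real n)"
      by (intro add_left_mono mult_left_mono energy_bound) simp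
    also have "\<dots> = ennreal (real M * real n * (?A + 1 / P))"
      using A P by (simp add: ennreal_of_nat_eq_real_of_nat ennreal_mult[symmetric] ennreal_plus[symmetric] algebra_simps del: ennreal_plus)
    finally show "(\<Sum>m<M. \<integral>\<^sup>+w. \<integral>\<^sup>+v. \<integral>\<^sup>+zr. ennreal (?W w v zr m) \<partial>iid_CN \<partial>iid_CN \<partial>iid_CN) \<le>
      ennreal (real M * real n * (?A + 1 / P))" .
    show "(\<lambda>(w, v, zr). ?W w v zr m) \<in> borel_measurable (cseq_borel \<Otimes>\<^sub>M cseq_borel \<Otimes>\<^sub>M cseq_borel)" for m
      unfolding cost_def by measurable
  qed (use A P in simp)
  then show ?thesis using A P \<theta> by (simp add: ennreal_plus[symmetric] del: ennreal_plus)
qed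

lemma success_sched:
  assumes \<theta>: "0 < \<theta>"
  shows "success g f h \<le> ennreal (real M * real n * (listen_time g * ln (1 + ((cmod (gain_sr g))\<^sup>2 + (cmod (gain_sd h))\<^sup>2)) +
     (1 - listen_time g) * ln (1 + (cmod (gain_sd h))\<^sup>2) + 1) / \<theta> + exp \<theta> * 2 ^ n)"
proof -
  let ?A = "ln (1 + ((cmod (gain_sr g))\<^sup>2 + (cmod (gain_sd h))\<^sup>2))" and ?B = "ln (1 + (cmod (gain_sd h))\<^sup>2)"
  let ?W = "\<lambda>w v zr m. cost n ?A ?B (sched g w v zr m) (energy w m)"
  let ?e = "real M * real n * (listen_time g * ?A + (1 - listen_time g) * ?B) + real M * real n"
  have AB: "0 \<le> ?A" "0 \<le> ?B" by (auto intro!: ln_ge_zero)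
  have e: "0 \<le> ?e" using AB listen_time(1,2)[of g] by (intro add_nonneg_nonneg mult_nonneg_nonneg) auto
  have "success g f h \<le> ennreal (?e / \<theta>) + ennreal (exp \<theta>) * 2 ^ n"
  proof (rule success_le[OF \<theta> e])
    show "(\<Sum>m<M. \<integral>\<^sup>+zr. \<integral>\<^sup>+zd. indicator {m. decoded a b c \<rho> C g f h w v zr zd m} m \<partial>iid_CN \<partial>iid_CN) \<le>
      (\<Sum>m<M. \<integral>\<^sup>+zr. indicator {zr. \<theta> < ?W w v zr m} zr \<partial>iid_CN) + ennreal (exp \<theta>) * 2 ^ n" for w v
      using source_cut[OF zero_less_one, of g f h w v \<theta> False] by (simp add: card_Pow)
    show "(\<Sum>m<M. \<integral>\<^sup>+w. \<integral>\<^sup>+v. \<integral>\<^sup>+zr. ennreal (?W w v zr m) \<partial>iid_CN \<partial>iid_CN \<partial>iid_CN) \<le> ennreal ?e"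
      by (rule expected_cost[OF AB energy_nonneg _ _ energy_bound]) simp_all
    show "(\<lambda>(w, v, zr). ?W w v zr m) \<in> borel_measurable (cseq_borel \<Otimes>\<^sub>M cseq_borel \<Otimes>\<^sub>M cseq_borel)" for m
      unfolding cost_def by measurable
  qed
  also have "\<dots> = ennreal (?e / \<theta> + exp \<theta> * 2 ^ n)"
    using e \<theta> by (simp add: ennreal_plus ennreal_mult ennreal_power[symmetric])
  finally show ?thesis by (simp add: algebra_simps)
qed

text \<open>The summand 2 collects the unit power budgets of source and relay.\<close>

lemma success_dest:
  assumes \<theta>: "0 < \<theta>"
  shows "success g f h \<le> ennreal (real M * real n * (listen_time g * ln (1 + (cmod (gain_sd h))\<^sup>2) +
     (1 - listen_time g) * ln (1 + ((cmod (gain_sd h))\<^sup>2 + (cmod (gain_rd f))\<^sup>2)) + 2) / \<theta> + exp \<theta> * 2 ^ n)"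
proof -
  let ?A = "ln (1 + (cmod (gain_sd h))\<^sup>2)" and ?B = "ln (1 + ((cmod (gain_sd h))\<^sup>2 + (cmod (gain_rd f))\<^sup>2))"
  let ?E = "\<lambda>w v zr m. energy w m + relay_energy g w v zr m"
  let ?e = "real M * real n * (listen_time g * ?A + (1 - listen_time g) * ?B) + 2 * (real M * real n)"
  have AB: "0 \<le> ?A" "0 \<le> ?B" by (auto intro!: ln_ge_zero)
  have e: "0 \<le> ?e" using AB listen_time(1,2)[of g] by (intro add_nonneg_nonneg mult_nonneg_nonneg) auto
  have "success g f h \<le> ennreal (?e / \<theta>) + ennreal (exp \<theta>) * 2 ^ n"
  proof (rule success_le[OF \<theta> e dest_cut])
    show "(\<Sum>m<M. \<integral>\<^sup>+w. \<integral>\<^sup>+v. \<integral>\<^sup>+zr. ennreal (dest_cost g f h w v zr m) \<partial>iid_CN \<partial>iid_CN \<partial>iid_CN) \<le> ennreal ?e"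
      unfolding dest_cost_def
    proof (rule expected_cost[OF AB])
      show "0 \<le> ?E w v zr m" for w v zr m
        using energy_nonneg relay_energy_nonneg by (simp add: add_nonneg_nonneg)
      have "(\<Sum>m<M. \<integral>\<^sup>+w. \<integral>\<^sup>+v. \<integral>\<^sup>+zr. ennreal (?E w v zr m) \<partial>iid_CN \<partial>iid_CN \<partial>iid_CN) =
        (\<Sum>m<M. \<integral>\<^sup>+w. \<integral>\<^sup>+v. \<integral>\<^sup>+zr. ennreal (energy w m) \<partial>iid_CN \<partial>iid_CN \<partial>iid_CN) +
        (\<Sum>m<M. \<integral>\<^sup>+w. \<integral>\<^sup>+v. \<integral>\<^sup>+zr. ennreal (relay_energy g w v zr m) \<partial>iid_CN \<partial>iid_CN \<partial>iid_CN)"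
        using energy_nonneg relay_energy_nonneg by (simp add: nn_integral_add sum.distrib)
      also have "\<dots> \<le> ennreal (real M * real n) + ennreal (real M * real n)"
        by (intro add_mono energy_bound relay_energy_bound)
      also have "\<dots> = ennreal (2 * (real M * real n))"
        by (simp add: ennreal_plus[symmetric] del: ennreal_plus)
      finally show "(\<Sum>m<M. \<integral>\<^sup>+w. \<integral>\<^sup>+v. \<integral>\<^sup>+zr. ennreal (?E w v zr m) \<partial>iid_CN \<partial>iid_CN \<partial>iid_CN) \<le> ennreal (2 * (real M * real n))" .
    qed simp_all
    show "(\<lambda>(w, v, zr). dest_cost g f h w v zr m) \<in> borel_measurable (cseq_borel \<Otimes>\<^sub>M cseq_borel \<Otimes>\<^sub>M cseq_borel)" for m
      unfolding dest_cost_def cost_def by measurable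
  qed
  also have "\<dots> = ennreal (?e / \<theta> + exp \<theta> * 2 ^ n)"
    using e \<theta> by (simp add: ennreal_plus ennreal_mult ennreal_power[symmetric])
  finally show ?thesis by (simp add: algebra_simps)
qed

section \<open>Error probability as an average over the fading\<close>

lemma error_event_eq:
  assumes "m < M"
  shows "error_event a b c \<rho> C m = {(g, f, h, zr, zd, w, v). \<not> decoded a b c \<rho> C g f h w v zr zd m}"
  by (auto simp: error_event_def decoded_def dest_output_eq_word[OF assms] channel_space_def space_pair_measure)

text \<open>The integrals are reordered so that the seeds precede the noises, as in
  \<open>success\<close> and in the cut bounds.\<close>

lemma emeasure_error_event:
  assumes "m < M"
  shows "error_event a b c \<rho> C m \<in> sets channel_space"
    and "emeasure channel_space (error_event a b c \<rho> C m) =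
     (\<integral>\<^sup>+g. \<integral>\<^sup>+f. \<integral>\<^sup>+h. \<integral>\<^sup>+w. \<integral>\<^sup>+v. \<integral>\<^sup>+zr. \<integral>\<^sup>+zd. indicator {m. \<not> decoded a b c \<rho> C g f h w v zr zd m} m
       \<partial>iid_CN \<partial>iid_CN \<partial>iid_CN \<partial>iid_CN \<partial>CN \<partial>CN \<partial>CN)"
proof -
  have "Measurable.pred channel_space (\<lambda>\<omega>. case \<omega> of (g, f, h, zr, zd, w, v) \<Rightarrow> \<not> decoded a b c \<rho> C g f h w v zr zd m)"
    unfolding channel_space_def by measurable
  then have "{\<omega> \<in> space channel_space. case \<omega> of (g, f, h, zr, zd, w, v) \<Rightarrow> \<not> decoded a b c \<rho> C g f h w v zr zd m} \<in> sets channel_space"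
    by (simp add: pred_def)
  moreover have "{\<omega> \<in> space channel_space. case \<omega> of (g, f, h, zr, zd, w, v) \<Rightarrow> \<not> decoded a b c \<rho> C g f h w v zr zd m} =
     error_event a b c \<rho> C m"
    unfolding error_event_eq[OF assms] by (auto simp: channel_space_def space_pair_measure)
  ultimately show ev: "error_event a b c \<rho> C m \<in> sets channel_space" by simp
  let ?I = "\<lambda>g f h zr zd w v. indicator {m. \<not> decoded a b c \<rho> C g f h w v zr zd m} m :: ennreal"
  have I: "indicator (error_event a b c \<rho> C m) (g, f, h, zr, zd, w, v) = ?I g f h zr zd w v" for g f h zr zd w v
    by (simp add: error_event_eq[OF assms] indicator_def)
  have [measurable]: "(\<lambda>x. ?I (g x) (f x) (h x) (zr x) (zd x) (w x) (v x)) \<in> borel_measurable N"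
    if [measurable]: "g \<in> borel_measurable N" "f \<in> borel_measurable N" "h \<in> borel_measurable N"
      "w \<in> measurable N cseq_borel" "v \<in> measurable N cseq_borel"
      "zr \<in> measurable N cseq_borel" "zd \<in> measurable N cseq_borel" for N :: "'x measure" and g f h w v zr zd
    unfolding indicator_def by measurable
  have "emeasure channel_space (error_event a b c \<rho> C m) = (\<integral>\<^sup>+\<omega>. indicator (error_event a b c \<rho> C m) \<omega> \<partial>channel_space)"
    using ev by simp
  also have "\<dots> = (\<integral>\<^sup>+(g, f, h, zr, zd, w, v). ?I g f h zr zd w v \<partial>channel_space)"
    by (intro nn_integral_cong) (auto simp: I)
  also have "\<dots> = (\<integral>\<^sup>+g. \<integral>\<^sup>+f. \<integral>\<^sup>+h. \<integral>\<^sup>+zr. \<integral>\<^sup>+zd. \<integral>\<^sup>+w. \<integral>\<^sup>+v. ?I g f h zr zd w v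
       \<partial>iid_CN \<partial>iid_CN \<partial>iid_CN \<partial>iid_CN \<partial>CN \<partial>CN \<partial>CN)"
    unfolding channel_space_def
    by (simp add: nn_integral_pair prob_space_pair prob_space_CN prob_space_iid_CN)
  also have "\<dots> = (\<integral>\<^sup>+g. \<integral>\<^sup>+f. \<integral>\<^sup>+h. \<integral>\<^sup>+w. \<integral>\<^sup>+v. \<integral>\<^sup>+zr. \<integral>\<^sup>+zd. ?I g f h zr zd w v
       \<partial>iid_CN \<partial>iid_CN \<partial>iid_CN \<partial>iid_CN \<partial>CN \<partial>CN \<partial>CN)"
  proof (rule nn_integral_cong, rule nn_integral_cong, rule nn_integral_cong)
    fix g f h
    have "(\<integral>\<^sup>+zr. \<integral>\<^sup>+zd. \<integral>\<^sup>+w. \<integral>\<^sup>+v. ?I g f h zr zd w v \<partial>iid_CN \<partial>iid_CN \<partial>iid_CN \<partial>iid_CN) =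
      (\<integral>\<^sup>+zr. \<integral>\<^sup>+w. \<integral>\<^sup>+zd. \<integral>\<^sup>+v. ?I g f h zr zd w v \<partial>iid_CN \<partial>iid_CN \<partial>iid_CN \<partial>iid_CN)"
      by (rule nn_integral_cong, rule nn_integral_swap[OF prob_space_iid_CN prob_space_iid_CN]) measurable
    also have "\<dots> = (\<integral>\<^sup>+w. \<integral>\<^sup>+zr. \<integral>\<^sup>+zd. \<integral>\<^sup>+v. ?I g f h zr zd w v \<partial>iid_CN \<partial>iid_CN \<partial>iid_CN \<partial>iid_CN)"
      by (rule nn_integral_swap[OF prob_space_iid_CN prob_space_iid_CN]) measurable
    also have "\<dots> = (\<integral>\<^sup>+w. \<integral>\<^sup>+zr. \<integral>\<^sup>+v. \<integral>\<^sup>+zd. ?I g f h zr zd w v \<partial>iid_CN \<partial>iid_CN \<partial>iid_CN \<partial>iid_CN)"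
      by (rule nn_integral_cong, rule nn_integral_cong, rule nn_integral_swap[OF prob_space_iid_CN prob_space_iid_CN]) measurable
    also have "\<dots> = (\<integral>\<^sup>+w. \<integral>\<^sup>+v. \<integral>\<^sup>+zr. \<integral>\<^sup>+zd. ?I g f h zr zd w v \<partial>iid_CN \<partial>iid_CN \<partial>iid_CN \<partial>iid_CN)"
      by (rule nn_integral_cong, rule nn_integral_swap[OF prob_space_iid_CN prob_space_iid_CN]) measurable
    finally show "(\<integral>\<^sup>+zr. \<integral>\<^sup>+zd. \<integral>\<^sup>+w. \<integral>\<^sup>+v. ?I g f h zr zd w v \<partial>iid_CN \<partial>iid_CN \<partial>iid_CN \<partial>iid_CN) =
      (\<integral>\<^sup>+w. \<integral>\<^sup>+v. \<integral>\<^sup>+zr. \<integral>\<^sup>+zd. ?I g f h zr zd w v \<partial>iid_CN \<partial>iid_CN \<partial>iid_CN \<partial>iid_CN)" .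
  qed
  finally show "emeasure channel_space (error_event a b c \<rho> C m) =
     (\<integral>\<^sup>+g. \<integral>\<^sup>+f. \<integral>\<^sup>+h. \<integral>\<^sup>+w. \<integral>\<^sup>+v. \<integral>\<^sup>+zr. \<integral>\<^sup>+zd. ?I g f h zr zd w v
       \<partial>iid_CN \<partial>iid_CN \<partial>iid_CN \<partial>iid_CN \<partial>CN \<partial>CN \<partial>CN)" .
qed

text \<open>B and D may depend on g; only the bound \<pi> on their probability is uniform. This
  allows the bad event to be chosen after the listening time, a function of g, is known.\<close>

lemma avg_error_ge:
  assumes \<kappa>: "0 \<le> \<kappa>" "\<kappa> \<le> 1" and \<pi>: "0 \<le> \<pi>" and A: "A \<in> sets borel"
    and box: "\<And>g. g \<in> A \<Longrightarrow> \<exists>B\<in>sets borel. \<exists>D\<in>sets borel. \<pi> \<le> measure CN B * measure CN D \<and>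
       (\<forall>f\<in>B. \<forall>h\<in>D. success g f h \<le> ennreal ((1 - \<kappa>) * real M))"
  shows "measure CN A * \<pi> * \<kappa> \<le> avg_error a b c \<rho> C"
proof -
  interpret ch: prob_space channel_space by (rule prob_space_channel_space)
  let ?I = "\<lambda>m g f h zr zd w v. indicator {m. \<not> decoded a b c \<rho> C g f h w v zr zd m} m :: ennreal"
  let ?J = "\<lambda>m g f h zr zd w v. indicator {m. decoded a b c \<rho> C g f h w v zr zd m} m :: ennreal"
  have mI[measurable]: "(\<lambda>x. ?I m (g x) (f x) (h x) (zr x) (zd x) (w x) (v x)) \<in> borel_measurable N"
      "(\<lambda>x. ?J m (g x) (f x) (h x) (zr x) (zd x) (w x) (v x)) \<in> borel_measurable N"
    if [measurable]: "g \<in> borel_measurable N" "f \<in> borel_measurable N" "h \<in> borel_measurable N"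
      "w \<in> measurable N cseq_borel" "v \<in> measurable N cseq_borel"
      "zr \<in> measurable N cseq_borel" "zd \<in> measurable N cseq_borel" for N :: "'x measure" and g f h w v zr zd m
    unfolding indicator_def by measurable
  define fail where "fail g f h = (\<Sum>m<M. \<integral>\<^sup>+w. \<integral>\<^sup>+v. \<integral>\<^sup>+zr. \<integral>\<^sup>+zd. ?I m g f h zr zd w v \<partial>iid_CN \<partial>iid_CN \<partial>iid_CN \<partial>iid_CN)" for g f h
  have "fail g f h + success g f h = (\<Sum>m<M. \<integral>\<^sup>+w. \<integral>\<^sup>+v. \<integral>\<^sup>+zr. \<integral>\<^sup>+zd. ?I m g f h zr zd w v + ?J m g f h zr zd w v
      \<partial>iid_CN \<partial>iid_CN \<partial>iid_CN \<partial>iid_CN)" for g f h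
    unfolding fail_def success_def by (simp add: nn_integral_add sum.distrib)
  also have "\<dots> g f h = (\<Sum>m<M. \<integral>\<^sup>+w. \<integral>\<^sup>+v. \<integral>\<^sup>+zr. \<integral>\<^sup>+zd. 1 \<partial>iid_CN \<partial>iid_CN \<partial>iid_CN \<partial>iid_CN)" for g f h
    by (intro sum.cong refl nn_integral_cong) (auto simp: indicator_def)
  finally have fs: "fail g f h + success g f h = of_nat M" for g f h by simp
  have fail_ge: "ennreal (\<kappa> * real M) \<le> fail g f h" if "success g f h \<le> ennreal ((1 - \<kappa>) * real M)" for g f h
  proof -
    have "ennreal (\<kappa> * real M) + ennreal ((1 - \<kappa>) * real M) = of_nat M"
      using \<kappa> by (subst ennreal_plus[symmetric]) (auto simp: ennreal_of_nat_eq_real_of_nat algebra_simps mult_left_le_one_le)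
    also have "\<dots> \<le> fail g f h + ennreal ((1 - \<kappa>) * real M)"
      unfolding fs[of g f h, symmetric] using that by (rule add_left_mono)
    finally show ?thesis
      using ennreal_add_left_cancel_le[of "ennreal ((1 - \<kappa>) * real M)" "ennreal (\<kappa> * real M)" "fail g f h"]
      by (simp add: add.commute)
  qed
  have "ennreal (real M * (measure CN A * \<pi> * \<kappa>)) = (\<integral>\<^sup>+g. ennreal (\<pi> * (\<kappa> * real M)) * indicator A g \<partial>CN)"
    using A \<pi> \<kappa>
    by (subst nn_integral_cmult_indicator) (simp_all add: CN.emeasure_eq_measure ennreal_mult[symmetric] mult_ac)
  also have "\<dots> \<le> (\<integral>\<^sup>+g. \<integral>\<^sup>+f. \<integral>\<^sup>+h. fail g f h \<partial>CN \<partial>CN \<partial>CN)"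
  proof (rule nn_integral_mono)
    fix g
    show "ennreal (\<pi> * (\<kappa> * real M)) * indicator A g \<le> (\<integral>\<^sup>+f. \<integral>\<^sup>+h. fail g f h \<partial>CN \<partial>CN)"
    proof (cases "g \<in> A")
      case True
      from box[OF True] obtain B D where BD1: "B \<in> sets borel" "D \<in> sets borel"
        "\<pi> \<le> measure CN B * measure CN D \<and> (\<forall>f\<in>B. \<forall>h\<in>D. success g f h \<le> ennreal ((1 - \<kappa>) * real M))"
        by (elim bexE)
      note BD = BD1(1,2) conjunct1[OF BD1(3)] conjunct2[OF BD1(3), rule_format]
      have "ennreal (\<pi> * (\<kappa> * real M)) \<le> ennreal (measure CN B * measure CN D * (\<kappa> * real M))"
        using BD(3) \<kappa> by (intro ennreal_leI mult_right_mono) auto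
      also have "\<dots> = ennreal (\<kappa> * real M) * emeasure CN D * emeasure CN B"
        using \<kappa> by (simp add: CN.emeasure_eq_measure ennreal_mult[symmetric] mult_ac)
      also have "\<dots> = (\<integral>\<^sup>+f. ennreal (\<kappa> * real M) * emeasure CN D * indicator B f \<partial>CN)"
        using BD(1) by (intro nn_integral_cmult_indicator[symmetric]) simp
      also have "\<dots> = (\<integral>\<^sup>+f. \<integral>\<^sup>+h. ennreal (\<kappa> * real M) * indicator D h * indicator B f \<partial>CN \<partial>CN)"
        using BD(1,2) by (simp add: nn_integral_multc nn_integral_cmult_indicator)
      also have "\<dots> \<le> (\<integral>\<^sup>+f. \<integral>\<^sup>+h. fail g f h \<partial>CN \<partial>CN)"
        using fail_ge[OF BD(4)] by (intro nn_integral_mono) (auto simp: indicator_def)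
      finally show ?thesis using True by simp
    qed simp
  qed
  also have "\<dots> = (\<Sum>m<M. emeasure channel_space (error_event a b c \<rho> C m))"
  proof -
    have "(\<Sum>m<M. emeasure channel_space (error_event a b c \<rho> C m)) =
      (\<Sum>m<M. \<integral>\<^sup>+g. \<integral>\<^sup>+f. \<integral>\<^sup>+h. \<integral>\<^sup>+w. \<integral>\<^sup>+v. \<integral>\<^sup>+zr. \<integral>\<^sup>+zd. ?I m g f h zr zd w v
       \<partial>iid_CN \<partial>iid_CN \<partial>iid_CN \<partial>iid_CN \<partial>CN \<partial>CN \<partial>CN)"
      by (intro sum.cong refl emeasure_error_event(2)) simp
    also have "\<dots> = (\<integral>\<^sup>+g. \<integral>\<^sup>+f. \<integral>\<^sup>+h. fail g f h \<partial>CN \<partial>CN \<partial>CN)"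
      unfolding fail_def by (simp add: nn_integral_sum)
    finally show ?thesis ..
  qed
  also have "\<dots> = ennreal (\<Sum>m<M. measure channel_space (error_event a b c \<rho> C m))"
    by (simp add: ch.emeasure_eq_measure)
  finally have "real M * (measure CN A * \<pi> * \<kappa>) \<le> (\<Sum>m<M. measure channel_space (error_event a b c \<rho> C m))"
    by (subst (asm) ennreal_le_iff) (auto intro: sum_nonneg)
  then show ?thesis
    using M_pos by (simp add: avg_error_def pos_le_divide_eq mult.commute)
qed

end


section \<open>Converse\<close>

text \<open>The threshold n (r - \<delta>/2) ln \<rho> separates the cost, about n (r - \<delta>) ln
  \<rho>, from the logarithm of the number of messages. The lower gap keeps the Markov term below 1,
  the upper gap outgrows 2 ^ n. The 5 leaves room for additive constants in the bounds on the
  cuts.\<close>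

lemma fano_margin:
  fixes r \<delta> :: real
  assumes \<delta>: "0 < \<delta>" "\<delta> < r"
  obtains \<kappa> where "0 < \<kappa>" "\<kappa> \<le> 1"
    "\<forall>\<^sub>F \<rho> in at_top. \<forall>n M :: nat. \<forall>X. 1 \<le> n \<longrightarrow> 0 < M \<longrightarrow> real n * ((r - \<delta> / 4) * ln \<rho>) \<le> ln (real M) \<longrightarrow>
       X \<le> (r - \<delta>) * ln \<rho> + 5 \<longrightarrow>
       0 < real n * ((r - \<delta> / 2) * ln \<rho>) \<and>
       real M * real n * X / (real n * ((r - \<delta> / 2) * ln \<rho>)) + exp (real n * ((r - \<delta> / 2) * ln \<rho>)) * 2 ^ n \<le> (1 - \<kappa>) * real M"
proof -
  define q where "q = (r - \<delta>) / (r - \<delta> / 2)"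
  have q: "0 < q" "q < 1" using \<delta> by (auto simp: q_def)
  \<comment> \<open>1 - 2 \<kappa> is the midpoint of q and 1: the Markov term may take the fraction
    1 - 2 \<kappa>, the reference term the fraction \<kappa>.\<close>
  define \<kappa> where "\<kappa> = (1 - q) / 4"
  have \<kappa>: "0 < \<kappa>" "\<kappa> \<le> 1" using q by (auto simp: \<kappa>_def)
  have "((\<lambda>\<rho>. ((r - \<delta>) * ln \<rho> + 5) / ((r - \<delta> / 2) * ln \<rho>)) \<longlongrightarrow> (r - \<delta>) * inverse (r - \<delta> / 2)) at_top"
    using \<delta> by real_asymp
  then have "((\<lambda>\<rho>. ((r - \<delta>) * ln \<rho> + 5) / ((r - \<delta> / 2) * ln \<rho>)) \<longlongrightarrow> q) at_top"
    by (simp only: q_def divide_inverse[of "r - \<delta>"])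
  moreover have "q < 1 - 2 * \<kappa>" using q by (simp add: \<kappa>_def field_simps)
  ultimately have ev1: "\<forall>\<^sub>F \<rho> in at_top. ((r - \<delta>) * ln \<rho> + 5) / ((r - \<delta> / 2) * ln \<rho>) < 1 - 2 * \<kappa>"
    by (rule order_tendstoD)
  have "filterlim (\<lambda>\<rho>. \<rho> powr (\<delta> / 4)) at_top at_top" using \<delta> by real_asymp
  then have ev2: "\<forall>\<^sub>F \<rho> in at_top. 2 / \<kappa> \<le> \<rho> powr (\<delta> / 4)"
    by (simp add: filterlim_at_top)
  have "\<forall>\<^sub>F \<rho> in at_top. \<forall>n M :: nat. \<forall>X. 1 \<le> n \<longrightarrow> 0 < M \<longrightarrow> real n * ((r - \<delta> / 4) * ln \<rho>) \<le> ln (real M) \<longrightarrow>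
       X \<le> (r - \<delta>) * ln \<rho> + 5 \<longrightarrow>
       0 < real n * ((r - \<delta> / 2) * ln \<rho>) \<and>
       real M * real n * X / (real n * ((r - \<delta> / 2) * ln \<rho>)) + exp (real n * ((r - \<delta> / 2) * ln \<rho>)) * 2 ^ n \<le> (1 - \<kappa>) * real M"
    using ev1 ev2 eventually_gt_at_top[of 1]
  proof (eventually_elim, intro allI impI)
    fix \<rho> X :: real and n M :: nat
    assume ev: "((r - \<delta>) * ln \<rho> + 5) / ((r - \<delta> / 2) * ln \<rho>) < 1 - 2 * \<kappa>" "2 / \<kappa> \<le> \<rho> powr (\<delta> / 4)" "1 < \<rho>"
      and n: "1 \<le> n" "0 < M" and M: "real n * ((r - \<delta> / 4) * ln \<rho>) \<le> ln (real M)" and X: "X \<le> (r - \<delta>) * ln \<rho> + 5"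
    define L where "L = (r - \<delta> / 2) * ln \<rho>"
    have L: "0 < L" using \<delta> ev(3) by (simp add: L_def)
    have "real M * real n * X / (real n * L) = real M * (X / L)"
      using n L by simp
    also have "\<dots> \<le> real M * (1 - 2 * \<kappa>)"
    proof (rule mult_left_mono)
      have "X / L \<le> ((r - \<delta>) * ln \<rho> + 5) / L" using X L by (simp add: divide_right_mono)
      then show "X / L \<le> 1 - 2 * \<kappa>" using ev(1) by (simp add: L_def)
    qed simp
    finally have a: "real M * real n * X / (real n * L) \<le> real M * (1 - 2 * \<kappa>)" .
    \<comment> \<open>Since n >= 1, the constant 1 / \<kappa> is absorbed into an n-th power, which
      makes the bound uniform in the blocklength.\<close>
    have "2 ^ n / \<kappa> \<le> 2 ^ n / \<kappa> ^ n"
      using \<kappa> n power_decreasing[of 1 n \<kappa>] by (intro divide_left_mono) auto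
    also have "\<dots> = (2 / \<kappa>) ^ n" by (simp add: power_divide)
    also have "\<dots> \<le> (\<rho> powr (\<delta> / 4)) ^ n" using ev(2) \<kappa> by (intro power_mono) auto
    also have "\<dots> = exp (real n * (\<delta> / 4 * ln \<rho>))"
      using ev(3) by (simp add: powr_def exp_of_nat_mult[symmetric])
    finally have "2 ^ n \<le> \<kappa> * exp (real n * (\<delta> / 4 * ln \<rho>))" using \<kappa> by (simp add: pos_divide_le_eq mult.commute)
    then have "exp (real n * L) * 2 ^ n \<le> exp (real n * L) * (\<kappa> * exp (real n * (\<delta> / 4 * ln \<rho>)))"
      by (rule mult_left_mono) simp
    also have "\<dots> = \<kappa> * exp (real n * ((r - \<delta> / 4) * ln \<rho>))"
      by (simp add: L_def exp_add[symmetric] algebra_simps)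
    also have "\<dots> \<le> \<kappa> * exp (ln (real M))" using M \<kappa> by (intro mult_left_mono) auto
    also have "\<dots> = \<kappa> * real M" using n by simp
    finally have b: "exp (real n * L) * 2 ^ n \<le> \<kappa> * real M" .
    show "0 < real n * ((r - \<delta> / 2) * ln \<rho>) \<and>
       real M * real n * X / (real n * ((r - \<delta> / 2) * ln \<rho>)) + exp (real n * ((r - \<delta> / 2) * ln \<rho>)) * 2 ^ n \<le> (1 - \<kappa>) * real M"
      using a b n L unfolding L_def[symmetric] by (auto simp: algebra_simps)
  qed
  then show thesis using that \<kappa> by blast
qed

section \<open>Balls of weak fading\<close>

definition gain_ball :: "real \<Rightarrow> complex set" where
  "gain_ball t = {z. (cmod z)\<^sup>2 \<le> t}"

lemma gain_ball_sets [measurable, simp]: "gain_ball t \<in> sets borel"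
  unfolding gain_ball_def by measurable

text \<open>The radius is capped at 1, the range of the small-ball bound. For negative x the ball is
  the unit disc and costs no power of \<rho>, hence the exponent max x 0.\<close>

lemma gain_ball_measure:
  obtains k where "0 < k" "k \<le> 1"
    "\<And>\<rho> x. 1 \<le> \<rho> \<Longrightarrow> k * \<rho> powr (- max x 0) \<le> measure CN (gain_ball (min 1 (\<rho> powr (- x))))"
    "\<And>t. 0 \<le> t \<Longrightarrow> t \<le> 1 \<Longrightarrow> k * t \<le> measure CN (gain_ball t)"
proof -
  obtain k where k: "0 < k" "\<And>t. 0 \<le> t \<Longrightarrow> t \<le> 1 \<Longrightarrow> ennreal (k * t) \<le> emeasure CN {z. (cmod z)\<^sup>2 \<le> t}"
    by (rule CN_small_ball_lower) blast
  have k': "k * t \<le> measure CN (gain_ball t)" if "0 \<le> t" "t \<le> 1" for t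
    using k(2)[OF that] by (simp add: CN.emeasure_eq_measure gain_ball_def)
  have k1: "k \<le> 1" using order.trans[OF k'[of 1] CN.prob_le_1] by simp
  have "k * \<rho> powr (- max x 0) \<le> measure CN (gain_ball (min 1 (\<rho> powr (- x))))" if "1 \<le> \<rho>" for \<rho> x :: real
  proof -
    have "\<rho> powr (- max x 0) \<le> min 1 (\<rho> powr (- x))"
      using that powr_mono[of "- max x 0" 0 \<rho>] powr_mono[of "- max x 0" "- x" \<rho>] by (auto simp: max_def)
    then have "k * \<rho> powr (- max x 0) \<le> k * min 1 (\<rho> powr (- x))"
      using k(1) by simp
    also have "\<dots> \<le> measure CN (gain_ball (min 1 (\<rho> powr (- x))))" by (rule k') auto
    finally show ?thesis .
  qed
  then show thesis using that k(1) k1 k' by blast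
qed

text \<open>The second bound comes from the cap at 1: inside the ball, fading never raises a gain
  above its nominal value.\<close>

lemma gain_ball_scaled:
  assumes "z \<in> gain_ball (min 1 (\<rho> powr (- x)))" "1 \<le> \<rho>"
  shows "(cmod (z * complex_of_real (\<rho> powr (a / 2))))\<^sup>2 \<le> \<rho> powr (a - x)"
    and "(cmod (z * complex_of_real (\<rho> powr (a / 2))))\<^sup>2 \<le> \<rho> powr a"
proof -
  have sq: "(\<rho> powr (a / 2))\<^sup>2 = \<rho> powr a"
    by (simp add: power2_eq_square powr_add[symmetric])
  have z: "(cmod z)\<^sup>2 \<le> \<rho> powr (- x)" "(cmod z)\<^sup>2 \<le> 1" using assms(1) by (auto simp: gain_ball_def)
  have eq: "(cmod (z * complex_of_real (\<rho> powr (a / 2))))\<^sup>2 = (cmod z)\<^sup>2 * \<rho> powr a"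
    by (simp add: norm_mult power_mult_distrib sq)
  have "(cmod z)\<^sup>2 * \<rho> powr a \<le> \<rho> powr (- x) * \<rho> powr a" using z(1) by (rule mult_right_mono) simp
  then show "(cmod (z * complex_of_real (\<rho> powr (a / 2))))\<^sup>2 \<le> \<rho> powr (a - x)"
    unfolding eq by (simp add: powr_add[symmetric])
  show "(cmod (z * complex_of_real (\<rho> powr (a / 2))))\<^sup>2 \<le> \<rho> powr a"
    unfolding eq using mult_right_mono[OF z(2), of "\<rho> powr a"] by simp
qed

text \<open>The constraints that \<open>achieves\<close> puts on a family, apart from those on its error probability.\<close>

definition code_family :: "real \<Rightarrow> real \<Rightarrow> (real \<Rightarrow> hd_code) \<Rightarrow> bool" where
  "code_family a r C \<longleftrightarrow> (\<forall>\<^sub>F \<rho> in at_top. valid_code a \<rho> (C \<rho>)) \<and>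
     (\<exists>R\<^sub>0>0. \<forall>\<^sub>F \<rho> in at_top. R\<^sub>0 \<le> rate (C \<rho>)) \<and> ((\<lambda>\<rho>. rate (C \<rho>) / ln \<rho>) \<longlongrightarrow> r) at_top"

lemma code_family_rate:
  assumes "code_family a r C" "q < r"
  shows "\<forall>\<^sub>F \<rho> in at_top. real (blocklength (C \<rho>)) * (q * ln \<rho>) \<le> ln (real (num_msgs (C \<rho>)))"
proof -
  have "\<forall>\<^sub>F \<rho> in at_top. q < rate (C \<rho>) / ln \<rho>"
    using assms by (auto simp: code_family_def intro: order_tendstoD)
  moreover have "\<forall>\<^sub>F \<rho> in at_top. valid_code a \<rho> (C \<rho>)"
    using assms by (simp add: code_family_def)
  ultimately show ?thesis using eventually_gt_at_top[of 1]
  proof eventually_elim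
    case (elim \<rho>)
    have n: "0 < real (blocklength (C \<rho>))" using elim by (auto simp: valid_code_def)
    have "q * ln \<rho> \<le> rate (C \<rho>)" using elim by (simp add: pos_less_divide_eq)
    then show ?case using n by (simp add: rate_def pos_le_divide_eq mult.commute)
  qed
qed

lemma ln_one_plus_powr:
  fixes \<rho> x s :: real
  assumes "1 \<le> \<rho>" "0 \<le> x" "0 \<le> s" "s \<le> \<rho> powr x"
  shows "ln (1 + s) \<le> x * ln \<rho> + 1"
proof -
  have r1: "1 \<le> \<rho> powr x" using assms powr_mono[of 0 x \<rho>] by simp
  have "ln (1 + s) \<le> ln (2 * \<rho> powr x)" using assms r1 by (subst ln_le_cancel_iff) auto
  also have "\<dots> = ln 2 + x * ln \<rho>" using assms by (subst ln_mult) (auto simp: ln_powr)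
  finally show ?thesis using ln_2_less_1 by linarith
qed

lemma ln_one_plus_powr2:
  fixes \<rho> x s t :: real
  assumes "1 \<le> \<rho>" "0 \<le> x" "0 \<le> s" "s \<le> \<rho> powr x" "0 \<le> t" "t \<le> \<rho> powr x"
  shows "ln (1 + (s + t)) \<le> x * ln \<rho> + 2"
proof -
  have r1: "1 \<le> \<rho> powr x" using assms powr_mono[of 0 x \<rho>] by simp
  have "ln (1 + (s + t)) \<le> ln (2 * (2 * \<rho> powr x))" using assms r1 by (subst ln_le_cancel_iff) auto
  also have "\<dots> = ln 2 + (ln 2 + x * ln \<rho>)"
  proof -
    have double: "ln (2 * y) = ln 2 + ln y" if "0 < y" for y :: real using that by (simp add: ln_mult)
    have "0 < \<rho> powr x" "0 < 2 * \<rho> powr x" using r1 by auto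
    then show ?thesis using assms by (simp only: double) (simp add: ln_powr)
  qed
  finally show ?thesis using ln_2_less_1 by linarith
qed

section \<open>Lower bounds on the error of a code family\<close>

text \<open>Both links leaving the source are pushed down to \<rho> powr (r - \<delta>), so that
  even a destination sharing the relay's observations lacks capacity; h_rd stays free. A link whose
  nominal exponent is already below this level costs nothing, hence the max with 0.\<close>

lemma source_cut_converse_pos:
  assumes C: "code_family a r C" and \<delta>: "0 < \<delta>" "\<delta> < r" and ac: "0 \<le> a" "0 \<le> c"
  obtains K where "0 < K"
    "\<forall>\<^sub>F \<rho> in at_top. K * \<rho> powr (- (max (a - r + \<delta>) 0 + max (c - r + \<delta>) 0)) \<le> avg_error a b c \<rho> (C \<rho>)"
proof -
  obtain k where k: "0 < k" "\<And>\<rho> x. 1 \<le> \<rho> \<Longrightarrow> k * \<rho> powr (- max x 0) \<le> measure CN (gain_ball (min 1 (\<rho> powr (- x))))"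
    by (rule gain_ball_measure) blast
  from \<delta> obtain \<kappa> where \<kappa>: "0 < \<kappa>" "\<kappa> \<le> 1" and ev: "\<forall>\<^sub>F \<rho> in at_top. \<forall>n M :: nat. \<forall>X. 1 \<le> n \<longrightarrow> 0 < M \<longrightarrow>
       real n * ((r - \<delta> / 4) * ln \<rho>) \<le> ln (real M) \<longrightarrow> X \<le> (r - \<delta>) * ln \<rho> + 5 \<longrightarrow>
       0 < real n * ((r - \<delta> / 2) * ln \<rho>) \<and>
       real M * real n * X / (real n * ((r - \<delta> / 2) * ln \<rho>)) + exp (real n * ((r - \<delta> / 2) * ln \<rho>)) * 2 ^ n \<le> (1 - \<kappa>) * real M"
    by (rule fano_margin)
  have valid: "\<forall>\<^sub>F \<rho> in at_top. valid_code a \<rho> (C \<rho>)" using C by (simp add: code_family_def)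
  have rt: "\<forall>\<^sub>F \<rho> in at_top. real (blocklength (C \<rho>)) * ((r - \<delta> / 4) * ln \<rho>) \<le> ln (real (num_msgs (C \<rho>)))"
    using \<delta> by (intro code_family_rate[OF C]) simp
  have "\<forall>\<^sub>F \<rho> in at_top. k * k * \<kappa> * \<rho> powr (- (max (a - r + \<delta>) 0 + max (c - r + \<delta>) 0)) \<le> avg_error a b c \<rho> (C \<rho>)"
    using ev valid rt eventually_ge_at_top[of 1]
  proof eventually_elim
    case (elim \<rho>)
    interpret relay_code a b c \<rho> "C \<rho>" by standard (rule elim(2))
    let ?n = "blocklength (C \<rho>)" and ?M = "num_msgs (C \<rho>)"
    let ?A = "gain_ball (min 1 (\<rho> powr (- (a - r + \<delta>))))" and ?D = "gain_ball (min 1 (\<rho> powr (- (c - r + \<delta>))))"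
    let ?\<theta> = "real ?n * ((r - \<delta> / 2) * ln \<rho>)"
    have n: "1 \<le> ?n" using n_pos by simp
    have suc: "success g f h \<le> ennreal ((1 - \<kappa>) * real ?M)" if "g \<in> ?A" "h \<in> ?D" for g f h
    proof -
      let ?X = "ln (1 + 1 * ((cmod (gain_sr g))\<^sup>2 + (cmod (gain_sd h))\<^sup>2)) + 1 / 1"
      have "(cmod (gain_sr g))\<^sup>2 \<le> \<rho> powr (r - \<delta>)" "(cmod (gain_sd h))\<^sup>2 \<le> \<rho> powr (r - \<delta>)"
        using gain_ball_scaled(1)[OF that(1) elim(4), of a] gain_ball_scaled(1)[OF that(2) elim(4), of c]
        by (simp_all add: gain_sr_def gain_sd_def)
      then have "ln (1 + ((cmod (gain_sr g))\<^sup>2 + (cmod (gain_sd h))\<^sup>2)) \<le> (r - \<delta>) * ln \<rho> + 2"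
        using \<delta> elim(4) by (intro ln_one_plus_powr2) auto
      then have X: "?X \<le> (r - \<delta>) * ln \<rho> + 5" by simp
      note fano = elim(1)[rule_format, OF n M_pos elim(3) X]
      have "success g f h \<le> ennreal (real ?M * real ?n * ?X / ?\<theta> + exp ?\<theta>)"
        using fano by (intro success_full) auto
      also have "\<dots> \<le> ennreal ((1 - \<kappa>) * real ?M)"
      proof (rule ennreal_leI)
        have "exp ?\<theta> * 1 \<le> exp ?\<theta> * 2 ^ ?n" by (intro mult_left_mono) auto
        then show "real ?M * real ?n * ?X / ?\<theta> + exp ?\<theta> \<le> (1 - \<kappa>) * real ?M" using fano by linarith
      qed
      finally show ?thesis .
    qed
    have "measure CN ?A * measure CN ?D * \<kappa> \<le> avg_error a b c \<rho> (C \<rho>)"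
    proof (rule avg_error_ge)
      fix g assume g: "g \<in> ?A"
      show "\<exists>B\<in>sets borel. \<exists>D\<in>sets borel. measure CN ?D \<le> measure CN B * measure CN D \<and>
       (\<forall>f\<in>B. \<forall>h\<in>D. success g f h \<le> ennreal ((1 - \<kappa>) * real ?M))"
        using suc[OF g] CN.prob_space by (intro bexI[of _ UNIV] bexI[of _ ?D]) auto
    qed (use \<kappa> in auto)
    moreover have "(k * \<rho> powr (- max (a - r + \<delta>) 0)) * (k * \<rho> powr (- max (c - r + \<delta>) 0)) * \<kappa> \<le>
      measure CN ?A * measure CN ?D * \<kappa>"
      using k(1) \<kappa> elim(4) by (intro mult_right_mono mult_mono k(2)) auto
    moreover have "(k * \<rho> powr (- max (a - r + \<delta>) 0)) * (k * \<rho> powr (- max (c - r + \<delta>) 0)) * \<kappa> =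
      k * k * \<kappa> * \<rho> powr (- (max (a - r + \<delta>) 0 + max (c - r + \<delta>) 0))"
      by (simp add: powr_add[symmetric] mult_ac)
    ultimately show ?case by linarith
  qed
  then show thesis using that[of "k * k * \<kappa>"] k(1) \<kappa>(1) by simp
qed

text \<open>Here the rate is only used through its constant lower bound \<open>R\<^sub>0\<close>, so
  additive constants in the cut bound matter. Both received gains are pushed below a small constant,
  and the reference power is raised until the whole cost is small compared with the rate.\<close>

lemma source_cut_converse_zero:
  assumes C: "code_family a r C"
  obtains K where "0 < K"
    "\<forall>\<^sub>F \<rho> in at_top. K * \<rho> powr (- (max a 0 + max c 0)) \<le> avg_error a b c \<rho> (C \<rho>)"
proof -
  obtain k where k: "0 < k" "\<And>t. 0 \<le> t \<Longrightarrow> t \<le> 1 \<Longrightarrow> k * t \<le> measure CN (gain_ball t)"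
    by (rule gain_ball_measure) blast
  obtain R\<^sub>0 where R0: "R\<^sub>0 > 0" and rt: "\<forall>\<^sub>F \<rho> in at_top. R\<^sub>0 \<le> rate (C \<rho>)"
    using C by (auto simp: code_family_def)
  have valid: "\<forall>\<^sub>F \<rho> in at_top. valid_code a \<rho> (C \<rho>)" using C by (simp add: code_family_def)
  \<comment> \<open>With reference power 1 / \<eta> and squared gains at most \<eta>^2, the cost per
    sample is at most 2 \<eta> from the logarithm plus \<eta> from the energy. The 60 makes this 3
    \<eta> at most a twentieth of the rate.\<close>
  define \<eta> where "\<eta> = min 1 (R\<^sub>0 / 60)"
  have \<eta>: "0 < \<eta>" "\<eta> \<le> 1" "60 * \<eta> \<le> R\<^sub>0" using R0 by (auto simp: \<eta>_def)
  let ?t = "\<lambda>\<rho> x. \<eta>\<^sup>2 * \<rho> powr (- max x 0)"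
  have "\<forall>\<^sub>F \<rho> in at_top. k * k * (\<eta>\<^sup>2 * \<eta>\<^sup>2) * (1 / 10) * \<rho> powr (- (max a 0 + max c 0)) \<le> avg_error a b c \<rho> (C \<rho>)"
    using valid rt eventually_ge_at_top[of 1]
  proof eventually_elim
    case (elim \<rho>)
    interpret relay_code a b c \<rho> "C \<rho>" by standard (rule elim(1))
    let ?n = "blocklength (C \<rho>)" and ?M = "num_msgs (C \<rho>)"
    let ?A = "gain_ball (?t \<rho> a)" and ?D = "gain_ball (?t \<rho> c)"
    define L where "L = ln (real ?M)"
    have n: "0 < real ?n" using n_pos by simp
    have L: "real ?n * R\<^sub>0 \<le> L" using elim(2) n by (simp add: rate_def L_def pos_le_divide_eq mult.commute)
    then have L0: "0 < L" using n R0 by (meson less_le_trans mult_pos_pos)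
    then have M2: "2 \<le> real ?M"
      using M_pos by (cases "?M = 1") (auto simp: L_def)
    have t01: "0 \<le> ?t \<rho> x" "?t \<rho> x \<le> 1" for x
    proof -
      have "\<rho> powr (- max x 0) \<le> \<rho> powr 0" using elim(3) by (intro powr_mono) auto
      then have "\<rho> powr (- max x 0) \<le> 1" using elim(3) by simp
      moreover have "\<eta>\<^sup>2 \<le> 1" using \<eta> by (simp add: power_le_one)
      ultimately show "?t \<rho> x \<le> 1" using mult_mono[of "\<eta>\<^sup>2" 1 "\<rho> powr (- max x 0)" 1] by simp
    qed simp
    have scaled: "(cmod (z * complex_of_real (\<rho> powr (x / 2))))\<^sup>2 \<le> \<eta>\<^sup>2" if "z \<in> gain_ball (?t \<rho> x)" for z x
    proof -
      have sq: "(\<rho> powr (x / 2))\<^sup>2 = \<rho> powr x"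
        by (simp add: power2_eq_square powr_add[symmetric])
      have "(cmod z)\<^sup>2 \<le> ?t \<rho> x" using that by (simp add: gain_ball_def)
      then have "(cmod z)\<^sup>2 * \<rho> powr x \<le> ?t \<rho> x * \<rho> powr x" by (rule mult_right_mono) simp
      also have "\<dots> = \<eta>\<^sup>2 * \<rho> powr (x - max x 0)" by (simp add: powr_add[symmetric])
      also have "\<dots> \<le> \<eta>\<^sup>2 * \<rho> powr 0" using elim(3) by (intro mult_left_mono powr_mono) auto
      finally show ?thesis using elim(3) by (simp add: norm_mult power_mult_distrib sq)
    qed
    have suc: "success g f h \<le> ennreal ((1 - 1 / 10) * real ?M)" if "g \<in> ?A" "h \<in> ?D" for g f h
    proof -
      let ?P = "1 / \<eta>" and ?s = "(cmod (gain_sr g))\<^sup>2 + (cmod (gain_sd h))\<^sup>2"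
      have s: "?s \<le> 2 * \<eta>\<^sup>2" using scaled[OF that(1)] scaled[OF that(2)] by (simp add: gain_sr_def gain_sd_def)
      have "ln (1 + ?P * ?s) \<le> ?P * ?s" using \<eta> by (intro ln_add_one_self_le_self) simp
      also have "\<dots> \<le> ?P * (2 * \<eta>\<^sup>2)" using s \<eta> by (intro mult_left_mono) auto
      also have "\<dots> = 2 * \<eta>" using \<eta> by (simp add: power2_eq_square)
      finally have X: "ln (1 + ?P * ?s) + 1 / ?P \<le> 3 * \<eta>" by simp
      \<comment> \<open>Threshold at half the log of the number of messages: the Markov term is at
        most M / 10, and exp (L / 2) = sqrt M is at most 8/10 M because M >= 2.\<close>
      have "success g f h \<le> ennreal (real ?M * real ?n * (ln (1 + ?P * ?s) + 1 / ?P) / (L / 2) + exp (L / 2))"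
        using \<eta> L0 by (intro success_full) auto
      also have "\<dots> \<le> ennreal ((1 - 1 / 10) * real ?M)"
      proof (rule ennreal_leI)
        have "real ?n * (3 * \<eta>) \<le> (1 / 20) * L" 
        proof -
          have "real ?n * (60 * \<eta>) \<le> real ?n * R\<^sub>0" using \<eta>(3) by (rule mult_left_mono) simp
          then show ?thesis using L by simp
        qed
        then have "real ?M * (real ?n * (ln (1 + ?P * ?s) + 1 / ?P)) \<le> real ?M * ((1 / 20) * L)"
          using mult_left_mono[OF X, of "real ?n"] by (intro mult_left_mono) linarith+
        then have a: "real ?M * real ?n * (ln (1 + ?P * ?s) + 1 / ?P) / (L / 2) \<le> (1 / 10) * real ?M"
          using L0 by (simp add: pos_divide_le_eq mult.assoc)
        have "(exp (L / 2))\<^sup>2 = real ?M" using M2 by (simp add: exp_double[symmetric] L_def)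
        moreover have "real ?M * 1 \<le> real ?M * (64 / 100 * real ?M)" using M2 by (intro mult_left_mono) auto
        then have "real ?M \<le> (8 / 10 * real ?M)\<^sup>2" by (simp add: power2_eq_square)
        ultimately have "(exp (L / 2))\<^sup>2 \<le> (8 / 10 * real ?M)\<^sup>2" by simp
        then have "exp (L / 2) \<le> 8 / 10 * real ?M" by (rule power2_le_imp_le) simp
        then show "real ?M * real ?n * (ln (1 + ?P * ?s) + 1 / ?P) / (L / 2) + exp (L / 2) \<le> (1 - 1 / 10) * real ?M"
          using a by simp
      qed
      finally show ?thesis .
    qed
    have "measure CN ?A * measure CN ?D * (1 / 10) \<le> avg_error a b c \<rho> (C \<rho>)"
    proof (rule avg_error_ge)
      fix g assume g: "g \<in> ?A"
      show "\<exists>B\<in>sets borel. \<exists>D\<in>sets borel. measure CN ?D \<le> measure CN B * measure CN D \<and>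
       (\<forall>f\<in>B. \<forall>h\<in>D. success g f h \<le> ennreal ((1 - 1 / 10) * real ?M))"
        using suc[OF g] CN.prob_space by (intro bexI[of _ UNIV] bexI[of _ ?D]) auto
    qed auto
    moreover have "(k * ?t \<rho> a) * (k * ?t \<rho> c) * (1 / 10) \<le> measure CN ?A * measure CN ?D * (1 / 10)"
      using k(1) t01 by (intro mult_right_mono mult_mono k(2)) auto
    moreover have "(k * ?t \<rho> a) * (k * ?t \<rho> c) * (1 / 10) = k * k * (\<eta>\<^sup>2 * \<eta>\<^sup>2) * (1 / 10) * \<rho> powr (- (max a 0 + max c 0))"
      by (simp add: powr_add mult_ac powr_diff powr_minus divide_simps)
    ultimately show ?case by linarith
  qed
  then show thesis using that[of "k * k * (\<eta>\<^sup>2 * \<eta>\<^sup>2) * (1 / 10)"] k(1) \<eta>(1) by simp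
qed

text \<open>
  The relay's listening time does not depend on the gains of the links to the destination. If it is
  short then the cut around the source fails as soon as the direct link is weak, otherwise the cut
  around the destination fails when both links to the destination are weak.
\<close>

lemma half_duplex_converse:
  assumes C: "code_family a r C" and \<delta>: "0 < \<delta>" "\<delta> < r" and ac: "0 \<le> a"
    and nn: "0 \<le> \<gamma>\<^sub>1" "\<gamma>\<^sub>1 \<le> a" "0 \<le> \<gamma>\<^sub>2" "\<gamma>\<^sub>2 \<le> \<beta>"
    and short: "\<And>\<tau>. 0 \<le> \<tau> \<Longrightarrow> \<tau> \<le> t \<Longrightarrow> \<tau> * a + (1 - \<tau>) * \<gamma>\<^sub>1 \<le> r - \<delta>"
    and long: "\<And>\<tau>. t \<le> \<tau> \<Longrightarrow> \<tau> \<le> 1 \<Longrightarrow> \<tau> * \<gamma>\<^sub>2 + (1 - \<tau>) * \<beta> \<le> r - \<delta>"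
    and D: "max (c - \<gamma>\<^sub>1) 0 \<le> D" "max (b - \<beta>) 0 + max (c - \<gamma>\<^sub>2) 0 \<le> D"
  obtains K where "0 < K" "\<forall>\<^sub>F \<rho> in at_top. K * \<rho> powr (- D) \<le> avg_error a b c \<rho> (C \<rho>)"
proof -
  obtain k where k: "0 < k" "k \<le> 1" "\<And>\<rho> x. 1 \<le> \<rho> \<Longrightarrow> k * \<rho> powr (- max x 0) \<le> measure CN (gain_ball (min 1 (\<rho> powr (- x))))"
    by (rule gain_ball_measure) blast
  from \<delta> obtain \<kappa> where \<kappa>: "0 < \<kappa>" "\<kappa> \<le> 1" and ev: "\<forall>\<^sub>F \<rho> in at_top. \<forall>n M :: nat. \<forall>X. 1 \<le> n \<longrightarrow> 0 < M \<longrightarrow>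
       real n * ((r - \<delta> / 4) * ln \<rho>) \<le> ln (real M) \<longrightarrow> X \<le> (r - \<delta>) * ln \<rho> + 5 \<longrightarrow>
       0 < real n * ((r - \<delta> / 2) * ln \<rho>) \<and>
       real M * real n * X / (real n * ((r - \<delta> / 2) * ln \<rho>)) + exp (real n * ((r - \<delta> / 2) * ln \<rho>)) * 2 ^ n \<le> (1 - \<kappa>) * real M"
    by (rule fano_margin)
  have valid: "\<forall>\<^sub>F \<rho> in at_top. valid_code a \<rho> (C \<rho>)" using C by (simp add: code_family_def)
  have rt: "\<forall>\<^sub>F \<rho> in at_top. real (blocklength (C \<rho>)) * ((r - \<delta> / 4) * ln \<rho>) \<le> ln (real (num_msgs (C \<rho>)))"
    using \<delta> by (intro code_family_rate[OF C]) simp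
  have "\<forall>\<^sub>F \<rho> in at_top. k * (k * k) * \<kappa> * \<rho> powr (- D) \<le> avg_error a b c \<rho> (C \<rho>)"
    using ev valid rt eventually_ge_at_top[of 1]
  proof eventually_elim
    case (elim \<rho>)
    interpret relay_code a b c \<rho> "C \<rho>" by standard (rule elim(2))
    let ?n = "blocklength (C \<rho>)" and ?M = "num_msgs (C \<rho>)"
    \<comment> \<open>Exponent 0: h_sr merely lies in the unit disc, which costs no power of \<rho>
      and caps the source-relay gain at \<rho> powr a.\<close>
    let ?A = "gain_ball (min 1 (\<rho> powr (- 0)))"
    let ?B = "gain_ball (min 1 (\<rho> powr (- (b - \<beta>))))"
    let ?D1 = "gain_ball (min 1 (\<rho> powr (- (c - \<gamma>\<^sub>1))))" and ?D2 = "gain_ball (min 1 (\<rho> powr (- (c - \<gamma>\<^sub>2))))"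
    let ?\<theta> = "real ?n * ((r - \<delta> / 2) * ln \<rho>)"
    have n: "1 \<le> ?n" using n_pos by simp
    have fano: "x \<le> ennreal ((1 - \<kappa>) * real ?M)"
      if "0 < ?\<theta> \<Longrightarrow> x \<le> ennreal (real ?M * real ?n * X / ?\<theta> + exp ?\<theta> * 2 ^ ?n)" "X \<le> (r - \<delta>) * ln \<rho> + 5" for x X
      using elim(1)[rule_format, OF n M_pos elim(3) that(2)] that(1) by (meson ennreal_leI order.trans)
    have mix: "\<tau> * x + (1 - \<tau>) * y + 2 \<le> (r - \<delta>) * ln \<rho> + 5"
      if "x \<le> u * ln \<rho> + 2" "y \<le> u' * ln \<rho> + 2" "\<tau> * u + (1 - \<tau>) * u' \<le> r - \<delta>" "0 \<le> \<tau>" "\<tau> \<le> 1" for \<tau> x y u u'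
    proof -
      have "\<tau> * x + (1 - \<tau>) * y \<le> \<tau> * (u * ln \<rho> + 2) + (1 - \<tau>) * (u' * ln \<rho> + 2)"
        using that by (intro add_mono mult_left_mono) auto
      also have "\<dots> = (\<tau> * u + (1 - \<tau>) * u') * ln \<rho> + 2" by (simp add: algebra_simps)
      also have "\<dots> \<le> (r - \<delta>) * ln \<rho> + 2" using that elim(4) by (intro add_right_mono mult_right_mono) auto
      finally show ?thesis by simp
    qed
    have "\<rho> \<noteq> 0" using elim(4) by simp
    then have "k \<le> measure CN ?A"
      using k(3)[OF elim(4), of 0] by simp
    \<comment> \<open>The outer k bounds the probability of the unit disc. The remaining k (k \<rho>
      powr (- D)) has to serve both cases below; the short one gives away a factor k <= 1.\<close>
    then have "k * (k * (k * \<rho> powr (- D))) \<le> measure CN ?A * (k * (k * \<rho> powr (- D)))"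
      by (rule mult_right_mono) (use k(1) in simp)
    then have "k * (k * (k * \<rho> powr (- D))) * \<kappa> \<le> measure CN ?A * (k * (k * \<rho> powr (- D))) * \<kappa>"
      by (rule mult_right_mono) (use \<kappa>(1) in simp)
    also have "\<dots> \<le> avg_error a b c \<rho> (C \<rho>)"
    proof (rule avg_error_ge)
      fix g assume g: "g \<in> ?A"
      note lt = listen_time(1,2)[of g]
      have G: "(cmod (gain_sr g))\<^sup>2 \<le> \<rho> powr a"
        using gain_ball_scaled(2)[OF g elim(4), of a] by (simp add: gain_sr_def)
      show "\<exists>B\<in>sets borel. \<exists>D'\<in>sets borel. k * (k * \<rho> powr (- D)) \<le> measure CN B * measure CN D' \<and>
         (\<forall>f\<in>B. \<forall>h\<in>D'. success g f h \<le> ennreal ((1 - \<kappa>) * real ?M))"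
      proof (cases "listen_time g \<le> t")
        case True
        have suc: "success g f h \<le> ennreal ((1 - \<kappa>) * real ?M)" if "h \<in> ?D1" for f h
        proof (rule fano[OF success_sched])
          have H: "(cmod (gain_sd h))\<^sup>2 \<le> \<rho> powr \<gamma>\<^sub>1"
            using gain_ball_scaled(1)[OF that elim(4), of c] by (simp add: gain_sd_def)
          then have Ha: "(cmod (gain_sd h))\<^sup>2 \<le> \<rho> powr a"
            using powr_mono[OF nn(2) elim(4)] by linarith
          have "listen_time g * ln (1 + ((cmod (gain_sr g))\<^sup>2 + (cmod (gain_sd h))\<^sup>2)) +
             (1 - listen_time g) * ln (1 + (cmod (gain_sd h))\<^sup>2) + 2 \<le> (r - \<delta>) * ln \<rho> + 5"
          proof (rule mix)
            show "ln (1 + ((cmod (gain_sr g))\<^sup>2 + (cmod (gain_sd h))\<^sup>2)) \<le> a * ln \<rho> + 2"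
              using G Ha ac elim(4) by (intro ln_one_plus_powr2) auto
            show "ln (1 + (cmod (gain_sd h))\<^sup>2) \<le> \<gamma>\<^sub>1 * ln \<rho> + 2"
              using H nn elim(4) ln_one_plus_powr[of \<rho> "\<gamma>\<^sub>1" "(cmod (gain_sd h))\<^sup>2"] by simp
          qed (use short lt True in auto)
          then show "listen_time g * ln (1 + ((cmod (gain_sr g))\<^sup>2 + (cmod (gain_sd h))\<^sup>2)) +
             (1 - listen_time g) * ln (1 + (cmod (gain_sd h))\<^sup>2) + 1 \<le> (r - \<delta>) * ln \<rho> + 5" by simp
        qed
        have "k * (k * \<rho> powr (- D)) \<le> 1 * (k * \<rho> powr (- max (c - \<gamma>\<^sub>1) 0))"
          using k D(1) elim(4) by (intro mult_mono mult_left_mono powr_mono) auto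
        also have "\<dots> \<le> measure CN UNIV * measure CN ?D1"
          using k(3)[OF elim(4), of "c - \<gamma>\<^sub>1"] CN.prob_space by simp
        finally show ?thesis
          using suc by (intro bexI[of _ UNIV] bexI[of _ ?D1]) auto
      next
        case False
        have suc: "success g f h \<le> ennreal ((1 - \<kappa>) * real ?M)" if "f \<in> ?B" "h \<in> ?D2" for f h
        proof (rule fano[OF success_dest])
          have H: "(cmod (gain_sd h))\<^sup>2 \<le> \<rho> powr \<gamma>\<^sub>2"
            using gain_ball_scaled(1)[OF that(2) elim(4), of c] by (simp add: gain_sd_def)
          then have Hb: "(cmod (gain_sd h))\<^sup>2 \<le> \<rho> powr \<beta>"
            using powr_mono[OF nn(4) elim(4)] by linarith
          have F: "(cmod (gain_rd f))\<^sup>2 \<le> \<rho> powr \<beta>"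
            using gain_ball_scaled(1)[OF that(1) elim(4), of b] by (simp add: gain_rd_def)
          show "listen_time g * ln (1 + (cmod (gain_sd h))\<^sup>2) +
             (1 - listen_time g) * ln (1 + ((cmod (gain_sd h))\<^sup>2 + (cmod (gain_rd f))\<^sup>2)) + 2 \<le> (r - \<delta>) * ln \<rho> + 5"
          proof (rule mix)
            show "ln (1 + ((cmod (gain_sd h))\<^sup>2 + (cmod (gain_rd f))\<^sup>2)) \<le> \<beta> * ln \<rho> + 2"
              using Hb F nn elim(4) by (intro ln_one_plus_powr2) auto
            show "ln (1 + (cmod (gain_sd h))\<^sup>2) \<le> \<gamma>\<^sub>2 * ln \<rho> + 2"
              using H nn elim(4) ln_one_plus_powr[of \<rho> "\<gamma>\<^sub>2" "(cmod (gain_sd h))\<^sup>2"] by simp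
          qed (use long lt False in auto)
        qed
        have "k * (k * \<rho> powr (- D)) \<le> k * (k * \<rho> powr (- (max (b - \<beta>) 0 + max (c - \<gamma>\<^sub>2) 0)))"
          using k D(2) elim(4) by (intro mult_left_mono powr_mono) auto
        also have "\<dots> = (k * \<rho> powr (- max (b - \<beta>) 0)) * (k * \<rho> powr (- max (c - \<gamma>\<^sub>2) 0))"
          by (simp add: powr_add[symmetric] mult_ac)
        also have "\<dots> \<le> measure CN ?B * measure CN ?D2"
          using k(1) elim(4) by (intro mult_mono k(3)) auto
        finally show ?thesis
          using suc by (intro bexI[of _ ?B] bexI[of _ ?D2]) auto
      qed
    qed (use \<kappa> k in auto)
    finally show ?case by (simp add: mult_ac)
  qed
  then show thesis using that[of "k * (k * k) * \<kappa>"] k(1) \<kappa>(1) by simp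
qed


section \<open>Gaussian codebooks and threshold decoding\<close>

text \<open>A fresh Gaussian input is compared with two arbitrary received values. Once the square
  is completed, Cauchy-Schwarz makes the exponent nonpositive, so the bound is uniform in the
  received values.\<close>

lemma nn_integral_CN_two_exp:
  "(\<integral>\<^sup>+x. ennreal (exp (- (cmod (a - h * x))\<^sup>2 - (cmod (b - g * x))\<^sup>2)) \<partial>CN) \<le> ennreal (1 / (1 + (cmod h)\<^sup>2 + (cmod g)\<^sup>2))"
proof -
  let ?s = "(cmod h)\<^sup>2 + (cmod g)\<^sup>2"
  define u where "u = cnj h * a + cnj g * b"
  have s: "0 \<le> ?s" by simp
  have sq: "(cmod (a - h * x))\<^sup>2 = (cmod a)\<^sup>2 - 2 * Re (cnj (cnj h * a) * x) + (cmod h)\<^sup>2 * (cmod x)\<^sup>2" for a h x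
    unfolding norm_mult[symmetric] power_mult_distrib[symmetric] cmod_power2 by (simp add: power2_eq_square algebra_simps)
  have eq: "exp (- (cmod (a - h * x))\<^sup>2 - (cmod (b - g * x))\<^sup>2) =
     exp (- ((cmod a)\<^sup>2 + (cmod b)\<^sup>2)) * exp (2 * Re (cnj u * x) - ?s * (cmod x)\<^sup>2)" for x
    unfolding exp_add[symmetric] sq u_def by (simp add: algebra_simps)
  have "(\<integral>\<^sup>+x. ennreal (exp (- (cmod (a - h * x))\<^sup>2 - (cmod (b - g * x))\<^sup>2)) \<partial>CN) =
    ennreal (exp (- ((cmod a)\<^sup>2 + (cmod b)\<^sup>2))) * ennreal (exp ((cmod u)\<^sup>2 / (1 + ?s)) / (1 + ?s))"
    unfolding eq using s
    by (simp only: ennreal_mult[OF exp_ge_zero exp_ge_zero])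
      (subst nn_integral_cmult, simp, subst nn_integral_CN_exp, linarith, rule refl)
  also have "\<dots> \<le> ennreal (1 / (1 + ?s))"
  proof -
    have "cmod u \<le> cmod h * cmod a + cmod g * cmod b"
      unfolding u_def by (metis complex_mod_cnj norm_mult norm_triangle_ineq)
    then have "(cmod u)\<^sup>2 \<le> (cmod h * cmod a + cmod g * cmod b)\<^sup>2" by (rule power_mono) simp
    also have "\<dots> \<le> ?s * ((cmod a)\<^sup>2 + (cmod b)\<^sup>2)"
    proof -
      have "0 \<le> (cmod h * cmod b - cmod g * cmod a)\<^sup>2" by simp
      also have "\<dots> = ?s * ((cmod a)\<^sup>2 + (cmod b)\<^sup>2) - (cmod h * cmod a + cmod g * cmod b)\<^sup>2"
        by (simp add: power2_eq_square algebra_simps)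
      finally show ?thesis by simp
    qed
    also have "\<dots> \<le> (1 + ?s) * ((cmod a)\<^sup>2 + (cmod b)\<^sup>2)" by (intro mult_right_mono) auto
    finally have "(cmod u)\<^sup>2 / (1 + ?s) \<le> (cmod a)\<^sup>2 + (cmod b)\<^sup>2"
      using s by (subst pos_divide_le_eq) (linarith, simp add: mult.commute)
    then have "exp (- ((cmod a)\<^sup>2 + (cmod b)\<^sup>2)) * exp ((cmod u)\<^sup>2 / (1 + ?s)) \<le> 1"
      unfolding exp_add[symmetric] by simp
    then have "exp (- ((cmod a)\<^sup>2 + (cmod b)\<^sup>2)) * exp ((cmod u)\<^sup>2 / (1 + ?s)) / (1 + ?s) \<le> 1 / (1 + ?s)"
      using s by (intro divide_right_mono) auto
    then show ?thesis using s by (subst ennreal_mult[symmetric]) (auto intro!: ennreal_leI)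
  qed
  finally show ?thesis by (simp add: add.assoc)
qed

text \<open>Kept as an equality because the Gaussian factor left in \<open>a\<close> is integrated
  again in \<open>nn_integral_CN_pair_exp\<close>.\<close>

lemma nn_integral_CN_one_exp:
  "(\<integral>\<^sup>+x. ennreal (exp (- (cmod (a - h * x))\<^sup>2)) \<partial>CN) =
    ennreal (exp (- ((cmod a)\<^sup>2 / (1 + (cmod h)\<^sup>2))) / (1 + (cmod h)\<^sup>2))"
proof -
  define u where "u = cnj h * a"
  have pos: "0 < 1 + (cmod h)\<^sup>2" by (simp add: add_pos_nonneg)
  have sq: "(cmod (a - h * x))\<^sup>2 = (cmod a)\<^sup>2 - 2 * Re (cnj u * x) + (cmod h)\<^sup>2 * (cmod x)\<^sup>2" for x
    unfolding norm_mult[symmetric] power_mult_distrib[symmetric] cmod_power2 u_def by (simp add: power2_eq_square algebra_simps)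
  have eq: "exp (- (cmod (a - h * x))\<^sup>2) = exp (- (cmod a)\<^sup>2) * exp (2 * Re (cnj u * x) - (cmod h)\<^sup>2 * (cmod x)\<^sup>2)" for x
    unfolding exp_add[symmetric] sq by (simp add: algebra_simps)
  have ex: "- (cmod a)\<^sup>2 + (cmod u)\<^sup>2 / (1 + (cmod h)\<^sup>2) = - ((cmod a)\<^sup>2 / (1 + (cmod h)\<^sup>2))"
    using pos by (simp add: u_def norm_mult power_mult_distrib field_simps)
  have "(\<integral>\<^sup>+x. ennreal (exp (- (cmod (a - h * x))\<^sup>2)) \<partial>CN) =
    ennreal (exp (- (cmod a)\<^sup>2)) * ennreal (exp ((cmod u)\<^sup>2 / (1 + (cmod h)\<^sup>2)) / (1 + (cmod h)\<^sup>2))"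
    unfolding eq using pos
    by (simp only: ennreal_mult[OF exp_ge_zero exp_ge_zero])
      (subst nn_integral_cmult, simp, subst nn_integral_CN_exp, linarith, rule refl)
  also have "\<dots> = ennreal (exp (- (cmod a)\<^sup>2 + (cmod u)\<^sup>2 / (1 + (cmod h)\<^sup>2)) / (1 + (cmod h)\<^sup>2))"
    unfolding exp_add times_divide_eq_right[symmetric] using pos by (intro ennreal_mult[symmetric]) auto
  finally show ?thesis unfolding ex .
qed

lemma nn_integral_CN_one_exp_le:
  "(\<integral>\<^sup>+x. ennreal (exp (- (cmod (a - h * x))\<^sup>2)) \<partial>CN) \<le> ennreal (1 / (1 + (cmod h)\<^sup>2))"
  unfolding nn_integral_CN_one_exp by (intro ennreal_leI divide_right_mono) auto

text \<open>Integrating out u leaves the same kind of integral in x with everything divided by sqrt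
  (1 + |f|^2); the two denominators multiply to 1 + |h|^2 + |f|^2.\<close>

lemma nn_integral_CN_pair_exp:
  "(\<integral>\<^sup>+x. \<integral>\<^sup>+u. ennreal (exp (- (cmod (a - h * x - f * u))\<^sup>2)) \<partial>CN \<partial>CN) \<le> ennreal (1 / (1 + (cmod h)\<^sup>2 + (cmod f)\<^sup>2))"
proof -
  let ?q = "1 + (cmod f)\<^sup>2"
  define s where "s = complex_of_real (sqrt ?q)"
  have q: "0 < ?q" by (simp add: add_pos_nonneg)
  have s: "(cmod s)\<^sup>2 = ?q" "s \<noteq> 0" using q by (simp_all add: s_def)
  have eq: "(cmod (a - h * x))\<^sup>2 / ?q = (cmod (a / s - h / s * x))\<^sup>2" for x
    using s by (simp add: diff_divide_distrib[symmetric] norm_divide power_divide)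
  have "(\<integral>\<^sup>+x. \<integral>\<^sup>+u. ennreal (exp (- (cmod (a - h * x - f * u))\<^sup>2)) \<partial>CN \<partial>CN) =
    (\<integral>\<^sup>+x. ennreal (1 / ?q) * ennreal (exp (- (cmod (a / s - h / s * x))\<^sup>2)) \<partial>CN)"
    unfolding nn_integral_CN_one_exp eq using q by (simp add: ennreal_mult[symmetric])
  also have "\<dots> = ennreal (1 / ?q) * (\<integral>\<^sup>+x. ennreal (exp (- (cmod (a / s - h / s * x))\<^sup>2)) \<partial>CN)"
    by (rule nn_integral_cmult) simp
  also have "\<dots> \<le> ennreal (1 / ?q) * ennreal (1 / (1 + (cmod (h / s))\<^sup>2))"
    by (intro mult_left_mono nn_integral_CN_one_exp_le) simp
  also have "\<dots> = ennreal (1 / (1 + (cmod h)\<^sup>2 + (cmod f)\<^sup>2))"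
  proof -
    have "?q * (1 + (cmod (h / s))\<^sup>2) = 1 + (cmod h)\<^sup>2 + (cmod f)\<^sup>2"
      using q by (simp add: norm_divide power_divide s distrib_left)
    then show ?thesis using q by (simp add: ennreal_mult[symmetric])
  qed
  finally show ?thesis .
qed

lemma nn_integral_iid_prod_inj:
  assumes "finite I" "inj_on k I" and [measurable]: "\<And>i. f i \<in> borel_measurable borel"
  shows "(\<integral>\<^sup>+w. (\<Prod>i\<in>I. f i (w (k i))) \<partial>iid_CN) = (\<Prod>i\<in>I. \<integral>\<^sup>+z. f i z \<partial>CN)"
proof -
  have "(\<integral>\<^sup>+w. (\<Prod>i\<in>I. f i (w (k i))) \<partial>iid_CN) = (\<integral>\<^sup>+w. (\<Prod>j\<in>k ` I. f (the_inv_into I k j) (w j)) \<partial>iid_CN)"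
    using assms(2) by (simp add: prod.reindex the_inv_into_f_f)
  also have "\<dots> = (\<Prod>j\<in>k ` I. \<integral>\<^sup>+z. f (the_inv_into I k j) z \<partial>CN)"
    using assms(1) by (intro nn_integral_iid_prod) auto
  also have "\<dots> = (\<Prod>i\<in>I. \<integral>\<^sup>+z. f i z \<partial>CN)"
    using assms(2) by (simp add: prod.reindex the_inv_into_f_f)
  finally show ?thesis .
qed

text \<open>Resampling the coordinates read through l separates them from those read through
  k.\<close>

lemma nn_integral_iid_prod_pair:
  assumes "finite I" "inj_on k I" "inj_on l I" "k ` I \<inter> l ` I = {}"
    and [measurable]: "\<And>i. F i \<in> borel_measurable (borel \<Otimes>\<^sub>M borel)"
  shows "(\<integral>\<^sup>+w. (\<Prod>i\<in>I. F i (w (k i), w (l i))) \<partial>iid_CN) = (\<Prod>i\<in>I. \<integral>\<^sup>+x. \<integral>\<^sup>+u. F i (x, u) \<partial>CN \<partial>CN)"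
proof -
  have "(\<integral>\<^sup>+w. (\<Prod>i\<in>I. F i (w (k i), w (l i))) \<partial>iid_CN) =
    (\<integral>\<^sup>+w. \<integral>\<^sup>+w'. (\<Prod>i\<in>I. F i (override_on w w' (l ` I) (k i), override_on w w' (l ` I) (l i))) \<partial>iid_CN \<partial>iid_CN)"
    by (rule nn_integral_iid_resample) measurable
  also have "\<dots> = (\<integral>\<^sup>+w. \<integral>\<^sup>+w'. (\<Prod>i\<in>I. F i (w (k i), w' (l i))) \<partial>iid_CN \<partial>iid_CN)"
    using assms(4) by (intro nn_integral_cong prod.cong refl) (auto simp: override_on_def)
  also have "\<dots> = (\<integral>\<^sup>+w. (\<Prod>i\<in>I. \<integral>\<^sup>+u. F i (w (k i), u) \<partial>CN) \<partial>iid_CN)"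
    using assms(1,3) by (intro nn_integral_cong nn_integral_iid_prod_inj) auto
  also have "\<dots> = (\<Prod>i\<in>I. \<integral>\<^sup>+x. \<integral>\<^sup>+u. F i (x, u) \<partial>CN \<partial>CN)"
    using assms(1,2) by (intro nn_integral_iid_prod_inj) auto
  finally show ?thesis .
qed

text \<open>Chernoff bound with exponent 1/2: each sample contributes the moment 2, the threshold
  contributes exp (- 2 n), and 2 <= e.\<close>

lemma iid_noise_tail:
  "(\<integral>\<^sup>+z. indicator {z. 4 * real n < (\<Sum>i<n. (cmod (z i))\<^sup>2)} z \<partial>iid_CN) \<le> ennreal (exp (- real n))"
proof -
  let ?f = "\<lambda>z. ennreal (exp (2 * Re (cnj 0 * z) - (-1/2) * (cmod z)\<^sup>2))"
  have "(\<integral>\<^sup>+z. indicator {z. 4 * real n < (\<Sum>i<n. (cmod (z i))\<^sup>2)} z \<partial>iid_CN) \<le>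
    (\<integral>\<^sup>+z. ennreal (exp (- (2 * real n))) * (\<Prod>i<n. ?f (z i)) \<partial>iid_CN)"
  proof (rule nn_integral_mono)
    fix z :: cseq
    have "(\<Prod>i<n. ?f (z i)) = ennreal (\<Prod>i<n. exp ((cmod (z i))\<^sup>2 / 2))" by (simp add: prod_ennreal)
    also have "\<dots> = ennreal (exp ((\<Sum>i<n. (cmod (z i))\<^sup>2) / 2))"
      by (simp add: exp_sum sum_divide_distrib)
    finally have "ennreal (exp (- (2 * real n))) * (\<Prod>i<n. ?f (z i)) =
      ennreal (exp (- (2 * real n) + (\<Sum>i<n. (cmod (z i))\<^sup>2) / 2))"
      by (simp add: ennreal_mult[symmetric] exp_add[symmetric])
    then show "indicator {z. 4 * real n < (\<Sum>i<n. (cmod (z i))\<^sup>2)} z \<le> ennreal (exp (- (2 * real n))) * (\<Prod>i<n. ?f (z i))"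
      by (auto simp: indicator_def ennreal_ge_1)
  qed
  also have "\<dots> = ennreal (exp (- (2 * real n))) * (\<Prod>i<n. \<integral>\<^sup>+z. ?f z \<partial>CN)"
    by (subst nn_integral_cmult, simp, subst nn_integral_iid_prod) simp_all
  also have "(\<integral>\<^sup>+z. ?f z \<partial>CN) = ennreal 2"
    by (subst nn_integral_CN_exp) simp_all
  also have "ennreal (exp (- (2 * real n))) * (\<Prod>i<n. ennreal 2) = ennreal (exp (- (2 * real n)) * 2 ^ n)"
    by (simp add: ennreal_mult ennreal_power[symmetric])
  also have "\<dots> \<le> ennreal (exp (- real n))"
  proof (rule ennreal_leI)
    have "(2::real) ^ n \<le> exp 1 ^ n" using exp_ge_add_one_self[of 1] by (intro power_mono) auto
    also have "\<dots> = exp (real n)" by (simp add: exp_of_nat_mult[symmetric])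
    finally have "exp (- (2 * real n)) * 2 ^ n \<le> exp (- (2 * real n)) * exp (real n)" by (rule mult_left_mono) simp
    then show "exp (- (2 * real n)) * 2 ^ n \<le> exp (- real n)" by (simp add: exp_add[symmetric])
  qed
  finally show ?thesis .
qed

section \<open>Counting quantizer labels\<close>

abbreviation label_point :: "int \<times> int \<Rightarrow> complex" where
  "label_point k \<equiv> Complex (real_of_int (fst k)) (real_of_int (snd k))"

lemma sigma_finite_swap:
  assumes "sigma_finite_measure M" "sigma_finite_measure N"
    and "(\<lambda>(x, y). f x y) \<in> borel_measurable (M \<Otimes>\<^sub>M N)"
  shows "(\<integral>\<^sup>+x. \<integral>\<^sup>+y. f x y \<partial>N \<partial>M) = (\<integral>\<^sup>+y. \<integral>\<^sup>+x. f x y \<partial>M \<partial>N)"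
proof -
  interpret pair_sigma_finite M N using assms(1,2) by (simp add: pair_sigma_finite_def)
  show ?thesis using Fubini'[OF assms(3)] by simp
qed

lemma nn_integral_count_swap:
  fixes A :: "'i set"
  assumes "countable A" "sigma_finite_measure M" and "\<And>k. k \<in> A \<Longrightarrow> f k \<in> borel_measurable M"
  shows "(\<integral>\<^sup>+x. \<integral>\<^sup>+k. f k x \<partial>count_space A \<partial>M) = (\<integral>\<^sup>+k. \<integral>\<^sup>+x. f k x \<partial>M \<partial>count_space A)"
proof (rule sigma_finite_swap[symmetric])
  show "(\<lambda>(k, x). f k x) \<in> borel_measurable (count_space A \<Otimes>\<^sub>M M)"
    using assms by (intro measurable_pair_measure_countable1) auto
qed (use assms in \<open>auto intro: sigma_finite_measure_count_space_countable\<close>)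

text \<open>Comparison with an integral: on the unit interval around k one has (x - t)^2 / 2 <= 1/4
  + (k - t)^2, so each summand is at most K times the mass that the normal law with mean t gives to
  this interval. Hence the form of K and the uniformity in t.\<close>

lemma sum_int_gauss_bound:
  obtains K where "1 \<le> K" "\<And>t. (\<integral>\<^sup>+k. ennreal (exp (- (real_of_int k - t)\<^sup>2)) \<partial>count_space UNIV) \<le> ennreal K"
proof -
  define K where "K = exp (1 / 4) * sqrt (2 * pi)"
  have le: "(\<integral>\<^sup>+k. ennreal (exp (- (real_of_int k - t)\<^sup>2)) \<partial>count_space UNIV) \<le> ennreal K" for t :: real
  proof -
    let ?I = "\<lambda>k x. indicator {real_of_int k - 1/2..<real_of_int k + 1/2} x :: ennreal"
    let ?g = "\<lambda>x. K * normal_density t 1 x"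
    have K0: "0 \<le> K" by (simp add: K_def)
    have "(\<integral>\<^sup>+k. ennreal (exp (- (real_of_int k - t)\<^sup>2)) \<partial>count_space UNIV) =
      (\<integral>\<^sup>+k. \<integral>\<^sup>+x. ennreal (exp (- (real_of_int k - t)\<^sup>2)) * ?I k x \<partial>lborel \<partial>count_space UNIV)"
      by (simp add: nn_integral_cmult_indicator)
    also have "\<dots> \<le> (\<integral>\<^sup>+k. \<integral>\<^sup>+x. ennreal (?g x) * ?I k x \<partial>lborel \<partial>count_space UNIV)"
    proof (intro nn_integral_mono)
      fix k :: int and x :: real
      have "exp (- (real_of_int k - t)\<^sup>2) \<le> ?g x" if "\<bar>x - real_of_int k\<bar> \<le> 1 / 2"
      proof -
        let ?d = "x - real_of_int k" and ?e = "real_of_int k - t"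
        have "?d\<^sup>2 \<le> (1/2)\<^sup>2" using that by (metis abs_le_square_iff abs_of_nonneg zero_le_divide_1_iff zero_le_numeral)
        moreover have "(d + e)\<^sup>2 / 2 \<le> 1 / 4 + e\<^sup>2" if "d\<^sup>2 \<le> (1/2)\<^sup>2" for d e :: real
        proof -
          have "0 \<le> (d - e)\<^sup>2" by simp
          then show ?thesis using that by (simp add: power2_sum power2_diff power_divide)
        qed
        ultimately have "(?d + ?e)\<^sup>2 / 2 \<le> 1 / 4 + ?e\<^sup>2" by blast
        then have "(x - t)\<^sup>2 / 2 \<le> 1 / 4 + ?e\<^sup>2" by simp
        then have "exp (- ?e\<^sup>2) \<le> exp (1 / 4 + - ((x - t)\<^sup>2 / 2))" by simp
        also have "\<dots> = ?g x" unfolding exp_add by (simp add: K_def normal_density_def)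
        finally show ?thesis .
      qed
      moreover have "\<bar>x - real_of_int k\<bar> \<le> 1 / 2" if "x \<in> {real_of_int k - 1/2..<real_of_int k + 1/2}"
        using that unfolding atLeastLessThan_iff by linarith
      ultimately show "ennreal (exp (- (real_of_int k - t)\<^sup>2)) * ?I k x \<le> ennreal (?g x) * ?I k x"
        by (cases "x \<in> {real_of_int k - 1/2..<real_of_int k + 1/2}") (simp_all only: indicator_simps mult_1_right mult_zero_right ennreal_leI order.refl not_False_eq_True simp_thms)
    qed
    also have "\<dots> = (\<integral>\<^sup>+x. \<integral>\<^sup>+k. ennreal (?g x) * ?I k x \<partial>count_space UNIV \<partial>lborel)"
      by (rule nn_integral_count_swap[symmetric]) (auto simp: sigma_finite_lborel)
    \<comment> \<open>Each x lies in just one of the half-open intervals, the one around the floor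
      of x + 1/2.\<close>
    also have "\<dots> \<le> (\<integral>\<^sup>+x. ennreal (?g x) \<partial>lborel)"
    proof (rule nn_integral_mono)
      fix x :: real
      have "(\<integral>\<^sup>+k. ennreal (?g x) * ?I k x \<partial>count_space UNIV) \<le>
        (\<integral>\<^sup>+k. ennreal (?g x) * indicator {\<lfloor>x + 1/2\<rfloor>} k \<partial>count_space UNIV)"
      proof (rule nn_integral_mono)
        fix k :: int
        have "k = \<lfloor>x + 1/2\<rfloor>" if "real_of_int k - 1/2 \<le> x" "x < real_of_int k + 1/2" using that by linarith
        then show "ennreal (?g x) * ?I k x \<le> ennreal (?g x) * indicator {\<lfloor>x + 1/2\<rfloor>} k"
          by (auto simp: indicator_def)
      qed
      also have "\<dots> = ennreal (?g x)" by (simp add: nn_integral_cmult_indicator)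
      finally show "(\<integral>\<^sup>+k. ennreal (?g x) * ?I k x \<partial>count_space UNIV) \<le> ennreal (?g x)" .
    qed
    also have "\<dots> = ennreal K * (\<integral>\<^sup>+x. ennreal (normal_density t 1 x) \<partial>lborel)"
      using K0 by (simp add: ennreal_mult nn_integral_cmult)
    also have "(\<integral>\<^sup>+x. ennreal (normal_density t 1 x) \<partial>lborel) = 1"
      using prob_space.emeasure_space_1[OF prob_space_normal_density[of 1 t]]
      by (simp add: emeasure_density)
    finally show ?thesis by simp
  qed
  have "1 \<le> K"
  proof -
    have "1 \<le> sqrt (2 * pi)" using pi_gt3 by simp
    moreover have "(1::real) \<le> exp (1 / 4)" by simp
    ultimately show ?thesis unfolding K_def using mult_mono[of 1 "exp (1/4)" 1 "sqrt (2 * pi)"] by simp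
  qed
  then show thesis using that le by blast
qed

text \<open>K acts as the number of quantizer labels compatible with one sample: a cost per sample
  that does not grow with \<rho>, which is the point of quantizing at the noise level.\<close>

lemma sum_label_gauss_bound:
  obtains K where "1 \<le> K"
    "\<And>a. (\<integral>\<^sup>+k. ennreal (exp (- (cmod (label_point k - a))\<^sup>2)) \<partial>count_space UNIV) \<le> ennreal K"
proof -
  obtain K where K: "1 \<le> K" "\<And>t. (\<integral>\<^sup>+k. ennreal (exp (- (real_of_int k - t)\<^sup>2)) \<partial>count_space UNIV) \<le> ennreal K"
    using sum_int_gauss_bound by blast
  have "(\<integral>\<^sup>+k. ennreal (exp (- (cmod (label_point k - a))\<^sup>2)) \<partial>count_space UNIV) \<le> ennreal (K * K)" for a
  proof -
    interpret sigma_finite_measure "count_space (UNIV :: int set)"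
      by (rule sigma_finite_measure_count_space_countable) simp
    have "(\<integral>\<^sup>+k. ennreal (exp (- (cmod (label_point k - a))\<^sup>2)) \<partial>count_space UNIV) =
      (\<integral>\<^sup>+k. ennreal (exp (- (cmod (label_point k - a))\<^sup>2)) \<partial>(count_space UNIV \<Otimes>\<^sub>M count_space UNIV))"
      by (subst pair_measure_countable) auto
    also have "\<dots> = (\<integral>\<^sup>+i. \<integral>\<^sup>+j. ennreal (exp (- (cmod (label_point (i, j) - a))\<^sup>2)) \<partial>count_space UNIV \<partial>count_space UNIV)"
      by (subst nn_integral_fst[symmetric]) (auto simp: pair_measure_countable)
    also have "\<dots> = (\<integral>\<^sup>+i. ennreal (exp (- (real_of_int i - Re a)\<^sup>2)) *
        (\<integral>\<^sup>+j. ennreal (exp (- (real_of_int j - Im a)\<^sup>2)) \<partial>count_space UNIV) \<partial>count_space UNIV)"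
    proof (rule nn_integral_cong)
      fix i :: int
      have "ennreal (exp (- (cmod (label_point (i, j) - a))\<^sup>2)) =
        ennreal (exp (- (real_of_int i - Re a)\<^sup>2)) * ennreal (exp (- (real_of_int j - Im a)\<^sup>2))" for j
        by (simp add: cmod_power2 ennreal_mult[symmetric] exp_add[symmetric])
      then show "(\<integral>\<^sup>+j. ennreal (exp (- (cmod (label_point (i, j) - a))\<^sup>2)) \<partial>count_space UNIV) =
        ennreal (exp (- (real_of_int i - Re a)\<^sup>2)) * (\<integral>\<^sup>+j. ennreal (exp (- (real_of_int j - Im a)\<^sup>2)) \<partial>count_space UNIV)"
        by (simp add: nn_integral_cmult)
    qed
    also have "\<dots> \<le> ennreal K * ennreal K"
      by (subst nn_integral_multc) (auto intro!: mult_mono K(2))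
    also have "\<dots> = ennreal (K * K)" using K(1) by (simp add: ennreal_mult)
    finally show ?thesis .
  qed
  moreover have "1 \<le> K * K" using K(1) mult_mono[of 1 K 1 K] by simp
  ultimately show thesis using that by blast
qed

text \<open>Distributivity for infinite sums: summing over blocks of labels factors over
  time.\<close>

lemma nn_integral_lists_prod:
  fixes \<phi> :: "nat \<Rightarrow> 'k::countable \<Rightarrow> ennreal"
  shows "(\<integral>\<^sup>+l. (\<Prod>i<N. \<phi> i (l ! i)) \<partial>count_space {l. length l = N}) = (\<Prod>i<N. \<integral>\<^sup>+k. \<phi> i k \<partial>count_space UNIV)"
proof (induction N arbitrary: \<phi>)
  case 0
  have "{l :: 'k list. length l = 0} = {[]}" by auto
  then show ?case by (simp add: nn_integral_count_space_finite)
next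
  case (Suc N)
  let ?L = "\<lambda>N. {l :: 'k list. length l = N}"
  interpret sigma_finite_measure "count_space (?L N)"
    by (rule sigma_finite_measure_count_space_countable) simp
  have bij: "bij_betw (\<lambda>(k, l). k # l) (UNIV \<times> ?L N) (?L (Suc N))"
    by (rule bij_betwI[where g="\<lambda>l. (hd l, tl l)"]) (auto simp: length_Suc_conv)
  have "(\<integral>\<^sup>+l. (\<Prod>i<Suc N. \<phi> i (l ! i)) \<partial>count_space (?L (Suc N))) =
    (\<integral>\<^sup>+p. (\<Prod>i<Suc N. \<phi> i ((case p of (k, l) \<Rightarrow> k # l) ! i)) \<partial>count_space (UNIV \<times> ?L N))"
    by (rule nn_integral_bij_count_space[OF bij, symmetric])
  also have "\<dots> = (\<integral>\<^sup>+(k, l). \<phi> 0 k * (\<Prod>i<N. \<phi> (Suc i) (l ! i)) \<partial>(count_space UNIV \<Otimes>\<^sub>M count_space (?L N)))"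
    by (subst pair_measure_countable) (auto intro!: nn_integral_cong simp: prod.lessThan_Suc_shift simp del: prod.lessThan_Suc)
  also have "\<dots> = (\<integral>\<^sup>+k. \<integral>\<^sup>+l. \<phi> 0 k * (\<Prod>i<N. \<phi> (Suc i) (l ! i)) \<partial>count_space (?L N) \<partial>count_space UNIV)"
    by (subst nn_integral_fst[symmetric]) (auto simp: pair_measure_countable)
  also have "\<dots> = (\<integral>\<^sup>+k. \<phi> 0 k \<partial>count_space UNIV) * (\<Prod>i<N. \<integral>\<^sup>+k. \<phi> (Suc i) k \<partial>count_space UNIV)"
    by (simp add: nn_integral_cmult nn_integral_multc Suc.IH[of "\<lambda>i. \<phi> (Suc i)"])
  also have "\<dots> = (\<Prod>i<Suc N. \<integral>\<^sup>+k. \<phi> i k \<partial>count_space UNIV)"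
    by (simp add: prod.lessThan_Suc_shift del: prod.lessThan_Suc)
  finally show ?case .
qed

lemma quantize_error: "(cmod (label_point (quantize y) - y))\<^sup>2 \<le> 1 / 2"
proof -
  have "(real_of_int (round x) - x)\<^sup>2 \<le> 1 / 4" for x :: real
    using of_int_round_abs_le[of x] abs_le_square_iff[of "real_of_int (round x) - x" "1/2"] by (simp add: power2_eq_square)
  from this[of "Re y"] this[of "Im y"] show ?thesis
    by (simp add: quantize_def cmod_power2)
qed

section \<open>Threshold decoding and the split by outage\<close>

definition test_decoder :: "nat \<Rightarrow> (nat \<Rightarrow> dest_view \<Rightarrow> bool) \<Rightarrow> dest_view \<Rightarrow> nat" where
  "test_decoder M T y = (if \<exists>m<M. T m y then LEAST m. m < M \<and> T m y else 0)"

lemma test_decoder_wrong: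
  assumes "test_decoder M T y \<noteq> m" "m < M" "T m y"
  shows "\<exists>m'<M. m' \<noteq> m \<and> T m' y"
proof -
  have ex: "\<exists>m<M. T m y" using assms(2,3) by blast
  have "(LEAST m. m < M \<and> T m y) < M \<and> T (LEAST m. m < M \<and> T m y) y"
    using LeastI_ex[of "\<lambda>m. m < M \<and> T m y"] ex by blast
  then show ?thesis using ex assms(1) by (auto simp: test_decoder_def)
qed

lemma measurable_test_decoder:
  assumes [measurable]: "\<And>m. m < M \<Longrightarrow> Measurable.pred dest_view_borel (T m)"
  shows "test_decoder M T \<in> measurable dest_view_borel (count_space UNIV)"
proof -
  have [measurable]: "Measurable.pred dest_view_borel (\<lambda>y. m < M \<and> T m y)" for m
    by (cases "m < M") simp_all
  show ?thesis unfolding test_decoder_def by measurable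
qed


text \<open>Total probability over the fading: \<epsilon> off the outage set, the trivial bound 1 on
  it.\<close>

lemma (in relay_code) avg_error_le:
  assumes Out: "Out \<in> sets (borel \<Otimes>\<^sub>M borel \<Otimes>\<^sub>M borel)" and \<epsilon>: "0 \<le> \<epsilon>" and \<pi>: "0 \<le> \<pi>"
    and err: "\<And>m g f h. m < M \<Longrightarrow> (g, f, h) \<notin> Out \<Longrightarrow>
      (\<integral>\<^sup>+w. \<integral>\<^sup>+v. \<integral>\<^sup>+zr. \<integral>\<^sup>+zd. indicator {m. \<not> decoded a b c \<rho> C g f h w v zr zd m} m
        \<partial>iid_CN \<partial>iid_CN \<partial>iid_CN \<partial>iid_CN) \<le> ennreal \<epsilon>"
    and out: "(\<integral>\<^sup>+g. \<integral>\<^sup>+f. \<integral>\<^sup>+h. indicator Out (g, f, h) \<partial>CN \<partial>CN \<partial>CN) \<le> ennreal \<pi>"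
  shows "avg_error a b c \<rho> C \<le> \<epsilon> + \<pi>"
proof -
  interpret ch: prob_space channel_space by (rule prob_space_channel_space)
  note [measurable] = Out
  have "measure channel_space (error_event a b c \<rho> C m) \<le> \<epsilon> + \<pi>" if m: "m < M" for m
  proof -
    let ?e = "\<lambda>g f h. \<integral>\<^sup>+w. \<integral>\<^sup>+v. \<integral>\<^sup>+zr. \<integral>\<^sup>+zd. indicator {m. \<not> decoded a b c \<rho> C g f h w v zr zd m} m
        \<partial>iid_CN \<partial>iid_CN \<partial>iid_CN \<partial>iid_CN"
    have "emeasure channel_space (error_event a b c \<rho> C m) \<le>
      (\<integral>\<^sup>+g. \<integral>\<^sup>+f. \<integral>\<^sup>+h. ennreal \<epsilon> + indicator Out (g, f, h) \<partial>CN \<partial>CN \<partial>CN)"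
      unfolding emeasure_error_event(2)[OF m]
    proof (rule nn_integral_mono, rule nn_integral_mono, rule nn_integral_mono)
      fix g f h
      have "?e g f h \<le> (\<integral>\<^sup>+w. \<integral>\<^sup>+v. \<integral>\<^sup>+zr. \<integral>\<^sup>+zd. 1 \<partial>iid_CN \<partial>iid_CN \<partial>iid_CN \<partial>iid_CN)"
        by (intro nn_integral_mono) (auto simp: indicator_def)
      then have "?e g f h \<le> 1" by simp
      then show "?e g f h \<le> ennreal \<epsilon> + indicator Out (g, f, h)"
        using err[OF m, of g f h] by (cases "(g, f, h) \<in> Out") (simp_all add: add_increasing)
    qed
    also have "\<dots> = ennreal \<epsilon> + (\<integral>\<^sup>+g. \<integral>\<^sup>+f. \<integral>\<^sup>+h. indicator Out (g, f, h) \<partial>CN \<partial>CN \<partial>CN)"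
      using CN.emeasure_space_1 by (simp add: nn_integral_add)
    also have "\<dots> \<le> ennreal (\<epsilon> + \<pi>)"
      using out \<epsilon> \<pi> by (subst ennreal_plus) (auto intro: add_left_mono)
    finally show ?thesis
      using \<epsilon> \<pi> by (simp add: ch.emeasure_eq_measure del: ennreal_plus)
  qed
  then have "(\<Sum>m<M. measure channel_space (error_event a b c \<rho> C m)) \<le> (\<Sum>m<M. \<epsilon> + \<pi>)"
    by (intro sum_mono) auto
  then show ?thesis using M_pos by (simp add: avg_error_def pos_divide_le_eq mult.commute)
qed

section \<open>Quantize-map-forward\<close>

type_synonym label = "(int \<times> int) list"

text \<open>These are the seed addresses behind \<open>source_gauss\<close> and
  \<open>relay_gauss\<close> for block labels; injectivity of \<open>to_nat\<close> keeps all
  codewords on disjoint coordinates.\<close>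

definition qmf_src :: "nat \<Rightarrow> nat \<Rightarrow> nat" where
  "qmf_src m i = to_nat (Inl (m, i) :: (nat \<times> nat) + (label \<times> nat))"

definition qmf_rel :: "label \<Rightarrow> nat \<Rightarrow> nat" where
  "qmf_rel l i = to_nat (Inr (l, i) :: (nat \<times> nat) + (label \<times> nat))"

lemma qmf_index_eq [simp]:
  "qmf_src m i = qmf_src m' i' \<longleftrightarrow> m = m' \<and> i = i'" "qmf_rel l i = qmf_rel l' i' \<longleftrightarrow> l = l' \<and> i = i'"
  "qmf_src m i \<noteq> qmf_rel l j" "qmf_rel l j \<noteq> qmf_src m i"
  by (auto simp: qmf_src_def qmf_rel_def)

definition quantize_block :: "nat \<Rightarrow> cseq \<Rightarrow> label" where
  "quantize_block N y = map (\<lambda>j. quantize (y j)) [0..<N]"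

text \<open>Distance of a joint hypothesis (m, l). In the listening half the label counts as a
  second noisy observation of the source codeword; in the other half l determines the relay's
  word.\<close>

definition qmf_dist :: "complex \<Rightarrow> complex \<Rightarrow> complex \<Rightarrow> nat \<Rightarrow> cseq \<Rightarrow> cseq \<Rightarrow> nat \<Rightarrow> label \<Rightarrow> real" where
  "qmf_dist g f h N w y m l = (\<Sum>i<2 * N. if i < N
      then (cmod (y i - h * w (qmf_src m i)))\<^sup>2 + (cmod (label_point (l ! i) - g * w (qmf_src m i)))\<^sup>2
      else (cmod (y i - h * w (qmf_src m i) - f * w (qmf_rel l i)))\<^sup>2)"

text \<open>The destination does not know the label and accepts m if some label fits. The threshold
  is the bound of \<open>qmf_true_dist\<close> for noise energies at most 8 N at the destination and
  4 N at the relay: 8 + 2 * 4 + 1 = 17.\<close>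

definition qmf_test :: "real \<Rightarrow> real \<Rightarrow> real \<Rightarrow> nat \<Rightarrow> nat \<Rightarrow> dest_view \<Rightarrow> bool" where
  "qmf_test p c \<rho> N m = (\<lambda>(w, (g, f, h), y). \<exists>l. length l = N \<and>
     qmf_dist (g * complex_of_real (\<rho> powr (p / 2))) (f * complex_of_real (\<rho> powr (p / 2)))
       (h * complex_of_real (\<rho> powr (c / 2))) N w y m l \<le> 17 * real N)"

definition qmf_code :: "real \<Rightarrow> real \<Rightarrow> real \<Rightarrow> nat \<Rightarrow> nat \<Rightarrow> hd_code" where
  "qmf_code p c \<rho> N M = \<lparr> blocklength = 2 * N, num_msgs = M,
     src_enc = (\<lambda>w m i. w (qmf_src m i)),
     listens = (\<lambda>i _. i < N),
     relay_enc = (\<lambda>i (w, v, g, y). if N \<le> i then w (qmf_rel (quantize_block N y) i) else 0),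
     dest_dec = test_decoder M (qmf_test p c \<rho> N) \<rparr>"

lemma qmf_code_simps [simp]:
  "blocklength (qmf_code p c \<rho> N M) = 2 * N"
  "num_msgs (qmf_code p c \<rho> N M) = M"
  "src_enc (qmf_code p c \<rho> N M) = (\<lambda>w m i. w (qmf_src m i))"
  "listens (qmf_code p c \<rho> N M) = (\<lambda>i _. i < N)"
  "relay_enc (qmf_code p c \<rho> N M) = (\<lambda>i (w, v, g, y). if N \<le> i then w (qmf_rel (quantize_block N y) i) else 0)"
  "dest_dec (qmf_code p c \<rho> N M) = test_decoder M (qmf_test p c \<rho> N)"
  by (simp_all add: qmf_code_def)

lemma static_qmf_half_qmf_code: "static_qmf_half (qmf_code p c \<rho> N M)"
  by (auto simp: static_qmf_half_def source_gauss_def relay_gauss_def qmf_src_def qmf_rel_def quantize_block_def)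

lemma measurable_quantize [measurable]: "quantize \<in> measurable borel (count_space UNIV)"
proof -
  have "(\<lambda>y. (\<lfloor>Re y + 1/2\<rfloor>, \<lfloor>Im y + 1/2\<rfloor>)) \<in> measurable borel (count_space UNIV)"
    by measurable
  then show ?thesis by (simp add: quantize_def[abs_def] round_def)
qed

lemma measurable_quantize_block [measurable]: "quantize_block N \<in> measurable cseq_borel (count_space UNIV)"
proof (induction N)
  case (Suc N)
  have "quantize_block (Suc N) = (\<lambda>y. quantize_block N y @ [quantize (y N)])"
    by (auto simp: quantize_block_def)
  moreover have "(\<lambda>y. quantize_block N y @ [quantize (y N)]) \<in> measurable cseq_borel (count_space UNIV)"
    using Suc by measurable
  ultimately show ?case by simp
qed (simp add: quantize_block_def[abs_def])

lemma measurable_qmf_rel_component: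
  assumes [measurable]: "w \<in> measurable A cseq_borel" "l \<in> measurable A (count_space UNIV)"
  shows "(\<lambda>x. w x (qmf_rel (l x) i)) \<in> borel_measurable A"
proof (rule measurable_compose_countable[where g=l])
  show "(\<lambda>x. w x (qmf_rel l' i)) \<in> borel_measurable A" for l'
    by (rule measurable_cseq_component) measurable
qed measurable

lemma measurable_qmf_dist:
  assumes [measurable]: "g \<in> borel_measurable A" "f \<in> borel_measurable A" "h \<in> borel_measurable A"
    "w \<in> measurable A cseq_borel" "y \<in> measurable A cseq_borel" "l \<in> measurable A (count_space UNIV)"
  shows "(\<lambda>x. qmf_dist (g x) (f x) (h x) N (w x) (y x) m (l x)) \<in> borel_measurable A"
proof -
  have [measurable]: "(\<lambda>x. w x (qmf_src m i)) \<in> borel_measurable A" "(\<lambda>x. y x i) \<in> borel_measurable A" for i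
    by (auto intro: measurable_cseq_component)
  have [measurable]: "(\<lambda>x. w x (qmf_rel (l x) i)) \<in> borel_measurable A" for i
    by (rule measurable_qmf_rel_component) measurable
  have [measurable]: "(\<lambda>x. label_point (l x ! i)) \<in> borel_measurable A" for i
    by (rule measurable_compose[of l A "count_space UNIV" "\<lambda>l. label_point (l ! i)"]) simp_all
  show ?thesis unfolding qmf_dist_def by measurable
qed

lemma measurable_qmf_test: "Measurable.pred dest_view_borel (qmf_test p c \<rho> N m)"
proof -
  have [measurable]: "(\<lambda>x. qmf_dist (fst (fst (snd x)) * complex_of_real (\<rho> powr (p / 2)))
      (fst (snd (fst (snd x))) * complex_of_real (\<rho> powr (p / 2)))
      (snd (snd (fst (snd x))) * complex_of_real (\<rho> powr (c / 2))) N (fst x) (snd (snd x)) m l) \<in> borel_measurable dest_view_borel" for l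
    by (rule measurable_qmf_dist) measurable
  show ?thesis unfolding qmf_test_def split_beta' by measurable
qed

lemma sum_two_halves:
  fixes N :: nat
  shows "(\<Sum>i<2 * N. if i < N then A i else B i) = (\<Sum>i<N. A i) + (\<Sum>i\<in>{N..<2 * N}. B i)"
proof -
  have "{..<2 * N} = {..<N} \<union> {N..<2 * N}" by auto
  then show ?thesis by (simp add: sum.union_disjoint ivl_disj_int)
qed

lemma prod_two_halves:
  fixes N :: nat
  shows "(\<Prod>i<2 * N. if i < N then A i else B i) = (\<Prod>i<N. A i) * (\<Prod>i\<in>{N..<2 * N}. B i)"
proof -
  have "{..<2 * N} = {..<N} \<union> {N..<2 * N}" by auto
  then show ?thesis by (simp add: prod.union_disjoint ivl_disj_int)
qed

lemma relay_past_qmf: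
  assumes "i \<le> 2 * N"
  shows "relay_past a \<rho> (qmf_code p c \<rho>' N M) g w v zr m i j =
    (if j < i \<and> j < N then g * complex_of_real (\<rho> powr (a / 2)) * w (qmf_src m j) + zr j else 0)"
  using assms by (induction i) (auto simp: Let_def)

lemma quantize_block_cong:
  "(\<And>j. j < N \<Longrightarrow> y j = y' j) \<Longrightarrow> quantize_block N y = quantize_block N y'"
  by (auto simp: quantize_block_def)

lemma nn_integral_iid_norm_sq: "(\<integral>\<^sup>+w. ennreal ((cmod (w k))\<^sup>2) \<partial>iid_CN) = 1"
  by (subst nn_integral_iid_component[of "\<lambda>z. ennreal ((cmod z)\<^sup>2)"]) (simp_all add: nn_integral_CN_norm_sq)

lemma valid_qmf_code:
  assumes "0 < N" "0 < M"
  shows "valid_code p \<rho> (qmf_code p c \<rho> N M)"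
proof -
  have relay_meas: "(\<lambda>(w, v, g, y). if N \<le> i then w (qmf_rel (quantize_block N y) i) else 0) \<in> borel_measurable relay_view_borel" for i
  proof (cases "N \<le> i")
    case True
    have "(\<lambda>x. fst x (qmf_rel (quantize_block N (snd (snd (snd x)))) i)) \<in> borel_measurable relay_view_borel"
      by (rule measurable_qmf_rel_component) measurable
    then show ?thesis using True by (simp add: split_beta')
  qed simp
  have src: "source_power_ok (qmf_code p c \<rho> N M)"
    by (simp add: source_power_ok_def nn_integral_sum nn_integral_iid_norm_sq sum_ennreal[symmetric] del: sum_ennreal)
      (simp add: ennreal_of_nat_eq_real_of_nat ennreal_mult)
  have "(\<integral>\<^sup>+(w, v, zr). ennreal (\<Sum>i<2 * N. (cmod (relay_input p \<rho> (qmf_code p c \<rho> N M) g w v zr m i))\<^sup>2)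
      \<partial>(iid_CN \<Otimes>\<^sub>M iid_CN \<Otimes>\<^sub>M iid_CN)) \<le> ennreal (2 * real N)" for g m
  proof -
    define lab where "lab w zr = quantize_block N (\<lambda>j. g * complex_of_real (\<rho> powr (p / 2)) * w (qmf_src m j) + zr j)" for w zr
    have inp: "relay_input p \<rho> (qmf_code p c \<rho> N M) g w v zr m i = (if i < N then 0 else w (qmf_rel (lab w zr) i))" if "i < 2 * N" for w v zr i
    proof -
      have "quantize_block N (relay_past p \<rho> (qmf_code p c \<rho> N M) g w v zr m i) = lab w zr" if "N \<le> i"
        unfolding lab_def using that \<open>i < 2 * N\<close> by (intro quantize_block_cong) (simp add: relay_past_qmf)
      then show ?thesis by (auto simp: relay_input_def Let_def)
    qed
    have lab_m[measurable]: "(\<lambda>x. lab (w x) (zr x)) \<in> measurable A (count_space UNIV)"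
      if [measurable]: "w \<in> measurable A cseq_borel" "zr \<in> measurable A cseq_borel" for A :: "'x measure" and w zr
    proof -
      have "(\<lambda>x j. g * complex_of_real (\<rho> powr (p / 2)) * w x (qmf_src m j) + zr x j) \<in> measurable A cseq_borel"
      proof (rule measurable_cseq_lambda)
        fix j
        have [measurable]: "(\<lambda>x. w x (qmf_src m j)) \<in> borel_measurable A" "(\<lambda>x. zr x j) \<in> borel_measurable A"
          by (auto intro: measurable_cseq_component)
        show "(\<lambda>x. g * complex_of_real (\<rho> powr (p / 2)) * w x (qmf_src m j) + zr x j) \<in> borel_measurable A" by measurable
      qed
      then show ?thesis unfolding lab_def by measurable
    qed
    have wl_m[measurable]: "(\<lambda>x. w x (qmf_rel (lab (w x) (zr x)) i)) \<in> borel_measurable A"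
      if [measurable]: "w \<in> measurable A cseq_borel" "zr \<in> measurable A cseq_borel" for A :: "'x measure" and w zr i
      by (rule measurable_qmf_rel_component) measurable
    \<comment> \<open>The label is a function of source codewords and noise only, so resampling
      every relay codeword leaves it fixed, and the selected entry has unit second moment.\<close>
    have one: "(\<integral>\<^sup>+w. ennreal ((cmod (w (qmf_rel (lab w zr) i)))\<^sup>2) \<partial>iid_CN) = 1" for zr i
    proof -
      let ?J = "{qmf_rel l i |l i. True}"
      have "lab (override_on w w' ?J) zr = lab w zr" for w w'
        unfolding lab_def by (intro quantize_block_cong) (auto simp: override_on_def)
      moreover have "override_on w w' ?J (qmf_rel l i) = w' (qmf_rel l i)" for w w' :: cseq and l
        by (auto simp: override_on_def)
      ultimately show ?thesis
        by (subst nn_integral_iid_resample[of _ ?J]) (simp_all add: nn_integral_iid_norm_sq)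
    qed
    have "(\<integral>\<^sup>+(w, v, zr). ennreal (\<Sum>i<2 * N. (cmod (relay_input p \<rho> (qmf_code p c \<rho> N M) g w v zr m i))\<^sup>2)
      \<partial>(iid_CN \<Otimes>\<^sub>M iid_CN \<Otimes>\<^sub>M iid_CN)) \<le>
      (\<integral>\<^sup>+(w, v, zr). (\<Sum>i<2 * N. ennreal ((cmod (w (qmf_rel (lab w zr) i)))\<^sup>2)) \<partial>(iid_CN \<Otimes>\<^sub>M iid_CN \<Otimes>\<^sub>M iid_CN))"
      by (intro nn_integral_mono) (auto simp: inp sum_ennreal intro!: ennreal_leI sum_mono)
    also have "\<dots> = (\<integral>\<^sup>+w. \<integral>\<^sup>+v. \<integral>\<^sup>+zr. (\<Sum>i<2 * N. ennreal ((cmod (w (qmf_rel (lab w zr) i)))\<^sup>2)) \<partial>iid_CN \<partial>iid_CN \<partial>iid_CN)"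
      by (simp add: nn_integral_pair prob_space_pair prob_space_iid_CN del: sum_ennreal)
    also have "\<dots> = (\<integral>\<^sup>+w. \<integral>\<^sup>+zr. (\<Sum>i<2 * N. ennreal ((cmod (w (qmf_rel (lab w zr) i)))\<^sup>2)) \<partial>iid_CN \<partial>iid_CN)"
      by simp
    also have "\<dots> = (\<integral>\<^sup>+zr. \<integral>\<^sup>+w. (\<Sum>i<2 * N. ennreal ((cmod (w (qmf_rel (lab w zr) i)))\<^sup>2)) \<partial>iid_CN \<partial>iid_CN)"
      by (rule nn_integral_swap[OF prob_space_iid_CN prob_space_iid_CN]) measurable
    also have "\<dots> = (\<integral>\<^sup>+zr. (\<Sum>i<2 * N. 1) \<partial>iid_CN)"
      by (intro nn_integral_cong, subst nn_integral_sum) (simp_all add: one)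
    also have "\<dots> = ennreal (2 * real N)"
      by (simp add: ennreal_of_nat_eq_real_of_nat ennreal_mult)
    finally show ?thesis .
  qed
  then have "(\<Sum>m<M. \<integral>\<^sup>+(w, v, zr). ennreal (\<Sum>i<2 * N. (cmod (relay_input p \<rho> (qmf_code p c \<rho> N M) g w v zr m i))\<^sup>2)
      \<partial>(iid_CN \<Otimes>\<^sub>M iid_CN \<Otimes>\<^sub>M iid_CN)) \<le> (\<Sum>m<M. ennreal (2 * real N))" for g
    by (rule sum_mono)
  also have "(\<Sum>m<M. ennreal (2 * real N)) = ennreal (real M * real (2 * N))"
    by (simp add: ennreal_mult ennreal_of_nat_eq_real_of_nat)
  finally have rel: "relay_power_ok p \<rho> (qmf_code p c \<rho> N M)"
    by (simp add: relay_power_ok_def)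
  have "(\<lambda>w. w (qmf_src m i)) \<in> borel_measurable cseq_borel" for m i
    by (rule measurable_cseq_component) simp
  then show ?thesis
    using assms src rel relay_meas measurable_test_decoder[of M "qmf_test p c \<rho> N"] measurable_qmf_test
    by (simp add: valid_code_def)
qed


lemma prod_mono_ennreal:
  fixes f g :: "'i \<Rightarrow> ennreal"
  shows "(\<And>i. i \<in> A \<Longrightarrow> f i \<le> g i) \<Longrightarrow> prod f A \<le> prod g A"
  by (induction A rule: infinite_finite_induct) (auto intro!: mult_mono)

section \<open>QMF: confusion with a wrong message\<close>

definition qmf_label :: "complex \<Rightarrow> nat \<Rightarrow> cseq \<Rightarrow> cseq \<Rightarrow> nat \<Rightarrow> label" where
  "qmf_label g N w zr m = quantize_block N (\<lambda>j. g * w (qmf_src m j) + zr j)"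

definition qmf_out :: "complex \<Rightarrow> complex \<Rightarrow> complex \<Rightarrow> nat \<Rightarrow> cseq \<Rightarrow> cseq \<Rightarrow> cseq \<Rightarrow> nat \<Rightarrow> cseq" where
  "qmf_out g f h N w zr zd m i = h * w (qmf_src m i) + (if i < N then 0 else f * w (qmf_rel (qmf_label g N w zr m) i)) + zd i"

lemma qmf_label_length: "length (qmf_label g N w zr m) = N"
  by (simp add: qmf_label_def quantize_block_def)

lemma measurable_affine_codeword [measurable (raw)]:
  assumes [measurable]: "w \<in> measurable A cseq_borel" "zr \<in> measurable A cseq_borel"
  shows "(\<lambda>x j. g * w x (qmf_src m j) + zr x j) \<in> measurable A cseq_borel"
proof (rule measurable_cseq_lambda)
  fix j
  have [measurable]: "(\<lambda>x. w x (qmf_src m j)) \<in> borel_measurable A" "(\<lambda>x. zr x j) \<in> borel_measurable A"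
    by (auto intro: measurable_cseq_component)
  show "(\<lambda>x. g * w x (qmf_src m j) + zr x j) \<in> borel_measurable A" by measurable
qed

lemma measurable_qmf_label [measurable (raw)]:
  assumes [measurable]: "w \<in> measurable A cseq_borel" "zr \<in> measurable A cseq_borel"
  shows "(\<lambda>x. qmf_label g N (w x) (zr x) m) \<in> measurable A (count_space UNIV)"
  unfolding qmf_label_def by measurable

lemma measurable_qmf_out [measurable (raw)]:
  assumes [measurable]: "w \<in> measurable A cseq_borel" "zr \<in> measurable A cseq_borel" "zd \<in> measurable A cseq_borel"
  shows "(\<lambda>x. qmf_out g f h N (w x) (zr x) (zd x) m) \<in> measurable A cseq_borel"
proof (rule measurable_cseq_lambda)
  fix i
  have [measurable]: "(\<lambda>x. w x (qmf_src m i)) \<in> borel_measurable A" "(\<lambda>x. zd x i) \<in> borel_measurable A"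
    by (auto intro: measurable_cseq_component)
  have [measurable]: "(\<lambda>x. w x (qmf_rel (qmf_label g N (w x) (zr x) m) i)) \<in> borel_measurable A"
    by (rule measurable_qmf_rel_component) measurable
  show "(\<lambda>x. qmf_out g f h N (w x) (zr x) (zd x) m i) \<in> borel_measurable A"
    unfolding qmf_out_def by measurable
qed

lemma qmf_label_override:
  assumes "\<And>j. qmf_src m j \<notin> J"
  shows "qmf_label g N (override_on w w' J) zr m = qmf_label g N w zr m"
  unfolding qmf_label_def using assms by (intro quantize_block_cong) simp

lemma qmf_out_override:
  assumes "\<And>j. qmf_src m j \<notin> J" "\<And>j. qmf_rel (qmf_label g N w zr m) j \<notin> J"
  shows "qmf_out g f h N (override_on w w' J) zr zd m = qmf_out g f h N w zr zd m"
  using assms by (auto simp: qmf_out_def qmf_label_override fun_eq_iff)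

text \<open>Under the true label the relay's word cancels in the second half, so only the source
  codeword of m' is fresh. The listening half then discriminates through both links out of the
  source, the second half through the direct link alone.\<close>

lemma qmf_confusion_same_label:
  assumes "m' \<noteq> m"
  shows "(\<integral>\<^sup>+w. ennreal (exp (- qmf_dist g f h N w (qmf_out g f h N w zr zd m) m' (qmf_label g N w zr m))) \<partial>iid_CN) \<le>
    ennreal (1 / (1 + (cmod h)\<^sup>2 + (cmod g)\<^sup>2)) ^ N * ennreal (1 / (1 + (cmod h)\<^sup>2)) ^ N"
proof -
  let ?J = "qmf_src m' ` {..<2 * N}"
  let ?y = "\<lambda>w. qmf_out g f h N w zr zd m" and ?l = "\<lambda>w. qmf_label g N w zr m"
  have nJ: "qmf_src m j \<notin> ?J" "qmf_rel l j \<notin> ?J" for j l using assms by auto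
  have inner: "(\<integral>\<^sup>+w'. ennreal (exp (- qmf_dist g f h N (override_on w w' ?J) (?y (override_on w w' ?J)) m' (?l (override_on w w' ?J)))) \<partial>iid_CN)
    \<le> ennreal (1 / (1 + (cmod h)\<^sup>2 + (cmod g)\<^sup>2)) ^ N * ennreal (1 / (1 + (cmod h)\<^sup>2)) ^ N" for w
  proof -
    define \<phi> where "\<phi> i x = (if i < N then ennreal (exp (- (cmod (?y w i - h * x))\<^sup>2 - (cmod (label_point (?l w ! i) - g * x))\<^sup>2))
      else ennreal (exp (- (cmod (?y w i - f * w (qmf_rel (?l w) i) - h * x))\<^sup>2)))" for i x
    have eq: "ennreal (exp (- qmf_dist g f h N (override_on w w' ?J) (?y (override_on w w' ?J)) m' (?l (override_on w w' ?J))))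
      = (\<Prod>i<2 * N. \<phi> i (w' (qmf_src m' i)))" for w'
    proof -
      have dist: "qmf_dist g f h N (override_on w w' ?J) (?y (override_on w w' ?J)) m' (?l (override_on w w' ?J)) =
        (\<Sum>i<2 * N. if i < N
          then (cmod (?y w i - h * w' (qmf_src m' i)))\<^sup>2 + (cmod (label_point (?l w ! i) - g * w' (qmf_src m' i)))\<^sup>2
          else (cmod (?y w i - f * w (qmf_rel (?l w) i) - h * w' (qmf_src m' i)))\<^sup>2)"
        unfolding qmf_dist_def
      proof (rule sum.cong[OF refl])
        have comm: "x - y - z = x - z - y" for x y z :: complex by simp
        fix i assume "i \<in> {..<2 * N}"
        then show "(if i < N
          then (cmod (?y (override_on w w' ?J) i - h * override_on w w' ?J (qmf_src m' i)))\<^sup>2 +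
            (cmod (label_point (?l (override_on w w' ?J) ! i) - g * override_on w w' ?J (qmf_src m' i)))\<^sup>2
          else (cmod (?y (override_on w w' ?J) i - h * override_on w w' ?J (qmf_src m' i) -
            f * override_on w w' ?J (qmf_rel (?l (override_on w w' ?J)) i)))\<^sup>2) =
          (if i < N
          then (cmod (?y w i - h * w' (qmf_src m' i)))\<^sup>2 + (cmod (label_point (?l w ! i) - g * w' (qmf_src m' i)))\<^sup>2
          else (cmod (?y w i - f * w (qmf_rel (?l w) i) - h * w' (qmf_src m' i)))\<^sup>2)"
          by (simp add: qmf_out_override qmf_label_override nJ comm[of _ "h * w' (qmf_src m' i)"])
      qed
      show ?thesis
        unfolding dist sum_negf[symmetric] exp_sum[OF finite_lessThan]
        by (subst prod_ennreal[symmetric]) (auto intro!: prod.cong simp: \<phi>_def)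
    qed
    have \<phi>: "\<phi> i \<in> borel_measurable borel" for i unfolding \<phi>_def by measurable
    have "(\<integral>\<^sup>+w'. (\<Prod>i<2 * N. \<phi> i (w' (qmf_src m' i))) \<partial>iid_CN) = (\<Prod>i<2 * N. \<integral>\<^sup>+x. \<phi> i x \<partial>CN)"
      by (rule nn_integral_iid_prod_inj) (auto simp: inj_on_def \<phi>)
    also have "\<dots> \<le> (\<Prod>i<2 * N. if i < N then ennreal (1 / (1 + (cmod h)\<^sup>2 + (cmod g)\<^sup>2)) else ennreal (1 / (1 + (cmod h)\<^sup>2)))"
      by (intro prod_mono_ennreal) (auto simp: \<phi>_def intro: nn_integral_CN_two_exp nn_integral_CN_one_exp_le)
    also have "\<dots> = ennreal (1 / (1 + (cmod h)\<^sup>2 + (cmod g)\<^sup>2)) ^ N * ennreal (1 / (1 + (cmod h)\<^sup>2)) ^ N"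
      by (simp only: prod_two_halves) simp
    finally show ?thesis unfolding eq .
  qed
  have [measurable]: "(\<lambda>w. qmf_dist g f h N w (?y w) m' (?l w)) \<in> borel_measurable cseq_borel"
    by (rule measurable_qmf_dist) measurable
  have "(\<integral>\<^sup>+w. ennreal (exp (- qmf_dist g f h N w (?y w) m' (?l w))) \<partial>iid_CN) =
    (\<integral>\<^sup>+w. \<integral>\<^sup>+w'. ennreal (exp (- qmf_dist g f h N (override_on w w' ?J) (?y (override_on w w' ?J)) m' (?l (override_on w w' ?J)))) \<partial>iid_CN \<partial>iid_CN)"
    by (rule nn_integral_iid_resample) measurable
  also have "\<dots> \<le> (\<integral>\<^sup>+w. ennreal (1 / (1 + (cmod h)\<^sup>2 + (cmod g)\<^sup>2)) ^ N * ennreal (1 / (1 + (cmod h)\<^sup>2)) ^ N \<partial>iid_CN)"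
    by (intro nn_integral_mono inner)
  finally show ?thesis by simp
qed

text \<open>
  Summed over the labels, the likelihood of the listening phase is bounded by that of the direct
  link alone: there are at most exponentially many labels near a given codeword.
\<close>

lemma qmf_confusion_other_label:
  assumes "m' \<noteq> m" and K: "0 \<le> K"
    "\<And>a. (\<integral>\<^sup>+k. ennreal (exp (- (cmod (label_point k - a))\<^sup>2)) \<partial>count_space UNIV) \<le> ennreal K"
  shows "(\<integral>\<^sup>+w. \<integral>\<^sup>+l. ennreal (exp (- qmf_dist g f h N w (qmf_out g f h N w zr zd m) m' l)) *
      indicator {l. l \<noteq> qmf_label g N w zr m} l \<partial>count_space {l. length l = N} \<partial>iid_CN) \<le>
    ennreal (K / (1 + (cmod h)\<^sup>2)) ^ N * ennreal (1 / (1 + (cmod h)\<^sup>2 + (cmod f)\<^sup>2)) ^ N"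
proof -
  let ?J = "\<lambda>l. qmf_src m' ` {..<2 * N} \<union> qmf_rel l ` {..<2 * N}"
  let ?y = "\<lambda>w. qmf_out g f h N w zr zd m" and ?l = "\<lambda>w. qmf_label g N w zr m"
  let ?L = "{l :: label. length l = N}"
  define G where "G w l = ennreal (exp (- qmf_dist g f h N w (?y w) m' l)) * indicator {l. l \<noteq> ?l w} l" for w l
  \<comment> \<open>The label stays inside the integral over the fresh source symbol and is summed
    over later. A label-free bound at this point would diverge when summed over infinitely many
    labels.\<close>
  define \<Phi> where "\<Phi> w i k = (\<integral>\<^sup>+x. ennreal (exp (- (cmod (?y w i - h * x))\<^sup>2 - (cmod (label_point k - g * x))\<^sup>2)) \<partial>CN)" for w i k
  have [measurable]: "(\<lambda>w. qmf_dist g f h N w (?y w) m' l) \<in> borel_measurable cseq_borel" for l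
    by (rule measurable_qmf_dist) measurable
  have G_m [measurable]: "(\<lambda>w. G w l) \<in> borel_measurable cseq_borel" for l
    unfolding G_def indicator_def by measurable
  have y_m [measurable]: "(\<lambda>w. ?y w i) \<in> borel_measurable cseq_borel" for i
    by (rule measurable_cseq_component) measurable
  have \<Phi>_m [measurable]: "(\<lambda>w. \<Phi> w i k) \<in> borel_measurable cseq_borel" for i k
    unfolding \<Phi>_def by measurable
  have inner: "(\<integral>\<^sup>+w'. G (override_on w w' (?J l)) l \<partial>iid_CN) \<le>
      (\<Prod>i<N. \<Phi> w i (l ! i)) * ennreal (1 / (1 + (cmod h)\<^sup>2 + (cmod f)\<^sup>2)) ^ N" for w l
  proof (cases "l = ?l w")
    case True
    have "?l (override_on w w' (?J l)) = ?l w" for w'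
      using assms(1) by (intro qmf_label_override) auto
    then show ?thesis using True by (simp add: G_def)
  next
    case False
    have lab: "?l (override_on w w' (?J l)) = ?l w" for w'
      using assms(1) by (intro qmf_label_override) auto
    \<comment> \<open>Here l differs from the true label, so its relay codeword was not transmitted
      and may be resampled without changing the output.\<close>
    have out: "?y (override_on w w' (?J l)) = ?y w" for w'
      using assms(1) False by (intro qmf_out_override) auto
    define \<psi> where "\<psi> i = (\<lambda>(x, u). if i < N then ennreal (exp (- (cmod (?y w i - h * x))\<^sup>2 - (cmod (label_point (l ! i) - g * x))\<^sup>2))
      else ennreal (exp (- (cmod (?y w i - h * x - f * u))\<^sup>2)))" for i
    have \<psi>: "\<psi> i \<in> borel_measurable (borel \<Otimes>\<^sub>M borel)" for i unfolding \<psi>_def by measurable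
    have eq: "G (override_on w w' (?J l)) l = (\<Prod>i<2 * N. \<psi> i (w' (qmf_src m' i), w' (qmf_rel l i)))" for w'
    proof -
      have dist: "qmf_dist g f h N (override_on w w' (?J l)) (?y (override_on w w' (?J l))) m' l =
        (\<Sum>i<2 * N. if i < N
          then (cmod (?y w i - h * w' (qmf_src m' i)))\<^sup>2 + (cmod (label_point (l ! i) - g * w' (qmf_src m' i)))\<^sup>2
          else (cmod (?y w i - h * w' (qmf_src m' i) - f * w' (qmf_rel l i)))\<^sup>2)"
        unfolding qmf_dist_def out by (intro sum.cong refl) (auto simp: override_on_def)
      have "G (override_on w w' (?J l)) l = ennreal (exp (- qmf_dist g f h N (override_on w w' (?J l)) (?y (override_on w w' (?J l))) m' l))"
        using False by (simp add: G_def lab)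
      then show ?thesis
        unfolding dist sum_negf[symmetric] exp_sum[OF finite_lessThan]
        by (simp only:) (subst prod_ennreal[symmetric], auto intro!: prod.cong simp: \<psi>_def)
    qed
    have "(\<integral>\<^sup>+w'. (\<Prod>i<2 * N. \<psi> i (w' (qmf_src m' i), w' (qmf_rel l i))) \<partial>iid_CN) = (\<Prod>i<2 * N. \<integral>\<^sup>+x. \<integral>\<^sup>+u. \<psi> i (x, u) \<partial>CN \<partial>CN)"
      by (rule nn_integral_iid_prod_pair) (auto simp: inj_on_def \<psi>)
    also have "\<dots> \<le> (\<Prod>i<2 * N. if i < N then \<Phi> w i (l ! i) else ennreal (1 / (1 + (cmod h)\<^sup>2 + (cmod f)\<^sup>2)))"
      using CN.emeasure_space_1
      by (intro prod_mono_ennreal) (auto simp: \<psi>_def \<Phi>_def intro: nn_integral_CN_pair_exp)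
    also have "\<dots> = (\<Prod>i<N. \<Phi> w i (l ! i)) * ennreal (1 / (1 + (cmod h)\<^sup>2 + (cmod f)\<^sup>2)) ^ N"
      by (simp only: prod_two_halves) simp
    finally show ?thesis unfolding eq .
  qed
  have \<Phi>_sum: "(\<integral>\<^sup>+k. \<Phi> w i k \<partial>count_space UNIV) \<le> ennreal (K / (1 + (cmod h)\<^sup>2))" for w i
  proof -
    have "(\<integral>\<^sup>+k. \<Phi> w i k \<partial>count_space UNIV) = (\<integral>\<^sup>+x. \<integral>\<^sup>+k. ennreal (exp (- (cmod (?y w i - h * x))\<^sup>2 - (cmod (label_point k - g * x))\<^sup>2)) \<partial>count_space UNIV \<partial>CN)"
      unfolding \<Phi>_def by (rule nn_integral_count_swap[symmetric]) (auto intro: CN.sigma_finite_measure_axioms)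
    also have "\<dots> = (\<integral>\<^sup>+x. ennreal (exp (- (cmod (?y w i - h * x))\<^sup>2)) * (\<integral>\<^sup>+k. ennreal (exp (- (cmod (label_point k - g * x))\<^sup>2)) \<partial>count_space UNIV) \<partial>CN)"
    proof (intro nn_integral_cong)
      fix x
      have "exp (- (cmod (?y w i - h * x))\<^sup>2 - (cmod (label_point k - g * x))\<^sup>2) =
        exp (- (cmod (?y w i - h * x))\<^sup>2) * exp (- (cmod (label_point k - g * x))\<^sup>2)" for k
        by (simp add: exp_add[symmetric])
      then show "(\<integral>\<^sup>+k. ennreal (exp (- (cmod (?y w i - h * x))\<^sup>2 - (cmod (label_point k - g * x))\<^sup>2)) \<partial>count_space UNIV) =
        ennreal (exp (- (cmod (?y w i - h * x))\<^sup>2)) * (\<integral>\<^sup>+k. ennreal (exp (- (cmod (label_point k - g * x))\<^sup>2)) \<partial>count_space UNIV)"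
        by (simp add: ennreal_mult nn_integral_cmult)
    qed
    also have "\<dots> \<le> (\<integral>\<^sup>+x. ennreal (exp (- (cmod (?y w i - h * x))\<^sup>2)) * ennreal K \<partial>CN)"
      by (intro nn_integral_mono mult_left_mono K(2)) simp
    also have "\<dots> = (\<integral>\<^sup>+x. ennreal (exp (- (cmod (?y w i - h * x))\<^sup>2)) \<partial>CN) * ennreal K"
      by (rule nn_integral_multc) simp
    also have "\<dots> \<le> ennreal (1 / (1 + (cmod h)\<^sup>2)) * ennreal K"
      by (intro mult_right_mono nn_integral_CN_one_exp_le) simp
    also have "\<dots> = ennreal (K / (1 + (cmod h)\<^sup>2))"
      using K(1) by (subst ennreal_mult[symmetric]) auto
    finally show ?thesis .
  qed
  have cL: "countable ?L" by simp
  \<comment> \<open>The resampled coordinates depend on l, so the sum over labels is moved outside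
    for the resampling and back inside to be factored over time.\<close>
  have "(\<integral>\<^sup>+w. \<integral>\<^sup>+l. G w l \<partial>count_space ?L \<partial>iid_CN) = (\<integral>\<^sup>+l. \<integral>\<^sup>+w. G w l \<partial>iid_CN \<partial>count_space ?L)"
    by (rule nn_integral_count_swap[OF cL]) (auto intro: iid.sigma_finite_measure_axioms)
  also have "\<dots> = (\<integral>\<^sup>+l. \<integral>\<^sup>+w. \<integral>\<^sup>+w'. G (override_on w w' (?J l)) l \<partial>iid_CN \<partial>iid_CN \<partial>count_space ?L)"
    by (intro nn_integral_cong nn_integral_iid_resample) measurable
  also have "\<dots> \<le> (\<integral>\<^sup>+l. \<integral>\<^sup>+w. (\<Prod>i<N. \<Phi> w i (l ! i)) * ennreal (1 / (1 + (cmod h)\<^sup>2 + (cmod f)\<^sup>2)) ^ N \<partial>iid_CN \<partial>count_space ?L)"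
    by (intro nn_integral_mono inner)
  also have "\<dots> = (\<integral>\<^sup>+w. \<integral>\<^sup>+l. (\<Prod>i<N. \<Phi> w i (l ! i)) * ennreal (1 / (1 + (cmod h)\<^sup>2 + (cmod f)\<^sup>2)) ^ N \<partial>count_space ?L \<partial>iid_CN)"
    by (rule nn_integral_count_swap[OF cL, symmetric]) (auto intro: iid.sigma_finite_measure_axioms)
  also have "\<dots> \<le> (\<integral>\<^sup>+w. ennreal (K / (1 + (cmod h)\<^sup>2)) ^ N * ennreal (1 / (1 + (cmod h)\<^sup>2 + (cmod f)\<^sup>2)) ^ N \<partial>iid_CN)"
  proof (rule nn_integral_mono)
    fix w
    have "(\<integral>\<^sup>+l. (\<Prod>i<N. \<Phi> w i (l ! i)) * ennreal (1 / (1 + (cmod h)\<^sup>2 + (cmod f)\<^sup>2)) ^ N \<partial>count_space ?L) =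
      (\<integral>\<^sup>+l. (\<Prod>i<N. \<Phi> w i (l ! i)) \<partial>count_space ?L) * ennreal (1 / (1 + (cmod h)\<^sup>2 + (cmod f)\<^sup>2)) ^ N"
      by (rule nn_integral_multc) simp
    also have "(\<integral>\<^sup>+l. (\<Prod>i<N. \<Phi> w i (l ! i)) \<partial>count_space ?L) = (\<Prod>i<N. \<integral>\<^sup>+k. \<Phi> w i k \<partial>count_space UNIV)"
      by (rule nn_integral_lists_prod)
    also have "\<dots> \<le> (\<Prod>i<N. ennreal (K / (1 + (cmod h)\<^sup>2)))"
      by (intro prod_mono_ennreal \<Phi>_sum)
    finally show "(\<integral>\<^sup>+l. (\<Prod>i<N. \<Phi> w i (l ! i)) * ennreal (1 / (1 + (cmod h)\<^sup>2 + (cmod f)\<^sup>2)) ^ N \<partial>count_space ?L) \<le>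
      ennreal (K / (1 + (cmod h)\<^sup>2)) ^ N * ennreal (1 / (1 + (cmod h)\<^sup>2 + (cmod f)\<^sup>2)) ^ N"
      by (simp add: mult_right_mono)
  qed
  finally show ?thesis unfolding G_def by simp
qed

lemma qmf_dist_cong:
  "(\<And>i. i < 2 * N \<Longrightarrow> y i = y' i) \<Longrightarrow> qmf_dist g f h N w y m l = qmf_dist g f h N w y' m l"
  unfolding qmf_dist_def by (intro sum.cong) auto

lemma decoded_qmf:
  fixes g f h :: complex and p c \<rho> :: real
  assumes "m < M"
  defines "g' \<equiv> g * complex_of_real (\<rho> powr (p / 2))" and "f' \<equiv> f * complex_of_real (\<rho> powr (p / 2))"
    and "h' \<equiv> h * complex_of_real (\<rho> powr (c / 2))"
  shows "decoded p p c \<rho> (qmf_code p c \<rho> N M) g f h w v zr zd m \<longleftrightarrow>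
    test_decoder M (qmf_test p c \<rho> N) (w, (g, f, h), \<lambda>i. if i < 2 * N then qmf_out g' f' h' N w zr zd m i else 0) = m"
proof -
  let ?C = "qmf_code p c \<rho> N M"
  let ?y = "shift (2 * N) (\<lambda>i. g' * codeword ?C w m i) zr"
  have run: "relay_run ?C g w v ?y i = (\<lambda>j. if j < i \<and> j < N then g' * w (qmf_src m j) + zr j else 0)" if "i \<le> 2 * N" for i
    using that by (induction i) (auto simp: fun_eq_iff shift_def codeword_def assms)
  have "run_input ?C g w v ?y i = (if i < N then 0 else w (qmf_rel (qmf_label g' N w zr m) i))" if "i < 2 * N" for i
  proof -
    have "quantize_block N (relay_run ?C g w v ?y i) = qmf_label g' N w zr m" if "N \<le> i"
      unfolding qmf_label_def using that \<open>i < 2 * N\<close> by (intro quantize_block_cong) (simp add: run)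
    then show ?thesis by (simp add: run_input_def)
  qed
  then have "dest_word p \<rho> ?C g f w v ?y (shift (2 * N) (\<lambda>i. h' * codeword ?C w m i) zd) =
    (\<lambda>i. if i < 2 * N then qmf_out g' f' h' N w zr zd m i else 0)"
    using assms(1) by (auto simp: dest_word_def fun_eq_iff shift_def codeword_def qmf_out_def f'_def)
  then show ?thesis by (simp add: decoded_def g'_def h'_def)
qed

text \<open>The label differs from the noiseless signal by relay noise plus a quantization error of
  squared modulus at most 1/2; squaring the sum costs a factor 2.\<close>

lemma qmf_true_dist:
  "qmf_dist g f h N w (qmf_out g f h N w zr zd m) m (qmf_label g N w zr m) \<le>
    (\<Sum>i<2 * N. (cmod (zd i))\<^sup>2) + 2 * (\<Sum>i<N. (cmod (zr i))\<^sup>2) + real N"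
proof -
  let ?l = "qmf_label g N w zr m"
  have lab: "(cmod (label_point (?l ! i) - g * w (qmf_src m i)))\<^sup>2 \<le> 2 * (cmod (zr i))\<^sup>2 + 1" if "i < N" for i
  proof -
    let ?y = "g * w (qmf_src m i) + zr i"
    let ?e = "label_point (quantize ?y) - ?y"
    have "?l ! i = quantize ?y" using that by (simp add: qmf_label_def quantize_block_def)
    then have "cmod (label_point (?l ! i) - g * w (qmf_src m i)) = cmod (?e + zr i)"
      by (simp add: algebra_simps)
    also have "\<dots> \<le> cmod ?e + cmod (zr i)" by (rule norm_triangle_ineq)
    finally have "(cmod (label_point (?l ! i) - g * w (qmf_src m i)))\<^sup>2 \<le> (cmod ?e + cmod (zr i))\<^sup>2"
      by (rule power_mono) simp
    also have "\<dots> \<le> 2 * (cmod ?e)\<^sup>2 + 2 * (cmod (zr i))\<^sup>2"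
    proof -
      have "0 \<le> (cmod ?e - cmod (zr i))\<^sup>2" by simp
      then show ?thesis unfolding power2_sum power2_diff by linarith
    qed
    finally show ?thesis using quantize_error[of ?y] by linarith
  qed
  have "qmf_dist g f h N w (qmf_out g f h N w zr zd m) m ?l \<le>
     (\<Sum>i<2 * N. if i < N then (cmod (zd i))\<^sup>2 + (2 * (cmod (zr i))\<^sup>2 + 1) else (cmod (zd i))\<^sup>2)"
    unfolding qmf_dist_def by (intro sum_mono) (auto simp: qmf_out_def lab)
  also have "\<dots> = (\<Sum>i<2 * N. (cmod (zd i))\<^sup>2 + (if i < N then 2 * (cmod (zr i))\<^sup>2 + 1 else 0))"
    by (intro sum.cong) auto
  also have "\<dots> = (\<Sum>i<2 * N. (cmod (zd i))\<^sup>2) + ((\<Sum>i<N. 2 * (cmod (zr i))\<^sup>2 + 1) + (\<Sum>i\<in>{N..<2 * N}. 0))"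
    by (simp only: sum.distrib sum_two_halves)
  finally show ?thesis by (simp add: sum.distrib sum_distrib_left)
qed

text \<open>Union bound in pointwise form: either noise is large, or a wrong pair of message and
  label lies within the threshold and its term exp (17 N - d) is at least 1. The true label is kept
  apart because its relay codeword is not independent of the output.\<close>

lemma qmf_error_union:
  fixes g f h :: complex and p c \<rho> :: real and m N :: nat
  assumes m: "m < M"
  defines "g' \<equiv> g * complex_of_real (\<rho> powr (p / 2))" and "f' \<equiv> f * complex_of_real (\<rho> powr (p / 2))"
    and "h' \<equiv> h * complex_of_real (\<rho> powr (c / 2))"
  defines "d \<equiv> \<lambda>w zr zd. qmf_dist g' f' h' N w (qmf_out g' f' h' N w zr zd m)"
  assumes wrong: "\<not> decoded p p c \<rho> (qmf_code p c \<rho> N M) g f h w v zr zd m"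
  shows "1 \<le> indicator {z. 4 * real (2 * N) < (\<Sum>i<2 * N. (cmod (z i))\<^sup>2)} zd + indicator {z. 4 * real N < (\<Sum>i<N. (cmod (z i))\<^sup>2)} zr +
     ennreal (exp (17 * real N)) * (\<Sum>m'\<in>{..<M} - {m}. ennreal (exp (- d w zr zd m' (qmf_label g' N w zr m))) +
      (\<integral>\<^sup>+l. ennreal (exp (- d w zr zd m' l)) * indicator {l. l \<noteq> qmf_label g' N w zr m} l \<partial>count_space {l. length l = N}))"
    (is "1 \<le> ?I1 + ?I2 + ennreal (exp (17 * real N)) * (\<Sum>m'\<in>_. ?A m')")
proof -
  let ?view = "(w, (g, f, h), \<lambda>i. if i < 2 * N then qmf_out g' f' h' N w zr zd m i else 0)"
  have test: "qmf_test p c \<rho> N m' ?view \<longleftrightarrow> (\<exists>l. length l = N \<and> d w zr zd m' l \<le> 17 * real N)" for m'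
    unfolding qmf_test_def d_def prod.case g'_def[symmetric] f'_def[symmetric] h'_def[symmetric]
    by (intro ex_cong1 conj_cong refl arg_cong2[where f="(\<le>)"] qmf_dist_cong) simp
  have dec: "test_decoder M (qmf_test p c \<rho> N) ?view \<noteq> m"
    using wrong unfolding decoded_qmf[OF m] g'_def f'_def h'_def .
  show ?thesis
  proof (cases "?I1 = 1 \<or> ?I2 = 1")
    case True
    then show ?thesis by (auto simp: add_increasing2 add_increasing add.assoc)
  next
    case False
    then have zd: "(\<Sum>i<2 * N. (cmod (zd i))\<^sup>2) \<le> 8 * real N" and zr: "(\<Sum>i<N. (cmod (zr i))\<^sup>2) \<le> 4 * real N"
      by (auto simp: indicator_def split: if_splits)
    have "d w zr zd m (qmf_label g' N w zr m) \<le> 17 * real N"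
      using qmf_true_dist[of g' f' h' N w zr zd m] zd zr unfolding d_def by linarith
    then have "qmf_test p c \<rho> N m ?view" unfolding test using qmf_label_length by blast
    from test_decoder_wrong[OF dec m this] obtain m' l where
      m': "m' < M" "m' \<noteq> m" and l: "length l = N" "d w zr zd m' l \<le> 17 * real N"
      unfolding test by blast
    have ge: "1 \<le> ennreal (exp (17 * real N)) * ennreal (exp (- d w zr zd m' l))"
      using l(2) by (simp add: ennreal_mult[symmetric] exp_add[symmetric] ennreal_ge_1)
    have "ennreal (exp (- d w zr zd m' l)) \<le> ?A m'"
    proof (cases "l = qmf_label g' N w zr m")
      case True
      then show ?thesis by (simp add: add_increasing2)
    next
      case False
      have "ennreal (exp (- d w zr zd m' l)) = (\<integral>\<^sup>+l'. ennreal (exp (- d w zr zd m' l)) * indicator {l} l' \<partial>count_space {l. length l = N})"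
        using l(1) by (simp add: nn_integral_cmult_indicator)
      also have "\<dots> \<le> (\<integral>\<^sup>+l. ennreal (exp (- d w zr zd m' l)) * indicator {l. l \<noteq> qmf_label g' N w zr m} l \<partial>count_space {l. length l = N})"
        using False by (intro nn_integral_mono) (auto simp: indicator_def)
      finally show ?thesis by (simp add: add_increasing)
    qed
    also have "\<dots> \<le> (\<Sum>m'\<in>{..<M} - {m}. ?A m')"
      using m' by (intro member_le_sum) auto
    finally have "ennreal (exp (17 * real N)) * ennreal (exp (- d w zr zd m' l)) \<le>
        ennreal (exp (17 * real N)) * (\<Sum>m'\<in>{..<M} - {m}. ?A m')"
      by (rule mult_left_mono) simp
    with ge have "1 \<le> ennreal (exp (17 * real N)) * (\<Sum>m'\<in>{..<M} - {m}. ?A m')"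
      by (rule order.trans)
    then show ?thesis by (simp add: add_increasing)
  qed
qed


lemma measurable_count_integral:
  assumes "countable A" "\<And>k. k \<in> A \<Longrightarrow> f k \<in> borel_measurable M"
  shows "(\<lambda>x. \<integral>\<^sup>+k. f k x \<partial>count_space A) \<in> borel_measurable M"
proof -
  interpret sigma_finite_measure "count_space A"
    by (rule sigma_finite_measure_count_space_countable) fact
  have "(\<lambda>(k, x). f k x) \<in> borel_measurable (count_space A \<Otimes>\<^sub>M M)"
    using assms by (intro measurable_pair_measure_countable1) auto
  then have "(\<lambda>(x, k). f k x) \<in> borel_measurable (M \<Otimes>\<^sub>M count_space A)"
    by (subst measurable_pair_swap_iff) (simp add: split_beta')
  then show ?thesis by (rule borel_measurable_nn_integral)
qed

text \<open>\<open>T1\<close> and \<open>T2\<close> are the two cuts at t = 1/2. In their common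
  left side s pays for the messages, K for the labels, 17 for the threshold and 1 for the decay exp
  (- N).\<close>

lemma qmf_conditional_error:
  fixes g f h :: complex and p c \<rho> :: real
  assumes N: "0 < N" and m: "m < M" and K: "1 \<le> K"
    "\<And>a. (\<integral>\<^sup>+k. ennreal (exp (- (cmod (label_point k - a))\<^sup>2)) \<partial>count_space UNIV) \<le> ennreal K"
  defines "G \<equiv> (cmod (g * complex_of_real (\<rho> powr (p / 2))))\<^sup>2" and "F \<equiv> (cmod (f * complex_of_real (\<rho> powr (p / 2))))\<^sup>2"
    and "H \<equiv> (cmod (h * complex_of_real (\<rho> powr (c / 2))))\<^sup>2"
  assumes M: "real M \<le> exp (real N * s)"
    and T1: "K * exp (18 + s) \<le> (1 + H) * (1 + H + G)" and T2: "K * exp (18 + s) \<le> (1 + H) * (1 + H + F)"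
  shows "(\<integral>\<^sup>+w. \<integral>\<^sup>+v. \<integral>\<^sup>+zr. \<integral>\<^sup>+zd. indicator {m. \<not> decoded p p c \<rho> (qmf_code p c \<rho> N M) g f h w v zr zd m} m
        \<partial>iid_CN \<partial>iid_CN \<partial>iid_CN \<partial>iid_CN) \<le> ennreal (4 * exp (- real N))"
proof -
  interpret relay_code p p c \<rho> "qmf_code p c \<rho> N M"
    by standard (use N m in \<open>auto intro: valid_qmf_code\<close>)
  let ?C = "qmf_code p c \<rho> N M"
  define g' f' h' where "g' = g * complex_of_real (\<rho> powr (p / 2))" and "f' = f * complex_of_real (\<rho> powr (p / 2))"
    and "h' = h * complex_of_real (\<rho> powr (c / 2))"
  define d where "d w zr zd = qmf_dist g' f' h' N w (qmf_out g' f' h' N w zr zd m)" for w zr zd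
  let ?lab = "\<lambda>w zr. qmf_label g' N w zr m"
  let ?L = "{l :: label. length l = N}"
  define A where "A w zr zd m' = ennreal (exp (- d w zr zd m' (?lab w zr)))" for w zr zd m'
  define B where "B w zr zd m' = (\<integral>\<^sup>+l. ennreal (exp (- d w zr zd m' l)) * indicator {l. l \<noteq> ?lab w zr} l \<partial>count_space ?L)" for w zr zd m'
  let ?I1 = "\<lambda>zd. indicator {z. 4 * real (2 * N) < (\<Sum>i<2 * N. (cmod (z i))\<^sup>2)} zd :: ennreal"
  let ?I2 = "\<lambda>zr. indicator {z. 4 * real N < (\<Sum>i<N. (cmod (z i))\<^sup>2)} zr :: ennreal"
  let ?J = "\<lambda>w v zr zd. indicator {m. \<not> decoded p p c \<rho> ?C g f h w v zr zd m} m :: ennreal"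
  have A_m: "(\<lambda>w. A w zr zd m') \<in> borel_measurable cseq_borel" for zr zd m'
  proof -
    have [measurable]: "(\<lambda>w. d w zr zd m' (?lab w zr)) \<in> borel_measurable cseq_borel"
      unfolding d_def by (rule measurable_qmf_dist) measurable
    show ?thesis unfolding A_def by measurable
  qed
  have B_m: "(\<lambda>w. B w zr zd m') \<in> borel_measurable cseq_borel" for zr zd m'
    unfolding B_def
  proof (rule measurable_count_integral)
    fix l
    have [measurable]: "(\<lambda>w. d w zr zd m' l) \<in> borel_measurable cseq_borel"
      unfolding d_def by (rule measurable_qmf_dist) measurable
    show "(\<lambda>w. ennreal (exp (- d w zr zd m' l)) * indicator {l. l \<noteq> ?lab w zr} l) \<in> borel_measurable cseq_borel"
      unfolding indicator_def by measurable
  qed simp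
  have J_m: "(\<lambda>x. ?J (w x) (v x) (zr x) (zd x)) \<in> borel_measurable N'"
    if [measurable]: "w \<in> measurable N' cseq_borel" "v \<in> measurable N' cseq_borel"
      "zr \<in> measurable N' cseq_borel" "zd \<in> measurable N' cseq_borel" for N' :: "'x measure" and w v zr zd
    unfolding indicator_def by measurable
  have pos: "0 < 1 + H" "0 < 1 + H + G" "0 < 1 + H + F"
    unfolding H_def G_def F_def by (simp_all add: add_pos_nonneg)
  define T where "T = K * exp (18 + s)"
  have T: "0 < T" using K(1) by (simp add: T_def)
  have wrong_le: "ennreal (exp (17 * real N)) * (\<Sum>m'\<in>{..<M} - {m}. (\<integral>\<^sup>+w. A w zr zd m' \<partial>iid_CN) + (\<integral>\<^sup>+w. B w zr zd m' \<partial>iid_CN))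
    \<le> ennreal (2 * exp (- real N))" for zr zd
  proof -
    have a: "(\<integral>\<^sup>+w. A w zr zd m' \<partial>iid_CN) \<le> ennreal ((K / T) ^ N)" if "m' \<in> {..<M} - {m}" for m'
    proof -
      have "(\<integral>\<^sup>+w. A w zr zd m' \<partial>iid_CN) \<le> ennreal (1 / (1 + H + G)) ^ N * ennreal (1 / (1 + H)) ^ N"
        unfolding A_def d_def H_def G_def h'_def[symmetric] g'_def[symmetric]
        using that by (intro qmf_confusion_same_label) auto
      also have "\<dots> = ennreal ((1 / ((1 + H) * (1 + H + G))) ^ N)"
        using pos by (simp add: ennreal_power ennreal_mult[symmetric] power_mult_distrib[symmetric] mult.commute)
      also have "\<dots> \<le> ennreal ((K / T) ^ N)"
        using pos T K(1) T1 unfolding T_def[symmetric]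
        by (intro ennreal_leI power_mono frac_le) auto
      finally show ?thesis .
    qed
    have b: "(\<integral>\<^sup>+w. B w zr zd m' \<partial>iid_CN) \<le> ennreal ((K / T) ^ N)" if "m' \<in> {..<M} - {m}" for m'
    proof -
      have "(\<integral>\<^sup>+w. B w zr zd m' \<partial>iid_CN) \<le> ennreal (K / (1 + H)) ^ N * ennreal (1 / (1 + H + F)) ^ N"
        unfolding B_def d_def H_def F_def h'_def[symmetric] f'_def[symmetric]
        using that K by (intro qmf_confusion_other_label) auto
      also have "\<dots> = ennreal ((K / ((1 + H) * (1 + H + F))) ^ N)"
        using pos K(1) by (simp add: ennreal_power ennreal_mult[symmetric] power_mult_distrib[symmetric])
      also have "\<dots> \<le> ennreal ((K / T) ^ N)"
        using pos T K(1) T2 unfolding T_def[symmetric]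
        by (intro ennreal_leI power_mono frac_le) auto
      finally show ?thesis .
    qed
    have "(\<Sum>m'\<in>{..<M} - {m}. (\<integral>\<^sup>+w. A w zr zd m' \<partial>iid_CN) + (\<integral>\<^sup>+w. B w zr zd m' \<partial>iid_CN)) \<le>
      (\<Sum>m'\<in>{..<M} - {m}. ennreal ((K / T) ^ N) + ennreal ((K / T) ^ N))"
      by (intro sum_mono add_mono a b)
    also have "\<dots> \<le> (\<Sum>m'\<in>{..<M}. ennreal ((K / T) ^ N) + ennreal ((K / T) ^ N))"
      by (intro sum_mono2) auto
    also have "\<dots> = ennreal (real M * (2 * (K / T) ^ N))"
      using K(1) T by (simp add: ennreal_plus[symmetric] ennreal_of_nat_eq_real_of_nat ennreal_mult[symmetric] del: ennreal_plus)
    finally have "ennreal (exp (17 * real N)) * (\<Sum>m'\<in>{..<M} - {m}. (\<integral>\<^sup>+w. A w zr zd m' \<partial>iid_CN) + (\<integral>\<^sup>+w. B w zr zd m' \<partial>iid_CN)) \<le>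
       ennreal (exp (17 * real N)) * ennreal (real M * (2 * (K / T) ^ N))" by (rule mult_left_mono) simp
    also have "\<dots> = ennreal (exp (17 * real N) * (real M * (2 * (K / T) ^ N)))"
      using K(1) T by (simp add: ennreal_mult[symmetric])
    also have "\<dots> \<le> ennreal (2 * exp (- real N))"
    proof (rule ennreal_leI)
      have "K / T = exp (- (18 + s))"
        using K(1) by (simp only: T_def exp_minus) (simp add: divide_inverse)
      then have "(K / T) ^ N = exp (real N * (- (18 + s)))"
        by (simp only: exp_of_nat_mult)
      then have "exp (17 * real N) * (real M * (2 * (K / T) ^ N)) \<le> exp (17 * real N) * (exp (real N * s) * (2 * exp (real N * (- (18 + s)))))"
        using M by (intro mult_left_mono mult_right_mono) auto
      also have "\<dots> = 2 * exp (- real N)"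
        by (simp add: exp_add[symmetric] algebra_simps)
      finally show "exp (17 * real N) * (real M * (2 * (K / T) ^ N)) \<le> 2 * exp (- real N)" .
    qed
    finally show ?thesis .
  qed
  have indep_v: "?J w v zr zd = ?J w (\<lambda>_. 0) zr zd" for w v zr zd
    by (simp add: decoded_qmf[OF m] indicator_def)
  have "(\<integral>\<^sup>+w. \<integral>\<^sup>+v. \<integral>\<^sup>+zr. \<integral>\<^sup>+zd. ?J w v zr zd \<partial>iid_CN \<partial>iid_CN \<partial>iid_CN \<partial>iid_CN) =
    (\<integral>\<^sup>+w. \<integral>\<^sup>+zr. \<integral>\<^sup>+zd. ?J w (\<lambda>_. 0) zr zd \<partial>iid_CN \<partial>iid_CN \<partial>iid_CN)"
    by (subst indep_v) simp
  \<comment> \<open>The codebook average is moved innermost: for fixed noises the union bound is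
    integrated over the seed alone.\<close>
  also have "\<dots> = (\<integral>\<^sup>+zr. \<integral>\<^sup>+w. \<integral>\<^sup>+zd. ?J w (\<lambda>_. 0) zr zd \<partial>iid_CN \<partial>iid_CN \<partial>iid_CN)"
    by (rule nn_integral_swap[OF prob_space_iid_CN prob_space_iid_CN]) (use J_m in measurable)
  also have "\<dots> = (\<integral>\<^sup>+zr. \<integral>\<^sup>+zd. \<integral>\<^sup>+w. ?J w (\<lambda>_. 0) zr zd \<partial>iid_CN \<partial>iid_CN \<partial>iid_CN)"
    by (rule nn_integral_cong, rule nn_integral_swap[OF prob_space_iid_CN prob_space_iid_CN]) (use J_m in measurable)
  also have "\<dots> \<le> (\<integral>\<^sup>+zr. \<integral>\<^sup>+zd. ?I1 zd + (?I2 zr + ennreal (2 * exp (- real N))) \<partial>iid_CN \<partial>iid_CN)"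
  proof (rule nn_integral_mono, rule nn_integral_mono)
    fix zr zd
    have "(\<integral>\<^sup>+w. ?J w (\<lambda>_. 0) zr zd \<partial>iid_CN) \<le>
      (\<integral>\<^sup>+w. ?I1 zd + (?I2 zr + ennreal (exp (17 * real N)) * (\<Sum>m'\<in>{..<M} - {m}. A w zr zd m' + B w zr zd m')) \<partial>iid_CN)"
    proof (rule nn_integral_mono)
      fix w
      show "?J w (\<lambda>_. 0) zr zd \<le> ?I1 zd + (?I2 zr + ennreal (exp (17 * real N)) * (\<Sum>m'\<in>{..<M} - {m}. A w zr zd m' + B w zr zd m'))"
      proof (cases "decoded p p c \<rho> ?C g f h w (\<lambda>_. 0) zr zd m")
        case False
        show ?thesis
          using False qmf_error_union[OF m False] unfolding A_def B_def d_def g'_def f'_def h'_def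
          by (simp add: add.assoc)
      qed simp
    qed
    also have "\<dots> = ?I1 zd + (?I2 zr + ennreal (exp (17 * real N)) *
        (\<Sum>m'\<in>{..<M} - {m}. (\<integral>\<^sup>+w. A w zr zd m' \<partial>iid_CN) + (\<integral>\<^sup>+w. B w zr zd m' \<partial>iid_CN)))"
      using A_m B_m by (simp add: nn_integral_add nn_integral_cmult nn_integral_sum)
    also have "\<dots> \<le> ?I1 zd + (?I2 zr + ennreal (2 * exp (- real N)))"
      by (intro add_left_mono wrong_le)
    finally show "(\<integral>\<^sup>+w. ?J w (\<lambda>_. 0) zr zd \<partial>iid_CN) \<le> ?I1 zd + (?I2 zr + ennreal (2 * exp (- real N)))" .
  qed
  also have "\<dots> = (\<integral>\<^sup>+zd. ?I1 zd \<partial>iid_CN) + ((\<integral>\<^sup>+zr. ?I2 zr \<partial>iid_CN) + ennreal (2 * exp (- real N)))"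
  proof -
    have [measurable]: "(\<lambda>z. z i) \<in> borel_measurable cseq_borel" for i
      by (rule measurable_cseq_component) simp
    have [measurable]: "?I1 \<in> borel_measurable cseq_borel" "?I2 \<in> borel_measurable cseq_borel"
      unfolding indicator_def by measurable
    show ?thesis by (simp add: nn_integral_add)
  qed
  also have "\<dots> \<le> ennreal (exp (- real (2 * N))) + (ennreal (exp (- real N)) + ennreal (2 * exp (- real N)))"
    by (intro add_mono iid_noise_tail order.refl)
  also have "\<dots> \<le> ennreal (4 * exp (- real N))"
    by (simp add: ennreal_plus[symmetric] del: ennreal_plus)
  finally show ?thesis .
qed

section \<open>Probability of small gains and small products of gains\<close>

definition inv_moment :: "real \<Rightarrow> real" where
  "inv_moment s = enn2real (\<integral>\<^sup>+z. ennreal ((cmod z)\<^sup>2 powr (- s)) \<partial>CN)"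

lemma inv_moment_nonneg: "0 \<le> inv_moment s"
  by (simp add: inv_moment_def)

lemma nn_integral_inv_moment:
  assumes "0 < s" "s < 1"
  shows "(\<integral>\<^sup>+z. ennreal ((cmod z)\<^sup>2 powr (- s)) \<partial>CN) = ennreal (inv_moment s)"
proof -
  from CN_inverse_moment_finite[OF assms] obtain K where "(\<integral>\<^sup>+z. ennreal ((cmod z)\<^sup>2 powr (- s)) \<partial>CN) \<le> ennreal K" .
  then have "(\<integral>\<^sup>+z. ennreal ((cmod z)\<^sup>2 powr (- s)) \<partial>CN) < \<top>"
    using ennreal_less_top le_less_trans by blast
  then show ?thesis by (simp add: inv_moment_def)
qed

lemma markov_powr:
  fixes u x t s :: real
  assumes "0 < s" "0 < u" "0 < x" "u * x \<le> t"
  shows "1 \<le> (t / x) powr s * u powr (- s)"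
proof -
    have "1 \<le> t / (x * u)" using assms by (simp add: mult.commute pos_le_divide_eq)
    then have "1 \<le> (t / x / u) powr s" using assms by (simp add: ge_one_powr_ge_zero)
    also have "\<dots> = (t / x) powr s * u powr (- s)"
      using assms by (subst powr_divide) (auto simp: powr_minus divide_inverse intro: order.trans[of 0 "u * x"])
    finally show ?thesis .
qed

text \<open>Since 0 powr (- s) = 0, the pointwise bound \<open>markov_powr\<close> fails at z = 0;
  this point is discarded as a null set.\<close>

lemma CN_nonzero: "AE z in CN. z \<noteq> 0"
  proof -
    have "emeasure CN {z. (cmod z)\<^sup>2 \<le> 0} = 0"
    proof -
      have "emeasure CN {0} = (\<integral>\<^sup>+z. indicator {0} z \<partial>CN)" by simp
      also have "\<dots> = (\<integral>\<^sup>+x. \<integral>\<^sup>+y. indicator {0} (Complex x y) \<partial>half_normal \<partial>half_normal)"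
        by (subst nn_integral_CN) simp_all
      also have "\<dots> \<le> (\<integral>\<^sup>+x. \<integral>\<^sup>+y. indicator {0} x \<partial>half_normal \<partial>half_normal)"
        by (intro nn_integral_mono) (auto simp: indicator_def Complex_eq_0)
      also have "\<dots> = emeasure half_normal {0}"
        using prob_space.emeasure_space_1[OF prob_space_half_normal] by simp
      also have "\<dots> = 0"
        by (simp add: emeasure_density nn_integral_0_iff_AE)
      finally show ?thesis by simp
    qed
    then show ?thesis by (auto simp: AE_iff_null null_sets_def)
  qed

lemma CN_small_gain:
  assumes s: "0 < s" "s < 1" and pos: "0 < x" "0 < t"
  shows "(\<integral>\<^sup>+h. indicator {h. (cmod h)\<^sup>2 * x \<le> t} h \<partial>CN) \<le> ennreal (inv_moment s * (t / x) powr s)"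
proof -
  define Q where "Q z = ennreal ((cmod z)\<^sup>2 powr (- s))" for z
  have [measurable]: "Q \<in> borel_measurable borel" unfolding Q_def by measurable
  have Q: "(\<integral>\<^sup>+z. Q z \<partial>CN) = ennreal (inv_moment s)"
    unfolding Q_def by (rule nn_integral_inv_moment[OF s])
  have "(\<integral>\<^sup>+h. indicator {h. (cmod h)\<^sup>2 * x \<le> t} h \<partial>CN) \<le> (\<integral>\<^sup>+h. ennreal ((t / x) powr s) * Q h \<partial>CN)"
  proof (rule nn_integral_mono_AE, rule eventually_mono[OF CN_nonzero])
    fix h :: complex assume "h \<noteq> 0"
    then show "indicator {h. (cmod h)\<^sup>2 * x \<le> t} h \<le> ennreal ((t / x) powr s) * Q h"
      using markov_powr[OF s(1), of "(cmod h)\<^sup>2" x t] pos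
      by (auto simp: indicator_def Q_def ennreal_mult[symmetric] ennreal_ge_1)
  qed
  also have "\<dots> = ennreal ((t / x) powr s) * (\<integral>\<^sup>+h. Q h \<partial>CN)" by (rule nn_integral_cmult) simp
  also have "\<dots> = ennreal ((t / x) powr s) * ennreal (inv_moment s)"
    unfolding Q ..
  finally show ?thesis using inv_moment_nonneg by (simp add: ennreal_mult[symmetric] mult.commute)
qed

text \<open>Conditioning on g turns the event into a small gain of h with the threshold divided by
  |g|^2, and the resulting power of |g| is integrated by the same moment. In this way the exponents
  of the links add up.\<close>

lemma CN_small_gain_product:
  assumes s: "0 < s" "s < 1" and pos: "0 < x" "0 < y" "0 < t"
  shows "(\<integral>\<^sup>+g. \<integral>\<^sup>+h. indicator {(g, h). (cmod g)\<^sup>2 * x * ((cmod h)\<^sup>2 * y) \<le> t} (g, h) \<partial>CN \<partial>CN) \<le> ennreal ((inv_moment s)\<^sup>2 * (t / (x * y)) powr s)"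
proof -
  define Q where "Q z = ennreal ((cmod z)\<^sup>2 powr (- s))" for z
  have [measurable]: "Q \<in> borel_measurable borel" unfolding Q_def by measurable
  have Q: "(\<integral>\<^sup>+z. Q z \<partial>CN) = ennreal (inv_moment s)"
    unfolding Q_def by (rule nn_integral_inv_moment[OF s])
  have "(\<integral>\<^sup>+g. \<integral>\<^sup>+h. indicator {(g, h). (cmod g)\<^sup>2 * x * ((cmod h)\<^sup>2 * y) \<le> t} (g, h) \<partial>CN \<partial>CN) \<le>
    (\<integral>\<^sup>+g. ennreal (inv_moment s * (t / (x * y)) powr s) * Q g \<partial>CN)"
  proof (rule nn_integral_mono_AE, rule eventually_mono[OF CN_nonzero])
    fix g :: complex assume g: "g \<noteq> 0"
    then have g2: "0 < (cmod g)\<^sup>2" by simp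
    have "(\<integral>\<^sup>+h. indicator {(g, h). (cmod g)\<^sup>2 * x * ((cmod h)\<^sup>2 * y) \<le> t} (g, h) \<partial>CN) =
      (\<integral>\<^sup>+h. indicator {h. (cmod h)\<^sup>2 * ((cmod g)\<^sup>2 * x * y) \<le> t} h \<partial>CN)"
      by (intro nn_integral_cong) (simp add: indicator_def mult_ac)
    also have "\<dots> \<le> ennreal (inv_moment s * (t / ((cmod g)\<^sup>2 * x * y)) powr s)"
      using pos g2 by (intro CN_small_gain s) auto
    also have "\<dots> = ennreal (inv_moment s * (t / (x * y)) powr s) * Q g"
    proof -
      have "(t / ((cmod g)\<^sup>2 * x * y)) powr s = (t / (x * y) / (cmod g)\<^sup>2) powr s" by (simp add: mult_ac)
      also have "\<dots> = (t / (x * y)) powr s * (cmod g)\<^sup>2 powr (- s)"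
        using pos by (subst powr_divide) (auto simp: powr_minus divide_inverse)
      finally show ?thesis using inv_moment_nonneg by (simp add: Q_def ennreal_mult[symmetric] mult_ac)
    qed
    finally show "(\<integral>\<^sup>+h. indicator {(g, h). (cmod g)\<^sup>2 * x * ((cmod h)\<^sup>2 * y) \<le> t} (g, h) \<partial>CN) \<le> \<dots>" .
  qed
  also have "\<dots> = ennreal (inv_moment s * (t / (x * y)) powr s) * (\<integral>\<^sup>+h. Q h \<partial>CN)" by (rule nn_integral_cmult) simp
  also have "\<dots> \<le> ennreal (inv_moment s * (t / (x * y)) powr s) * ennreal (inv_moment s)"
    unfolding Q ..
  finally show ?thesis using inv_moment_nonneg by (simp add: ennreal_mult[symmetric] mult_ac power2_eq_square)
qed

lemma CN_small_gain_product3: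
  assumes s: "0 < s" "s < 1" and pos: "0 < x" "0 < y" "0 < z" "0 < t"
  shows "(\<integral>\<^sup>+g. \<integral>\<^sup>+f. \<integral>\<^sup>+h. indicator {(g, f, h). (cmod g)\<^sup>2 * x * ((cmod f)\<^sup>2 * y) * ((cmod h)\<^sup>2 * z) \<le> t} (g, f, h) \<partial>CN \<partial>CN \<partial>CN)
        \<le> ennreal (inv_moment s ^ 3 * (t / (x * y * z)) powr s)"
proof -
  define Q where "Q z = ennreal ((cmod z)\<^sup>2 powr (- s))" for z
  have [measurable]: "Q \<in> borel_measurable borel" unfolding Q_def by measurable
  have Q: "(\<integral>\<^sup>+z. Q z \<partial>CN) = ennreal (inv_moment s)"
    unfolding Q_def by (rule nn_integral_inv_moment[OF s])
  have "(\<integral>\<^sup>+g. \<integral>\<^sup>+f. \<integral>\<^sup>+h. indicator {(g, f, h). (cmod g)\<^sup>2 * x * ((cmod f)\<^sup>2 * y) * ((cmod h)\<^sup>2 * z) \<le> t} (g, f, h) \<partial>CN \<partial>CN \<partial>CN) \<le>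
    (\<integral>\<^sup>+g. ennreal ((inv_moment s)\<^sup>2 * (t / (x * y * z)) powr s) * Q g \<partial>CN)"
  proof (rule nn_integral_mono_AE, rule eventually_mono[OF CN_nonzero])
    fix g :: complex assume g: "g \<noteq> 0"
    then have g2: "0 < (cmod g)\<^sup>2" by simp
    have "(\<integral>\<^sup>+f. \<integral>\<^sup>+h. indicator {(g, f, h). (cmod g)\<^sup>2 * x * ((cmod f)\<^sup>2 * y) * ((cmod h)\<^sup>2 * z) \<le> t} (g, f, h) \<partial>CN \<partial>CN) =
      (\<integral>\<^sup>+f. \<integral>\<^sup>+h. indicator {(f, h). (cmod f)\<^sup>2 * ((cmod g)\<^sup>2 * x * y) * ((cmod h)\<^sup>2 * z) \<le> t} (f, h) \<partial>CN \<partial>CN)"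
      by (intro nn_integral_cong) (simp add: indicator_def mult_ac)
    also have "\<dots> \<le> ennreal ((inv_moment s)\<^sup>2 * (t / ((cmod g)\<^sup>2 * x * y * z)) powr s)"
      using pos g2 by (intro CN_small_gain_product s) auto
    also have "\<dots> = ennreal ((inv_moment s)\<^sup>2 * (t / (x * y * z)) powr s) * Q g"
    proof -
      have "(t / ((cmod g)\<^sup>2 * x * y * z)) powr s = (t / (x * y * z) / (cmod g)\<^sup>2) powr s" by (simp add: mult_ac)
      also have "\<dots> = (t / (x * y * z)) powr s * (cmod g)\<^sup>2 powr (- s)"
        using pos by (subst powr_divide) (auto simp: powr_minus divide_inverse)
      finally show ?thesis using inv_moment_nonneg by (simp add: Q_def ennreal_mult[symmetric] mult_ac)
    qed
    finally show "(\<integral>\<^sup>+f. \<integral>\<^sup>+h. indicator {(g, f, h). (cmod g)\<^sup>2 * x * ((cmod f)\<^sup>2 * y) * ((cmod h)\<^sup>2 * z) \<le> t} (g, f, h) \<partial>CN \<partial>CN) \<le> \<dots>" .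
  qed
  also have "\<dots> = ennreal ((inv_moment s)\<^sup>2 * (t / (x * y * z)) powr s) * (\<integral>\<^sup>+h. Q h \<partial>CN)" by (rule nn_integral_cmult) simp
  also have "\<dots> \<le> ennreal ((inv_moment s)\<^sup>2 * (t / (x * y * z)) powr s) * ennreal (inv_moment s)"
    unfolding Q ..
  finally show ?thesis using inv_moment_nonneg by (simp add: ennreal_mult[symmetric] mult_ac power2_eq_square power3_eq_cube)
qed


lemma norm_scaled_sq: "(cmod (z * complex_of_real (\<rho> powr (x / 2))))\<^sup>2 = (cmod z)\<^sup>2 * \<rho> powr x"
  by (simp add: norm_mult power_mult_distrib power2_eq_square[of "\<rho> powr _"] powr_add[symmetric])

lemma (in relay_code) avg_error_le_one: "avg_error a b c \<rho> C \<le> 1"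
proof -
  interpret ch: prob_space channel_space by (rule prob_space_channel_space)
  have "(\<Sum>m<M. measure channel_space (error_event a b c \<rho> C m)) \<le> (\<Sum>m<M. 1)"
    by (intro sum_mono) simp
  then show ?thesis using M_pos by (simp add: avg_error_def pos_divide_le_eq)
qed

text \<open>Both relay links have the exponent p, so the two cut conditions fail with the same
  probability, hence 2 \<pi>.\<close>

lemma qmf_avg_error:
  fixes p c \<rho> :: real
  assumes N: "0 < N" and M: "0 < M" "real M \<le> exp (real N * s)" and K: "1 \<le> K"
    "\<And>a. (\<integral>\<^sup>+k. ennreal (exp (- (cmod (label_point k - a))\<^sup>2)) \<partial>count_space UNIV) \<le> ennreal K"
    and \<pi>: "0 \<le> \<pi>" and out: "(\<integral>\<^sup>+g. \<integral>\<^sup>+h. indicator {(g, h). (1 + (cmod h)\<^sup>2 * \<rho> powr c) *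
       (1 + (cmod h)\<^sup>2 * \<rho> powr c + (cmod g)\<^sup>2 * \<rho> powr p) < K * exp (18 + s)} (g, h) \<partial>CN \<partial>CN) \<le> ennreal \<pi>"
  shows "avg_error p p c \<rho> (qmf_code p c \<rho> N M) \<le> 4 * exp (- real N) + 2 * \<pi>"
proof -
  interpret relay_code p p c \<rho> "qmf_code p c \<rho> N M"
    by standard (use N M in \<open>auto intro: valid_qmf_code\<close>)
  define E where "E g h \<longleftrightarrow> (1 + (cmod h)\<^sup>2 * \<rho> powr c) *
       (1 + (cmod h)\<^sup>2 * \<rho> powr c + (cmod g)\<^sup>2 * \<rho> powr p) < K * exp (18 + s)" for g h :: complex
  have E_m [measurable]: "Measurable.pred A (\<lambda>x. E (g x) (h x))"
    if [measurable]: "g \<in> borel_measurable A" "h \<in> borel_measurable A" for A :: "'x measure" and g h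
    unfolding E_def by measurable
  have I_m [measurable]: "(\<lambda>x. indicator {(g, h). E g h} (g x, h x) :: ennreal) \<in> borel_measurable A"
    if [measurable]: "g \<in> borel_measurable A" "h \<in> borel_measurable A" for A :: "'x measure" and g h
    unfolding indicator_def by simp
  have "avg_error p p c \<rho> (qmf_code p c \<rho> N M) \<le> 4 * exp (- real N) + (\<pi> + \<pi>)"
  proof (rule avg_error_le)
    let ?O = "{(g, f, h). E g h \<or> E f h}"
    have "{x \<in> space (borel \<Otimes>\<^sub>M borel \<Otimes>\<^sub>M borel). E (fst x) (snd (snd x)) \<or> E (fst (snd x)) (snd (snd x))} \<in> sets (borel \<Otimes>\<^sub>M borel \<Otimes>\<^sub>M borel)"
      by measurable
    then show "?O \<in> sets (borel \<Otimes>\<^sub>M borel \<Otimes>\<^sub>M borel)"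
      by (simp add: space_pair_measure split_beta')
    show "(\<integral>\<^sup>+w. \<integral>\<^sup>+v. \<integral>\<^sup>+zr. \<integral>\<^sup>+zd. indicator {m. \<not> decoded p p c \<rho> (qmf_code p c \<rho> N M) g f h w v zr zd m} m
        \<partial>iid_CN \<partial>iid_CN \<partial>iid_CN \<partial>iid_CN) \<le> ennreal (4 * exp (- real N))"
      if "m < num_msgs (qmf_code p c \<rho> N M)" "(g, f, h) \<notin> ?O" for m g f h
      using that N K M(2) by (intro qmf_conditional_error[where s=s and K=K]) (auto simp: norm_scaled_sq E_def)
    have "(\<integral>\<^sup>+g. \<integral>\<^sup>+f. \<integral>\<^sup>+h. indicator ?O (g, f, h) \<partial>CN \<partial>CN \<partial>CN) \<le>
      (\<integral>\<^sup>+g. \<integral>\<^sup>+f. \<integral>\<^sup>+h. indicator {(g, h). E g h} (g, h) + indicator {(g, h). E g h} (f, h) \<partial>CN \<partial>CN \<partial>CN)"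
      by (intro nn_integral_mono) (auto simp: indicator_def)
    also have "\<dots> = (\<integral>\<^sup>+g. \<integral>\<^sup>+h. indicator {(g, h). E g h} (g, h) \<partial>CN \<partial>CN) + (\<integral>\<^sup>+f. \<integral>\<^sup>+h. indicator {(g, h). E g h} (f, h) \<partial>CN \<partial>CN)"
      using CN.emeasure_space_1 by (simp add: nn_integral_add)
    also have "\<dots> \<le> ennreal \<pi> + ennreal \<pi>"
      by (intro add_mono out[folded E_def])
    finally show "(\<integral>\<^sup>+g. \<integral>\<^sup>+f. \<integral>\<^sup>+h. indicator ?O (g, f, h) \<partial>CN \<partial>CN \<partial>CN) \<le> ennreal (\<pi> + \<pi>)"
      using \<pi> by (subst ennreal_plus)
  qed (use \<pi> in auto)
  then show ?thesis by simp
qed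

section \<open>The QMF code family\<close>

text \<open>Rounding down a number that is at least 1 loses at most a factor 2.\<close>

lemma floor_exp_messages:
  assumes "0 \<le> (x::real)"
  shows "0 < nat \<lfloor>exp x\<rfloor>" "real (nat \<lfloor>exp x\<rfloor>) \<le> exp x" "x - ln 2 \<le> ln (real (nat \<lfloor>exp x\<rfloor>))"
proof -
  have ge1: "1 \<le> exp x" using assms by simp
  then have fl: "1 \<le> \<lfloor>exp x\<rfloor>" by simp
  show "0 < nat \<lfloor>exp x\<rfloor>" using fl by linarith
  have pos: "0 < real_of_int \<lfloor>exp x\<rfloor>" using fl by linarith
  then have eq: "real (nat \<lfloor>exp x\<rfloor>) = of_int \<lfloor>exp x\<rfloor>" by (intro of_nat_nat) linarith
  show "real (nat \<lfloor>exp x\<rfloor>) \<le> exp x" unfolding eq by simp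
  have "exp x \<le> 2 * of_int \<lfloor>exp x\<rfloor>" using fl by linarith
  then have "ln (exp x) \<le> ln (2 * of_int \<lfloor>exp x\<rfloor>)" using pos by (subst ln_le_cancel_iff) auto
  also have "\<dots> = ln 2 + ln (of_int \<lfloor>exp x\<rfloor>)" 
  proof -
    have "ln (2 * y) = ln 2 + ln y" if "0 < y" for y :: real using that by (simp add: ln_mult)
    then show ?thesis using pos by blast
  qed
  finally show "x - ln 2 \<le> ln (real (nat \<lfloor>exp x\<rfloor>))" unfolding eq by simp
qed

lemma exp_block_le:
  assumes "1 \<le> \<rho>" "D \<le> k"
  shows "exp (- real (nat \<lceil>k * ln \<rho>\<rceil> + 1)) \<le> \<rho> powr (- D)"
proof -
  have "D * ln \<rho> \<le> k * ln \<rho>" using assms by (intro mult_right_mono) auto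
  also have "\<dots> \<le> real (nat \<lceil>k * ln \<rho>\<rceil> + 1)" by linarith
  finally show ?thesis using assms by (simp add: powr_def)
qed

text \<open>The alternatives for D reflect three ways to bound the error: a small product of a relay
  gain and the direct gain, a small direct gain alone, or the trivial bound 1. The family is fixed
  before D, as the limit in \<open>achieves\<close> requires.\<close>

lemma qmf_family:
  fixes p c r :: real
  assumes pc: "0 \<le> p" "0 \<le> c" and r: "0 \<le> r"
  obtains C where "code_family p r C" "\<And>\<rho>. static_qmf_half (C \<rho>)"
    "\<And>D. D < p + c - 2 * r \<or> D < c - r \<or> D < 0 \<Longrightarrow> \<exists>K. \<forall>\<^sub>F \<rho> in at_top. avg_error p p c \<rho> (C \<rho>) \<le> K * \<rho> powr (- D)"
proof -
  obtain K where K: "1 \<le> K"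
    "\<And>a. (\<integral>\<^sup>+k. ennreal (exp (- (cmod (label_point k - a))\<^sup>2)) \<partial>count_space UNIV) \<le> ennreal K"
    using sum_label_gauss_bound by blast
  \<comment> \<open>A half block of this length makes exp (- N) at most \<rho> powr (- D) for every
    D <= p + c + 1.\<close>
  define N where "N \<rho> = nat \<lceil>(p + c + 1) * ln \<rho>\<rceil> + 1" for \<rho> :: real
  \<comment> \<open>s counts nats per sample of a half block, hence the factor 2. The + 1 keeps the
    rate bounded away from 0 when r = 0.\<close>
  define s where "s \<rho> = 2 * (r * ln \<rho> + 1)" for \<rho> :: real
  define M where "M \<rho> = nat \<lfloor>exp (real (N \<rho>) * s \<rho>)\<rfloor>" for \<rho>
  define C where "C \<rho> = qmf_code p c \<rho> (N \<rho>) (M \<rho>)" for \<rho>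
  have N: "0 < N \<rho>" for \<rho> by (simp add: N_def)
  have s: "0 \<le> s \<rho>" if "1 \<le> \<rho>" for \<rho> using that r by (simp add: s_def)
  have M: "0 < M \<rho>" "real (M \<rho>) \<le> exp (real (N \<rho>) * s \<rho>)" "real (N \<rho>) * s \<rho> - ln 2 \<le> ln (real (M \<rho>))" if "1 \<le> \<rho>" for \<rho>
    unfolding M_def using s[OF that] by (intro floor_exp_messages mult_nonneg_nonneg, simp, simp)+
  have valid: "valid_code p \<rho> (C \<rho>)" if "1 \<le> \<rho>" for \<rho>
    unfolding C_def using N M[OF that] by (intro valid_qmf_code) auto
  have rate_bounds: "r * ln \<rho> + 1 / 2 \<le> rate (C \<rho>)" "rate (C \<rho>) \<le> r * ln \<rho> + 1" if "1 \<le> \<rho>" for \<rho>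
  proof -
    have n: "1 \<le> real (N \<rho>)" using N[of \<rho>] by linarith
    have "ln (real (M \<rho>)) \<le> ln (exp (real (N \<rho>) * s \<rho>))"
      using M[OF that] by (subst ln_le_cancel_iff) auto
    then have up: "ln (real (M \<rho>)) \<le> real (N \<rho>) * s \<rho>" by simp
    then show "rate (C \<rho>) \<le> r * ln \<rho> + 1"
      using n by (simp add: C_def rate_def s_def pos_divide_le_eq algebra_simps)
    have "real (N \<rho>) * s \<rho> - real (N \<rho>) \<le> real (N \<rho>) * s \<rho> - ln 2"
      using n ln_2_less_1 by linarith
    then have "real (N \<rho>) * s \<rho> - real (N \<rho>) \<le> ln (real (M \<rho>))" using M(3)[OF that] by linarith
    then show "r * ln \<rho> + 1 / 2 \<le> rate (C \<rho>)"
      using n by (simp add: C_def rate_def s_def pos_le_divide_eq algebra_simps)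
  qed
  have fam: "code_family p r C"
    unfolding code_family_def
  proof (intro conjI exI[of _ "1/2 :: real"])
    show "\<forall>\<^sub>F \<rho> in at_top. valid_code p \<rho> (C \<rho>)"
      using eventually_ge_at_top[of 1] by eventually_elim (rule valid)
    show "\<forall>\<^sub>F \<rho> in at_top. 1 / 2 \<le> rate (C \<rho>)"
      using eventually_ge_at_top[of 1]
    proof eventually_elim
      case (elim \<rho>)
      have "0 \<le> r * ln \<rho>" using r elim by simp
      then show ?case using rate_bounds(1)[OF elim] by linarith
    qed
    show "((\<lambda>\<rho>. rate (C \<rho>) / ln \<rho>) \<longlongrightarrow> r) at_top"
    proof (rule tendsto_sandwich)
      show "((\<lambda>\<rho>. (r * ln \<rho> + 1 / 2) / ln \<rho>) \<longlongrightarrow> r) at_top" by real_asymp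
      show "((\<lambda>\<rho>. (r * ln \<rho> + 1) / ln \<rho>) \<longlongrightarrow> r) at_top" by real_asymp
      show "\<forall>\<^sub>F \<rho> in at_top. (r * ln \<rho> + 1 / 2) / ln \<rho> \<le> rate (C \<rho>) / ln \<rho>"
        using eventually_ge_at_top[of 1] by eventually_elim (intro divide_right_mono rate_bounds, auto)
      show "\<forall>\<^sub>F \<rho> in at_top. rate (C \<rho>) / ln \<rho> \<le> (r * ln \<rho> + 1) / ln \<rho>"
        using eventually_ge_at_top[of 1] by eventually_elim (intro divide_right_mono rate_bounds, auto)
    qed
  qed simp
  define T where "T \<rho> = K * exp (18 + s \<rho>)" for \<rho>
  have T: "0 < T \<rho>" "T \<rho> = K * exp 20 * \<rho> powr (2 * r)" if "1 \<le> \<rho>" for \<rho>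
  proof -
    show "0 < T \<rho>" using K(1) by (simp add: T_def)
    have "exp (18 + s \<rho>) = exp 20 * exp (2 * r * ln \<rho>)"
      by (simp add: exp_add[symmetric] s_def algebra_simps)
    then show "T \<rho> = K * exp 20 * \<rho> powr (2 * r)" using that by (simp add: T_def powr_def)
  qed
  let ?O = "\<lambda>\<rho>. {(g, h). (1 + (cmod h)\<^sup>2 * \<rho> powr c) * (1 + (cmod h)\<^sup>2 * \<rho> powr c + (cmod g)\<^sup>2 * \<rho> powr p) < T \<rho>}"
  have avg: "avg_error p p c \<rho> (C \<rho>) \<le> 4 * exp (- real (N \<rho>)) + 2 * \<pi>"
    if "1 \<le> \<rho>" "0 \<le> \<pi>" "(\<integral>\<^sup>+g. \<integral>\<^sup>+h. indicator (?O \<rho>) (g, h) \<partial>CN \<partial>CN) \<le> ennreal \<pi>" for \<rho> \<pi>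
    unfolding C_def using that N M[OF that(1)] K by (intro qmf_avg_error[where s="s \<rho>" and K=K]) (auto simp: T_def)
  have achieves: "\<exists>K'. \<forall>\<^sub>F \<rho> in at_top. avg_error p p c \<rho> (C \<rho>) \<le> K' * \<rho> powr (- D)"
    if "\<And>\<rho>. 1 \<le> \<rho> \<Longrightarrow> (\<integral>\<^sup>+g. \<integral>\<^sup>+h. indicator (?O \<rho>) (g, h) \<partial>CN \<partial>CN) \<le> ennreal (B * \<rho> powr (- D))" "0 \<le> B" "D \<le> p + c + 1" for B D
  proof (rule exI[of _ "4 + 2 * B"], rule eventually_mono[OF eventually_ge_at_top[of 1]])
    fix \<rho> :: real assume \<rho>: "1 \<le> \<rho>"
    have "avg_error p p c \<rho> (C \<rho>) \<le> 4 * exp (- real (N \<rho>)) + 2 * (B * \<rho> powr (- D))"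
      using that(2) by (intro avg \<rho> that(1)[OF \<rho>]) auto
    also have "exp (- real (N \<rho>)) \<le> \<rho> powr (- D)"
      unfolding N_def by (rule exp_block_le[OF \<rho> that(3)])
    finally show "avg_error p p c \<rho> (C \<rho>) \<le> (4 + 2 * B) * \<rho> powr (- D)" by (simp add: algebra_simps)
  qed
  have "\<exists>K'. \<forall>\<^sub>F \<rho> in at_top. avg_error p p c \<rho> (C \<rho>) \<le> K' * \<rho> powr (- D)"
    if D: "D < p + c - 2 * r \<or> D < c - r \<or> D < 0" for D
  proof (cases "D \<le> 0")
    case True
    show ?thesis
    proof (rule exI[of _ 1], rule eventually_mono[OF eventually_ge_at_top[of 1]])
      fix \<rho> :: real assume \<rho>: "1 \<le> \<rho>"
      interpret relay_code p p c \<rho> "C \<rho>" by standard (rule valid[OF \<rho>])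
      have "\<rho> powr 0 \<le> \<rho> powr (- D)" using \<rho> True by (intro powr_mono) auto
      then have "1 \<le> \<rho> powr (- D)" using \<rho> by simp
      then show "avg_error p p c \<rho> (C \<rho>) \<le> 1 * \<rho> powr (- D)" using avg_error_le_one by linarith
    qed
  next
    case False
    define d where "d = (if D < p + c - 2 * r then p + c - 2 * r else c - r)"
    have d: "0 < D" "D < d" using D False by (auto simp: d_def)
    \<comment> \<open>The moment order below 1 for which the outage exponent d shrinks to exactly
      D.\<close>
    define \<sigma> where "\<sigma> = D / d"
    have \<sigma>: "0 < \<sigma>" "\<sigma> < 1" "\<sigma> * d = D" using d by (auto simp: \<sigma>_def)
    show ?thesis
    proof (cases "D < p + c - 2 * r")
      case True
      show ?thesis
      proof (rule achieves[of "(inv_moment \<sigma>)\<^sup>2 * (K * exp 20) powr \<sigma>"])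
        fix \<rho> :: real assume \<rho>: "1 \<le> \<rho>"
        have "(\<integral>\<^sup>+g. \<integral>\<^sup>+h. indicator (?O \<rho>) (g, h) \<partial>CN \<partial>CN) \<le>
          (\<integral>\<^sup>+g. \<integral>\<^sup>+h. indicator {(g, h). (cmod g)\<^sup>2 * \<rho> powr p * ((cmod h)\<^sup>2 * \<rho> powr c) \<le> T \<rho>} (g, h) \<partial>CN \<partial>CN)"
        proof (intro nn_integral_mono)
          fix g h :: complex
          let ?G = "(cmod g)\<^sup>2 * \<rho> powr p" and ?H = "(cmod h)\<^sup>2 * \<rho> powr c"
          have "x * y \<le> (1 + x) * (1 + x + y)" if "0 \<le> x" "0 \<le> y" for x y :: real
            using that by (intro mult_mono) auto
          from this[of ?H ?G] have "?H * ?G \<le> (1 + ?H) * (1 + ?H + ?G)" by simp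
          then show "indicator (?O \<rho>) (g, h) \<le> (indicator {(g, h). (cmod g)\<^sup>2 * \<rho> powr p * ((cmod h)\<^sup>2 * \<rho> powr c) \<le> T \<rho>} (g, h) :: ennreal)"
            by (auto simp: indicator_def mult.commute)
        qed
        also have "\<dots> \<le> ennreal ((inv_moment \<sigma>)\<^sup>2 * (T \<rho> / (\<rho> powr p * \<rho> powr c)) powr \<sigma>)"
          using \<rho> T by (intro CN_small_gain_product \<sigma>) auto
        also have "(T \<rho> / (\<rho> powr p * \<rho> powr c)) powr \<sigma> = (K * exp 20) powr \<sigma> * \<rho> powr (- D)"
        proof -
          have "T \<rho> / (\<rho> powr p * \<rho> powr c) = K * exp 20 * \<rho> powr (- d)"
            using \<rho> True by (simp add: T(2) d_def powr_add[symmetric] powr_diff[symmetric] powr_minus divide_inverse)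
              (simp add: powr_minus[symmetric] powr_add[symmetric] algebra_simps)
          then show ?thesis using K(1) \<rho> \<sigma>(3) by (simp add: powr_mult powr_powr mult.commute)
        qed
        finally show "(\<integral>\<^sup>+g. \<integral>\<^sup>+h. indicator (?O \<rho>) (g, h) \<partial>CN \<partial>CN) \<le> ennreal ((inv_moment \<sigma>)\<^sup>2 * (K * exp 20) powr \<sigma> * \<rho> powr (- D))"
          by (simp add: mult.assoc)
      qed (use inv_moment_nonneg[of \<sigma>] True pc r in auto)
    next
      case False
      show ?thesis
      proof (rule achieves[of "inv_moment \<sigma> * sqrt (K * exp 20) powr \<sigma>"])
        fix \<rho> :: real assume \<rho>: "1 \<le> \<rho>"
        have "(\<integral>\<^sup>+g. \<integral>\<^sup>+h. indicator (?O \<rho>) (g, h) \<partial>CN \<partial>CN) \<le>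
          (\<integral>\<^sup>+g. \<integral>\<^sup>+h. indicator {h. (cmod h)\<^sup>2 * \<rho> powr c \<le> sqrt (T \<rho>)} h \<partial>CN \<partial>CN)"
        proof (intro nn_integral_mono)
          \<comment> \<open>Outage forces the direct gain below sqrt (T \<rho>), of order \<rho>
            powr r, whatever the relay links are.\<close>
          fix g h :: complex
          let ?G = "(cmod g)\<^sup>2 * \<rho> powr p" and ?H = "(cmod h)\<^sup>2 * \<rho> powr c"
          have "x\<^sup>2 \<le> (1 + x) * (1 + x + y)" if "0 \<le> x" "0 \<le> y" for x y :: real
            unfolding power2_eq_square using that by (intro mult_mono) auto
          from this[of ?H ?G] have "?H\<^sup>2 \<le> (1 + ?H) * (1 + ?H + ?G)" by simp
          then have "?H \<le> sqrt (T \<rho>)" if "(1 + ?H) * (1 + ?H + ?G) < T \<rho>"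
            using that by (intro real_le_rsqrt) linarith
          then show "indicator (?O \<rho>) (g, h) \<le> (indicator {h. (cmod h)\<^sup>2 * \<rho> powr c \<le> sqrt (T \<rho>)} h :: ennreal)"
            by (auto simp: indicator_def)
        qed
        also have "\<dots> = (\<integral>\<^sup>+h. indicator {h. (cmod h)\<^sup>2 * \<rho> powr c \<le> sqrt (T \<rho>)} h \<partial>CN)"
          using CN.emeasure_space_1 by simp
        also have "\<dots> \<le> ennreal (inv_moment \<sigma> * (sqrt (T \<rho>) / \<rho> powr c) powr \<sigma>)"
          using \<rho> T by (intro CN_small_gain \<sigma>) auto
        also have "(sqrt (T \<rho>) / \<rho> powr c) powr \<sigma> = sqrt (K * exp 20) powr \<sigma> * \<rho> powr (- D)"
        proof -
          have "sqrt (\<rho> powr (2 * r)) = \<rho> powr r"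
            using \<rho> by (simp add: powr_half_sqrt[symmetric] powr_powr)
          then have "sqrt (T \<rho>) / \<rho> powr c = sqrt (K * exp 20) * \<rho> powr (- d)"
            using \<rho> False by (simp add: T(2) d_def real_sqrt_mult powr_diff)
          then show ?thesis using K(1) \<rho> \<sigma>(3) by (simp add: powr_mult powr_powr mult.commute)
        qed
        finally show "(\<integral>\<^sup>+g. \<integral>\<^sup>+h. indicator (?O \<rho>) (g, h) \<partial>CN \<partial>CN) \<le> ennreal (inv_moment \<sigma> * sqrt (K * exp 20) powr \<sigma> * \<rho> powr (- D))"
          by (simp add: mult.assoc)
      qed (use inv_moment_nonneg[of \<sigma>] D False \<open>\<not> D \<le> 0\<close> pc r in auto)
    qed
  qed
  moreover have "static_qmf_half (C \<rho>)" for \<rho>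
    unfolding C_def by (rule static_qmf_half_qmf_code)
  ultimately show thesis using that fam by blast
qed


section \<open>Dynamic decode-and-forward\<close>

text \<open>Seed addresses behind \<open>source_gauss\<close> and \<open>relay_gauss\<close> when
  relay codewords are indexed by messages.\<close>

definition ddf_src :: "nat \<Rightarrow> nat \<Rightarrow> nat" where
  "ddf_src m i = to_nat (Inl (m, i) :: (nat \<times> nat) + (nat \<times> nat))"

definition ddf_rel :: "nat \<Rightarrow> nat \<Rightarrow> nat" where
  "ddf_rel m i = to_nat (Inr (m, i) :: (nat \<times> nat) + (nat \<times> nat))"

lemma ddf_index_eq [simp]:
  "ddf_src m i = ddf_src m' i' \<longleftrightarrow> m = m' \<and> i = i'" "ddf_rel m i = ddf_rel m' i' \<longleftrightarrow> m = m' \<and> i = i'"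
  "ddf_src m i \<noteq> ddf_rel m' j" "ddf_rel m' j \<noteq> ddf_src m i"
  by (auto simp: ddf_src_def ddf_rel_def)

definition relay_dist :: "nat set \<Rightarrow> complex \<Rightarrow> cseq \<Rightarrow> cseq \<Rightarrow> nat \<Rightarrow> real" where
  "relay_dist S g w y m = (\<Sum>i\<in>S. (cmod (y i - g * w (ddf_src m i)))\<^sup>2)"

text \<open>LEAST picks one minimizer measurably and supplies an explicit witness for the decision
  function \<mu> in \<open>ddf\<close>.\<close>

definition relay_decode :: "nat \<Rightarrow> nat set \<Rightarrow> complex \<Rightarrow> cseq \<Rightarrow> cseq \<Rightarrow> nat" where
  "relay_decode M S g w y = (LEAST m. m < M \<and> (\<forall>m'\<in>{..<M}. relay_dist S g w y m \<le> relay_dist S g w y m'))"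

lemma relay_decode:
  assumes "0 < M"
  shows "relay_decode M S g w y < M" "m < M \<Longrightarrow> relay_dist S g w y (relay_decode M S g w y) \<le> relay_dist S g w y m"
proof -
  have "\<exists>m. is_arg_min (relay_dist S g w y) (\<lambda>m. m \<in> {..<M}) m"
    using assms by (intro ex_is_arg_min_if_finite) auto
  then have "\<exists>m. m < M \<and> (\<forall>m'\<in>{..<M}. relay_dist S g w y m \<le> relay_dist S g w y m')"
    by (auto simp: is_arg_min_linorder)
  from LeastI_ex[OF this] show "relay_decode M S g w y < M"
    "m < M \<Longrightarrow> relay_dist S g w y (relay_decode M S g w y) \<le> relay_dist S g w y m"
    unfolding relay_decode_def by auto
qed

lemma relay_dist_cong: "(\<And>i. i \<in> S \<Longrightarrow> y i = y' i) \<Longrightarrow> relay_dist S g w y m = relay_dist S g w y' m"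
  by (simp add: relay_dist_def)

lemma relay_decode_cong: "(\<And>i. i \<in> S \<Longrightarrow> y i = y' i) \<Longrightarrow> relay_decode M S g w y = relay_decode M S g w y'"
  unfolding relay_decode_def by (simp add: relay_dist_cong[of S y y'])

text \<open>Hypothesis m presumes that the relay decoded m too, hence the same message in both
  codebooks.\<close>

definition ddf_dist :: "nat set \<Rightarrow> nat \<Rightarrow> complex \<Rightarrow> complex \<Rightarrow> cseq \<Rightarrow> cseq \<Rightarrow> nat \<Rightarrow> real" where
  "ddf_dist S n f h w y m = (\<Sum>i<n. (cmod (y i - h * w (ddf_src m i) - (if i \<in> S then 0 else f) * w (ddf_rel m i)))\<^sup>2)"

definition ddf_test :: "real \<Rightarrow> real \<Rightarrow> real \<Rightarrow> real \<Rightarrow> nat \<Rightarrow> nat \<Rightarrow> dest_view \<Rightarrow> bool" where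
  "ddf_test p c r \<rho> n m = (\<lambda>(w, (g, f, h), y). ddf_dist (ddf_listening p \<rho> r n g) n
     (f * complex_of_real (\<rho> powr (p / 2))) (h * complex_of_real (\<rho> powr (c / 2))) w y m \<le> 4 * real n)"

definition ddf_code :: "real \<Rightarrow> real \<Rightarrow> real \<Rightarrow> real \<Rightarrow> nat \<Rightarrow> nat \<Rightarrow> hd_code" where
  "ddf_code p c r \<rho> n M = \<lparr> blocklength = n, num_msgs = M,
     src_enc = (\<lambda>w m i. w (ddf_src m i)),
     listens = (\<lambda>i (w, v, g, y). i \<in> ddf_listening p \<rho> r n g),
     relay_enc = (\<lambda>i (w, v, g, y). w (ddf_rel (relay_decode M (ddf_listening p \<rho> r n g) (g * complex_of_real (\<rho> powr (p / 2))) w y) i)),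
     dest_dec = test_decoder M (ddf_test p c r \<rho> n) \<rparr>"

lemma ddf_code_simps [simp]:
  "blocklength (ddf_code p c r \<rho> n M) = n"
  "num_msgs (ddf_code p c r \<rho> n M) = M"
  "src_enc (ddf_code p c r \<rho> n M) = (\<lambda>w m i. w (ddf_src m i))"
  "listens (ddf_code p c r \<rho> n M) = (\<lambda>i (w, v, g, y). i \<in> ddf_listening p \<rho> r n g)"
  "relay_enc (ddf_code p c r \<rho> n M) = (\<lambda>i (w, v, g, y). w (ddf_rel (relay_decode M (ddf_listening p \<rho> r n g) (g * complex_of_real (\<rho> powr (p / 2))) w y) i))"
  "dest_dec (ddf_code p c r \<rho> n M) = test_decoder M (ddf_test p c r \<rho> n)"
  by (simp_all add: ddf_code_def)

lemma ddf_ddf_code: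
  assumes "0 < M"
  shows "ddf p r \<rho> (ddf_code p c r \<rho> n M)"
  unfolding ddf_def
proof (intro conjI exI[of _ "\<lambda>(w, g, y). relay_decode M (ddf_listening p \<rho> r n g) (g * complex_of_real (\<rho> powr (p / 2))) w y"])
  show "\<forall>w g y. is_arg_min (\<lambda>m. \<Sum>i\<in>ddf_listening p \<rho> r (blocklength (ddf_code p c r \<rho> n M)) g.
      (cmod (y i - g * complex_of_real (\<rho> powr (p / 2)) * src_enc (ddf_code p c r \<rho> n M) w m i))\<^sup>2)
      (\<lambda>m. m < num_msgs (ddf_code p c r \<rho> n M))
      ((\<lambda>(w, g, y). relay_decode M (ddf_listening p \<rho> r n g) (g * complex_of_real (\<rho> powr (p / 2))) w y) (w, g, y))"
  proof (intro allI)
    fix w g y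
    let ?S = "ddf_listening p \<rho> r n g" and ?g = "g * complex_of_real (\<rho> powr (p / 2))"
    have "is_arg_min (relay_dist ?S ?g w y) (\<lambda>m. m < M) (relay_decode M ?S ?g w y)"
      using relay_decode(1)[OF assms, of ?S ?g w y] relay_decode(2)[OF assms, of _ ?S ?g w y]
      by (auto simp: is_arg_min_linorder)
    then show "is_arg_min (\<lambda>m. \<Sum>i\<in>ddf_listening p \<rho> r (blocklength (ddf_code p c r \<rho> n M)) g.
      (cmod (y i - g * complex_of_real (\<rho> powr (p / 2)) * src_enc (ddf_code p c r \<rho> n M) w m i))\<^sup>2)
      (\<lambda>m. m < num_msgs (ddf_code p c r \<rho> n M))
      ((\<lambda>(w, g, y). relay_decode M (ddf_listening p \<rho> r n g) (g * complex_of_real (\<rho> powr (p / 2))) w y) (w, g, y))"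
      by (simp add: relay_dist_def[abs_def])
  qed
qed (auto simp: source_gauss_def relay_gauss_def ddf_src_def ddf_rel_def)

lemma measurable_ddf_listening [measurable (raw)]:
  assumes [measurable]: "g \<in> borel_measurable A"
  shows "Measurable.pred A (\<lambda>x. i \<in> ddf_listening p \<rho> r n (g x))"
  unfolding ddf_listening_def mem_Collect_eq by measurable

lemma ddf_listening_finite [simp]: "finite (ddf_listening p \<rho> r n g)"
  and ddf_listening_subset: "ddf_listening p \<rho> r n g \<subseteq> {..<n}"
  by (auto simp: ddf_listening_def)

text \<open>The logarithm is nonnegative, so the listening times form an initial segment: the relay
  decodes from samples that all precede its first transmission.\<close>

lemma ddf_listening_downward:
  assumes "i \<in> ddf_listening p \<rho> r n g" "j \<le> i"
  shows "j \<in> ddf_listening p \<rho> r n g"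
proof -
  have "0 \<le> ln (1 + (cmod g)\<^sup>2 * \<rho> powr p)" by (intro ln_ge_zero) simp
  then have "real j * ln (1 + (cmod g)\<^sup>2 * \<rho> powr p) \<le> real i * ln (1 + (cmod g)\<^sup>2 * \<rho> powr p)"
    using assms(2) by (intro mult_right_mono) auto
  then show ?thesis using assms by (auto simp: ddf_listening_def)
qed

lemma sum_listening: "(\<Sum>i\<in>ddf_listening p \<rho> r n g. F i) = (\<Sum>i<n. if i \<in> ddf_listening p \<rho> r n g then F i else 0)"
  using ddf_listening_subset[of p \<rho> r n g] by (subst sum.If_cases) (auto simp: Int_absorb1)

lemma measurable_relay_decode:
  assumes [measurable]: "g \<in> borel_measurable A" "w \<in> measurable A cseq_borel" "y \<in> measurable A cseq_borel"
  shows "(\<lambda>x. relay_decode M (ddf_listening p \<rho> r n (g x)) (g x * k) (w x) (y x)) \<in> measurable A (count_space UNIV)"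
proof -
  have [measurable]: "(\<lambda>x. w x (ddf_src m i)) \<in> borel_measurable A" "(\<lambda>x. y x i) \<in> borel_measurable A" for m i
    by (auto intro: measurable_cseq_component)
  have [measurable]: "(\<lambda>x. relay_dist (ddf_listening p \<rho> r n (g x)) (g x * k) (w x) (y x) m) \<in> borel_measurable A" for m
    unfolding relay_dist_def sum_listening by measurable
  show ?thesis unfolding relay_decode_def by measurable
qed

lemma measurable_ddf_rel_component:
  assumes [measurable]: "w \<in> measurable A cseq_borel" "l \<in> measurable A (count_space UNIV)"
  shows "(\<lambda>x. w x (ddf_rel (l x) i)) \<in> borel_measurable A"
proof (rule measurable_compose_countable[where g=l])
  show "(\<lambda>x. w x (ddf_rel l' i)) \<in> borel_measurable A" for l'
    by (rule measurable_cseq_component) measurable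
qed measurable

lemma measurable_ddf_test: "Measurable.pred dest_view_borel (ddf_test p c r \<rho> n m)"
proof -
  have [measurable]: "(\<lambda>x :: dest_view. fst x k) \<in> borel_measurable dest_view_borel"
     "(\<lambda>x :: dest_view. snd (snd x) k) \<in> borel_measurable dest_view_borel" for k
    by (rule measurable_cseq_component, measurable)+
  show ?thesis unfolding ddf_test_def ddf_dist_def split_beta' by measurable
qed

lemma relay_past_ddf:
  assumes "i \<le> n"
  shows "relay_past p \<rho> (ddf_code p c r \<rho> n M) g w v zr m i j =
    (if j < i \<and> j \<in> ddf_listening p \<rho> r n g then g * complex_of_real (\<rho> powr (p / 2)) * w (ddf_src m j) + zr j else 0)"
  using assms by (induction i) (auto simp: Let_def)

lemma valid_ddf_code:
  assumes "0 < n" "0 < M"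
  shows "valid_code p \<rho> (ddf_code p c r \<rho> n M)"
proof -
  let ?C = "ddf_code p c r \<rho> n M"
  have relay_meas: "(\<lambda>(w, v, g, y). w (ddf_rel (relay_decode M (ddf_listening p \<rho> r n g) (g * complex_of_real (\<rho> powr (p / 2))) w y) i))
      \<in> borel_measurable relay_view_borel" for i
  proof -
    have dec: "(\<lambda>x. relay_decode M (ddf_listening p \<rho> r n (fst (snd (snd x)))) (fst (snd (snd x)) * complex_of_real (\<rho> powr (p / 2)))
        (fst x) (snd (snd (snd x)))) \<in> measurable relay_view_borel (count_space UNIV)"
      by (rule measurable_relay_decode) measurable
    show ?thesis
      unfolding split_beta' by (rule measurable_ddf_rel_component[OF measurable_fst dec])
  qed
  have src: "source_power_ok ?C"
    by (simp add: source_power_ok_def nn_integral_sum nn_integral_iid_norm_sq sum_ennreal[symmetric] del: sum_ennreal)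
  have "(\<integral>\<^sup>+(w, v, zr). ennreal (\<Sum>i<n. (cmod (relay_input p \<rho> ?C g w v zr m i))\<^sup>2)
      \<partial>(iid_CN \<Otimes>\<^sub>M iid_CN \<Otimes>\<^sub>M iid_CN)) \<le> ennreal (real n)" for g m
  proof -
    let ?S = "ddf_listening p \<rho> r n g"
    define dec where "dec w zr = relay_decode M ?S (g * complex_of_real (\<rho> powr (p / 2))) w
       (\<lambda>j. g * complex_of_real (\<rho> powr (p / 2)) * w (ddf_src m j) + zr j)" for w zr
    have inp: "relay_input p \<rho> ?C g w v zr m i = (if i \<in> ?S then 0 else w (ddf_rel (dec w zr) i))" if "i < n" for w v zr i
    proof -
      \<comment> \<open>A transmission time i comes after the whole listening set, so the past
        before i already contains every sample used for decoding.\<close>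
      have "relay_decode M ?S (g * complex_of_real (\<rho> powr (p / 2))) w (relay_past p \<rho> ?C g w v zr m i) = dec w zr" if "i \<notin> ?S"
        unfolding dec_def
      proof (rule relay_decode_cong)
        fix j assume j: "j \<in> ?S"
        then have "j < i" using that ddf_listening_downward[OF j] by (meson not_less)
        then show "relay_past p \<rho> ?C g w v zr m i j = g * complex_of_real (\<rho> powr (p / 2)) * w (ddf_src m j) + zr j"
          using j \<open>i < n\<close> by (simp add: relay_past_ddf)
      qed
      then show ?thesis by (auto simp: relay_input_def Let_def)
    qed
    have dec_m[measurable]: "(\<lambda>x. dec (w x) (zr x)) \<in> measurable A (count_space UNIV)"
      if [measurable]: "w \<in> measurable A cseq_borel" "zr \<in> measurable A cseq_borel" for A :: "'x measure" and w zr
    proof -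
      have "(\<lambda>x j. g * complex_of_real (\<rho> powr (p / 2)) * w x (ddf_src m j) + zr x j) \<in> measurable A cseq_borel"
      proof (rule measurable_cseq_lambda)
        fix j
        have [measurable]: "(\<lambda>x. w x (ddf_src m j)) \<in> borel_measurable A" "(\<lambda>x. zr x j) \<in> borel_measurable A"
          by (auto intro: measurable_cseq_component)
        show "(\<lambda>x. g * complex_of_real (\<rho> powr (p / 2)) * w x (ddf_src m j) + zr x j) \<in> borel_measurable A" by measurable
      qed
      then show ?thesis unfolding dec_def by (intro measurable_relay_decode) measurable
    qed
    have wl_m[measurable]: "(\<lambda>x. w x (ddf_rel (dec (w x) (zr x)) i)) \<in> borel_measurable A"
      if [measurable]: "w \<in> measurable A cseq_borel" "zr \<in> measurable A cseq_borel" for A :: "'x measure" and w zr i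
      by (rule measurable_ddf_rel_component) measurable
    \<comment> \<open>The decision depends on source codewords and noise only, so all relay
      codewords can be resampled without changing it.\<close>
    have one: "(\<integral>\<^sup>+w. ennreal ((cmod (w (ddf_rel (dec w zr) i)))\<^sup>2) \<partial>iid_CN) = 1" for zr i
    proof -
      let ?J = "{ddf_rel l i |l i. True}"
      have src: "override_on w w' ?J (ddf_src l i) = w (ddf_src l i)" for w w' :: cseq and l i
        by (auto simp: override_on_def)
      have "dec (override_on w w' ?J) zr = dec w zr" for w w'
        unfolding dec_def relay_decode_def relay_dist_def src ..
      moreover have "override_on w w' ?J (ddf_rel l i) = w' (ddf_rel l i)" for w w' :: cseq and l
        by (auto simp: override_on_def)
      ultimately show ?thesis
        by (subst nn_integral_iid_resample[of _ ?J]) (simp_all add: nn_integral_iid_norm_sq)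
    qed
    have "(\<integral>\<^sup>+(w, v, zr). ennreal (\<Sum>i<n. (cmod (relay_input p \<rho> ?C g w v zr m i))\<^sup>2)
      \<partial>(iid_CN \<Otimes>\<^sub>M iid_CN \<Otimes>\<^sub>M iid_CN)) \<le>
      (\<integral>\<^sup>+(w, v, zr). (\<Sum>i<n. ennreal ((cmod (w (ddf_rel (dec w zr) i)))\<^sup>2)) \<partial>(iid_CN \<Otimes>\<^sub>M iid_CN \<Otimes>\<^sub>M iid_CN))"
      by (intro nn_integral_mono) (auto simp: inp sum_ennreal intro!: ennreal_leI sum_mono)
    also have "\<dots> = (\<integral>\<^sup>+w. \<integral>\<^sup>+v. \<integral>\<^sup>+zr. (\<Sum>i<n. ennreal ((cmod (w (ddf_rel (dec w zr) i)))\<^sup>2)) \<partial>iid_CN \<partial>iid_CN \<partial>iid_CN)"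
      by (simp add: nn_integral_pair prob_space_pair prob_space_iid_CN del: sum_ennreal)
    also have "\<dots> = (\<integral>\<^sup>+w. \<integral>\<^sup>+zr. (\<Sum>i<n. ennreal ((cmod (w (ddf_rel (dec w zr) i)))\<^sup>2)) \<partial>iid_CN \<partial>iid_CN)"
      by simp
    also have "\<dots> = (\<integral>\<^sup>+zr. \<integral>\<^sup>+w. (\<Sum>i<n. ennreal ((cmod (w (ddf_rel (dec w zr) i)))\<^sup>2)) \<partial>iid_CN \<partial>iid_CN)"
      by (rule nn_integral_swap[OF prob_space_iid_CN prob_space_iid_CN]) measurable
    also have "\<dots> = (\<integral>\<^sup>+zr. (\<Sum>i<n. 1) \<partial>iid_CN)"
      by (intro nn_integral_cong, subst nn_integral_sum) (simp_all add: one)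
    also have "\<dots> = ennreal (real n)"
      by (simp add: ennreal_of_nat_eq_real_of_nat)
    finally show ?thesis .
  qed
  then have "(\<Sum>m<M. \<integral>\<^sup>+(w, v, zr). ennreal (\<Sum>i<n. (cmod (relay_input p \<rho> ?C g w v zr m i))\<^sup>2)
      \<partial>(iid_CN \<Otimes>\<^sub>M iid_CN \<Otimes>\<^sub>M iid_CN)) \<le> (\<Sum>m<M. ennreal (real n))" for g
    by (rule sum_mono)
  also have "(\<Sum>m<M. ennreal (real n)) = ennreal (real M * real n)"
    by (simp add: ennreal_mult ennreal_of_nat_eq_real_of_nat)
  finally have rel: "relay_power_ok p \<rho> ?C"
    by (simp add: relay_power_ok_def)
  have "(\<lambda>w. w (ddf_src m i)) \<in> borel_measurable cseq_borel" for m i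
    by (rule measurable_cseq_component) simp
  moreover have "(\<lambda>(w, v, g, y). i \<in> ddf_listening p \<rho> r n g) \<in> measurable relay_view_borel (count_space UNIV)" for i
    unfolding split_beta' by measurable
  ultimately show ?thesis
    using assms src rel relay_meas measurable_test_decoder[of M "ddf_test p c r \<rho> n"] measurable_ddf_test
    by (simp add: valid_code_def)
qed

text \<open>The second assumption says that the signal \<open>a\<close> does not depend on the codewords of message \<open>m'\<close>.\<close>

lemma ddf_confusion:
  assumes I: "finite I"
    and a: "\<And>i w w'. i \<in> I \<Longrightarrow> a (override_on w w' (ddf_src m' ` I \<union> ddf_rel m' ` I)) i = a w i"
    and am: "\<And>i. i \<in> I \<Longrightarrow> (\<lambda>w. a w i) \<in> borel_measurable cseq_borel"
  shows "(\<integral>\<^sup>+w. ennreal (exp (- (\<Sum>i\<in>I. (cmod (a w i - h * w (ddf_src m' i) - f i * w (ddf_rel m' i)))\<^sup>2))) \<partial>iid_CN) \<le>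
    ennreal (\<Prod>i\<in>I. 1 / (1 + (cmod h)\<^sup>2 + (cmod (f i))\<^sup>2))"
proof -
  let ?J = "ddf_src m' ` I \<union> ddf_rel m' ` I"
  let ?F = "\<lambda>w. ennreal (exp (- (\<Sum>i\<in>I. (cmod (a w i - h * w (ddf_src m' i) - f i * w (ddf_rel m' i)))\<^sup>2)))"
  have [measurable]: "(\<lambda>w. w k) \<in> borel_measurable cseq_borel" for k
    by (rule measurable_cseq_component) simp
  have F_m: "?F \<in> borel_measurable cseq_borel"
  proof -
    have "(\<lambda>w. \<Sum>i\<in>I. (cmod (a w i - h * w (ddf_src m' i) - f i * w (ddf_rel m' i)))\<^sup>2) \<in> borel_measurable cseq_borel"
    proof (rule borel_measurable_sum)
      fix i assume "i \<in> I"
      note [measurable] = am[OF this]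
      show "(\<lambda>w. (cmod (a w i - h * w (ddf_src m' i) - f i * w (ddf_rel m' i)))\<^sup>2) \<in> borel_measurable cseq_borel" by measurable
    qed
    then show ?thesis by measurable
  qed
  have "(\<integral>\<^sup>+w. ?F w \<partial>iid_CN) = (\<integral>\<^sup>+w. \<integral>\<^sup>+w'. ?F (override_on w w' ?J) \<partial>iid_CN \<partial>iid_CN)"
    by (rule nn_integral_iid_resample[OF F_m])
  also have "\<dots> \<le> (\<integral>\<^sup>+w. ennreal (\<Prod>i\<in>I. 1 / (1 + (cmod h)\<^sup>2 + (cmod (f i))\<^sup>2)) \<partial>iid_CN)"
  proof (rule nn_integral_mono)
    fix w
    define \<psi> where "\<psi> i = (\<lambda>(x, u). ennreal (exp (- (cmod (a w i - h * x - f i * u))\<^sup>2)))" for i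
    have \<psi>: "\<psi> i \<in> borel_measurable (borel \<Otimes>\<^sub>M borel)" for i unfolding \<psi>_def by measurable
    have eq: "?F (override_on w w' ?J) = (\<Prod>i\<in>I. \<psi> i (w' (ddf_src m' i), w' (ddf_rel m' i)))" for w'
    proof -
      have "(\<Sum>i\<in>I. (cmod (a (override_on w w' ?J) i - h * override_on w w' ?J (ddf_src m' i) - f i * override_on w w' ?J (ddf_rel m' i)))\<^sup>2) =
        (\<Sum>i\<in>I. (cmod (a w i - h * w' (ddf_src m' i) - f i * w' (ddf_rel m' i)))\<^sup>2)"
        using a by (intro sum.cong refl) simp
      then show ?thesis
        unfolding \<psi>_def by (simp add: sum_negf[symmetric] exp_sum[OF I] prod_ennreal)
    qed
    have "(\<integral>\<^sup>+w'. ?F (override_on w w' ?J) \<partial>iid_CN) = (\<Prod>i\<in>I. \<integral>\<^sup>+x. \<integral>\<^sup>+u. \<psi> i (x, u) \<partial>CN \<partial>CN)"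
      unfolding eq by (rule nn_integral_iid_prod_pair) (auto simp: inj_on_def \<psi> I)
    also have "\<dots> \<le> (\<Prod>i\<in>I. ennreal (1 / (1 + (cmod h)\<^sup>2 + (cmod (f i))\<^sup>2)))"
      by (intro prod_mono_ennreal) (simp add: \<psi>_def nn_integral_CN_pair_exp)
    also have "\<dots> = ennreal (\<Prod>i\<in>I. 1 / (1 + (cmod h)\<^sup>2 + (cmod (f i))\<^sup>2))"
      by (rule prod_ennreal) simp
    finally show "(\<integral>\<^sup>+w'. ?F (override_on w w' ?J) \<partial>iid_CN) \<le> \<dots>" .
  qed
  finally show ?thesis by simp
qed

section \<open>DDF: error probability for given fading\<close>

text \<open>The relay's decision is a parameter, so that it can be replaced by the constant m once
  it is known to be correct.\<close>

definition ddf_out :: "nat set \<Rightarrow> complex \<Rightarrow> complex \<Rightarrow> (cseq \<Rightarrow> nat) \<Rightarrow> cseq \<Rightarrow> cseq \<Rightarrow> nat \<Rightarrow> cseq" where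
  "ddf_out S f h \<mu> w zd m i = h * w (ddf_src m i) + (if i \<in> S then 0 else f) * w (ddf_rel (\<mu> w) i) + zd i"

lemma decoded_ddf:
  fixes g f h :: complex and p c r \<rho> :: real and m n M :: nat and zr zd :: cseq
  assumes "m < M"
  defines "g' \<equiv> g * complex_of_real (\<rho> powr (p / 2))" and "f' \<equiv> f * complex_of_real (\<rho> powr (p / 2))"
    and "h' \<equiv> h * complex_of_real (\<rho> powr (c / 2))" and "S \<equiv> ddf_listening p \<rho> r n g"
  defines "\<mu> \<equiv> \<lambda>w. relay_decode M S g' w (\<lambda>j. g' * w (ddf_src m j) + zr j)"
  shows "decoded p p c \<rho> (ddf_code p c r \<rho> n M) g f h w v zr zd m \<longleftrightarrow>
    test_decoder M (ddf_test p c r \<rho> n) (w, (g, f, h), \<lambda>i. if i < n then ddf_out S f' h' \<mu> w zd m i else 0) = m"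
proof -
  let ?C = "ddf_code p c r \<rho> n M"
  let ?y = "shift n (\<lambda>i. g' * codeword ?C w m i) zr"
  have run: "relay_run ?C g w v ?y i = (\<lambda>j. if j < i \<and> j \<in> S then g' * w (ddf_src m j) + zr j else 0)" if "i \<le> n" for i
    using that by (induction i) (auto simp: fun_eq_iff shift_def codeword_def assms)
  have "run_input ?C g w v ?y i = (if i \<in> S then 0 else w (ddf_rel (\<mu> w) i))" if "i < n" for i
  proof -
    have "relay_decode M S g' w (relay_run ?C g w v ?y i) = \<mu> w" if "i \<notin> S"
      unfolding \<mu>_def
    proof (rule relay_decode_cong)
      fix j assume j: "j \<in> S"
      then have "j < i" using that ddf_listening_downward[of j p \<rho> r n g] unfolding S_def by (meson ddf_listening_downward not_less)
      then show "relay_run ?C g w v ?y i j = g' * w (ddf_src m j) + zr j"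
        using j \<open>i < n\<close> by (simp add: run)
    qed
    then show ?thesis by (simp add: run_input_def S_def g'_def)
  qed
  then have "dest_word p \<rho> ?C g f w v ?y (shift n (\<lambda>i. h' * codeword ?C w m i) zd) =
    (\<lambda>i. if i < n then ddf_out S f' h' \<mu> w zd m i else 0)"
    using assms(1) by (auto simp: dest_word_def fun_eq_iff shift_def codeword_def ddf_out_def f'_def)
  then show ?thesis by (simp add: decoded_def g'_def h'_def)
qed

text \<open>If the relay errs, its minimum-distance choice is at least as close as m, hence within 4
  n. If it does not, its decision is replaced by the constant m, which frees the output from the
  codewords of m' and makes \<open>ddf_confusion\<close> applicable.\<close>

lemma ddf_error_union:
  fixes g f h :: complex and p c r \<rho> :: real and m n M :: nat
  assumes m: "m < M"
  defines "g' \<equiv> g * complex_of_real (\<rho> powr (p / 2))" and "f' \<equiv> f * complex_of_real (\<rho> powr (p / 2))"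
    and "h' \<equiv> h * complex_of_real (\<rho> powr (c / 2))" and "S \<equiv> ddf_listening p \<rho> r n g"
  assumes wrong: "\<not> decoded p p c \<rho> (ddf_code p c r \<rho> n M) g f h w v zr zd m"
  shows "1 \<le> indicator {z. 4 * real n < (\<Sum>i<n. (cmod (z i))\<^sup>2)} zd + indicator {z. 4 * real n < (\<Sum>i<n. (cmod (z i))\<^sup>2)} zr +
     ennreal (exp (4 * real n)) * (\<Sum>m'\<in>{..<M} - {m}.
       ennreal (exp (- relay_dist S g' w (\<lambda>j. g' * w (ddf_src m j) + zr j) m')) +
       ennreal (exp (- ddf_dist S n f' h' w (ddf_out S f' h' (\<lambda>_. m) w zd m) m')))"
    (is "1 \<le> ?I1 + ?I2 + ennreal (exp (4 * real n)) * (\<Sum>m'\<in>_. ?A m' + ?B m')")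
proof -
  let ?y = "\<lambda>j. g' * w (ddf_src m j) + zr j"
  define \<mu> where "\<mu> w = relay_decode M S g' w (\<lambda>j. g' * w (ddf_src m j) + zr j)" for w
  let ?view = "(w, (g, f, h), \<lambda>i. if i < n then ddf_out S f' h' \<mu> w zd m i else 0)"
  have M: "0 < M" using m by simp
  have dec: "test_decoder M (ddf_test p c r \<rho> n) ?view \<noteq> m"
    using wrong unfolding decoded_ddf[OF m] g'_def f'_def h'_def S_def \<mu>_def[abs_def] .
  have test: "ddf_test p c r \<rho> n m' ?view \<longleftrightarrow> ddf_dist S n f' h' w (ddf_out S f' h' \<mu> w zd m) m' \<le> 4 * real n" for m'
    unfolding ddf_test_def prod.case f'_def[symmetric] h'_def[symmetric] S_def[symmetric]
    by (intro arg_cong2[where f="(\<le>)"] refl) (simp add: ddf_dist_def)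
  have enough: "1 \<le> ennreal (exp (4 * real n)) * (\<Sum>m'\<in>{..<M} - {m}. ?A m' + ?B m')"
    if "m' < M" "m' \<noteq> m" "ennreal (exp (- d)) \<le> ?A m' + ?B m'" "d \<le> 4 * real n" for m' d
  proof -
    have "1 \<le> ennreal (exp (4 * real n)) * ennreal (exp (- d))"
      using that(4) by (simp add: ennreal_mult[symmetric] exp_add[symmetric] ennreal_ge_1)
    also have "\<dots> \<le> ennreal (exp (4 * real n)) * (\<Sum>m'\<in>{..<M} - {m}. ?A m' + ?B m')"
      using that(1,2) by (intro mult_left_mono order.trans[OF that(3)] member_le_sum) auto
    finally show ?thesis .
  qed
  show ?thesis
  proof (cases "?I1 = 1 \<or> ?I2 = 1")
    case True
    then show ?thesis by (auto simp: add_increasing2 add_increasing add.assoc)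
  next
    case False
    then have zd: "(\<Sum>i<n. (cmod (zd i))\<^sup>2) \<le> 4 * real n" and zr: "(\<Sum>i<n. (cmod (zr i))\<^sup>2) \<le> 4 * real n"
      by (auto simp: indicator_def split: if_splits)
    show ?thesis
    proof (cases "\<mu> w = m")
      case False
      have "relay_dist S g' w ?y (\<mu> w) \<le> relay_dist S g' w ?y m"
        unfolding \<mu>_def by (rule relay_decode[OF M]) fact
      also have "\<dots> = (\<Sum>i\<in>S. (cmod (zr i))\<^sup>2)" by (simp add: relay_dist_def)
      also have "\<dots> \<le> (\<Sum>i<n. (cmod (zr i))\<^sup>2)"
        unfolding S_def using ddf_listening_subset by (intro sum_mono2) auto
      also have "\<dots> \<le> 4 * real n" by (rule zr)
      finally have "1 \<le> ennreal (exp (4 * real n)) * (\<Sum>m'\<in>{..<M} - {m}. ?A m' + ?B m')"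
        using False relay_decode(1)[OF M, of S g' w ?y] unfolding \<mu>_def
        by (intro enough) (auto simp: add_increasing2)
      then show ?thesis by (simp add: add_increasing)
    next
      case True
      then have out: "ddf_out S f' h' \<mu> w zd m = ddf_out S f' h' (\<lambda>_. m) w zd m"
        by (simp add: ddf_out_def fun_eq_iff)
      have "ddf_dist S n f' h' w (ddf_out S f' h' \<mu> w zd m) m = (\<Sum>i<n. (cmod (zd i))\<^sup>2)"
        unfolding out by (simp add: ddf_dist_def ddf_out_def)
      then have "ddf_test p c r \<rho> n m ?view" unfolding test using zd by simp
      from test_decoder_wrong[OF dec m this] obtain m' where
        m': "m' < M" "m' \<noteq> m" and d: "ddf_dist S n f' h' w (ddf_out S f' h' \<mu> w zd m) m' \<le> 4 * real n"
        unfolding test by blast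
      have "1 \<le> ennreal (exp (4 * real n)) * (\<Sum>m'\<in>{..<M} - {m}. ?A m' + ?B m')"
        using m' d unfolding out by (intro enough) (auto simp: add_increasing)
      then show ?thesis by (simp add: add_increasing)
    qed
  qed
qed

text \<open>In 5 n, 4 n pays for the threshold and n for the decay. \<open>relay_ok\<close> and
  \<open>dest_ok\<close> say that the relay during its listening time and the destination over the
  block collect enough information for M messages.\<close>

lemma ddf_conditional_error:
  fixes g f h :: complex and p c r \<rho> :: real and m n M :: nat
  assumes n: "0 < n" and m: "m < M"
  defines "G \<equiv> (cmod (g * complex_of_real (\<rho> powr (p / 2))))\<^sup>2" and "F \<equiv> (cmod (f * complex_of_real (\<rho> powr (p / 2))))\<^sup>2"
    and "H \<equiv> (cmod (h * complex_of_real (\<rho> powr (c / 2))))\<^sup>2" and "S \<equiv> ddf_listening p \<rho> r n g"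
  assumes relay_ok: "real M * exp (5 * real n) \<le> (1 + G) ^ card S"
    and dest_ok: "real M * exp (5 * real n) \<le> (1 + H) ^ card S * (1 + H + F) ^ (n - card S)"
  shows "(\<integral>\<^sup>+w. \<integral>\<^sup>+v. \<integral>\<^sup>+zr. \<integral>\<^sup>+zd. indicator {m. \<not> decoded p p c \<rho> (ddf_code p c r \<rho> n M) g f h w v zr zd m} m
        \<partial>iid_CN \<partial>iid_CN \<partial>iid_CN \<partial>iid_CN) \<le> ennreal (4 * exp (- real n))"
proof -
  interpret relay_code p p c \<rho> "ddf_code p c r \<rho> n M"
    by standard (use n m in \<open>auto intro: valid_ddf_code\<close>)
  let ?C = "ddf_code p c r \<rho> n M"
  define g' f' h' where "g' = g * complex_of_real (\<rho> powr (p / 2))" and "f' = f * complex_of_real (\<rho> powr (p / 2))"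
    and "h' = h * complex_of_real (\<rho> powr (c / 2))"
  define A where "A w zr m' = ennreal (exp (- relay_dist S g' w (\<lambda>j. g' * w (ddf_src m j) + zr j) m'))" for w zr m'
  define B where "B w zd m' = ennreal (exp (- ddf_dist S n f' h' w (ddf_out S f' h' (\<lambda>_. m) w zd m) m'))" for w zd m'
  let ?I = "\<lambda>z. indicator {z. 4 * real n < (\<Sum>i<n. (cmod (z i))\<^sup>2)} z :: ennreal"
  let ?J = "\<lambda>w v zr zd. indicator {m. \<not> decoded p p c \<rho> ?C g f h w v zr zd m} m :: ennreal"
  have [measurable]: "(\<lambda>w. w k) \<in> borel_measurable cseq_borel" for k
    by (rule measurable_cseq_component) simp
  have A_m: "(\<lambda>w. A w zr m') \<in> borel_measurable cseq_borel" for zr m'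
    unfolding A_def relay_dist_def by measurable
  have B_m: "(\<lambda>w. B w zd m') \<in> borel_measurable cseq_borel" for zd m'
    unfolding B_def ddf_dist_def ddf_out_def by measurable
  have J_m: "(\<lambda>x. ?J (w x) (v x) (zr x) (zd x)) \<in> borel_measurable N'"
    if [measurable]: "w \<in> measurable N' cseq_borel" "v \<in> measurable N' cseq_borel"
      "zr \<in> measurable N' cseq_borel" "zd \<in> measurable N' cseq_borel" for N' :: "'x measure" and w v zr zd
    unfolding indicator_def by measurable
  have finS: "finite S" and subS: "S \<subseteq> {..<n}" by (simp_all add: S_def ddf_listening_subset)
  have pos: "0 < 1 + H" "0 < 1 + G" "0 < 1 + H + F"
    unfolding H_def G_def F_def by (simp_all add: add_pos_nonneg)
  have M: "0 < real M" using m by simp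
  have small: "ennreal (exp (4 * real n)) * ennreal x \<le> ennreal (exp (- real n) / real M)"
    if "0 < y" "real M * exp (5 * real n) \<le> y" "x = 1 / y" for x y
  proof -
    have "exp (4 * real n) * x \<le> exp (4 * real n) * (1 / (real M * exp (5 * real n)))"
      unfolding that(3) using that(1,2) M by (intro mult_left_mono divide_left_mono) auto
    also have "\<dots> = exp (- real n) / real M"
    proof -
      have "exp (5 * real n) = exp (4 * real n) * exp (real n)" by (simp add: exp_add[symmetric])
      then show ?thesis by (simp add: exp_minus divide_inverse)
    qed
    finally have "exp (4 * real n) * x \<le> exp (- real n) / real M" .
    then show ?thesis using that by (subst ennreal_mult[symmetric]) (auto intro!: ennreal_leI)
  qed
  have nJ: "override_on w w' (ddf_src m' ` I \<union> ddf_rel m' ` I) (ddf_src m i) = w (ddf_src m i)"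
    "override_on w w' (ddf_src m' ` I \<union> ddf_rel m' ` I) (ddf_rel m i) = w (ddf_rel m i)" if "m' \<noteq> m" for w w' :: cseq and m' I i
    using that by (auto simp: override_on_def)
  have a: "ennreal (exp (4 * real n)) * (\<integral>\<^sup>+w. A w zr m' \<partial>iid_CN) \<le> ennreal (exp (- real n) / real M)" if "m' \<noteq> m" for zr m'
  proof -
    have "(\<integral>\<^sup>+w. A w zr m' \<partial>iid_CN) \<le> ennreal (\<Prod>i\<in>S. 1 / (1 + (cmod g')\<^sup>2 + (cmod (0::complex))\<^sup>2))"
      using ddf_confusion[OF finS, of "\<lambda>w j. g' * w (ddf_src m j) + zr j" m' g' "\<lambda>_. 0"] nJ[OF that]
      by (simp add: A_def relay_dist_def)
    also have "\<dots> = ennreal (1 / (1 + G) ^ card S)"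
      by (simp add: G_def g'_def power_one_over)
    finally have "ennreal (exp (4 * real n)) * (\<integral>\<^sup>+w. A w zr m' \<partial>iid_CN) \<le> ennreal (exp (4 * real n)) * ennreal (1 / (1 + G) ^ card S)"
      by (rule mult_left_mono) simp
    also have "\<dots> \<le> ennreal (exp (- real n) / real M)"
      using pos relay_ok by (intro small[of "(1 + G) ^ card S"]) auto
    finally show ?thesis .
  qed
  have b: "ennreal (exp (4 * real n)) * (\<integral>\<^sup>+w. B w zd m' \<partial>iid_CN) \<le> ennreal (exp (- real n) / real M)" if "m' \<noteq> m" for zd m'
  proof -
    have "(\<integral>\<^sup>+w. B w zd m' \<partial>iid_CN) \<le> ennreal (\<Prod>i<n. 1 / (1 + (cmod h')\<^sup>2 + (cmod (if i \<in> S then 0 else f'))\<^sup>2))"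
      using ddf_confusion[of "{..<n}" "\<lambda>w. ddf_out S f' h' (\<lambda>_. m) w zd m" m' h' "\<lambda>i. if i \<in> S then 0 else f'"] nJ[OF that]
      unfolding B_def ddf_dist_def ddf_out_def by simp
    also have "(\<Prod>i<n. 1 / (1 + (cmod h')\<^sup>2 + (cmod (if i \<in> S then 0 else f'))\<^sup>2)) = 1 / ((1 + H) ^ card S * (1 + H + F) ^ (n - card S))"
    proof -
      have "(\<Prod>i<n. 1 / (1 + (cmod h')\<^sup>2 + (cmod (if i \<in> S then 0 else f'))\<^sup>2)) = (\<Prod>i<n. if i \<in> S then 1 / (1 + H) else 1 / (1 + H + F))"
        by (intro prod.cong) (auto simp: H_def F_def h'_def f'_def)
      also have "\<dots> = (\<Prod>i\<in>S. 1 / (1 + H)) * (\<Prod>i\<in>{..<n} - S. 1 / (1 + H + F))"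
        using subS by (subst prod.If_cases) (auto simp: Int_absorb1 Diff_eq)
      also have "\<dots> = 1 / ((1 + H) ^ card S * (1 + H + F) ^ (n - card S))"
        using finS subS by (simp add: card_Diff_subset power_one_over)
      finally show ?thesis .
    qed
    finally have "ennreal (exp (4 * real n)) * (\<integral>\<^sup>+w. B w zd m' \<partial>iid_CN) \<le>
       ennreal (exp (4 * real n)) * ennreal (1 / ((1 + H) ^ card S * (1 + H + F) ^ (n - card S)))"
      by (rule mult_left_mono) simp
    also have "\<dots> \<le> ennreal (exp (- real n) / real M)"
      using pos dest_ok by (intro small[of "(1 + H) ^ card S * (1 + H + F) ^ (n - card S)"]) auto
    finally show ?thesis .
  qed
  have wrong_le: "ennreal (exp (4 * real n)) * (\<Sum>m'\<in>{..<M} - {m}. (\<integral>\<^sup>+w. A w zr m' \<partial>iid_CN) + (\<integral>\<^sup>+w. B w zd m' \<partial>iid_CN))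
    \<le> ennreal (2 * exp (- real n))" for zr zd
  proof -
    have "ennreal (exp (4 * real n)) * (\<Sum>m'\<in>{..<M} - {m}. (\<integral>\<^sup>+w. A w zr m' \<partial>iid_CN) + (\<integral>\<^sup>+w. B w zd m' \<partial>iid_CN)) \<le>
      (\<Sum>m'\<in>{..<M} - {m}. ennreal (exp (- real n) / real M) + ennreal (exp (- real n) / real M))"
      unfolding sum_distrib_left distrib_left by (intro sum_mono add_mono a b) auto
    also have "\<dots> \<le> (\<Sum>m'\<in>{..<M}. ennreal (exp (- real n) / real M) + ennreal (exp (- real n) / real M))"
      by (intro sum_mono2) auto
    also have "\<dots> = ennreal (2 * exp (- real n))"
      using M by (simp add: ennreal_plus[symmetric] ennreal_of_nat_eq_real_of_nat ennreal_mult[symmetric] del: ennreal_plus)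
    finally show ?thesis .
  qed
  have indep_v: "?J w v zr zd = ?J w (\<lambda>_. 0) zr zd" for w v zr zd
    by (simp add: decoded_ddf[OF m] indicator_def)
  have "(\<integral>\<^sup>+w. \<integral>\<^sup>+v. \<integral>\<^sup>+zr. \<integral>\<^sup>+zd. ?J w v zr zd \<partial>iid_CN \<partial>iid_CN \<partial>iid_CN \<partial>iid_CN) =
    (\<integral>\<^sup>+w. \<integral>\<^sup>+zr. \<integral>\<^sup>+zd. ?J w (\<lambda>_. 0) zr zd \<partial>iid_CN \<partial>iid_CN \<partial>iid_CN)"
    by (subst indep_v) simp
  also have "\<dots> = (\<integral>\<^sup>+zr. \<integral>\<^sup>+w. \<integral>\<^sup>+zd. ?J w (\<lambda>_. 0) zr zd \<partial>iid_CN \<partial>iid_CN \<partial>iid_CN)"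
    by (rule nn_integral_swap[OF prob_space_iid_CN prob_space_iid_CN]) (use J_m in measurable)
  also have "\<dots> = (\<integral>\<^sup>+zr. \<integral>\<^sup>+zd. \<integral>\<^sup>+w. ?J w (\<lambda>_. 0) zr zd \<partial>iid_CN \<partial>iid_CN \<partial>iid_CN)"
    by (rule nn_integral_cong, rule nn_integral_swap[OF prob_space_iid_CN prob_space_iid_CN]) (use J_m in measurable)
  also have "\<dots> \<le> (\<integral>\<^sup>+zr. \<integral>\<^sup>+zd. ?I zd + (?I zr + ennreal (2 * exp (- real n))) \<partial>iid_CN \<partial>iid_CN)"
  proof (rule nn_integral_mono, rule nn_integral_mono)
    fix zr zd
    have "(\<integral>\<^sup>+w. ?J w (\<lambda>_. 0) zr zd \<partial>iid_CN) \<le>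
      (\<integral>\<^sup>+w. ?I zd + (?I zr + ennreal (exp (4 * real n)) * (\<Sum>m'\<in>{..<M} - {m}. A w zr m' + B w zd m')) \<partial>iid_CN)"
    proof (rule nn_integral_mono)
      fix w
      show "?J w (\<lambda>_. 0) zr zd \<le> ?I zd + (?I zr + ennreal (exp (4 * real n)) * (\<Sum>m'\<in>{..<M} - {m}. A w zr m' + B w zd m'))"
      proof (cases "decoded p p c \<rho> ?C g f h w (\<lambda>_. 0) zr zd m")
        case False
        show ?thesis
          using False ddf_error_union[OF m False] unfolding A_def B_def g'_def f'_def h'_def S_def
          by (simp add: add.assoc)
      qed simp
    qed
    also have "\<dots> = ?I zd + (?I zr + ennreal (exp (4 * real n)) *
        (\<Sum>m'\<in>{..<M} - {m}. (\<integral>\<^sup>+w. A w zr m' \<partial>iid_CN) + (\<integral>\<^sup>+w. B w zd m' \<partial>iid_CN)))"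
      using A_m B_m by (simp add: nn_integral_add nn_integral_cmult nn_integral_sum)
    also have "\<dots> \<le> ?I zd + (?I zr + ennreal (2 * exp (- real n)))"
      by (intro add_left_mono wrong_le)
    finally show "(\<integral>\<^sup>+w. ?J w (\<lambda>_. 0) zr zd \<partial>iid_CN) \<le> ?I zd + (?I zr + ennreal (2 * exp (- real n)))" .
  qed
  also have "\<dots> = (\<integral>\<^sup>+zd. ?I zd \<partial>iid_CN) + ((\<integral>\<^sup>+zr. ?I zr \<partial>iid_CN) + ennreal (2 * exp (- real n)))"
  proof -
    have [measurable]: "?I \<in> borel_measurable cseq_borel"
      unfolding indicator_def by measurable
    show ?thesis by (simp add: nn_integral_add)
  qed
  also have "\<dots> \<le> ennreal (exp (- real n)) + (ennreal (exp (- real n)) + ennreal (2 * exp (- real n)))"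
    by (intro add_mono iid_noise_tail order.refl)
  also have "\<dots> \<le> ennreal (4 * exp (- real n))"
    by (simp add: ennreal_plus[symmetric] del: ennreal_plus)
  finally show ?thesis .
qed


section \<open>DDF: the outage region\<close>

text \<open>For exponents a, b, \<gamma> of the three received gains, the diversity gain is the
  least value of (p - a) + (p - b) + (c - \<gamma>) in outage. The extreme point is a = p, \<gamma>
  = c, b = (p - c) r / (p - r): both links out of the source are nominal and only the
  relay-destination link is weak.\<close>

lemma ddf_region:
  fixes p c r a b \<gamma> :: real
  assumes c: "0 \<le> c" "c < r" and p: "2 * r < p" and a: "r \<le> a" "a \<le> p" and b: "b \<le> p" and \<gamma>: "\<gamma> \<le> c"
    and out: "r * \<gamma> + (a - r) * b \<le> r * a"
  shows "a + b + \<gamma> \<le> p + c + (p - c) * r / (p - r)"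
proof -
  define \<alpha> where "\<alpha> = (p - c) * r / (p - r)"
  have r: "0 < r" "0 < p - r" using c p by auto
  have \<alpha>: "\<alpha> * (p - r) = (p - c) * r" using r by (simp add: \<alpha>_def)
  consider "a \<le> \<alpha>" | "\<alpha> < a" "a < 2 * r" | "2 * r \<le> a" by linarith
  then have "a + b + \<gamma> \<le> p + c + \<alpha>"
  proof cases
    case 1
    then show ?thesis using b \<gamma> by linarith
  next
    \<comment> \<open>The coefficient 2 r - a of b is positive, so b <= p is the active constraint;
      the resulting bound decreases in a and is evaluated at a = \<alpha>.\<close>
    case 2
    have "r * (b + \<gamma>) \<le> r * a + (2 * r - a) * b" using out by (simp add: algebra_simps)
    also have "\<dots> \<le> r * a + (2 * r - a) * p" using 2 b by (intro add_left_mono mult_left_mono) auto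
    finally have "r * (a + b + \<gamma>) \<le> 2 * r * p - a * (p - 2 * r)" by (simp add: algebra_simps)
    also have "\<dots> \<le> 2 * r * p - \<alpha> * (p - 2 * r)" using 2 p by (intro diff_left_mono mult_right_mono) auto
    also have "\<dots> = r * (p + c + \<alpha>)" using \<alpha> by (simp add: algebra_simps)
    finally show ?thesis using r by simp
  next
    \<comment> \<open>Now \<gamma> <= c is active. What remains is x + r (r - c) / x with x = a - r,
      which increases for x >= r, so a = p is the worst case.\<close>
    case 3
    define x y where "x = a - r" and "y = p - r"
    have xy: "r \<le> x" "x \<le> y" "0 < x" "0 < y" using 3 a p r by (auto simp: x_def y_def)
    have "x * (b + \<gamma>) \<le> r * a + (a - 2 * r) * \<gamma>" using out by (simp add: x_def algebra_simps)
    also have "\<dots> \<le> r * a + (a - 2 * r) * c" using 3 \<gamma> by (intro add_left_mono mult_left_mono) auto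
    finally have "x * (a + b + \<gamma>) \<le> x * x + (2 * r + c) * x + r * (r - c)"
      by (simp add: x_def algebra_simps)
    then have ab: "a + b + \<gamma> \<le> x + (2 * r + c) + r * (r - c) / x"
      using xy by (simp add: field_simps)
    have "r * (r - c) \<le> x * y"
    proof -
      have "r * (r - c) \<le> r * r" using r c by (intro mult_left_mono) auto
      also have "\<dots> \<le> x * y" using xy r by (intro mult_mono) auto
      finally show ?thesis .
    qed
    then have "0 \<le> (y - x) * (x * y - r * (r - c))" using xy by (intro mult_nonneg_nonneg) auto
    then have "y * (x * x + r * (r - c)) \<le> x * (y * y + r * (r - c))" by (simp add: algebra_simps)
    then have "x + r * (r - c) / x \<le> y + r * (r - c) / y" using xy by (simp add: field_simps)
    moreover have "y + (2 * r + c) + r * (r - c) / y = p + c + \<alpha>"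
      using r by (simp add: y_def \<alpha>_def field_simps)
    ultimately show ?thesis using ab by linarith
  qed
  then show ?thesis by (simp add: \<alpha>_def)
qed

lemma card_downward_closed:
  fixes S :: "nat set"
  assumes fin: "finite S" and down: "\<And>i j. i \<in> S \<Longrightarrow> j \<le> i \<Longrightarrow> j \<in> S"
  shows "S = {..<card S}"
proof -
  have "S = {..<k}" if "k = (LEAST k. k \<notin> S)" for k
  proof -
    have ex: "\<exists>k. k \<notin> S" using fin ex_new_if_finite infinite_UNIV_nat by blast
    have "k \<notin> S" unfolding that by (rule LeastI_ex[OF ex])
    moreover have "j \<in> S" if "j < k" for j using not_less_Least[of j "\<lambda>k. k \<notin> S"] that \<open>k = _\<close> by blast
    ultimately show ?thesis using down by (metis lessThan_iff not_less subsetI subset_antisym)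
  qed
  then show ?thesis by (metis card_lessThan)
qed

text \<open>The listening time is n r ln \<rho> / A rounded up to an integer; r ln \<rho> <= A
  ensures that it is not cut off by the end of the block. The second bound is the off-by-one of the
  rounding.\<close>

lemma ddf_listening_card:
  fixes p \<rho> r :: real and g :: complex and n :: nat
  defines "S \<equiv> ddf_listening p \<rho> r n g" and "A \<equiv> ln (1 + (cmod g)\<^sup>2 * \<rho> powr p)"
  shows "r * ln \<rho> \<le> A \<Longrightarrow> real n * (r * ln \<rho>) \<le> real (card S) * A"
    and "0 < card S \<Longrightarrow> (real (card S) - 1) * A < real n * (r * ln \<rho>)"
    and "card S \<le> n"
proof -
  have S: "S = {..<card S}"
    unfolding S_def by (rule card_downward_closed) (auto intro: ddf_listening_downward)
  show le: "card S \<le> n"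
    using card_mono[OF finite_lessThan ddf_listening_subset[of p \<rho> r n g]] by (simp add: S_def)
  show "real n * (r * ln \<rho>) \<le> real (card S) * A" if "r * ln \<rho> \<le> A"
  proof (cases "card S = n")
    case True
    then show ?thesis using that by (simp add: mult_left_mono)
  next
    case False
    have "card S \<notin> S" using S by (metis lessThan_iff less_irrefl)
    then show ?thesis using False le by (auto simp: S_def A_def ddf_listening_def)
  qed
  show "(real (card S) - 1) * A < real n * (r * ln \<rho>)" if "0 < card S"
  proof -
    have "card S - 1 \<in> S" using S that by (metis diff_less lessThan_iff zero_less_one)
    then show ?thesis using that by (auto simp: S_def A_def ddf_listening_def of_nat_diff)
  qed
qed

text \<open>Of the 6 n given up in the message count, 5 n go to \<open>ddf_conditional_error\<close>
  and n covers the rounding of the listening time: one sample too many loses at most ln (1 + H + F)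
  - ln (1 + H) <= ln (1 + F) <= n.\<close>

lemma ddf_no_outage:
  fixes p c r \<rho> :: real and g f h :: complex and n m M :: nat
  assumes n: "0 < n" and m: "m < M" and \<rho>: "1 < \<rho>" and r: "0 < r"
    and M: "real M \<le> exp (real n * (r * ln \<rho> - 6))"
  defines "A \<equiv> ln (1 + (cmod g)\<^sup>2 * \<rho> powr p)" and "F \<equiv> (cmod f)\<^sup>2 * \<rho> powr p" and "H \<equiv> (cmod h)\<^sup>2 * \<rho> powr c"
  assumes relay: "r * ln \<rho> \<le> A" and F: "ln (1 + F) \<le> real n"
    and dest: "r * ln \<rho> * A \<le> r * ln \<rho> * ln (1 + H) + (A - r * ln \<rho>) * ln (1 + H + F)"
  shows "(\<integral>\<^sup>+w. \<integral>\<^sup>+v. \<integral>\<^sup>+zr. \<integral>\<^sup>+zd. indicator {m. \<not> decoded p p c \<rho> (ddf_code p c r \<rho> n M) g f h w v zr zd m} m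
        \<partial>iid_CN \<partial>iid_CN \<partial>iid_CN \<partial>iid_CN) \<le> ennreal (4 * exp (- real n))"
proof (rule ddf_conditional_error[OF n m], unfold norm_scaled_sq)
  let ?S = "ddf_listening p \<rho> r n g" and ?L = "r * ln \<rho>"
  define k where "k = real (card ?S)"
  have L: "0 < ?L" using r \<rho> by simp
  then have A: "0 < A" using relay by linarith
  have FH: "0 \<le> F" "0 \<le> H" by (simp_all add: F_def H_def)
  have k: "real n * ?L \<le> k * A" "0 < card ?S \<Longrightarrow> (k - 1) * A < real n * ?L" "k \<le> real n"
    using ddf_listening_card[where r = r and \<rho> = \<rho> and g = g and p = p and n = n] relay by (auto simp: k_def A_def)
  have M': "real M * exp (5 * real n) \<le> exp (real n * ?L - real n)"
  proof -
    have "real M * exp (5 * real n) \<le> exp (real n * (?L - 6)) * exp (5 * real n)"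
      using M by (rule mult_right_mono) simp
    then show ?thesis by (simp add: exp_add[symmetric] algebra_simps)
  qed
  have "exp (real n * ?L - real n) \<le> exp (k * A)" using k(1) by simp
  also have "\<dots> = (1 + (cmod g)\<^sup>2 * \<rho> powr p) ^ card ?S"
    by (simp add: k_def A_def exp_of_nat_mult add_pos_nonneg)
  finally show "real M * exp (5 * real n) \<le> (1 + (cmod g)\<^sup>2 * \<rho> powr p) ^ card ?S" using M' by linarith
  define x y where "x = ln (1 + H)" and "y = ln (1 + H + F)"
  have xy: "x \<le> y" unfolding x_def y_def using FH by (subst ln_le_cancel_iff) auto
  have "y \<le> ln ((1 + H) * (1 + F))"
  proof -
    have "0 < 1 + H + F" "1 + H + F \<le> (1 + H) * (1 + F)" using FH by (auto simp: algebra_simps)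
    then show ?thesis unfolding y_def by (subst ln_le_cancel_iff) auto
  qed
  also have "\<dots> = x + ln (1 + F)" unfolding x_def using FH by (intro ln_mult_pos) auto
  finally have yx: "y - x \<le> real n" using F by linarith
  have "real n * ?L - real n \<le> k * x + (real n - k) * y"
  proof -
    have kA: "k * A \<le> real n * ?L + A"
    proof (cases "0 < card ?S")
      case True
      then show ?thesis using k(2) by (simp add: algebra_simps)
    next
      case False
      then show ?thesis using A L by (simp add: k_def)
    qed
    have "A * (real n * ?L) \<le> real n * (?L * x + (A - ?L) * y)"
      using mult_left_mono[OF dest, of "real n"] unfolding x_def y_def by (simp add: mult_ac)
    also have "\<dots> = A * (real n * y) - (real n * ?L) * (y - x)" by (simp add: algebra_simps)
    also have "\<dots> \<le> A * (real n * y) - (k * A - A) * (y - x)"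
      using kA xy by (intro diff_left_mono mult_right_mono) auto
    also have "\<dots> = A * (k * x + (real n - k) * y + (y - x))" by (simp add: algebra_simps)
    finally have "real n * ?L \<le> k * x + (real n - k) * y + (y - x)" using A by simp
    then show ?thesis using yx by linarith
  qed
  then have "exp (real n * ?L - real n) \<le> exp (k * x + (real n - k) * y)" by simp
  also have "\<dots> = (1 + H) ^ card ?S * (1 + H + F) ^ (n - card ?S)"
  proof -
    have "real n - k = real (n - card ?S)" using k(3) by (simp add: k_def of_nat_diff)
    moreover have "exp (real j * ln z) = z ^ j" if "0 < z" for z :: real and j
      using that by (simp add: exp_of_nat_mult)
    ultimately show ?thesis using FH by (simp only: exp_add k_def x_def y_def add_pos_nonneg zero_less_one)
  qed
  finally show "real M * exp (5 * real n) \<le> (1 + (cmod h)\<^sup>2 * \<rho> powr c) ^ card ?S *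
      (1 + (cmod h)\<^sup>2 * \<rho> powr c + (cmod f)\<^sup>2 * \<rho> powr p) ^ (n - card ?S)"
    using M' by (simp add: H_def F_def)
qed

text \<open>The last inequality is the destination's outage condition with t = r ln \<rho> / ln (1 +
  G), G the received gain of the source-relay link, multiplied by ln (1 + G). The middle event, an
  exceptionally strong relay-destination link, is where rounding t to whole samples could cost too
  much.\<close>

definition ddf_outage :: "real \<Rightarrow> real \<Rightarrow> real \<Rightarrow> real \<Rightarrow> nat \<Rightarrow> (complex \<times> complex \<times> complex) set" where
  "ddf_outage p c r \<rho> n = {(g, f, h). ln (1 + (cmod g)\<^sup>2 * \<rho> powr p) < r * ln \<rho> \<or>
     real n < ln (1 + (cmod f)\<^sup>2 * \<rho> powr p) \<or>
     r * ln \<rho> * ln (1 + (cmod h)\<^sup>2 * \<rho> powr c) +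
       (ln (1 + (cmod g)\<^sup>2 * \<rho> powr p) - r * ln \<rho>) * ln (1 + (cmod h)\<^sup>2 * \<rho> powr c + (cmod f)\<^sup>2 * \<rho> powr p)
       < r * ln \<rho> * ln (1 + (cmod g)\<^sup>2 * \<rho> powr p)}"

lemma ddf_avg_error:
  assumes n: "0 < n" and M: "0 < M" "real M \<le> exp (real n * (r * ln \<rho> - 6))" and \<rho>: "1 < \<rho>" and r: "0 < r"
    and \<pi>: "0 \<le> \<pi>" "(\<integral>\<^sup>+g. \<integral>\<^sup>+f. \<integral>\<^sup>+h. indicator (ddf_outage p c r \<rho> n) (g, f, h) \<partial>CN \<partial>CN \<partial>CN) \<le> ennreal \<pi>"
  shows "avg_error p p c \<rho> (ddf_code p c r \<rho> n M) \<le> 4 * exp (- real n) + \<pi>"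
proof -
  interpret relay_code p p c \<rho> "ddf_code p c r \<rho> n M"
    by standard (use n M in \<open>auto intro: valid_ddf_code\<close>)
  show ?thesis
  proof (rule avg_error_le[OF _ _ \<pi>(1) _ \<pi>(2)])
    have "{x \<in> space (borel \<Otimes>\<^sub>M borel \<Otimes>\<^sub>M borel). case x of (g :: complex, f :: complex, h :: complex) \<Rightarrow>
       ln (1 + (cmod g)\<^sup>2 * \<rho> powr p) < r * ln \<rho> \<or> real n < ln (1 + (cmod f)\<^sup>2 * \<rho> powr p) \<or>
       r * ln \<rho> * ln (1 + (cmod h)\<^sup>2 * \<rho> powr c) +
       (ln (1 + (cmod g)\<^sup>2 * \<rho> powr p) - r * ln \<rho>) * ln (1 + (cmod h)\<^sup>2 * \<rho> powr c + (cmod f)\<^sup>2 * \<rho> powr p)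
       < r * ln \<rho> * ln (1 + (cmod g)\<^sup>2 * \<rho> powr p)} \<in> sets (borel \<Otimes>\<^sub>M borel \<Otimes>\<^sub>M borel)"
      unfolding split_beta' by measurable
    then show "ddf_outage p c r \<rho> n \<in> sets (borel \<Otimes>\<^sub>M borel \<Otimes>\<^sub>M borel)"
      unfolding ddf_outage_def by (simp add: space_pair_measure)
    show "(\<integral>\<^sup>+w. \<integral>\<^sup>+v. \<integral>\<^sup>+zr. \<integral>\<^sup>+zd. indicator {m. \<not> decoded p p c \<rho> (ddf_code p c r \<rho> n M) g f h w v zr zd m} m
        \<partial>iid_CN \<partial>iid_CN \<partial>iid_CN \<partial>iid_CN) \<le> ennreal (4 * exp (- real n))"
      if "m < num_msgs (ddf_code p c r \<rho> n M)" "(g, f, h) \<notin> ddf_outage p c r \<rho> n" for m g f h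
      using that n M \<rho> r by (intro ddf_no_outage) (auto simp: ddf_outage_def not_less)
  qed simp
qed

text \<open>The fading is capped at \<rho> powr \<epsilon>, and 2 <= \<rho> powr \<epsilon> absorbs
  the 1 inside the logarithms, so the exponents stay below p + 2 \<epsilon> and c + 2 \<epsilon>.
  \<open>ddf_region\<close> is applied with these enlarged parameters.\<close>

lemma ddf_outage_region:
  fixes p c r \<rho> \<epsilon> :: real
  assumes \<epsilon>: "0 < \<epsilon>" "c + 2 * \<epsilon> < r" and pc: "0 \<le> c" "2 * r < p" and \<rho>: "1 < \<rho>" "2 \<le> \<rho> powr \<epsilon>"
    and n: "(p + 2 * \<epsilon>) * ln \<rho> \<le> real n"
    and gfh: "(g, f, h) \<in> ddf_outage p c r \<rho> n" "(cmod g)\<^sup>2 \<le> \<rho> powr \<epsilon>" "(cmod f)\<^sup>2 \<le> \<rho> powr \<epsilon>" "(cmod h)\<^sup>2 \<le> \<rho> powr \<epsilon>"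
  shows "(cmod g)\<^sup>2 * \<rho> powr p * ((cmod f)\<^sup>2 * \<rho> powr p) * ((cmod h)\<^sup>2 * \<rho> powr c) \<le>
     \<rho> powr (p + c + 4 * \<epsilon> + (p - c) * r / (p - r))"
proof -
  let ?L = "ln \<rho>"
  let ?p = "p + 2 * \<epsilon>" and ?c = "c + 2 * \<epsilon>"
  have L: "0 < ?L" using \<rho> by simp
  have bound: "ln (1 + x * \<rho> powr q) \<le> (q + 2 * \<epsilon>) * ?L" if "0 \<le> x" "x \<le> \<rho> powr \<epsilon>" "0 \<le> q" for x q
  proof -
    have "x * \<rho> powr q \<le> \<rho> powr (q + \<epsilon>)"
      unfolding add.commute[of q] powr_add using that by (intro mult_right_mono) auto
    moreover have "1 \<le> \<rho> powr (q + \<epsilon>)" using \<rho> that \<epsilon> by (intro ge_one_powr_ge_zero) auto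
    ultimately have "1 + x * \<rho> powr q \<le> 2 * \<rho> powr (q + \<epsilon>)" by linarith
    also have "\<dots> \<le> \<rho> powr \<epsilon> * \<rho> powr (q + \<epsilon>)" using \<rho> by (intro mult_right_mono) auto
    also have "\<dots> = \<rho> powr (q + 2 * \<epsilon>)" by (simp add: powr_add[symmetric] algebra_simps)
    finally have "ln (1 + x * \<rho> powr q) \<le> ln (\<rho> powr (q + 2 * \<epsilon>))"
      using that \<rho> by (subst ln_le_cancel_iff) (auto intro: add_pos_nonneg)
    then show ?thesis using \<rho> by (simp add: ln_powr)
  qed
  define G F H where "G = (cmod g)\<^sup>2 * \<rho> powr p" and "F = (cmod f)\<^sup>2 * \<rho> powr p" and "H = (cmod h)\<^sup>2 * \<rho> powr c"
  have nn: "0 \<le> G" "0 \<le> F" "0 \<le> H" by (auto simp: G_def F_def H_def)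
  define a b \<gamma> where "a = ln (1 + G) / ?L" and "b = ln (1 + F) / ?L" and "\<gamma> = ln (1 + H) / ?L"
  have ln_eq: "ln (1 + G) = a * ?L" "ln (1 + F) = b * ?L" "ln (1 + H) = \<gamma> * ?L"
    using L by (auto simp: a_def b_def \<gamma>_def)
  have le: "a \<le> ?p" "b \<le> ?p" "\<gamma> \<le> ?c"
    using bound[of "(cmod g)\<^sup>2" p] bound[of "(cmod f)\<^sup>2" p] bound[of "(cmod h)\<^sup>2" c] gfh pc \<epsilon> L
    by (auto simp: a_def b_def \<gamma>_def G_def F_def H_def pos_divide_le_eq)
  have pr: "0 < p - r" "0 < ?p - r" "0 < r" "0 < p - c" using pc \<epsilon> by auto
  \<comment> \<open>Raising p and c by the same amount keeps p - c and only enlarges the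
    denominator.\<close>
  have frac: "(p - c) * r / (?p - r) \<le> (p - c) * r / (p - r)"
    using pr \<epsilon> by (intro divide_left_mono) auto
  have "a + b + \<gamma> \<le> ?p + ?c + (?p - ?c) * r / (?p - r)"
  proof (cases "a < r")
    \<comment> \<open>The relay cannot decode. The bound follows from a < r alone, because the
      fraction is at least r.\<close>
    case True
    have "r * (?p - r) \<le> (?p - ?c) * r" using pr \<epsilon> by (simp add: mult.commute mult_left_mono)
    then have "r \<le> (?p - ?c) * r / (?p - r)" using pr by (simp add: pos_le_divide_eq)
    then show ?thesis using True le by linarith
  next
    case False
    have "\<not> real n < ln (1 + F)" using le(2) n L ln_eq(2) mult_right_mono[OF le(2), of ?L] by linarith
    moreover have "\<not> ln (1 + G) < r * ?L" using False L by (simp add: ln_eq)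
    ultimately have "r * ?L * ln (1 + H) + (ln (1 + G) - r * ?L) * ln (1 + H + F) < r * ?L * ln (1 + G)"
      using gfh(1) by (auto simp: ddf_outage_def G_def F_def H_def)
    \<comment> \<open>Dropping H from the transmitting phase relaxes the outage condition to the one
      in a, b, \<gamma> that \<open>ddf_region\<close> expects.\<close>
    moreover have "(ln (1 + G) - r * ?L) * ln (1 + F) \<le> (ln (1 + G) - r * ?L) * ln (1 + H + F)"
    proof (rule mult_left_mono)
      show "ln (1 + F) \<le> ln (1 + H + F)" using nn by (subst ln_le_cancel_iff) auto
      show "0 \<le> ln (1 + G) - r * ?L" using False L by (simp add: ln_eq)
    qed
    ultimately have "r * ?L * (\<gamma> * ?L) + (a * ?L - r * ?L) * (b * ?L) < r * ?L * (a * ?L)"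
      unfolding ln_eq by linarith
    then have "(?L * ?L) * (r * \<gamma> + (a - r) * b) < (?L * ?L) * (r * a)"
      by (simp add: algebra_simps)
    then have "r * \<gamma> + (a - r) * b \<le> r * a" using L by (simp add: mult_less_cancel_left)
    then show ?thesis using False le pc \<epsilon> by (intro ddf_region) auto
  qed
  also have "\<dots> \<le> p + c + 4 * \<epsilon> + (p - c) * r / (p - r)" using frac by simp
  finally have T: "a + b + \<gamma> \<le> p + c + 4 * \<epsilon> + (p - c) * r / (p - r)" .
  have prod_le: "x * y * z \<le> (1 + x) * (1 + y) * (1 + z)" if "0 \<le> x" "0 \<le> y" "0 \<le> z" for x y z :: real
    using that by (intro mult_mono) auto
  have "G * F * H \<le> (1 + G) * (1 + F) * (1 + H)" by (rule prod_le[OF nn])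
  also have "\<dots> = exp (a * ?L) * exp (b * ?L) * exp (\<gamma> * ?L)"
    unfolding ln_eq[symmetric] using nn by (simp add: add_pos_nonneg)
  also have "\<dots> = \<rho> powr (a + b + \<gamma>)" using \<rho> by (simp add: powr_def exp_add[symmetric] algebra_simps)
  also have "\<dots> \<le> \<rho> powr (p + c + 4 * \<epsilon> + (p - c) * r / (p - r))" using T \<rho> by (intro powr_mono) auto
  finally show ?thesis by (simp add: G_def F_def H_def)
qed

lemma nn_integral_CN_add:
  assumes [measurable]: "X \<in> borel_measurable borel" "Y \<in> borel_measurable (borel \<Otimes>\<^sub>M borel \<Otimes>\<^sub>M borel)"
  shows "(\<integral>\<^sup>+g. \<integral>\<^sup>+f. \<integral>\<^sup>+h. X g + (X f + (X h + Y (g, f, h))) \<partial>CN \<partial>CN \<partial>CN) =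
    (\<integral>\<^sup>+z. X z \<partial>CN) + ((\<integral>\<^sup>+z. X z \<partial>CN) + ((\<integral>\<^sup>+z. X z \<partial>CN) + (\<integral>\<^sup>+g. \<integral>\<^sup>+f. \<integral>\<^sup>+h. Y (g, f, h) \<partial>CN \<partial>CN \<partial>CN)))"
  using CN.emeasure_space_1 by (simp add: nn_integral_add)

text \<open>The 6 nats per sample taken off r ln \<rho> do not affect the multiplexing gain. The
  blocklength factor p + c + 2 dominates both the exponents D and the p + 2 \<epsilon>, \<epsilon>
  <= 1, demanded by \<open>ddf_outage_region\<close>.\<close>

lemma ddf_family:
  fixes p c r :: real
  assumes pc: "0 \<le> c" "c < p" and r: "c < r" "r < p / 2"
  obtains C where "code_family p r C" "\<forall>\<^sub>F \<rho> in at_top. ddf p r \<rho> (C \<rho>)"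
    "\<And>D. D < p - (p - c) * r / (p - r) \<Longrightarrow> \<exists>K. \<forall>\<^sub>F \<rho> in at_top. avg_error p p c \<rho> (C \<rho>) \<le> K * \<rho> powr (- D)"
proof -
  have r0: "0 < r" using pc r by simp
  define n where "n \<rho> = nat \<lceil>(p + c + 2) * ln \<rho>\<rceil> + 1" for \<rho> :: real
  define s where "s \<rho> = r * ln \<rho> - 6" for \<rho> :: real
  define M where "M \<rho> = nat \<lfloor>exp (real (n \<rho>) * s \<rho>)\<rfloor>" for \<rho>
  define C where "C \<rho> = ddf_code p c r \<rho> (n \<rho>) (M \<rho>)" for \<rho>
  \<comment> \<open>From this point on r ln \<rho> >= 8, so that s is at least 2 and the rate at
    least 1.\<close>
  define \<rho>\<^sub>0 where "\<rho>\<^sub>0 = exp (8 / r)"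
  have \<rho>0: "1 < \<rho>\<^sub>0" using r0 by (simp add: \<rho>\<^sub>0_def)
  have n: "0 < n \<rho>" for \<rho> by (simp add: n_def)
  have s: "2 \<le> s \<rho>" if "\<rho>\<^sub>0 \<le> \<rho>" for \<rho>
  proof -
    have "ln \<rho>\<^sub>0 \<le> ln \<rho>" using that \<rho>0 by (subst ln_le_cancel_iff) auto
    then have "8 \<le> r * ln \<rho>" using r0 by (simp add: \<rho>\<^sub>0_def pos_divide_le_eq mult.commute)
    then show ?thesis by (simp add: s_def)
  qed
  have M: "0 < M \<rho>" "real (M \<rho>) \<le> exp (real (n \<rho>) * s \<rho>)" "real (n \<rho>) * s \<rho> - ln 2 \<le> ln (real (M \<rho>))" if "\<rho>\<^sub>0 \<le> \<rho>" for \<rho>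
    unfolding M_def using s[OF that] by (intro floor_exp_messages mult_nonneg_nonneg, simp, simp)+
  have valid: "valid_code p \<rho> (C \<rho>)" if "\<rho>\<^sub>0 \<le> \<rho>" for \<rho>
    unfolding C_def using n M[OF that] by (intro valid_ddf_code) auto
  have rate_bounds: "s \<rho> - 1 \<le> rate (C \<rho>)" "rate (C \<rho>) \<le> s \<rho>" if "\<rho>\<^sub>0 \<le> \<rho>" for \<rho>
  proof -
    have n1: "1 \<le> real (n \<rho>)" using n[of \<rho>] by linarith
    have "ln (real (M \<rho>)) \<le> ln (exp (real (n \<rho>) * s \<rho>))"
      using M[OF that] by (subst ln_le_cancel_iff) auto
    then show "rate (C \<rho>) \<le> s \<rho>"
      using n1 by (simp add: C_def rate_def pos_divide_le_eq mult.commute)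
    have "real (n \<rho>) * s \<rho> - real (n \<rho>) \<le> real (n \<rho>) * s \<rho> - ln 2"
      using n1 ln_2_less_1 by linarith
    then have "real (n \<rho>) * s \<rho> - real (n \<rho>) \<le> ln (real (M \<rho>))" using M(3)[OF that] by linarith
    then show "s \<rho> - 1 \<le> rate (C \<rho>)"
      using n1 by (simp add: C_def rate_def field_simps)
  qed
  have fam: "code_family p r C"
    unfolding code_family_def
  proof (intro conjI exI[of _ "1 :: real"])
    show "\<forall>\<^sub>F \<rho> in at_top. valid_code p \<rho> (C \<rho>)"
      using eventually_ge_at_top[of \<rho>\<^sub>0] by eventually_elim (rule valid)
    show "\<forall>\<^sub>F \<rho> in at_top. 1 \<le> rate (C \<rho>)"
      using eventually_ge_at_top[of \<rho>\<^sub>0]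
    proof eventually_elim
      case (elim \<rho>)
      then show ?case using rate_bounds(1)[OF elim] s[OF elim] by linarith
    qed
    show "((\<lambda>\<rho>. rate (C \<rho>) / ln \<rho>) \<longlongrightarrow> r) at_top"
    proof (rule tendsto_sandwich)
      show "((\<lambda>\<rho>. (s \<rho> - 1) / ln \<rho>) \<longlongrightarrow> r) at_top" unfolding s_def by real_asymp
      show "((\<lambda>\<rho>. s \<rho> / ln \<rho>) \<longlongrightarrow> r) at_top" unfolding s_def by real_asymp
      show "\<forall>\<^sub>F \<rho> in at_top. (s \<rho> - 1) / ln \<rho> \<le> rate (C \<rho>) / ln \<rho>"
        using eventually_ge_at_top[of \<rho>\<^sub>0]
        by eventually_elim (intro divide_right_mono rate_bounds, use \<rho>0 in auto)
      show "\<forall>\<^sub>F \<rho> in at_top. rate (C \<rho>) / ln \<rho> \<le> s \<rho> / ln \<rho>"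
        using eventually_ge_at_top[of \<rho>\<^sub>0]
        by eventually_elim (intro divide_right_mono rate_bounds, use \<rho>0 in auto)
    qed
  qed simp
  have is_ddf: "\<forall>\<^sub>F \<rho> in at_top. ddf p r \<rho> (C \<rho>)"
    using eventually_ge_at_top[of \<rho>\<^sub>0] by eventually_elim (unfold C_def, intro ddf_ddf_code M)
  let ?d = "p - (p - c) * r / (p - r)"
  have "\<exists>K. \<forall>\<^sub>F \<rho> in at_top. avg_error p p c \<rho> (C \<rho>) \<le> K * \<rho> powr (- D)" if D: "D < ?d" for D
  proof (cases "D \<le> 0")
    case True
    show ?thesis
    proof (rule exI[of _ 1], rule eventually_mono[OF eventually_ge_at_top[of \<rho>\<^sub>0]])
      fix \<rho> :: real assume \<rho>: "\<rho>\<^sub>0 \<le> \<rho>"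
      interpret relay_code p p c \<rho> "C \<rho>" by standard (rule valid[OF \<rho>])
      have "\<rho> powr 0 \<le> \<rho> powr (- D)" using \<rho> \<rho>0 True by (intro powr_mono) auto
      then have "1 \<le> \<rho> powr (- D)" using \<rho> \<rho>0 by simp
      then show "avg_error p p c \<rho> (C \<rho>) \<le> 1 * \<rho> powr (- D)" using avg_error_le_one by linarith
    qed
  next
    case False
    \<comment> \<open>Capping the fading costs 4 \<epsilon> of the exponent, which must fit between
      D and the target; c + 2 \<epsilon> < r is required by
      \<open>ddf_outage_region\<close>.\<close>
    define \<epsilon> where "\<epsilon> = min (min 1 ((r - c) / 4)) ((?d - D) / 8)"
    have \<epsilon>: "0 < \<epsilon>" "\<epsilon> \<le> 1" "c + 2 * \<epsilon> < r" "D < ?d - 4 * \<epsilon>"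
    proof -
      show "0 < \<epsilon>" "\<epsilon> \<le> 1" using r D by (auto simp: \<epsilon>_def)
      have "\<epsilon> \<le> (r - c) / 4" unfolding \<epsilon>_def by linarith
      then show "c + 2 * \<epsilon> < r" using r(1) by (simp add: field_simps)
      have "\<epsilon> \<le> (?d - D) / 8" unfolding \<epsilon>_def by linarith
      moreover have "\<epsilon> < (?d - D) / 4" if "\<epsilon> \<le> (?d - D) / 8" using that D by argo
      ultimately show "D < ?d - 4 * \<epsilon>" by argo
    qed
    define \<sigma> where "\<sigma> = D / (?d - 4 * \<epsilon>)"
    have \<sigma>: "0 < \<sigma>" "\<sigma> < 1" "\<sigma> * (?d - 4 * \<epsilon>) = D" using False \<epsilon>(4) by (auto simp: \<sigma>_def)
    have d_le: "?d \<le> p" using pc r by simp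
    \<comment> \<open>Fading above the cap \<rho> powr \<epsilon> has probability below every
      negative power of \<rho>.\<close>
    have "((\<lambda>\<rho>. exp (- (\<rho> powr \<epsilon>) / 2) / \<rho> powr (- D)) \<longlongrightarrow> 0) at_top" using \<epsilon>(1) by real_asymp
    then have "\<forall>\<^sub>F \<rho> in at_top. exp (- (\<rho> powr \<epsilon>) / 2) / \<rho> powr (- D) < 1" by (rule order_tendstoD) simp
    moreover have "filterlim (\<lambda>\<rho>. \<rho> powr \<epsilon>) at_top at_top" using \<epsilon>(1) by real_asymp
    then have "\<forall>\<^sub>F \<rho> in at_top. 2 \<le> \<rho> powr \<epsilon>" by (simp add: filterlim_at_top)
    ultimately have "\<forall>\<^sub>F \<rho> in at_top. avg_error p p c \<rho> (C \<rho>) \<le> (4 + (6 + inv_moment \<sigma> ^ 3)) * \<rho> powr (- D)"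
      using eventually_ge_at_top[of \<rho>\<^sub>0]
    proof eventually_elim
      case (elim \<rho>)
      have \<rho>: "1 < \<rho>" using elim(3) \<rho>0 by linarith
      have tail: "exp (- (\<rho> powr \<epsilon>) / 2) \<le> \<rho> powr (- D)" using elim(1) \<rho> by (simp add: pos_divide_less_eq)
      let ?O = "ddf_outage p c r \<rho> (n \<rho>)"
      let ?X = "{z :: complex. \<rho> powr \<epsilon> < (cmod z)\<^sup>2}"
      let ?T = "\<rho> powr (p + c + 4 * \<epsilon> + (p - c) * r / (p - r))"
      let ?Y = "{(g, f, h). (cmod g)\<^sup>2 * \<rho> powr p * ((cmod f)\<^sup>2 * \<rho> powr p) * ((cmod h)\<^sup>2 * \<rho> powr c) \<le> ?T}"
      have n_ge: "(p + 2 * \<epsilon>) * ln \<rho> \<le> real (n \<rho>)"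
      proof -
        have "(p + 2 * \<epsilon>) * ln \<rho> \<le> (p + c + 2) * ln \<rho>" using \<rho> \<epsilon> pc by (intro mult_right_mono) auto
        also have "\<dots> \<le> real (n \<rho>)" unfolding n_def by linarith
        finally show ?thesis .
      qed
      have X_m [measurable]: "?X \<in> sets borel" by measurable
      have Y_m [measurable]: "?Y \<in> sets (borel \<Otimes>\<^sub>M borel \<Otimes>\<^sub>M borel)"
      proof -
        have "{x \<in> space (borel \<Otimes>\<^sub>M borel \<Otimes>\<^sub>M borel). case x of (g, f, h) \<Rightarrow>
          (cmod g)\<^sup>2 * \<rho> powr p * ((cmod f)\<^sup>2 * \<rho> powr p) * ((cmod h)\<^sup>2 * \<rho> powr c) \<le> ?T} \<in> sets (borel \<Otimes>\<^sub>M borel \<Otimes>\<^sub>M borel)"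
          unfolding split_beta' by measurable
        then show ?thesis by (simp add: space_pair_measure)
      qed
      have X_le: "(\<integral>\<^sup>+z. indicator ?X z \<partial>CN) \<le> ennreal (2 * \<rho> powr (- D))"
      proof -
        have "(\<integral>\<^sup>+z. indicator ?X z \<partial>CN) \<le> ennreal (2 * exp (- (\<rho> powr \<epsilon>) / 2))"
          using CN_tail[of "\<rho> powr \<epsilon>"] by simp
        also have "\<dots> \<le> ennreal (2 * \<rho> powr (- D))" using tail by (intro ennreal_leI) simp
        finally show ?thesis .
      qed
      have Y_le: "(\<integral>\<^sup>+g. \<integral>\<^sup>+f. \<integral>\<^sup>+h. indicator ?Y (g, f, h) \<partial>CN \<partial>CN \<partial>CN) \<le> ennreal (inv_moment \<sigma> ^ 3 * \<rho> powr (- D))"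
      proof -
        have "(\<integral>\<^sup>+g. \<integral>\<^sup>+f. \<integral>\<^sup>+h. indicator ?Y (g, f, h) \<partial>CN \<partial>CN \<partial>CN) \<le>
          ennreal (inv_moment \<sigma> ^ 3 * (?T / (\<rho> powr p * \<rho> powr p * \<rho> powr c)) powr \<sigma>)"
          using \<rho> by (intro CN_small_gain_product3 \<sigma>) auto
        also have "(?T / (\<rho> powr p * \<rho> powr p * \<rho> powr c)) powr \<sigma> = \<rho> powr (- D)"
        proof -
          have "?T / (\<rho> powr p * \<rho> powr p * \<rho> powr c) = \<rho> powr (- (?d - 4 * \<epsilon>))"
            using \<rho> by (simp add: powr_add[symmetric] powr_diff[symmetric] algebra_simps)
          then have "(?T / (\<rho> powr p * \<rho> powr p * \<rho> powr c)) powr \<sigma> = \<rho> powr (- (\<sigma> * (?d - 4 * \<epsilon>)))"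
            by (simp only: powr_powr) (simp only: mult_minus_left mult.commute[of "?d - 4 * \<epsilon>"])
          then show ?thesis by (simp only: \<sigma>(3))
        qed
        finally show ?thesis .
      qed
      have "(\<integral>\<^sup>+g. \<integral>\<^sup>+f. \<integral>\<^sup>+h. indicator ?O (g, f, h) \<partial>CN \<partial>CN \<partial>CN) \<le>
        (\<integral>\<^sup>+g. \<integral>\<^sup>+f. \<integral>\<^sup>+h. indicator ?X g + (indicator ?X f + (indicator ?X h + indicator ?Y (g, f, h))) \<partial>CN \<partial>CN \<partial>CN)"
      proof (intro nn_integral_mono)
        fix g f h
        show "indicator ?O (g, f, h) \<le> indicator ?X g + (indicator ?X f + (indicator ?X h + (indicator ?Y (g, f, h) :: ennreal)))"
        proof (cases "(g, f, h) \<in> ?O \<and> g \<notin> ?X \<and> f \<notin> ?X \<and> h \<notin> ?X")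
          case True
          then have "(g, f, h) \<in> ?Y"
            using ddf_outage_region[OF \<epsilon>(1,3) pc(1) _ \<rho> elim(2) n_ge, of g f h] r by (auto simp: not_less)
          then show ?thesis by (simp add: indicator_def)
        qed (auto simp: indicator_def)
      qed
      also have "\<dots> = (\<integral>\<^sup>+z. indicator ?X z \<partial>CN) + ((\<integral>\<^sup>+z. indicator ?X z \<partial>CN) + ((\<integral>\<^sup>+z. indicator ?X z \<partial>CN) +
          (\<integral>\<^sup>+g. \<integral>\<^sup>+f. \<integral>\<^sup>+h. indicator ?Y (g, f, h) \<partial>CN \<partial>CN \<partial>CN)))"
        by (rule nn_integral_CN_add) measurable
      also have "\<dots> \<le> ennreal (2 * \<rho> powr (- D)) + (ennreal (2 * \<rho> powr (- D)) + (ennreal (2 * \<rho> powr (- D)) + ennreal (inv_moment \<sigma> ^ 3 * \<rho> powr (- D))))"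
        by (intro add_mono X_le Y_le)
      also have "\<dots> = ennreal ((6 + inv_moment \<sigma> ^ 3) * \<rho> powr (- D))"
        using inv_moment_nonneg[of \<sigma>] by (simp add: ennreal_plus[symmetric] distrib_right del: ennreal_plus)
      finally have out: "(\<integral>\<^sup>+g. \<integral>\<^sup>+f. \<integral>\<^sup>+h. indicator ?O (g, f, h) \<partial>CN \<partial>CN \<partial>CN) \<le> ennreal ((6 + inv_moment \<sigma> ^ 3) * \<rho> powr (- D))" .
      have "avg_error p p c \<rho> (C \<rho>) \<le> 4 * exp (- real (n \<rho>)) + (6 + inv_moment \<sigma> ^ 3) * \<rho> powr (- D)"
        unfolding C_def using M[OF elim(3)] n r0 \<rho> inv_moment_nonneg[of \<sigma>] out
        by (intro ddf_avg_error) (auto simp: s_def)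
      also have "exp (- real (n \<rho>)) \<le> \<rho> powr (- D)"
        unfolding n_def using \<rho> D d_le pc by (intro exp_block_le) auto
      finally show ?case by (simp add: algebra_simps)
    qed
    then show ?thesis by blast
  qed
  with fam is_ddf show thesis by (rule that)
qed


section \<open>The optimal diversity gain\<close>

text \<open>The converse serves three times: it makes the error of the constructed family positive,
  bounds its exponent from the other side so that the limit exists, and excludes larger diversity
  gains for all families. As one family meets every D < d, the supremum is attained.\<close>

lemma gdmt_eqI:
  fixes a b c r d :: real
  assumes converse: "\<And>C D. code_family a r C \<Longrightarrow> d < D \<Longrightarrow>
      \<exists>K>0. \<forall>\<^sub>F \<rho> in at_top. K * \<rho> powr (- D) \<le> avg_error a b c \<rho> (C \<rho>)"
    and fam: "code_family a r C" and S: "\<forall>\<^sub>F \<rho> in at_top. S \<rho> (C \<rho>)"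
    and upper: "\<And>D. D < d \<Longrightarrow> \<exists>K. \<forall>\<^sub>F \<rho> in at_top. avg_error a b c \<rho> (C \<rho>) \<le> K * \<rho> powr (- D)"
  shows "gdmt a b c r = ereal d \<and> achieves a b c S r d"
proof -
  have lower_lim: "\<forall>\<^sub>F \<rho> in at_top. 0 < avg_error a b c \<rho> (C \<rho>)"
    "\<forall>\<^sub>F \<rho> in at_top. y < ln (avg_error a b c \<rho> (C \<rho>)) / ln \<rho>"
    if fam: "code_family a r C" and y: "y < - d" for C y
  proof -
    \<comment> \<open>- D is the midpoint of y and - d; the slack absorbs ln K / ln \<rho>.\<close>
    define D where "D = (d - y) / 2"
    have D: "d < D" "y < - D" using y by (auto simp: D_def field_simps)
    obtain K where K: "0 < K" "\<forall>\<^sub>F \<rho> in at_top. K * \<rho> powr (- D) \<le> avg_error a b c \<rho> (C \<rho>)"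
      using converse[OF fam D(1)] by blast
    show "\<forall>\<^sub>F \<rho> in at_top. 0 < avg_error a b c \<rho> (C \<rho>)"
      using K(2) eventually_gt_at_top[of 0]
    proof eventually_elim
      case (elim \<rho>)
      have "0 < K * \<rho> powr (- D)" using K(1) elim by simp
      then show ?case using elim by linarith
    qed
    have "((\<lambda>\<rho>. ln K / ln \<rho> - D) \<longlongrightarrow> - D) at_top" by real_asymp
    then have "\<forall>\<^sub>F \<rho> in at_top. y < ln K / ln \<rho> - D" using D(2) by (rule order_tendstoD)
    then show "\<forall>\<^sub>F \<rho> in at_top. y < ln (avg_error a b c \<rho> (C \<rho>)) / ln \<rho>"
      using K(2) eventually_gt_at_top[of 1]
    proof eventually_elim
      case (elim \<rho>)
      have pos: "0 < K * \<rho> powr (- D)" using K(1) elim by simp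
      have "ln K - D * ln \<rho> = ln (K * \<rho> powr (- D))"
        using K(1) elim by (simp add: ln_mult ln_powr)
      also have "\<dots> \<le> ln (avg_error a b c \<rho> (C \<rho>))" using elim pos by (subst ln_le_cancel_iff) auto
      finally have "(ln K - D * ln \<rho>) / ln \<rho> \<le> ln (avg_error a b c \<rho> (C \<rho>)) / ln \<rho>"
        using elim by (intro divide_right_mono) auto
      moreover have "(ln K - D * ln \<rho>) / ln \<rho> = ln K / ln \<rho> - D" using elim by (simp add: diff_divide_distrib)
      ultimately show ?case using elim by linarith
    qed
  qed
  have upper_lim: "\<forall>\<^sub>F \<rho> in at_top. ln (avg_error a b c \<rho> (C \<rho>)) / ln \<rho> < y" if y: "- d < y" for y
  proof -
    define D where "D = (d - y) / 2"
    have D: "D < d" "- D < y" using y by (auto simp: D_def field_simps)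
    obtain K where K: "\<forall>\<^sub>F \<rho> in at_top. avg_error a b c \<rho> (C \<rho>) \<le> K * \<rho> powr (- D)"
      using upper[OF D(1)] by blast
    have "((\<lambda>\<rho>. ln K / ln \<rho> - D) \<longlongrightarrow> - D) at_top" by real_asymp
    then have "\<forall>\<^sub>F \<rho> in at_top. ln K / ln \<rho> - D < y" using D(2) by (rule order_tendstoD)
    moreover have "\<forall>\<^sub>F \<rho> in at_top. 0 < avg_error a b c \<rho> (C \<rho>)" by (rule lower_lim(1)[OF fam, of "- d - 1"]) simp
    ultimately show ?thesis
      using K eventually_gt_at_top[of 1]
    proof eventually_elim
      case (elim \<rho>)
      then have pos: "0 < avg_error a b c \<rho> (C \<rho>)" by simp
      then have "0 < K * \<rho> powr (- D)" using elim by linarith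
      then have K0: "0 < K" by (simp add: zero_less_mult_iff)
      have "ln (avg_error a b c \<rho> (C \<rho>)) \<le> ln (K * \<rho> powr (- D))"
        using elim pos by (subst ln_le_cancel_iff) auto
      also have "\<dots> = ln K - D * ln \<rho>" using K0 elim by (simp add: ln_mult ln_powr)
      finally have "ln (avg_error a b c \<rho> (C \<rho>)) / ln \<rho> \<le> (ln K - D * ln \<rho>) / ln \<rho>"
        using elim by (intro divide_right_mono) auto
      moreover have "(ln K - D * ln \<rho>) / ln \<rho> = ln K / ln \<rho> - D" using elim by (simp add: diff_divide_distrib)
      ultimately show ?case using elim by linarith
    qed
  qed
  have lim: "((\<lambda>\<rho>. ln (avg_error a b c \<rho> (C \<rho>)) / ln \<rho>) \<longlongrightarrow> - d) at_top"
    by (rule order_tendstoI) (fact lower_lim(2)[OF fam], fact upper_lim)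
  have ach: "achieves a b c S' r d" if "\<forall>\<^sub>F \<rho> in at_top. S' \<rho> (C \<rho>)" for S'
    unfolding achieves_def
  proof (intro exI[of _ C] conjI lim)
    show "\<forall>\<^sub>F \<rho> in at_top. valid_code a \<rho> (C \<rho>) \<and> S' \<rho> (C \<rho>)"
      using fam that by (auto simp: code_family_def eventually_conj_iff)
    show "\<exists>R\<^sub>0>0. \<forall>\<^sub>F \<rho> in at_top. R\<^sub>0 \<le> rate (C \<rho>)" "((\<lambda>\<rho>. rate (C \<rho>) / ln \<rho>) \<longlongrightarrow> r) at_top"
      using fam by (auto simp: code_family_def)
    show "\<forall>\<^sub>F \<rho> in at_top. 0 < avg_error a b c \<rho> (C \<rho>)" by (rule lower_lim(1)[OF fam, of "- d - 1"]) simp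
  qed
  have "d' \<le> d" if ach': "achieves a b c (\<lambda>_ _. True) r d'" for d'
  proof (rule ccontr)
    assume "\<not> d' \<le> d"
    then have y: "- ((d + d') / 2) < - d" "- d' < - ((d + d') / 2)" by auto
    obtain C' where C': "code_family a r C'"
      "((\<lambda>\<rho>. ln (avg_error a b c \<rho> (C' \<rho>)) / ln \<rho>) \<longlongrightarrow> - d') at_top"
      using ach' unfolding achieves_def code_family_def by auto
    have "\<forall>\<^sub>F \<rho> in at_top. ln (avg_error a b c \<rho> (C' \<rho>)) / ln \<rho> < - ((d + d') / 2)"
      using C'(2) y(2) by (rule order_tendstoD)
    moreover have "\<forall>\<^sub>F \<rho> in at_top. - ((d + d') / 2) < ln (avg_error a b c \<rho> (C' \<rho>)) / ln \<rho>"
      by (rule lower_lim(2)[OF C'(1) y(1)])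
    ultimately have "\<forall>\<^sub>F \<rho> :: real in at_top. False" by eventually_elim linarith
    then show False by simp
  qed
  then have "gdmt a b c r = ereal d"
    unfolding gdmt_def using ach[of "\<lambda>_ _. True"] by (intro antisym Sup_least Sup_upper) auto
  then show ?thesis using ach[of S] S by simp
qed

section \<open>Converse for equal relay links\<close>

lemma powr_lower_bound_mono:
  fixes D E :: real
  assumes "0 < K" "\<forall>\<^sub>F \<rho> in at_top. K * \<rho> powr (- E) \<le> f \<rho>" "E \<le> D"
  shows "\<exists>K>0. \<forall>\<^sub>F \<rho> in at_top. K * \<rho> powr (- D) \<le> f \<rho>"
proof (intro exI[of _ K] conjI assms(1))
  show "\<forall>\<^sub>F \<rho> in at_top. K * \<rho> powr (- D) \<le> f \<rho>"
    using assms(2) eventually_ge_at_top[of 1]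
  proof eventually_elim
    case (elim \<rho>)
    have "K * \<rho> powr (- D) \<le> K * \<rho> powr (- E)"
      using assms elim by (intro mult_left_mono powr_mono) auto
    then show ?case using elim by linarith
  qed
qed

lemma source_cut_converse:
  fixes p c r D :: real
  assumes C: "code_family p r C" and nn: "0 \<le> p" "0 \<le> c" "0 \<le> r"
    and D: "max (p - r) 0 + max (c - r) 0 < D"
  shows "\<exists>K>0. \<forall>\<^sub>F \<rho> in at_top. K * \<rho> powr (- D) \<le> avg_error p p c \<rho> (C \<rho>)"
proof (cases "r = 0")
  case True
  obtain K where "0 < K" "\<forall>\<^sub>F \<rho> in at_top. K * \<rho> powr (- (max p 0 + max c 0)) \<le> avg_error p p c \<rho> (C \<rho>)"
    using source_cut_converse_zero[OF C] .
  then show ?thesis by (rule powr_lower_bound_mono) (use True D in auto)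
next
  case False
  \<comment> \<open>Each max grows by at most \<delta>, so 2 \<delta> has to fit into the gap below
    D.\<close>
  define \<delta> where "\<delta> = min (r / 2) ((D - (max (p - r) 0 + max (c - r) 0)) / 2)"
  have \<delta>: "0 < \<delta>" "\<delta> < r" "2 * \<delta> \<le> D - (max (p - r) 0 + max (c - r) 0)"
    using False nn D by (auto simp: \<delta>_def min_def field_simps)
  obtain K where "0 < K"
    "\<forall>\<^sub>F \<rho> in at_top. K * \<rho> powr (- (max (p - r + \<delta>) 0 + max (c - r + \<delta>) 0)) \<le> avg_error p p c \<rho> (C \<rho>)"
    using source_cut_converse_pos[OF C \<delta>(1,2) nn(1,2)] .
  then show ?thesis by (rule powr_lower_bound_mono) (use \<delta> in linarith)
qed

text \<open>Threshold t = 1/2. Short listening: a direct link of exponent 2 r - p averages with p to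
  r. Long listening: the nominal direct link c averages with a relay link of exponent 2 r - c to r.
  Either weakening costs p + c - 2 r.\<close>

lemma half_duplex_converse_high_rate:
  fixes p c r D :: real
  assumes C: "code_family p r C" and c: "0 \<le> c" "c < r" and r: "p < 2 * r" "2 * r \<le> p + c"
    and D: "p + c - 2 * r < D"
  shows "\<exists>K>0. \<forall>\<^sub>F \<rho> in at_top. K * \<rho> powr (- D) \<le> avg_error p p c \<rho> (C \<rho>)"
proof -
  \<comment> \<open>Besides the slack below D, \<eta> keeps the weakened exponents admissible: 2 r -
    p - 2 \<eta> >= 0 and 2 r - c - 2 \<eta> >= c.\<close>
  define \<eta> where "\<eta> = min (min ((2 * r - p) / 2) (r - c)) (min (r / 2) ((D - (p + c - 2 * r)) / 2))"
  have \<eta>: "0 < \<eta>" "2 * \<eta> \<le> 2 * r - p" "\<eta> \<le> r - c" "\<eta> < r" "2 * \<eta> \<le> D - (p + c - 2 * r)"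
    using c r D by (auto simp: \<eta>_def min_def field_simps)
  \<comment> \<open>On either side of 1/2 the relevant mixture is largest at \<tau> = 1/2, where it
    is the plain average.\<close>
  have convex: "\<tau> * x + (1 - \<tau>) * y \<le> (x + y) / 2" if "0 \<le> (1 / 2 - \<tau>) * (x - y)" for \<tau> x y :: real
    using that by (simp add: field_simps)
  obtain K where "0 < K" "\<forall>\<^sub>F \<rho> in at_top. K * \<rho> powr (- D) \<le> avg_error p p c \<rho> (C \<rho>)"
  proof (rule half_duplex_converse[OF C \<eta>(1,4), where b = p and c = c and D = D and ?\<gamma>\<^sub>1 = "2 * r - p - 2 * \<eta>" and ?\<gamma>\<^sub>2 = c and \<beta> = "2 * r - c - 2 * \<eta>" and t = "1 / 2"])
    show "\<tau> * p + (1 - \<tau>) * (2 * r - p - 2 * \<eta>) \<le> r - \<eta>" if "0 \<le> \<tau>" "\<tau> \<le> 1 / 2" for \<tau>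
      using convex[of \<tau> p "2 * r - p - 2 * \<eta>"] mult_nonneg_nonneg[of "1 / 2 - \<tau>" "p - (2 * r - p - 2 * \<eta>)"] that \<eta> c r by simp
    show "\<tau> * c + (1 - \<tau>) * (2 * r - c - 2 * \<eta>) \<le> r - \<eta>" if "1 / 2 \<le> \<tau>" "\<tau> \<le> 1" for \<tau>
      using convex[of \<tau> c "2 * r - c - 2 * \<eta>"] mult_nonpos_nonpos[of "1 / 2 - \<tau>" "c - (2 * r - c - 2 * \<eta>)"] that \<eta> c r by simp
  qed (use c r D \<eta> in auto)
  then show ?thesis by blast
qed

text \<open>In the short case the direct link is removed altogether, at cost c, and the threshold r
  / p is the listening time at which the source-relay link carries r. In the long case
  \<open>\<beta>\<^sub>0\<close> solves (r / p) c + (1 - r / p) \<open>\<beta>\<^sub>0\<close> = r,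
  and its cost p - \<open>\<beta>\<^sub>0\<close> is at least c.\<close>

lemma half_duplex_converse_low_rate:
  fixes p c r D :: real
  assumes C: "code_family p r C" and c: "0 \<le> c" "c < r" and r: "2 * r \<le> p"
    and D: "p - (p - c) * r / (p - r) < D"
  shows "\<exists>K>0. \<forall>\<^sub>F \<rho> in at_top. K * \<rho> powr (- D) \<le> avg_error p p c \<rho> (C \<rho>)"
proof -
  define \<beta>\<^sub>0 where "\<beta>\<^sub>0 = (p - c) * r / (p - r)"
  have pr: "0 < r" "0 < p - r" "0 < p" "c < p" using c r by auto
  have \<beta>0: "(p - r) * \<beta>\<^sub>0 = (p - c) * r" using pr by (simp add: \<beta>\<^sub>0_def)
  \<comment> \<open>c < \<open>\<beta>\<^sub>0\<close> makes additional listening harmful for the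
    cut around the destination, so that \<tau> = t is the critical time of the long case.\<close>
  have "(p - r) * c < (p - r) * \<beta>\<^sub>0"
    unfolding \<beta>0 using mult_strict_left_mono[OF c(2) pr(3)] by (simp add: algebra_simps)
  then have c_less: "c < \<beta>\<^sub>0" using pr by simp
  have "(p - r) * \<beta>\<^sub>0 \<le> (p - r) * (p - c)"
    unfolding \<beta>0 using mult_left_mono[of r "p - r" "p - c"] pr r by (simp add: mult.commute)
  then have \<beta>0_le: "\<beta>\<^sub>0 \<le> p - c" using pr by simp
  define \<eta> where "\<eta> = min (\<beta>\<^sub>0 - c) (D - (p - \<beta>\<^sub>0))"
  \<comment> \<open>Replacing r by r - \<delta> in threshold and target costs at most 2 \<delta> p,
    lowering \<open>\<beta>\<^sub>0\<close> by \<eta> gains at least \<eta> p / 2; hence 4 \<delta>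
    <= \<eta>.\<close>
  define \<delta> where "\<delta> = min (r / 2) (\<eta> / 4)"
  have \<eta>: "0 < \<eta>" "\<eta> \<le> \<beta>\<^sub>0 - c" "\<eta> \<le> D - (p - \<beta>\<^sub>0)"
    using c_less D by (auto simp: \<eta>_def \<beta>\<^sub>0_def)
  have \<delta>: "0 < \<delta>" "\<delta> < r" "4 * \<delta> \<le> \<eta>" using \<eta> pr by (auto simp: \<delta>_def min_def field_simps)
  obtain K where "0 < K" "\<forall>\<^sub>F \<rho> in at_top. K * \<rho> powr (- D) \<le> avg_error p p c \<rho> (C \<rho>)"
  proof (rule half_duplex_converse[OF C \<delta>(1,2), where b = p and c = c and D = D and ?\<gamma>\<^sub>1 = 0 and ?\<gamma>\<^sub>2 = c and \<beta> = "\<beta>\<^sub>0 - \<eta>" and t = "(r - \<delta>) / p"])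
    show "\<tau> * p + (1 - \<tau>) * 0 \<le> r - \<delta>" if "\<tau> \<le> (r - \<delta>) / p" for \<tau>
      using that pr by (simp add: pos_le_divide_eq)
    show "\<tau> * c + (1 - \<tau>) * (\<beta>\<^sub>0 - \<eta>) \<le> r - \<delta>" if "(r - \<delta>) / p \<le> \<tau>" for \<tau>
    proof -
      have "(r - \<delta>) * (\<beta>\<^sub>0 - \<eta> - c) \<le> p * \<tau> * (\<beta>\<^sub>0 - \<eta> - c)"
        using that pr \<eta> by (intro mult_right_mono) (auto simp: pos_divide_le_eq mult.commute)
      then have "p * (\<tau> * c + (1 - \<tau>) * (\<beta>\<^sub>0 - \<eta>)) \<le> (r - \<delta>) * c + (p - r + \<delta>) * (\<beta>\<^sub>0 - \<eta>)"
        by (simp add: algebra_simps)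
      also have "\<dots> = p * r + \<delta> * (\<beta>\<^sub>0 - c) - \<eta> * (p - r) - \<eta> * \<delta>" using \<beta>0 by (simp add: algebra_simps)
      also have "\<dots> \<le> p * r + \<delta> * p - \<eta> * (p / 2)"
      proof -
        have "\<delta> * (\<beta>\<^sub>0 - c) \<le> \<delta> * p" using \<delta> \<beta>0_le c by (intro mult_left_mono) auto
        moreover have "\<eta> * (p / 2) \<le> \<eta> * (p - r)" using \<eta> r by (intro mult_left_mono) auto
        moreover have "0 \<le> \<eta> * \<delta>" using \<eta> \<delta> by simp
        ultimately show ?thesis by linarith
      qed
      also have "\<dots> \<le> p * r + \<delta> * p - (4 * \<delta>) * (p / 2)"
        using \<delta>(3) pr by (intro diff_left_mono mult_right_mono) auto
      also have "\<dots> = p * (r - \<delta>)" by (simp add: algebra_simps)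
      finally show ?thesis using pr by simp
    qed
    show "max (p - (\<beta>\<^sub>0 - \<eta>)) 0 + max (c - c) 0 \<le> D" "max (c - 0) 0 \<le> D"
      using \<eta> \<beta>0_le c by auto
  qed (use c pr \<eta> in auto)
  then show ?thesis by blast
qed

theorem theorem1:
  fixes p c r :: real
  assumes "0 \<le> p" and "0 \<le> c" and "0 \<le> r"
  shows
    "(p \<le> c \<longrightarrow>
        gdmt p p c r = ereal (max (p - r) 0 + max (c - r) 0) \<and>
        qmf_achieves p p c r (max (p - r) 0 + max (c - r) 0)) \<and>
     (c < p \<and> r \<le> c \<longrightarrow>
        gdmt p p c r = ereal (p + c - 2 * r) \<and>
        qmf_achieves p p c r (p + c - 2 * r)) \<and>
     (c < p \<and> c < r \<and> r < p / 2 \<longrightarrow>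
        gdmt p p c r = ereal (p - (p - c) * r / (p - r)) \<and>
        ddf_achieves p p c r (p - (p - c) * r / (p - r))) \<and>
     (c < p \<and> p / 2 \<le> r \<and> r \<le> (p + c) / 2 \<longrightarrow>
        gdmt p p c r = ereal (p + c - 2 * r) \<and>
        qmf_achieves p p c r (p + c - 2 * r))"
proof (intro conjI impI)
  \<comment> \<open>The three QMF regimes differ only in their converse and in which exponent bound
    of \<open>qmf_family\<close> reaches d, so both are left as premises.\<close>
  have qmf: "gdmt p p c r = ereal d \<and> qmf_achieves p p c r d"
    if conv: "\<And>C D. code_family p r C \<Longrightarrow> d < D \<Longrightarrow>
          \<exists>K>0. \<forall>\<^sub>F \<rho> in at_top. K * \<rho> powr (- D) \<le> avg_error p p c \<rho> (C \<rho>)"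
      and d: "\<And>D. D < d \<Longrightarrow> D < p + c - 2 * r \<or> D < c - r \<or> D < 0" for d
  proof -
    show ?thesis
    proof (rule qmf_family[OF assms])
      fix C
      assume C: "code_family p r C" "\<And>\<rho>. static_qmf_half (C \<rho>)"
        "\<And>D. D < p + c - 2 * r \<or> D < c - r \<or> D < 0 \<Longrightarrow> \<exists>K. \<forall>\<^sub>F \<rho> in at_top. avg_error p p c \<rho> (C \<rho>) \<le> K * \<rho> powr (- D)"
      show ?thesis
        unfolding qmf_achieves_def by (rule gdmt_eqI[OF conv C(1) _ C(3)[OF d]]) (simp_all add: C(2))
    qed
  qed
  have source: "\<exists>K>0. \<forall>\<^sub>F \<rho> in at_top. K * \<rho> powr (- D) \<le> avg_error p p c \<rho> (C \<rho>)"
    if "code_family p r C" "max (p - r) 0 + max (c - r) 0 < D" for C D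
    by (rule source_cut_converse[OF that(1) assms that(2)])
  have low: "\<exists>K>0. \<forall>\<^sub>F \<rho> in at_top. K * \<rho> powr (- D) \<le> avg_error p p c \<rho> (C \<rho>)"
    if "code_family p r C" "c < r" "2 * r \<le> p" "p - (p - c) * r / (p - r) < D" for C D
    by (rule half_duplex_converse_low_rate[OF that(1) assms(2) that(2-4)])
  {
    assume "p \<le> c"
    then have "gdmt p p c r = ereal (max (p - r) 0 + max (c - r) 0) \<and>
        qmf_achieves p p c r (max (p - r) 0 + max (c - r) 0)"
      by (intro qmf source) auto
    then show "gdmt p p c r = ereal (max (p - r) 0 + max (c - r) 0)"
      "qmf_achieves p p c r (max (p - r) 0 + max (c - r) 0)" by auto
  next
    assume "c < p \<and> r \<le> c"
    then have "gdmt p p c r = ereal (p + c - 2 * r) \<and> qmf_achieves p p c r (p + c - 2 * r)"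
      by (intro qmf source) auto
    then show "gdmt p p c r = ereal (p + c - 2 * r)" "qmf_achieves p p c r (p + c - 2 * r)" by auto
  next
    assume r: "c < p \<and> c < r \<and> r < p / 2"
    obtain C where C: "code_family p r C" "\<forall>\<^sub>F \<rho> in at_top. ddf p r \<rho> (C \<rho>)"
      "\<And>D. D < p - (p - c) * r / (p - r) \<Longrightarrow> \<exists>K. \<forall>\<^sub>F \<rho> in at_top. avg_error p p c \<rho> (C \<rho>) \<le> K * \<rho> powr (- D)"
      by (rule ddf_family[of c p r]) (use assms r in auto)
    have "gdmt p p c r = ereal (p - (p - c) * r / (p - r)) \<and> ddf_achieves p p c r (p - (p - c) * r / (p - r))"
      unfolding ddf_achieves_def by (rule gdmt_eqI[OF low C(1) _ C(3)]) (use r C(2) in auto)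
    then show "gdmt p p c r = ereal (p - (p - c) * r / (p - r))" "ddf_achieves p p c r (p - (p - c) * r / (p - r))"
      by auto
  next
    assume r: "c < p \<and> p / 2 \<le> r \<and> r \<le> (p + c) / 2"
    have "\<exists>K>0. \<forall>\<^sub>F \<rho> in at_top. K * \<rho> powr (- D) \<le> avg_error p p c \<rho> (C \<rho>)"
      if C: "code_family p r C" and D: "p + c - 2 * r < D" for C D
    proof -
      \<comment> \<open>For r <= c < p the cut around the source already gives p + c - 2 r; beyond c
        the half-duplex constraint decides.\<close>
      consider "r \<le> c" | "c < r" "p < 2 * r" | "c < r" "p = 2 * r" using r by linarith
      then show ?thesis
      proof cases
        case 1
        then show ?thesis using r D by (intro source[OF C]) auto
      next
        case 2
        then show ?thesis using r D assms by (intro half_duplex_converse_high_rate[OF C]) auto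
      next
        \<comment> \<open>The high-rate converse requires p < 2 r strictly. At p = 2 r the low-rate
          exponent has the same value, namely c.\<close>
        case 3
        then show ?thesis using r D assms by (intro low[OF C]) auto
      qed
    qed
    then have "gdmt p p c r = ereal (p + c - 2 * r) \<and> qmf_achieves p p c r (p + c - 2 * r)"
      by (intro qmf) auto
    then show "gdmt p p c r = ereal (p + c - 2 * r)" "qmf_achieves p p c r (p + c - 2 * r)" by auto
  }
qed


end
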